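(* Let $G$ be a connected solvable Lie group and $\Gamma$ an algebraically dense closed subgroup of $G$. Then $\Gamma$ has a syndetic hull in $G$. The syndetic hull of $\Gamma$ in $G$ is unique if $G$ is simply connected.
   Context: Lie groups are real and finite-dimensional; $\mathfrak g$ denotes the Lie algebra of $G$, $\mathrm{Ad}:G\to\mathrm{Aut}(\mathfrak g)$ the adjoint representation, and $\mathrm{Aut}(\mathfrak g)$ is regarded as a real algebraic subgroup of $GL(\mathfrak g)$. A subgroup $\Gamma$ of a Lie group $G$ is called algebraically dense if $\mathrm{Ad}(G)$ is contained in the Zariski closure of $\mathrm{Ad}(\Gamma)$ in $\mathrm{Aut}(\mathfrak g)$. Let $\Gamma$ be a closed subgroup of a Lie group $G$. A connected Lie subgroup $S$ of $G$ with $\Gamma\subset S$ and $\Gamma\backslash S$ compact is called a syndetic hull of $\Gamma$ in $G$ (such an $S$ is automatically closed in $G$). *)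

theory Defs
  imports "HOL-Analysis.Analysis" "HOL-Algebra.Solvable_Groups"
begin

section \<open>Smooth maps between subsets of Euclidean spaces\<close>

text \<open>On an open set \<open>U\<close> of a finite-dimensional space, \<open>Ck_on k U f\<close> says that
  \<open>f\<close> is of class \<open>C\<^sup>k\<close> there.\<close>

fun Ck_on :: "nat \<Rightarrow> 'a::real_normed_vector set \<Rightarrow> ('a \<Rightarrow> 'b::real_normed_vector) \<Rightarrow> bool" where
  "Ck_on 0 U f \<longleftrightarrow> continuous_on U f"
| "Ck_on (Suc k) U f \<longleftrightarrow>
     (\<forall>x\<in>U. f differentiable (at x)) \<and>
     (\<forall>v. Ck_on k U (\<lambda>x. frechet_derivative f (at x) v))"

text \<open>On an arbitrary set, a map is smooth if it extends, locally around each point of the set, to a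
  smooth map on an open set. For relatively open subsets of a linear subspace this is smoothness in
  the usual sense.\<close>

definition smooth_on :: "'a::real_normed_vector set \<Rightarrow> ('a \<Rightarrow> 'b::real_normed_vector) \<Rightarrow> bool" where
  "smooth_on X f \<longleftrightarrow>
     (\<forall>x\<in>X. \<exists>U F. open U \<and> x \<in> U \<and> (\<forall>k. Ck_on k U F) \<and> (\<forall>y\<in>U \<inter> X. F y = f y))"


section \<open>Smooth manifolds\<close>

text \<open>The model space is a linear subspace of a Euclidean space \<open>'e\<close>, not \<open>'e\<close> itself. A fixed
  type \<open>'e\<close> thus accommodates manifolds of every dimension from \<open>0\<close> to \<open>DIM('e)\<close>, in
  particular a manifold together with all its submanifolds. The points of the manifold are
  \<open>topspace (mtop M)\<close>, and the atlas is not required to be maximal.\<close>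

record ('a, 'e) manifold =
  mtop :: "'a topology"
  model :: "'e set"
  atlas :: "('a set \<times> ('a \<Rightarrow> 'e)) set"

definition is_chart :: "'a topology \<Rightarrow> 'e::euclidean_space set \<Rightarrow> 'a set \<times> ('a \<Rightarrow> 'e) \<Rightarrow> bool" where
  "is_chart T E = (\<lambda>(U, \<phi>).
     openin T U \<and> openin (top_of_set E) (\<phi> ` U) \<and>
     homeomorphic_map (subtopology T U) (top_of_set (\<phi> ` U)) \<phi>)"

definition smooth_manifold :: "('a, 'e::euclidean_space) manifold \<Rightarrow> bool" where
  "smooth_manifold M \<longleftrightarrow>
     Hausdorff_space (mtop M) \<and> second_countable (mtop M) \<and> subspace (model M) \<and>
     (\<forall>c\<in>atlas M. is_chart (mtop M) (model M) c) \<and>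
     (\<Union>c\<in>atlas M. fst c) = topspace (mtop M) \<and>
     (\<forall>(U, \<phi>)\<in>atlas M. \<forall>(V, \<psi>)\<in>atlas M. smooth_on (\<phi> ` (U \<inter> V)) (\<psi> \<circ> inv_into U \<phi>))"

definition smooth_map ::
    "('a, 'e::euclidean_space) manifold \<Rightarrow> ('b, 'f::euclidean_space) manifold \<Rightarrow> ('a \<Rightarrow> 'b) \<Rightarrow> bool" where
  "smooth_map M N f \<longleftrightarrow>
     continuous_map (mtop M) (mtop N) f \<and>
     (\<forall>(U, \<phi>)\<in>atlas M. \<forall>(V, \<psi>)\<in>atlas N. smooth_on (\<phi> ` (U \<inter> f -` V)) (\<psi> \<circ> f \<circ> inv_into U \<phi>))"

definition smooth_fun :: "('a, 'e::euclidean_space) manifold \<Rightarrow> ('a \<Rightarrow> real) \<Rightarrow> bool" where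
  "smooth_fun M f \<longleftrightarrow> (\<forall>(U, \<phi>)\<in>atlas M. smooth_on (\<phi> ` U) (f \<circ> inv_into U \<phi>))"

definition prod_manifold ::
    "('a, 'e::euclidean_space) manifold \<Rightarrow> ('b, 'f::euclidean_space) manifold
       \<Rightarrow> ('a \<times> 'b, 'e \<times> 'f) manifold" where
  "prod_manifold M N =
     \<lparr> mtop = prod_topology (mtop M) (mtop N),
       model = model M \<times> model N,
       atlas = {(U \<times> V, map_prod \<phi> \<psi>) | U \<phi> V \<psi>. (U, \<phi>) \<in> atlas M \<and> (V, \<psi>) \<in> atlas N} \<rparr>"

text \<open>Tangent vectors are point derivations of the algebra of smooth functions. Smoothness ignores
  the values of a function outside the manifold, and so does a derivation: if \<open>f\<close> vanishes on the
  manifold and \<open>\<chi>\<close> is the indicator function of its complement, then \<open>f = \<chi> f\<close>, and the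
  Leibniz rule gives \<open>D f = 0\<close>. The value \<open>0\<close> at non-smooth functions is a convention that makes
  derivations equal when they agree on smooth functions.\<close>

definition tangent_space ::
    "('a, 'e::euclidean_space) manifold \<Rightarrow> 'a \<Rightarrow> (('a \<Rightarrow> real) \<Rightarrow> real) set" where
  "tangent_space M p =
     {D. (\<forall>f. \<not> smooth_fun M f \<longrightarrow> D f = 0) \<and>
         (\<forall>f g. smooth_fun M f \<longrightarrow> smooth_fun M g \<longrightarrow>
            (\<forall>a b. D (\<lambda>x. a * f x + b * g x) = a * D f + b * D g) \<and>
            D (\<lambda>x. f x * g x) = D f * g p + f p * D g)}"

definition differential ::
    "('a, 'e::euclidean_space) manifold \<Rightarrow> ('b, 'f::euclidean_space) manifold \<Rightarrow> ('a \<Rightarrow> 'b)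
       \<Rightarrow> (('a \<Rightarrow> real) \<Rightarrow> real) \<Rightarrow> (('b \<Rightarrow> real) \<Rightarrow> real)" where
  "differential M N f D = (\<lambda>h. if smooth_fun N h then D (h \<circ> f) else 0)"

definition immersion ::
    "('a, 'e::euclidean_space) manifold \<Rightarrow> ('b, 'f::euclidean_space) manifold \<Rightarrow> ('a \<Rightarrow> 'b) \<Rightarrow> bool" where
  "immersion M N f \<longleftrightarrow>
     smooth_map M N f \<and>
     (\<forall>p\<in>topspace (mtop M). inj_on (differential M N f) (tangent_space M p))"


section \<open>Topological notions\<close>

text \<open>The analogue of \<^const>\<open>simply_connected\<close> for abstract topologies.\<close>

definition simply_connected_space :: "'a topology \<Rightarrow> bool" where
  "simply_connected_space T \<longleftrightarrow>
     (\<forall>p q. pathin T p \<and> p 1 = p 0 \<and> pathin T q \<and> q 1 = q 0 \<longrightarrow>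
        homotopic_with (\<lambda>r. r 1 = r 0) (top_of_set {0..1::real}) T p q)"

definition quotient_topology :: "'a topology \<Rightarrow> ('a \<Rightarrow> 'b) \<Rightarrow> 'b topology" where
  "quotient_topology T q =
     topology (\<lambda>W. W \<subseteq> q ` topspace T \<and> openin T {x \<in> topspace T. q x \<in> W})"

lemma openin_quotient_topology:
  "openin (quotient_topology T q) W \<longleftrightarrow>
     W \<subseteq> q ` topspace T \<and> openin T {x \<in> topspace T. q x \<in> W}"
proof -
  have "istopology (\<lambda>W. W \<subseteq> q ` topspace T \<and> openin T {x \<in> topspace T. q x \<in> W})"
    unfolding istopology_def
  proof (intro conjI allI impI; (elim conjE)?)
    fix V W
    assume "openin T {x \<in> topspace T. q x \<in> V}" "openin T {x \<in> topspace T. q x \<in> W}"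
    then have "openin T ({x \<in> topspace T. q x \<in> V} \<inter> {x \<in> topspace T. q x \<in> W})"
      by (rule openin_Int)
    moreover have "{x \<in> topspace T. q x \<in> V} \<inter> {x \<in> topspace T. q x \<in> W} =
        {x \<in> topspace T. q x \<in> V \<inter> W}"
      by auto
    ultimately show "openin T {x \<in> topspace T. q x \<in> V \<inter> W}"
      by simp
  next
    fix \<W>
    assume *: "\<forall>W\<in>\<W>. W \<subseteq> q ` topspace T \<and> openin T {x \<in> topspace T. q x \<in> W}"
    then have "openin T (\<Union>W\<in>\<W>. {x \<in> topspace T. q x \<in> W})"
      by auto
    moreover have "(\<Union>W\<in>\<W>. {x \<in> topspace T. q x \<in> W}) = {x \<in> topspace T. q x \<in> \<Union>\<W>}"
      by auto
    ultimately show "openin T {x \<in> topspace T. q x \<in> \<Union>\<W>}"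
      by simp
    show "\<Union>\<W> \<subseteq> q ` topspace T"
      using * by blast
  qed blast
  then show ?thesis
    by (simp add: quotient_topology_def topology_inverse')
qed


section \<open>Zariski closure\<close>

text \<open>Vector spaces occur here as sets \<open>V\<close> of real-valued functions that are closed under
  pointwise linear combinations. A polynomial function on \<open>End(V)\<close> is a polynomial in matrix
  coefficients \<open>T \<mapsto> l (T X)\<close>, with \<open>X \<in> V\<close> and \<open>l\<close> a linear functional on \<open>V\<close>.\<close>

definition linear_functional :: "('s \<Rightarrow> real) set \<Rightarrow> (('s \<Rightarrow> real) \<Rightarrow> real) \<Rightarrow> bool" where
  "linear_functional V l \<longleftrightarrow>
     (\<forall>X\<in>V. \<forall>Y\<in>V. \<forall>a b. l (\<lambda>s. a * X s + b * Y s) = a * l X + b * l Y)"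

definition linear_endo :: "('s \<Rightarrow> real) set \<Rightarrow> (('s \<Rightarrow> real) \<Rightarrow> ('s \<Rightarrow> real)) \<Rightarrow> bool" where
  "linear_endo V T \<longleftrightarrow> T \<in> V \<rightarrow> V \<and>
     (\<forall>X\<in>V. \<forall>Y\<in>V. \<forall>a b. T (\<lambda>s. a * X s + b * Y s) = (\<lambda>s. a * T X s + b * T Y s))"

inductive_set End_polynomials ::
    "('s \<Rightarrow> real) set \<Rightarrow> ((('s \<Rightarrow> real) \<Rightarrow> ('s \<Rightarrow> real)) \<Rightarrow> real) set"
  for V where
    const: "(\<lambda>T. c) \<in> End_polynomials V"
  | coefficient: "X \<in> V \<Longrightarrow> linear_functional V l \<Longrightarrow> (\<lambda>T. l (T X)) \<in> End_polynomials V"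
  | add: "P \<in> End_polynomials V \<Longrightarrow> Q \<in> End_polynomials V \<Longrightarrow> (\<lambda>T. P T + Q T) \<in> End_polynomials V"
  | mult: "P \<in> End_polynomials V \<Longrightarrow> Q \<in> End_polynomials V \<Longrightarrow> (\<lambda>T. P T * Q T) \<in> End_polynomials V"

text \<open>The Zariski topology on a set \<open>A\<close> of linear automorphisms of \<open>V\<close>. The regular functions
  on \<open>GL(V)\<close> are quotients of polynomials by powers of \<open>det\<close>, so they define the same closed
  subsets as the polynomials.\<close>

definition zariski_closedin ::
    "('s \<Rightarrow> real) set \<Rightarrow> (('s \<Rightarrow> real) \<Rightarrow> ('s \<Rightarrow> real)) set
       \<Rightarrow> (('s \<Rightarrow> real) \<Rightarrow> ('s \<Rightarrow> real)) set \<Rightarrow> bool" where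
  "zariski_closedin V A Z \<longleftrightarrow> (\<exists>\<P>\<subseteq>End_polynomials V. Z = {T \<in> A. \<forall>P\<in>\<P>. P T = 0})"

definition zariski_closure ::
    "('s \<Rightarrow> real) set \<Rightarrow> (('s \<Rightarrow> real) \<Rightarrow> ('s \<Rightarrow> real)) set
       \<Rightarrow> (('s \<Rightarrow> real) \<Rightarrow> ('s \<Rightarrow> real)) set \<Rightarrow> (('s \<Rightarrow> real) \<Rightarrow> ('s \<Rightarrow> real)) set" where
  "zariski_closure V A B = \<Inter>{Z. zariski_closedin V A Z \<and> B \<subseteq> Z}"


section \<open>Lie groups\<close>

locale lie_group = group G
  for G :: "('g, 'm) monoid_scheme" (structure) +
  fixes M :: "('g, 'e::euclidean_space) manifold"
  assumes manifold: "smooth_manifold M"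
    and topspace_eq: "topspace (mtop M) = carrier G"
    and smooth_mult: "smooth_map (prod_manifold M M) M (\<lambda>(x, y). x \<otimes> y)"
    and smooth_inv: "smooth_map M M (\<lambda>x. inv x)"

definition lie_algebra ::
    "('g, 'm) monoid_scheme \<Rightarrow> ('g, 'e::euclidean_space) manifold \<Rightarrow> (('g \<Rightarrow> real) \<Rightarrow> real) set" where
  "lie_algebra G M = tangent_space M \<one>\<^bsub>G\<^esub>"

text \<open>The left-invariant vector field with value \<open>X\<close> at the identity maps \<open>f\<close> to the function
  \<open>x \<mapsto> X (\<lambda>y. f (x y))\<close>. The bracket below is the value at the identity of the commutator of the
  two vector fields.\<close>

definition lie_bracket ::
    "('g, 'm) monoid_scheme \<Rightarrow> ('g, 'e::euclidean_space) manifold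
       \<Rightarrow> (('g \<Rightarrow> real) \<Rightarrow> real) \<Rightarrow> (('g \<Rightarrow> real) \<Rightarrow> real) \<Rightarrow> (('g \<Rightarrow> real) \<Rightarrow> real)" where
  "lie_bracket G M X Y = (\<lambda>f. if smooth_fun M f
     then X (\<lambda>x. Y (\<lambda>y. f (x \<otimes>\<^bsub>G\<^esub> y))) - Y (\<lambda>x. X (\<lambda>y. f (x \<otimes>\<^bsub>G\<^esub> y)))
     else 0)"

text \<open>Automorphisms are \<^const>\<open>undefined\<close> outside the Lie algebra, so that they are equal when
  they agree on it.\<close>

definition Aut_lie_algebra ::
    "('g, 'm) monoid_scheme \<Rightarrow> ('g, 'e::euclidean_space) manifold
       \<Rightarrow> ((('g \<Rightarrow> real) \<Rightarrow> real) \<Rightarrow> (('g \<Rightarrow> real) \<Rightarrow> real)) set" where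
  "Aut_lie_algebra G M =
     {T \<in> extensional (lie_algebra G M).
        linear_endo (lie_algebra G M) T \<and> bij_betw T (lie_algebra G M) (lie_algebra G M) \<and>
        (\<forall>X\<in>lie_algebra G M. \<forall>Y\<in>lie_algebra G M.
           T (lie_bracket G M X Y) = lie_bracket G M (T X) (T Y))}"

definition Ad ::
    "('g, 'm) monoid_scheme \<Rightarrow> ('g, 'e::euclidean_space) manifold \<Rightarrow> 'g
       \<Rightarrow> (('g \<Rightarrow> real) \<Rightarrow> real) \<Rightarrow> (('g \<Rightarrow> real) \<Rightarrow> real)" where
  "Ad G M g = restrict (differential M M (\<lambda>x. g \<otimes>\<^bsub>G\<^esub> x \<otimes>\<^bsub>G\<^esub> inv\<^bsub>G\<^esub> g)) (lie_algebra G M)"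

definition algebraically_dense ::
    "('g, 'm) monoid_scheme \<Rightarrow> ('g, 'e::euclidean_space) manifold \<Rightarrow> 'g set \<Rightarrow> bool" where
  "algebraically_dense G M \<Gamma> \<longleftrightarrow>
     Ad G M ` carrier G \<subseteq>
       zariski_closure (lie_algebra G M) (Aut_lie_algebra G M) (Ad G M ` \<Gamma>)"

text \<open>A Lie subgroup is an immersed one: its manifold structure \<open>N\<close> may carry a finer topology than
  the subspace topology. No generality is lost by giving \<open>N\<close> the same ambient Euclidean type as
  \<open>M\<close>, because \<open>dim (model N) \<le> dim (model M)\<close> for an immersion.\<close>

definition connected_lie_subgroup ::
    "('g, 'm) monoid_scheme \<Rightarrow> ('g, 'e::euclidean_space) manifold
       \<Rightarrow> 'g set \<Rightarrow> ('g, 'e) manifold \<Rightarrow> bool" where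
  "connected_lie_subgroup G M S N \<longleftrightarrow>
     subgroup S G \<and> lie_group (G\<lparr>carrier := S\<rparr>) N \<and> immersion N M (\<lambda>x. x) \<and>
     connected_space (mtop N)"

text \<open>The points of \<open>\<Gamma>\S\<close> are the cosets \<open>\<Gamma>s\<close>, which HOL-Algebra calls right cosets.\<close>

definition syndetic_hull ::
    "('g, 'm) monoid_scheme \<Rightarrow> ('g, 'e::euclidean_space) manifold \<Rightarrow> 'g set \<Rightarrow> 'g set \<Rightarrow> bool" where
  "syndetic_hull G M \<Gamma> S \<longleftrightarrow>
     (\<exists>N. connected_lie_subgroup G M S N \<and> \<Gamma> \<subseteq> S \<and>
          compact_space (quotient_topology (mtop N) (\<lambda>s. \<Gamma> #>\<^bsub>G\<^esub> s)))"

end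

theory Submission
  imports Defs "Jordan_Normal_Form.Determinant"
begin

text \<open>
  All Lie theory takes place in one chart at the identity, \<open>Exp X\<close> being the limit of the \<open>n\<close>-th powers
  of the points with coordinates \<open>X / n\<close>. Algebraic density means that a polynomial in the coefficients of \<open>Ad g\<close>
  vanishing on \<open>\<Gamma>\<close> vanishes on \<open>G\<close>. If \<open>l\<close> is a continuous homomorphism from the closure of the
  derived group of \<open>H\<close> to the reals, then \<open>l [g, h]\<close> is polynomial in \<open>g\<close> and in \<open>h\<close>; so going down the derived
  series, \<open>l\<close> vanishes if it vanishes on the corresponding term of \<open>\<Gamma>\<close>, and the closure of \<open>[G, G]\<close> lies in
  \<open>\<Gamma> K\<close> for a compact \<open>K\<close>. Hence \<open>\<Lambda> = \<Gamma> K'\<close> with \<open>K'\<close> compact, where \<open>\<Lambda>\<close> is the closure of \<open>\<Gamma> [G, G]\<close>.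
  Let \<open>W\<close> be the span of \<open>{X. Exp X \<in> \<Lambda>}\<close>. The logarithm modulo \<open>W\<close> is a homomorphism \<open>F\<close> on \<open>G\<close>, and its kernel
  \<open>S\<close> is a syndetic hull.

  Any hull \<open>S'\<close> lies in \<open>S\<close>, because \<open>F\<close> maps it to a compact, hence trivial, group. By density \<open>S'\<close> is normal and
  contains \<open>\<Lambda>\<close>. If \<open>G\<close> is simply connected, a winding number argument shows that \<open>Exp X\<close> lies in the closure of
  \<open>[G, G]\<close> only for \<open>X\<close> in its Lie algebra; hence \<open>W\<close> lies in the Lie algebra of \<open>S'\<close>, and \<open>S' = S\<close>.
\<close>

text \<open>The reason why \<open>l [g, h]\<close> is polynomial: for \<open>h = Exp X\<close> the
  commutator is \<open>Exp (X + Z) Exp (- X)\<close> with \<open>Z = Ad g X - X\<close>, a vector of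
  the Lie algebra of the group on which \<open>l\<close> lives. Up to a limit this element is a
  product of conjugates of \<open>Exp (Z / n)\<close>, so \<open>l\<close> of it is linear in
  \<open>Z\<close>. Compactness comes from rounding: the logarithm on an abelian quotient is
  determined modulo the vectors that exponentiate into the subgroup, and every vector of their span
  lies at bounded distance from one of them; so an element whose logarithm vanishes modulo the span
  is an element of the subgroup times one of a compact set. Two obstacles shape the development.
  Density speaks of polynomials in \<open>Ad g\<close>, whereas commutators involve
  \<open>Ad (g^-1)\<close>; powers of the determinant clear the latter. And a hull is an immersed
  subgroup with a topology of its own; hence the exponential map is developed for a topological
  group with one chart and a Lipschitz estimate, and is applied both to \<open>G\<close> and to the
  hull, whose one-parameter subgroups are then recognised as those of \<open>G\<close>.\<close>

section \<open>Orthogonal projections and perturbations of the identity on a subspace\<close>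

definition onb :: "'a::euclidean_space set \<Rightarrow> 'a set" where
  "onb W = (SOME B. B \<subseteq> W \<and> pairwise Linear_Algebra.orthogonal B \<and> (\<forall>b\<in>B. norm b = 1) \<and> independent B \<and> span B = W)"

lemma onb:
  fixes W :: "'a::euclidean_space set"
  assumes "subspace W"
  shows "onb W \<subseteq> W" "pairwise Linear_Algebra.orthogonal (onb W)" "\<And>b. b \<in> onb W \<Longrightarrow> norm b = 1"
    "independent (onb W)" "span (onb W) = W" "finite (onb W)"
proof -
  have "\<exists>B. B \<subseteq> W \<and> pairwise Linear_Algebra.orthogonal B \<and> (\<forall>b\<in>B. norm b = 1) \<and> independent B \<and> span B = W"
    using orthonormal_basis_subspace[OF assms] by metis
  from someI_ex[OF this, folded onb_def]
  show "onb W \<subseteq> W" "pairwise Linear_Algebra.orthogonal (onb W)" "\<And>b. b \<in> onb W \<Longrightarrow> norm b = 1"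
    "independent (onb W)" "span (onb W) = W" by auto
  thus "finite (onb W)" using independent_imp_finite by blast
qed

text \<open>Model spaces, Lie algebras and kernels are all subspaces of one Euclidean type.
  Composition with this projection turns maps that behave well only on a subspace into maps on the
  whole type.\<close>

definition oproj :: "'a::euclidean_space set \<Rightarrow> 'a \<Rightarrow> 'a" where
  "oproj W x = (\<Sum>b\<in>onb W. (x \<bullet> b) *\<^sub>R b)"

lemma oproj_in: "subspace W \<Longrightarrow> oproj W x \<in> W"
  unfolding oproj_def using onb(1) by (intro subspace_sum subspace_scale) auto

lemma oproj_id: "subspace W \<Longrightarrow> x \<in> W \<Longrightarrow> oproj W x = x"
  unfolding oproj_def by (rule orthonormal_basis_expand) (simp_all add: onb)

lemma linear_oproj: "linear (oproj W)"
  unfolding oproj_def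
  by (intro linearI) (simp_all add: inner_add_left scaleR_add_left sum.distrib scaleR_sum_right)

lemma bounded_linear_oproj: "bounded_linear (oproj W)"
  using linear_oproj by (rule linear_conv_bounded_linear[THEN iffD1])

lemma oproj_orth:
  assumes W: "subspace W" and w: "w \<in> W"
  shows "(x - oproj W x) \<bullet> w = 0"
proof -
  have *: "(x - oproj W x) \<bullet> b = 0" if b: "b \<in> onb W" for b
  proof -
    have "oproj W x \<bullet> b = (\<Sum>c\<in>onb W. (x \<bullet> c) * (c \<bullet> b))" by (simp add: oproj_def inner_sum_left)
    also have "\<dots> = (\<Sum>c\<in>onb W. if c = b then x \<bullet> b else 0)"
    proof (rule sum.cong[OF refl])
      fix c assume c: "c \<in> onb W"
      show "(x \<bullet> c) * (c \<bullet> b) = (if c = b then x \<bullet> b else 0)" using onb(2)[OF W] onb(3)[OF W b] b c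
        by (auto simp: pairwise_def Linear_Algebra.orthogonal_def norm_eq_1)
    qed
    also have "\<dots> = x \<bullet> b" using b onb(6)[OF W] by simp
    finally show ?thesis by (simp add: inner_diff_left)
  qed
  have "w = (\<Sum>b\<in>onb W. (w \<bullet> b) *\<^sub>R b)" using oproj_id[OF W w] by (simp add: oproj_def)
  hence "(x - oproj W x) \<bullet> w = (\<Sum>b\<in>onb W. (w \<bullet> b) * ((x - oproj W x) \<bullet> b))"
    by (metis (mono_tags, lifting) inner_scaleR_right inner_sum_right sum.cong)
  thus ?thesis using * by simp
qed

lemma norm_oproj:
  assumes W: "subspace W"
  shows "norm (oproj W x) \<le> norm x" "norm (x - oproj W x) \<le> norm x"
proof -
  have "(x - oproj W x) \<bullet> oproj W x = 0" by (rule oproj_orth[OF W oproj_in[OF W]])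
  hence "(norm x)\<^sup>2 = (norm (x - oproj W x))\<^sup>2 + (norm (oproj W x))\<^sup>2"
    unfolding power2_norm_eq_inner by (simp add: inner_diff_left inner_diff_right inner_commute)
  hence "(norm (oproj W x))\<^sup>2 \<le> (norm x)\<^sup>2" "(norm (x - oproj W x))\<^sup>2 \<le> (norm x)\<^sup>2" by auto
  thus "norm (oproj W x) \<le> norm x" "norm (x - oproj W x) \<le> norm x" by (auto intro: power2_le_imp_le)
qed

lemma linear_on_subspace_bound:
  fixes f :: "'a::euclidean_space \<Rightarrow> 'b::real_normed_vector"
  assumes W: "subspace W"
    and add: "\<And>x y. x \<in> W \<Longrightarrow> y \<in> W \<Longrightarrow> f (x + y) = f x + f y"
    and scale: "\<And>c x. x \<in> W \<Longrightarrow> f (c *\<^sub>R x) = c *\<^sub>R f x"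
  shows "linear (\<lambda>x. f (oproj W x))"
  by (intro linearI) (simp_all add: linear_add[OF linear_oproj] linear_scale[OF linear_oproj] add scale oproj_in[OF W])

text \<open>The map \<open>x - f x + y\<close> contracts by the factor 1/2 and sends the ball of
  radius \<open>2 * norm y\<close> in \<open>E\<close> to itself; its fixed point solves
  \<open>f x = y\<close>.\<close>

lemma near_identity_onto:
  fixes f :: "'a::euclidean_space \<Rightarrow> 'a"
  assumes E: "subspace E"
    and fE: "\<And>x. x \<in> E \<Longrightarrow> norm x \<le> \<rho> \<Longrightarrow> f x \<in> E"
    and lip: "\<And>x y. x \<in> E \<Longrightarrow> y \<in> E \<Longrightarrow> norm x \<le> \<rho> \<Longrightarrow> norm y \<le> \<rho> \<Longrightarrow>
        norm (f x - f y - (x - y)) \<le> norm (x - y) / 2"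
    and f0: "f 0 = 0" and y: "y \<in> E" "2 * norm y \<le> \<rho>"
  shows "\<exists>x\<in>E. norm x \<le> 2 * norm y \<and> f x = y"
proof -
  let ?s = "E \<inter> cball 0 (2 * norm y)"
  let ?g = "\<lambda>x. x - f x + y"
  have 0: "0 \<in> E" using E by (rule subspace_0)
  have in\<rho>: "norm x \<le> \<rho>" if "x \<in> ?s" for x using that y by auto
  have "\<exists>!x. x \<in> ?s \<and> ?g x = x"
  proof (rule Banach_fix)
    show "complete ?s" using E by (simp add: closed_Int closed_subspace complete_eq_closed)
    show "?s \<noteq> {}" using 0 by force
    show "?g ` ?s \<subseteq> ?s"
    proof (rule image_subsetI)
      fix x assume x: "x \<in> ?s"
      have "norm (f x - f 0 - (x - 0)) \<le> norm (x - 0) / 2"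
        by (rule lip) (use in\<rho>[OF x] x 0 order_trans[OF norm_ge_zero in\<rho>[OF x]] in auto)
      hence "norm (x - f x) \<le> norm x / 2" using f0 by (simp add: norm_minus_commute)
      hence "norm (?g x) \<le> 2 * norm y" using norm_triangle_ineq[of "x - f x" y] x by auto
      moreover have "?g x \<in> E" by (intro subspace_add[OF E] subspace_diff[OF E] fE y in\<rho>[OF x]) (use x in auto)
      ultimately show "?g x \<in> ?s" by simp
    qed
    show "\<And>x z. x \<in> ?s \<Longrightarrow> z \<in> ?s \<Longrightarrow> dist (?g x) (?g z) \<le> 1/2 * dist x z"
    proof -
      fix x z assume a: "x \<in> ?s" "z \<in> ?s"
      have "norm (f x - f z - (x - z)) \<le> norm (x - z) / 2" using lip[of x z] a in\<rho>[of x] in\<rho>[of z] by blast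
      moreover have "?g x - ?g z = - (f x - f z - (x - z))" by simp
      ultimately show "dist (?g x) (?g z) \<le> 1/2 * dist x z" by (simp only: dist_norm norm_minus_cancel)
    qed
  qed auto
  then obtain x where "x \<in> ?s" "?g x = x" by blast
  thus ?thesis by (intro bexI[of _ x]) (auto simp: algebra_simps)
qed

section \<open>Local groups and the exponential map\<close>

text \<open>The origin of the last axiom: in coordinates, the remainder
  \<open>\<phi> (x \<otimes> y) - \<phi> x - \<phi> y\<close> vanishes as soon as one factor is the
  identity, so its differences are bounded like those of a bilinear map. Nothing else is kept of the
  manifold, so that the theory can be instantiated for a Lie group and for an immersed subgroup with
  its own topology.\<close>

locale local_group = group G for G :: "('g, 'm) monoid_scheme" (structure) +
  fixes T :: "'g topology" and E :: "'e::euclidean_space set" and \<phi> :: "'g \<Rightarrow> 'e"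
    and U :: "'g set" and r C :: real
  assumes topspace_T [simp]: "topspace T = carrier G"
    and mult_cont: "continuous_map (prod_topology T T) T (\<lambda>(x, y). x \<otimes> y)"
    and inv_cont: "continuous_map T T (\<lambda>x. inv x)"
    and hausdorff: "Hausdorff_space T"
    and subspace_E: "subspace E"
    and open_U: "openin T U" and one_U: "\<one> \<in> U"
    and homeo_\<phi>: "homeomorphic_map (subtopology T U) (top_of_set (\<phi> ` U)) \<phi>"
    and \<phi>_one: "\<phi> \<one> = 0"
    and \<phi>_E: "\<phi> ` U \<subseteq> E"
    and r_pos: "0 < r" and ball_r: "E \<inter> ball 0 r \<subseteq> \<phi> ` U"
    and C_nonneg: "0 \<le> C"
    and mult_U: "\<lbrakk>x \<in> U; y \<in> U; norm (\<phi> x) < r; norm (\<phi> y) < r\<rbrakk> \<Longrightarrow> x \<otimes> y \<in> U"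
    and mult_est: "\<lbrakk>x \<in> U; y \<in> U; x' \<in> U; y' \<in> U;
        norm (\<phi> x) < r; norm (\<phi> y) < r; norm (\<phi> x') < r; norm (\<phi> y') < r\<rbrakk> \<Longrightarrow>
        norm ((\<phi> (x \<otimes> y) - \<phi> x - \<phi> y) - (\<phi> (x' \<otimes> y') - \<phi> x' - \<phi> y'))
          \<le> C * (norm (\<phi> x - \<phi> x') * norm (\<phi> y) + norm (\<phi> x') * norm (\<phi> y - \<phi> y'))"
begin

lemma U_carrier: "U \<subseteq> carrier G"
  using openin_subset[OF open_U] by simp

lemma U_closed: "x \<in> U \<Longrightarrow> x \<in> carrier G"
  using U_carrier by blast

lemma inj_\<phi>: "inj_on \<phi> U"
proof -
  have "topspace (subtopology T U) = U" using U_carrier by (auto simp: topspace_subtopology)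
  thus ?thesis using homeomorphic_imp_injective_map[OF homeo_\<phi>] by simp
qed

lemma limitin_mult:
  assumes "limitin T f a F" "limitin T g b F"
  shows "limitin T (\<lambda>n. f n \<otimes> g n) (a \<otimes> b) F"
proof -
  have "limitin (prod_topology T T) (\<lambda>n. (f n, g n)) (a, b) F" using assms by (simp add: limitin_pairwise o_def)
  from continuous_map_limit[OF mult_cont this] show ?thesis by (simp add: o_def)
qed

lemma limitin_inv:
  assumes "limitin T f a F"
  shows "limitin T (\<lambda>n. inv (f n)) (inv a) F" using continuous_map_limit[OF inv_cont assms] by (simp add: o_def)

lemma limitin_pow:
  assumes "limitin T f a F"
  shows "limitin T (\<lambda>n. f n [^] (k::nat)) (a [^] k) F"
proof (induction k)
  case 0
  thus ?case using one_closed by (simp add: limitin_const_iff)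
next
  case (Suc k)
  thus ?case using limitin_mult[OF Suc assms] by simp
qed

lemma limitin_chart:
  assumes a: "a \<in> U" and x: "eventually (\<lambda>n. x n \<in> U) F" and lim: "((\<lambda>n. \<phi> (x n)) \<longlongrightarrow> \<phi> a) F"
  shows "limitin T x a F" unfolding limitin_def
proof (intro conjI allI impI)
  show "a \<in> topspace T" using a U_closed by simp
  fix V assume V: "openin T V \<and> a \<in> V"
  have "openin (subtopology T U) (U \<inter> V)" using V by (auto simp: openin_subtopology)
  hence "openin (top_of_set (\<phi> ` U)) (\<phi> ` (U \<inter> V))" using homeo_\<phi> by (meson homeomorphic_imp_open_map open_map_def)
  then obtain O' where O': "open O'" "\<phi> ` (U \<inter> V) = \<phi> ` U \<inter> O'" by (auto simp: openin_open)
  have "\<phi> a \<in> O'" using O' a V by blast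
  hence "eventually (\<lambda>n. \<phi> (x n) \<in> O') F" using lim O' by (simp add: tendsto_def)
  with x show "eventually (\<lambda>n. x n \<in> V) F"
  proof eventually_elim
    case (elim n)
    hence "\<phi> (x n) \<in> \<phi> ` (U \<inter> V)" using O' by blast
    thus ?case using inj_\<phi> elim by (metis IntD1 IntD2 imageE inj_onD)
  qed
qed

lemma limitin_eventually_U:
  assumes "limitin T x a F" "a \<in> U"
  shows "eventually (\<lambda>n. x n \<in> U) F" using assms open_U by (simp add: limitin_def)

lemma tendsto_chart:
  assumes lim: "limitin T x a F" and a: "a \<in> U"
  shows "((\<lambda>n. \<phi> (x n)) \<longlongrightarrow> \<phi> a) F"
proof (rule topological_tendstoI)
  fix S assume S: "open S" "\<phi> a \<in> S"
  have "continuous_map (subtopology T U) (top_of_set (\<phi> ` U)) \<phi>"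
    using homeo_\<phi> by (rule homeomorphic_imp_continuous_map)
  moreover have "openin (top_of_set (\<phi> ` U)) (\<phi> ` U \<inter> S)" using S by auto
  ultimately have "openin (subtopology T U) {x \<in> topspace (subtopology T U). \<phi> x \<in> \<phi> ` U \<inter> S}"
    by (rule openin_continuous_map_preimage)
  hence "openin T {x \<in> topspace (subtopology T U). \<phi> x \<in> \<phi> ` U \<inter> S}" using open_U openin_open_subtopology by blast
  moreover have "a \<in> {x \<in> topspace (subtopology T U). \<phi> x \<in> \<phi> ` U \<inter> S}" using a S U_closed by auto
  ultimately have "eventually (\<lambda>n. x n \<in> {x \<in> topspace (subtopology T U). \<phi> x \<in> \<phi> ` U \<inter> S}) F"
    using lim unfolding limitin_def by blast
  thus "eventually (\<lambda>n. \<phi> (x n) \<in> S) F" by (rule eventually_mono) auto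
qed

lemma limitin_unique:
  "limitin T x a F \<Longrightarrow> limitin T x b F \<Longrightarrow> F \<noteq> bot \<Longrightarrow> a = b" by (metis limitin_Hausdorff_unique hausdorff)

end

section \<open>Powers of small elements and the exponential map as their limit\<close>

context local_group
begin

lemma mult_est0:
  assumes "x \<in> U" "y \<in> U" "norm (\<phi> x) < r" "norm (\<phi> y) < r"
  shows "norm (\<phi> (x \<otimes> y) - \<phi> x - \<phi> y) \<le> C * norm (\<phi> x) * norm (\<phi> y)"
  using mult_est[OF assms(1,2) one_U assms(2) assms(3,4) _ assms(4)] r_pos U_closed assms(2)
  by (simp add: \<phi>_one mult.assoc)

text \<open>The estimates support each other: the Lipschitz bound \<open>2 * k\<close> for the
  powers controls the remainder added by the next factor, and these remainders add up to a term
  quadratic in \<open>k\<close>, which the smallness hypothesis bounds by \<open>k\<close> times the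
  distance. The conditions with \<open>r\<close> keep all powers inside the chart.\<close>

lemma pow_est:
  assumes "x \<in> U" "y \<in> U" "C * real k * (norm (\<phi> x) + norm (\<phi> y)) \<le> 1" "2 * real k * norm (\<phi> x) < r" "2 * real k * norm (\<phi> y) < r"
  shows "x [^] k \<in> U \<and> norm (\<phi> (x [^] k) - \<phi> (y [^] k) - real k *\<^sub>R (\<phi> x - \<phi> y))
     \<le> C * (real k)\<^sup>2 * (norm (\<phi> x) + norm (\<phi> y)) * norm (\<phi> x - \<phi> y) \<and>
     norm (\<phi> (x [^] k) - \<phi> (y [^] k)) \<le> 2 * real k * norm (\<phi> x - \<phi> y)" using assms
proof (induction k arbitrary: x y)
  case 0
  thus ?case using one_U by simp
next
  case (Suc k)
  let ?x = "norm (\<phi> x)" and ?y = "norm (\<phi> y)" and ?d = "norm (\<phi> x - \<phi> y)"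
  have le: "C * real k * a \<le> C * real (Suc k) * a" "2 * real k * a \<le> 2 * real (Suc k) * a" "2 * a \<le> 2 * real (Suc k) * a"
    if "0 \<le> a" for a using C_nonneg that by (intro mult_right_mono mult_left_mono; simp)+
  have Ck: "C * real k * (?x + ?y) \<le> 1" and rk: "2 * real k * ?x < r" "2 * real k * ?y < r" and nr: "?x < r" "?y < r"
    using Suc.prems le(1)[of "?x + ?y"] le(2,3)[of ?x] le(2,3)[of ?y] norm_ge_zero[of "\<phi> x"] norm_ge_zero[of "\<phi> y"]
    by linarith+
  have C2: "C * real k * ?x \<le> 1" "C * real k * ?y \<le> 1"
    using Ck C_nonneg mult_left_mono[of ?x "?x + ?y" "C * real k"] mult_left_mono[of ?y "?x + ?y" "C * real k"] by auto
  \<comment> \<open>Comparison with the identity, whose coordinate is 0, bounds the powers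
    themselves.\<close>
  have X: "x [^] k \<in> U" "norm (\<phi> (x [^] k)) \<le> 2 * real k * ?x" and Y: "y [^] k \<in> U" "norm (\<phi> (y [^] k)) \<le> 2 * real k * ?y"
    using Suc.IH[of x \<one>] Suc.IH[of y \<one>] Suc.prems(1,2) C2 rk one_U \<phi>_one r_pos by simp_all
  let ?D = "\<phi> (x [^] k) - \<phi> (y [^] k)" and ?r = "(\<phi> (x [^] k \<otimes> x) - \<phi> (x [^] k) - \<phi> x) - (\<phi> (y [^] k \<otimes> y) - \<phi> (y [^] k) - \<phi> y)"
  have IH: "norm (?D - real k *\<^sub>R (\<phi> x - \<phi> y)) \<le> C * (real k)\<^sup>2 * (?x + ?y) * ?d" and D: "norm ?D \<le> 2 * real k * ?d"
    using Suc.IH[OF Suc.prems(1,2) Ck rk] by auto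
  have nkr: "norm (\<phi> (x [^] k)) < r" "norm (\<phi> (y [^] k)) < r" using X Y rk by linarith+
  have "norm ?r \<le> C * (norm ?D * ?x + norm (\<phi> (y [^] k)) * ?d)"
    by (rule mult_est) (use X Y Suc.prems nr nkr in auto)
  also have "\<dots> \<le> C * ((2 * real k * ?d) * ?x + (2 * real k * ?y) * ?d)"
    using D Y C_nonneg by (intro mult_left_mono add_mono mult_right_mono) auto
  also have "\<dots> = C * (2 * real k) * (?x + ?y) * ?d" by (simp add: algebra_simps)
  finally have a: "norm ?r \<le> C * (2 * real k) * (?x + ?y) * ?d" .
  have e: "\<phi> (x [^] Suc k) - \<phi> (y [^] Suc k) - real (Suc k) *\<^sub>R (\<phi> x - \<phi> y) = ?r + (?D - real k *\<^sub>R (\<phi> x - \<phi> y))"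
    by (simp add: scaleR_add_left)
  have "C * (real (Suc k))\<^sup>2 * (?x + ?y) * ?d
      = C * (2 * real k) * (?x + ?y) * ?d + C * (real k)\<^sup>2 * (?x + ?y) * ?d + C * (?x + ?y) * ?d"
    by (simp add: power2_eq_square algebra_simps)
  moreover have "0 \<le> C * (?x + ?y) * ?d" using C_nonneg by simp
  ultimately have est: "norm (\<phi> (x [^] Suc k) - \<phi> (y [^] Suc k) - real (Suc k) *\<^sub>R (\<phi> x - \<phi> y))
     \<le> C * (real (Suc k))\<^sup>2 * (?x + ?y) * ?d"
    unfolding e using a IH norm_triangle_ineq[of ?r "?D - real k *\<^sub>R (\<phi> x - \<phi> y)"] by linarith
  have "C * (real (Suc k))\<^sup>2 * (?x + ?y) * ?d = (C * real (Suc k) * (?x + ?y)) * (real (Suc k) * ?d)"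
    by (simp only: power2_eq_square mult_ac)
  also have "\<dots> \<le> 1 * (real (Suc k) * ?d)" using Suc.prems(3) by (intro mult_right_mono) auto
  finally have "norm (\<phi> (x [^] Suc k) - \<phi> (y [^] Suc k)) \<le> 2 * real (Suc k) * ?d"
    using est norm_triangle_sub[of "\<phi> (x [^] Suc k) - \<phi> (y [^] Suc k)" "real (Suc k) *\<^sub>R (\<phi> x - \<phi> y)"] by (auto simp: distrib_right)
  moreover have "x [^] Suc k \<in> U" using mult_U[OF X(1) Suc.prems(1) nkr(1) nr(1)] by simp
  ultimately show ?case using est by blast
qed

lemma pow_norm:
  assumes "x \<in> U" "C * real k * norm (\<phi> x) \<le> 1" "2 * real k * norm (\<phi> x) < r"
  shows "x [^] k \<in> U \<and> norm (\<phi> (x [^] k) - real k *\<^sub>R \<phi> x) \<le> C * (real k)\<^sup>2 * (norm (\<phi> x))\<^sup>2"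
    "norm (\<phi> (x [^] k)) \<le> 2 * real k * norm (\<phi> x)"
  using pow_est[of x \<one> k] assms one_U \<phi>_one r_pos by (simp_all add: power2_eq_square mult.assoc)

text \<open>Chosen so that \<open>real k * norm v \<le> 2 * \<delta>\<close> implies the hypotheses
  of \<open>pow_est\<close>; the factor 2 leaves room for vectors that merely converge to one of
  norm below \<open>\<delta>\<close>.\<close>

definition \<delta> :: real where "\<delta> = min (r / 8) (1 / (8 * (C + 1)))"

lemma \<delta>_pos: "0 < \<delta>" and \<delta>_r: "8 * \<delta> \<le> r" and \<delta>_C: "8 * C * \<delta> \<le> 1"
proof -
  show "0 < \<delta>" "8 * \<delta> \<le> r" using r_pos C_nonneg by (auto simp: \<delta>_def)
  have "8 * C * \<delta> \<le> 8 * C * (1 / (8 * (C + 1)))" using C_nonneg by (intro mult_left_mono) (auto simp: \<delta>_def)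
  also have "\<dots> \<le> 1" using C_nonneg by (simp add: divide_simps)
  finally show "8 * C * \<delta> \<le> 1" .
qed

definition \<psi> :: "'e \<Rightarrow> 'g" where "\<psi> = inv_into U \<phi>"

lemma \<psi>: "v \<in> E \<Longrightarrow> norm v < r \<Longrightarrow> \<psi> v \<in> U" "v \<in> E \<Longrightarrow> norm v < r \<Longrightarrow> \<phi> (\<psi> v) = v"
  unfolding \<psi>_def using ball_r by (meson IntI inv_into_into f_inv_into_f mem_ball_0 subsetD)+

lemma \<psi>_\<phi>: "x \<in> U \<Longrightarrow> \<psi> (\<phi> x) = x"
  unfolding \<psi>_def using inj_\<phi> by simp

lemma small_imp:
  assumes "real k * norm v \<le> 2 * \<delta>"
  shows "C * real k * norm v \<le> 1" "2 * real k * norm v < r"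
proof -
  have "C * real k * norm v = C * (real k * norm v)" by simp
  also have "\<dots> \<le> C * (2 * \<delta>)" using assms C_nonneg by (intro mult_left_mono)
  finally show "C * real k * norm v \<le> 1" using \<delta>_C C_nonneg \<delta>_pos by (auto simp: mult_ac)
  show "2 * real k * norm v < r" using assms \<delta>_r \<delta>_pos r_pos by (simp add: mult_ac)
qed

lemma small_imp2:
  assumes "real k * norm v \<le> 2 * \<delta>" "real k * norm w \<le> 2 * \<delta>"
  shows "C * real k * (norm v + norm w) \<le> 1"
proof -
  have "C * real k * (norm v + norm w) = C * (real k * norm v + real k * norm w)" by (simp add: algebra_simps)
  also have "\<dots> \<le> C * (2 * \<delta> + 2 * \<delta>)" using assms C_nonneg by (intro mult_left_mono) auto
  also have "\<dots> = 4 * C * \<delta>" by simp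
  finally show ?thesis using \<delta>_C C_nonneg \<delta>_pos mult_nonneg_nonneg[of C \<delta>] by linarith
qed

definition ex :: "nat \<Rightarrow> 'e \<Rightarrow> 'e" where "ex n X = \<phi> (\<psi> (X /\<^sub>R real n) [^] n)"

lemma \<psi>_scaled:
  assumes "X \<in> E" "norm X \<le> 2 * \<delta>" "0 < n"
  shows "\<psi> (X /\<^sub>R real n) \<in> U" "\<phi> (\<psi> (X /\<^sub>R real n)) = X /\<^sub>R real n"
    "real n * norm (\<phi> (\<psi> (X /\<^sub>R real n))) \<le> 2 * \<delta>"
proof -
  have "norm (X /\<^sub>R real n) \<le> norm X / 1" using assms(3) by (simp add: divide_simps mult_le_cancel_left1)
  hence "norm (X /\<^sub>R real n) < r" using assms \<delta>_r \<delta>_pos by linarith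
  moreover have "X /\<^sub>R real n \<in> E" using assms(1) subspace_E by (simp add: subspace_scale)
  ultimately show "\<psi> (X /\<^sub>R real n) \<in> U" "\<phi> (\<psi> (X /\<^sub>R real n)) = X /\<^sub>R real n" using \<psi> by auto
  thus "real n * norm (\<phi> (\<psi> (X /\<^sub>R real n))) \<le> 2 * \<delta>" using assms by (simp add: field_simps)
qed

lemma ex_E:
  assumes "X \<in> E" "norm X \<le> 2 * \<delta>" "0 < n"
  shows "ex n X \<in> E" "\<psi> (X /\<^sub>R real n) [^] n \<in> U" "norm (ex n X - X) \<le> C * (norm X)\<^sup>2"
proof -
  note P = \<psi>_scaled[OF assms]
  note Q = pow_norm(1)[OF P(1) small_imp[OF P(3)]]
  thus 1: "\<psi> (X /\<^sub>R real n) [^] n \<in> U" by blast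
  thus "ex n X \<in> E" unfolding ex_def using \<phi>_E by blast
  show "norm (ex n X - X) \<le> C * (norm X)\<^sup>2"
    using Q P(2) assms(3) by (simp add: ex_def power_mult_distrib field_simps)
qed

text \<open>The \<open>m\<close>-th power of the point with coordinates \<open>X / (n m)\<close>
  differs from the point with coordinates \<open>X / n\<close> by at most
  \<open>C * (norm X)^2 / n^2\<close>. Taking \<open>n\<close>-th powers multiplies this error by at
  most \<open>2 * n\<close>.\<close>

lemma ex_refine:
  assumes X: "X \<in> E" "norm X \<le> \<delta>" and n: "0 < n" and m: "0 < m"
  shows "norm (ex (n * m) X - ex n X) \<le> 2 * C * (norm X)\<^sup>2 / real n"
proof -
  have X2: "norm X \<le> 2 * \<delta>" using X \<delta>_pos by linarith
  have nm: "0 < n * m" using n m by simp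
  define x where "x = \<psi> (X /\<^sub>R real (n * m))"
  define a where "a = x [^] m"
  define b where "b = \<psi> (X /\<^sub>R real n)"
  note x = \<psi>_scaled[OF X(1) X2 nm, folded x_def]
  note b = \<psi>_scaled[OF X(1) X2 n, folded b_def]
  have nx: "norm (\<phi> x) = norm X / (real n * real m)" using x(2) by (simp add: divide_simps)
  have m1: "real m * norm (\<phi> x) \<le> 2 * \<delta>"
  proof -
    have "real m * norm (\<phi> x) = norm X / real n" using nx m by simp
    also have "\<dots> \<le> norm X" using n by (simp add: divide_simps mult_le_cancel_left1)
    finally show ?thesis using X2 by linarith
  qed
  note A = pow_norm(1)[OF x(1) small_imp[OF m1], folded a_def]
  note A2 = pow_norm(2)[OF x(1) small_imp[OF m1], folded a_def]
  have na: "norm (\<phi> a) \<le> 2 * norm X / real n" using A2 nx m by simp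
  have "\<phi> b = real m *\<^sub>R \<phi> x" using x(2) b(2) m by simp
  hence ab: "norm (\<phi> a - \<phi> b) \<le> C * (norm X)\<^sup>2 / (real n)\<^sup>2"
    using A nx m by (simp add: power_divide power_mult_distrib)
  have s: "real n * norm (\<phi> a) \<le> 2 * \<delta>"
  proof -
    have "real n * norm (\<phi> a) \<le> real n * (2 * norm X / real n)" using na by (intro mult_left_mono) auto
    thus ?thesis using X n by simp
  qed
  have "x [^] (n * m) = a [^] n" using x(1) U_closed by (simp add: a_def nat_pow_pow mult.commute)
  hence "norm (ex (n * m) X - ex n X) = norm (\<phi> (a [^] n) - \<phi> (b [^] n))" by (simp add: ex_def x_def b_def)
  also have "\<dots> \<le> 2 * real n * norm (\<phi> a - \<phi> b)"
    by (rule pow_est[THEN conjunct2, THEN conjunct2]) (use A b small_imp2[OF s b(3)] small_imp[OF s] small_imp[OF b(3)] in auto)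
  also have "\<dots> \<le> 2 * real n * (C * (norm X)\<^sup>2 / (real n)\<^sup>2)" using ab by (intro mult_left_mono) auto
  also have "\<dots> = 2 * C * (norm X)\<^sup>2 / real n" using n by (simp add: power2_eq_square)
  finally show ?thesis .
qed

definition lexp :: "'e \<Rightarrow> 'e" where "lexp X = lim (\<lambda>n. ex n X)"

text \<open>\<open>ex m X\<close> and \<open>ex n X\<close> are both compared with their common
  refinement \<open>ex (m * n) X\<close>.\<close>

lemma ex_tendsto:
  assumes X: "X \<in> E" "norm X \<le> \<delta>"
  shows "(\<lambda>n. ex n X) \<longlonglongrightarrow> lexp X"
proof -
  define K where "K = 2 * C * (norm X)\<^sup>2"
  have "Cauchy (\<lambda>n. ex n X)"
  proof (rule CauchyI)
    fix e :: real assume e: "0 < e"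
    have K: "0 \<le> K" using C_nonneg by (simp add: K_def)
    obtain N :: nat where N: "real N > 2 * K / e" using reals_Archimedean2 by blast
    show "\<exists>M. \<forall>m\<ge>M. \<forall>n\<ge>M. norm (ex m X - ex n X) < e"
    proof (intro exI allI impI)
      fix m n assume mn: "m \<ge> Suc N" "n \<ge> Suc N"
      have *: "K / real l < e / 2" if "l \<ge> Suc N" for l
      proof -
        have "2 * K / e < real l" using N that by linarith
        thus ?thesis using e that by (simp add: divide_simps mult_ac)
      qed
      have "norm (ex (m * n) X - ex m X) \<le> K / real m" "norm (ex (n * m) X - ex n X) \<le> K / real n"
        unfolding K_def using mn by (intro ex_refine[OF X]; simp)+
      moreover have eq: "ex (m * n) X - ex n X - (ex (m * n) X - ex m X) = ex m X - ex n X" by simp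
      ultimately show "norm (ex m X - ex n X) < e"
        using *[OF mn(1)] *[OF mn(2)] norm_triangle_ineq4[of "ex (m * n) X - ex n X" "ex (m * n) X - ex m X"]

        unfolding eq by (simp only: mult.commute[of n m])
    qed
  qed
  thus ?thesis unfolding lexp_def using Cauchy_convergent_iff convergent_LIMSEQ_iff by blast
qed

text \<open>Only the limit of \<open>k * \<phi> g\<close> matters: the \<open>k\<close>-th powers of
  \<open>g\<close> and of the point with coordinates \<open>X / k\<close> differ by at most twice
  the norm of \<open>k * \<phi> g - X\<close>.\<close>

lemma pow_tendsto_lexp:
  assumes k: "filterlim k at_top F" and g: "eventually (\<lambda>i. g i \<in> U) F"
    and lim: "((\<lambda>i. real (k i) *\<^sub>R \<phi> (g i)) \<longlongrightarrow> X) F" and X: "X \<in> E" "norm X < \<delta>"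
  shows "eventually (\<lambda>i. g i [^] k i \<in> U) F" "((\<lambda>i. \<phi> (g i [^] k i)) \<longlongrightarrow> lexp X) F"
proof -
  have X2: "norm X \<le> 2 * \<delta>" "norm X \<le> \<delta>" using X \<delta>_pos by linarith+
  have "((\<lambda>i. norm (real (k i) *\<^sub>R \<phi> (g i))) \<longlongrightarrow> norm X) F" using lim by (rule tendsto_norm)
  hence small: "eventually (\<lambda>i. norm (real (k i) *\<^sub>R \<phi> (g i)) < 2 * \<delta>) F"
    using X \<delta>_pos by (intro order_tendstoD(2)) auto
  have kpos: "eventually (\<lambda>i. 0 < k i) F"
    using k by (auto simp: filterlim_at_top elim!: allE[of _ "Suc 0"] eventually_mono)
  show "eventually (\<lambda>i. g i [^] k i \<in> U) F" using small g
  proof eventually_elim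
    case (elim i)
    hence "real (k i) * norm (\<phi> (g i)) \<le> 2 * \<delta>" by simp
    thus ?case using pow_norm(1) small_imp elim(2) by blast
  qed
  have "eventually (\<lambda>i. norm (\<phi> (g i [^] k i) - ex (k i) X) \<le> 2 * norm (real (k i) *\<^sub>R \<phi> (g i) - X)) F"
    using small g kpos
  proof eventually_elim
    case (elim i)
    let ?b = "\<psi> (X /\<^sub>R real (k i))"
    note b = \<psi>_scaled[OF X(1) X2(1) elim(3)]
    have s: "real (k i) * norm (\<phi> (g i)) \<le> 2 * \<delta>" using elim(1) by simp
    have "norm (\<phi> (g i [^] k i) - \<phi> (?b [^] k i)) \<le> 2 * real (k i) * norm (\<phi> (g i) - \<phi> ?b)"
      by (rule pow_est[THEN conjunct2, THEN conjunct2]) (use elim b small_imp2[OF s b(3)] small_imp[OF s] small_imp[OF b(3)] in auto)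
    also have "\<dots> = 2 * norm (real (k i) *\<^sub>R (\<phi> (g i) - \<phi> ?b))" by simp
    also have "real (k i) *\<^sub>R (\<phi> (g i) - \<phi> ?b) = real (k i) *\<^sub>R \<phi> (g i) - X"
      using b(2) elim(3) by (simp add: algebra_simps)
    finally show ?case by (simp add: ex_def)
  qed
  moreover have "((\<lambda>i. 2 * norm (real (k i) *\<^sub>R \<phi> (g i) - X)) \<longlongrightarrow> 0) F"
    using lim by (simp add: LIM_zero tendsto_mult_right_zero tendsto_norm_zero)
  ultimately have "((\<lambda>i. \<phi> (g i [^] k i) - ex (k i) X) \<longlongrightarrow> 0) F" by (rule Lim_null_comparison)
  moreover have "((\<lambda>i. ex (k i) X) \<longlongrightarrow> lexp X) F" using filterlim_compose[OF ex_tendsto[OF X(1) X2(2)] k] .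
  ultimately show "((\<lambda>i. \<phi> (g i [^] k i)) \<longlongrightarrow> lexp X) F" using tendsto_add by fastforce
qed

text \<open>The limit \<open>lexp\<close> is controlled for norms up to \<open>\<delta>\<close>, so
  a long vector is divided by \<open>N\<close> first; the \<open>Suc\<close> makes the quotient
  strictly shorter than \<open>\<delta>\<close>. That the result is the limit of powers, and thus
  does not depend on this choice, is the content of \<open>Exp_limit\<close>.\<close>

definition Exp :: "'e \<Rightarrow> 'g" where
  "Exp X = (let N = Suc (nat \<lceil>norm X / \<delta>\<rceil>) in \<psi> (lexp (X /\<^sub>R real N)) [^] N)"

lemma limitin_one:
  assumes "eventually (\<lambda>i. g i \<in> U) F" "((\<lambda>i. \<phi> (g i)) \<longlongrightarrow> 0) F"
  shows "limitin T g \<one> F" using limitin_chart[OF one_U] assms \<phi>_one by simp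

lemma lexp_E:
  assumes "X \<in> E" "norm X \<le> \<delta>"
  shows "lexp X \<in> E" "norm (lexp X - X) \<le> C * (norm X)\<^sup>2" "norm (lexp X) < r" "norm (lexp X) \<le> 2 * norm X"
proof -
  note lim = ex_tendsto[OF assms]
  have Y: "norm X \<le> 2 * \<delta>" using assms \<delta>_pos by linarith
  have "eventually (\<lambda>n. ex n X \<in> E) sequentially" "eventually (\<lambda>n. norm (ex n X - X) \<le> C * (norm X)\<^sup>2) sequentially"
    using ex_E[OF assms(1) Y] by (auto simp: eventually_sequentially intro!: exI[of _ 1])
  thus "lexp X \<in> E" and *: "norm (lexp X - X) \<le> C * (norm X)\<^sup>2"
    using Lim_in_closed_set[OF closed_subspace[OF subspace_E] _ _ lim]
      tendsto_upperbound[OF tendsto_norm[OF tendsto_diff[OF lim tendsto_const]]] by auto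
  have "C * (norm X)\<^sup>2 = (C * norm X) * norm X" by (simp add: power2_eq_square)
  also have "\<dots> \<le> 1 * norm X"
  proof (rule mult_right_mono)
    have "C * norm X \<le> C * \<delta>" using assms C_nonneg by (intro mult_left_mono)
    thus "C * norm X \<le> 1" using \<delta>_C mult_nonneg_nonneg[OF C_nonneg less_imp_le[OF \<delta>_pos]] by linarith
  qed simp
  finally show "norm (lexp X) \<le> 2 * norm X" using * norm_triangle_sub[of "lexp X" X] by linarith
  thus "norm (lexp X) < r" using assms \<delta>_r \<delta>_pos by linarith
qed

lemma scaled_limit_null:
  assumes k: "filterlim k at_top F" and lim: "((\<lambda>i. real (k i) *\<^sub>R v i) \<longlongrightarrow> X) F"
  shows "(v \<longlongrightarrow> (0::'a::real_normed_vector)) F"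
proof -
  have kpos: "eventually (\<lambda>i. 0 < k i) F"
    using k by (auto simp: filterlim_at_top elim!: allE[of _ "Suc 0"] eventually_mono)
  have "((\<lambda>i. inverse (real (k i))) \<longlongrightarrow> 0) F"
    using filterlim_compose[OF tendsto_inverse_0_at_top[OF filterlim_real_sequentially] k] by simp
  from tendsto_scaleR[OF this lim]
  have "((\<lambda>i. inverse (real (k i)) *\<^sub>R real (k i) *\<^sub>R v i) \<longlongrightarrow> 0) F" by simp
  thus "(v \<longlongrightarrow> 0) F" by (rule Lim_transform_eventually) (use kpos in \<open>auto elim: eventually_mono\<close>)
qed

text \<open>The source of all identities for \<open>Exp\<close>: each is obtained by feeding in
  suitable elements \<open>g\<close>. With \<open>k = q * N + s\<close> and \<open>s < N\<close>,
  the powers \<open>g [^] q\<close> converge inside the chart, their \<open>N\<close>-th powers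
  converge by continuity of the multiplication, and the remaining factors tend to the
  identity.\<close>

theorem Exp_limit:
  assumes k: "filterlim k at_top F" and g: "eventually (\<lambda>i. g i \<in> U) F"
    and lim: "((\<lambda>i. real (k i) *\<^sub>R \<phi> (g i)) \<longlongrightarrow> X) F" and X: "X \<in> E"
  shows "limitin T (\<lambda>i. g i [^] k i) (Exp X) F"
proof -
  define N where "N = Suc (nat \<lceil>norm X / \<delta>\<rceil>)"
  have N: "0 < N" by (simp add: N_def)
  have "norm X / \<delta> < real N" unfolding N_def by linarith
  hence XN: "norm (X /\<^sub>R real N) < \<delta>" using \<delta>_pos N by (simp add: divide_simps mult_ac)
  have XE: "X /\<^sub>R real N \<in> E" using X subspace_E by (simp add: subspace_scale)
  define q where "q i = k i div N" for i
  define s where "s i = k i mod N" for i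
  have q: "filterlim q at_top F" unfolding filterlim_at_top
  proof
    fix Z
    have "eventually (\<lambda>i. N * Z \<le> k i) F" using k by (simp add: filterlim_at_top)
    thus "eventually (\<lambda>i. Z \<le> q i) F"
      by (rule eventually_mono) (simp add: q_def less_eq_div_iff_mult_less_eq[OF N] mult.commute)
  qed
  note g0 = scaled_limit_null[OF k lim]
  have "((\<lambda>i. real (s i) *\<^sub>R \<phi> (g i)) \<longlongrightarrow> 0) F"
  proof (rule Lim_null_comparison)
    show "eventually (\<lambda>i. norm (real (s i) *\<^sub>R \<phi> (g i)) \<le> real N * norm (\<phi> (g i))) F"
      using less_imp_le[OF mod_less_divisor[OF N]]
      by (intro always_eventually allI) (simp add: s_def mult_right_mono)
    show "((\<lambda>i. real N * norm (\<phi> (g i))) \<longlongrightarrow> 0) F" using tendsto_mult_right_zero[OF tendsto_norm_zero[OF g0]] .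
  qed
  from tendsto_scaleR[OF tendsto_const[of "inverse (real N)"] tendsto_diff[OF lim this]]
  have "((\<lambda>i. inverse (real N) *\<^sub>R (real (k i) *\<^sub>R \<phi> (g i) - real (s i) *\<^sub>R \<phi> (g i))) \<longlongrightarrow> X /\<^sub>R real N) F" by simp
  moreover have "inverse (real N) *\<^sub>R (real (k i) *\<^sub>R \<phi> (g i) - real (s i) *\<^sub>R \<phi> (g i)) = real (q i) *\<^sub>R \<phi> (g i)" for i
  proof -
    have "k i = N * q i + s i" by (simp add: q_def s_def)
    hence "real (k i) = real N * real (q i) + real (s i)" by (metis of_nat_add of_nat_mult)
    thus ?thesis using N by (simp add: scaleR_diff_left[symmetric])
  qed
  ultimately have lq: "((\<lambda>i. real (q i) *\<^sub>R \<phi> (g i)) \<longlongrightarrow> X /\<^sub>R real N) F" by simp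
  note L = pow_tendsto_lexp[OF q g lq XE XN]
  note lexp_small = lexp_E(1,3)[OF XE less_imp_le[OF XN]]
  have "limitin T (\<lambda>i. g i [^] q i) (\<psi> (lexp (X /\<^sub>R real N))) F"
    by (rule limitin_chart) (use L \<psi> lexp_small in auto)
  from limitin_pow[OF this, of N]
  have 1: "limitin T (\<lambda>i. (g i [^] q i) [^] N) (Exp X) F" by (simp add: Exp_def N_def[symmetric] Let_def)
  have 2: "limitin T (\<lambda>i. g i [^] s i) \<one> F" unfolding limitin_def
  proof (intro conjI allI impI)
    fix V assume V: "openin T V \<and> \<one> \<in> V"
    have "eventually (\<lambda>i. g i [^] j \<in> V) F" for j :: nat
      using limitin_pow[OF limitin_one[OF g g0], of j] V by (simp add: limitin_def)
    \<comment> \<open>The exponent \<open>s i\<close> varies with \<open>i\<close> but takes only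
      the values below \<open>N\<close>, so finitely many conditions suffice.\<close>
    hence "eventually (\<lambda>i. \<forall>j\<in>{..<N}. g i [^] j \<in> V) F" by (intro eventually_ball_finite) auto
    thus "eventually (\<lambda>i. g i [^] s i \<in> V) F" by (rule eventually_mono) (use N in \<open>auto simp: s_def\<close>)
  qed simp
  have "limitin T (\<lambda>i. (g i [^] q i) [^] N \<otimes> g i [^] s i) (Exp X \<otimes> \<one>) F" by (rule limitin_mult[OF 1 2])
  moreover have "Exp X \<otimes> \<one> = Exp X" using 1 by (simp add: limitin_def)
  moreover have "eventually (\<lambda>i. (g i [^] q i) [^] N \<otimes> g i [^] s i = g i [^] k i) F" using g
  proof eventually_elim
    case (elim i)
    have "k i = q i * N + s i" by (simp add: q_def s_def)
    thus ?case using elim U_closed by (simp add: nat_pow_pow nat_pow_mult)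
  qed
  ultimately show ?thesis using limitin_transform_eventually by force
qed

lemma filterlim_id_nat: "filterlim (\<lambda>n::nat. n) at_top sequentially"
  by (rule filterlim_ident)

lemma \<psi>_div_limit:
  assumes "X \<in> E"
  shows "eventually (\<lambda>n. \<psi> (X /\<^sub>R real n) \<in> U) sequentially"
    "(\<lambda>n. real n *\<^sub>R \<phi> (\<psi> (X /\<^sub>R real n))) \<longlonglongrightarrow> X"
proof -
  have "(\<lambda>n. inverse (real n) *\<^sub>R X) \<longlonglongrightarrow> 0 *\<^sub>R X" by (intro tendsto_scaleR lim_inverse_n tendsto_const)
  from tendsto_norm[OF this] have "eventually (\<lambda>n. norm (X /\<^sub>R real n) < r) sequentially"
    using r_pos by (intro order_tendstoD(2)[of _ "norm (0 *\<^sub>R X)"]) auto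
  hence *: "eventually (\<lambda>n. \<psi> (X /\<^sub>R real n) \<in> U \<and> \<phi> (\<psi> (X /\<^sub>R real n)) = X /\<^sub>R real n) sequentially"
    by (rule eventually_mono) (use \<psi> assms subspace_E in \<open>simp add: subspace_scale\<close>)
  thus "eventually (\<lambda>n. \<psi> (X /\<^sub>R real n) \<in> U) sequentially" by (rule eventually_mono) auto
  show "(\<lambda>n. real n *\<^sub>R \<phi> (\<psi> (X /\<^sub>R real n))) \<longlonglongrightarrow> X"
    by (rule tendsto_eventually) (use * eventually_gt_at_top[of 0] in \<open>eventually_elim, simp\<close>)
qed

lemma Exp_limit_\<psi>:
  assumes "X \<in> E"
  shows "limitin T (\<lambda>n. \<psi> (X /\<^sub>R real n) [^] n) (Exp X) sequentially"
  using Exp_limit[OF filterlim_id_nat \<psi>_div_limit[OF assms] assms] .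

lemma Exp_carrier [simp, intro]: "X \<in> E \<Longrightarrow> Exp X \<in> carrier G"
  using Exp_limit_\<psi> by (simp add: limitin_def)

lemma Exp_small:
  assumes "X \<in> E" "norm X < \<delta>"
  shows "Exp X \<in> U" "\<phi> (Exp X) = lexp X" "Exp X = \<psi> (lexp X)"
proof -
  note L = pow_tendsto_lexp[OF filterlim_id_nat \<psi>_div_limit[OF assms(1)] assms]
  have l: "lexp X \<in> E" "norm (lexp X) < r" using lexp_E assms by auto
  have "limitin T (\<lambda>n. \<psi> (X /\<^sub>R real n) [^] n) (\<psi> (lexp X)) sequentially"
    by (rule limitin_chart) (use L \<psi> l in auto)
  from limitin_unique[OF Exp_limit_\<psi>[OF assms(1)] this]
  show "Exp X = \<psi> (lexp X)" by simp
  thus "Exp X \<in> U" "\<phi> (Exp X) = lexp X" using \<psi> l by auto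
qed

lemma Exp_small_est:
  assumes "X \<in> E" "norm X < \<delta>"
  shows "norm (\<phi> (Exp X) - X) \<le> C * (norm X)\<^sup>2" "norm (\<phi> (Exp X)) \<le> 2 * norm X"
  using lexp_E[of X] Exp_small[OF assms] assms by auto

text \<open>Applied to the points with coordinates \<open>X / n\<close> and \<open>Y / n\<close> and
  to \<open>n\<close>-th powers, \<open>pow_est\<close> gives a bound in which \<open>n\<close>
  cancels, so it survives the limit.\<close>

lemma lexp_near_identity:
  assumes X: "X \<in> E" "norm X < \<delta>" and Y: "Y \<in> E" "norm Y < \<delta>"
  shows "norm (lexp X - lexp Y - (X - Y)) \<le> C * (norm X + norm Y) * norm (X - Y)"
proof -
  have X': "norm X \<le> \<delta>" "norm X \<le> 2 * \<delta>" and Y': "norm Y \<le> \<delta>" "norm Y \<le> 2 * \<delta>" using X Y \<delta>_pos by linarith+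
  have *: "norm (ex n X - ex n Y - (X - Y)) \<le> C * (norm X + norm Y) * norm (X - Y)" if n: "0 < n" for n
  proof -
    note x = \<psi>_scaled[OF X(1) X'(2) n] and y = \<psi>_scaled[OF Y(1) Y'(2) n]
    have nd: "norm (X /\<^sub>R real n - Y /\<^sub>R real n) = norm (X - Y) / real n"
    proof -
      have "X /\<^sub>R real n - Y /\<^sub>R real n = (X - Y) /\<^sub>R real n" by (simp add: scaleR_diff_right)
      thus ?thesis by (simp add: divide_inverse mult.commute)
    qed
    have "real n *\<^sub>R (X /\<^sub>R real n - Y /\<^sub>R real n) = X - Y" using n by (simp add: scaleR_diff_right)
    hence "norm (ex n X - ex n Y - (X - Y)) \<le> C * (real n)\<^sup>2 * (norm (X /\<^sub>R real n) + norm (Y /\<^sub>R real n)) * norm (X /\<^sub>R real n - Y /\<^sub>R real n)"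
      using pow_est[THEN conjunct2, THEN conjunct1, OF x(1) y(1) small_imp2[OF x(3) y(3)] small_imp(2)[OF x(3)] small_imp(2)[OF y(3)]]
      by (simp only: ex_def x(2) y(2))
    also have "\<dots> = C * (norm X + norm Y) * norm (X - Y)"
      unfolding nd using n by (simp add: field_simps power2_eq_square)
    finally show ?thesis .
  qed
  show ?thesis
  proof (rule tendsto_upperbound)
    show "(\<lambda>n. norm (ex n X - ex n Y - (X - Y))) \<longlonglongrightarrow> norm (lexp X - lexp Y - (X - Y))"
      by (intro tendsto_norm tendsto_diff ex_tendsto X X' Y Y' tendsto_const)
    show "eventually (\<lambda>n. norm (ex n X - ex n Y - (X - Y)) \<le> C * (norm X + norm Y) * norm (X - Y)) sequentially"
      using * by (auto simp: eventually_sequentially intro!: exI[of _ 1])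
  qed simp
qed

lemma lexp_near_identity2:
  assumes X: "X \<in> E" "norm X < \<delta>" and Y: "Y \<in> E" "norm Y < \<delta>"
  shows "norm (lexp X - lexp Y - (X - Y)) \<le> norm (X - Y) / 4"
proof -
  have "C * (norm X + norm Y) \<le> C * (\<delta> + \<delta>)" using X Y C_nonneg by (intro mult_left_mono) auto
  hence "C * (norm X + norm Y) \<le> 1/4" using \<delta>_C by (simp add: algebra_simps)
  hence "C * (norm X + norm Y) * norm (X - Y) \<le> 1/4 * norm (X - Y)" by (intro mult_right_mono) auto
  thus ?thesis using lexp_near_identity[OF assms] by linarith
qed

lemma Exp_inj:
  assumes "X \<in> E" "norm X < \<delta>" "Y \<in> E" "norm Y < \<delta>" "Exp X = Exp Y"
  shows "X = Y"
proof -
  have "lexp X = lexp Y" using Exp_small(2) assms by metis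
  hence "norm (X - Y) \<le> norm (X - Y) / 4"
    using lexp_near_identity2[OF assms(1-4)] by (simp add: norm_minus_commute)
  thus ?thesis by simp
qed

lemma Exp_onto:
  assumes "g \<in> U" "norm (\<phi> g) < \<delta> / 4"
  shows "\<exists>X\<in>E. norm X \<le> 2 * norm (\<phi> g) \<and> Exp X = g"
proof -
  have "\<exists>X\<in>E. norm X \<le> 2 * norm (\<phi> g) \<and> lexp X = \<phi> g"
  proof (rule near_identity_onto[OF subspace_E, where \<rho> = "\<delta> / 2"])
    show "\<phi> g \<in> E" using assms \<phi>_E by blast
    show "2 * norm (\<phi> g) \<le> \<delta> / 2" using assms by simp
    show "lexp 0 = 0" using lexp_E(2)[of 0] subspace_0[OF subspace_E] \<delta>_pos by simp
    show "lexp X \<in> E" if "X \<in> E" "norm X \<le> \<delta> / 2" for X using lexp_E(1) that \<delta>_pos by simp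
    show "norm (lexp x - lexp y - (x - y)) \<le> norm (x - y) / 2"
      if "x \<in> E" "y \<in> E" "norm x \<le> \<delta> / 2" "norm y \<le> \<delta> / 2" for x y
    proof -
      have "norm (lexp x - lexp y - (x - y)) \<le> norm (x - y) / 4"
        by (rule lexp_near_identity2) (use that \<delta>_pos in auto)
      thus ?thesis using norm_ge_zero[of "x - y"] by linarith
    qed
  qed
  then obtain X where X: "X \<in> E" "norm X \<le> 2 * norm (\<phi> g)" "lexp X = \<phi> g" by blast
  hence "norm X < \<delta>" using assms \<delta>_pos by linarith
  hence "Exp X = g" using Exp_small(3)[OF X(1)] X(3) \<psi>_\<phi> assms(1) by simp
  thus ?thesis using X by blast
qed

text \<open>Lets exponentials of short vectors be the input of \<open>Exp_limit\<close>:
  \<open>\<phi> (Exp v)\<close> differs from \<open>v\<close> by a term quadratic in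
  \<open>v\<close>, which is negligible even after multiplication by \<open>k\<close>.\<close>

lemma Exp_limit_seq:
  assumes X: "X \<in> E" and k: "filterlim k at_top F" and v: "\<And>i. v i \<in> E"
    and lim: "((\<lambda>i. real (k i) *\<^sub>R v i) \<longlongrightarrow> X) F"
  shows "eventually (\<lambda>i. Exp (v i) \<in> U) F" "((\<lambda>i. real (k i) *\<^sub>R \<phi> (Exp (v i))) \<longlongrightarrow> X) F"
    and "(v \<longlongrightarrow> 0) F"
proof -
  show v0: "(v \<longlongrightarrow> 0) F" by (rule scaled_limit_null[OF k lim])
  have small: "eventually (\<lambda>i. norm (v i) < \<delta>) F"
    using tendsto_norm[OF v0] \<delta>_pos by (intro order_tendstoD(2)[of _ "norm (0::'e)"]) auto
  thus "eventually (\<lambda>i. Exp (v i) \<in> U) F" by (rule eventually_mono) (use Exp_small v in auto)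
  have "((\<lambda>i. real (k i) *\<^sub>R \<phi> (Exp (v i)) - real (k i) *\<^sub>R v i) \<longlongrightarrow> 0) F"
  proof (rule Lim_null_comparison)
    show "eventually (\<lambda>i. norm (real (k i) *\<^sub>R \<phi> (Exp (v i)) - real (k i) *\<^sub>R v i)
       \<le> C * norm (real (k i) *\<^sub>R v i) * norm (v i)) F" using small
    proof eventually_elim
      case (elim i)
      have "norm (real (k i) *\<^sub>R \<phi> (Exp (v i)) - real (k i) *\<^sub>R v i) = real (k i) * norm (\<phi> (Exp (v i)) - v i)"
        by (simp add: scaleR_diff_right[symmetric])
      also have "\<dots> \<le> real (k i) * (C * (norm (v i))\<^sup>2)"
        using Exp_small_est(1)[OF v elim] by (intro mult_left_mono) auto
      finally show ?case by (simp add: power2_eq_square mult_ac)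
    qed
    have "((\<lambda>i. C * norm (real (k i) *\<^sub>R v i) * norm (v i)) \<longlongrightarrow> C * norm X * norm (0::'e)) F"
      by (intro tendsto_mult tendsto_const tendsto_norm lim v0)
    thus "((\<lambda>i. C * norm (real (k i) *\<^sub>R v i) * norm (v i)) \<longlongrightarrow> 0) F" by simp
  qed
  from tendsto_add[OF this lim] show "((\<lambda>i. real (k i) *\<^sub>R \<phi> (Exp (v i))) \<longlongrightarrow> X) F" by simp
qed

end

lemma atin_top_of_set: "x \<in> S \<Longrightarrow> atin (top_of_set S) x = at x within S"
  unfolding filter_eq_iff by (auto simp: eventually_atin eventually_at_topological openin_open Bex_def)

lemma continuous_map_top_of_set:
  "continuous_map (top_of_set S) X f \<longleftrightarrow> (\<forall>x\<in>S. limitin X f (f x) (at x within S))"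
  by (simp add: continuous_map_atin atin_top_of_set)

text \<open>Integer multiples of a step that tends to 0 approximate every \<open>t > 0\<close>. This
  is how powers of discrete elements become one-parameter subgroups.\<close>

lemma floor_divide_limit:
  fixes a :: "nat \<Rightarrow> real"
  assumes t: "0 < t" and a: "eventually (\<lambda>n. 0 < a n) sequentially" "a \<longlonglongrightarrow> 0"
  shows "(\<lambda>n. real (nat \<lfloor>t / a n\<rfloor>) * a n) \<longlonglongrightarrow> t" and "filterlim (\<lambda>n. nat \<lfloor>t / a n\<rfloor>) at_top sequentially"
proof -
  have 1: "(\<lambda>n. t - a n) \<longlonglongrightarrow> t" using tendsto_diff[OF tendsto_const a(2)] by simp
  have b: "eventually (\<lambda>n. t - a n \<le> real (nat \<lfloor>t / a n\<rfloor>) * a n \<and> real (nat \<lfloor>t / a n\<rfloor>) * a n \<le> t) sequentially"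
    using a(1)
  proof eventually_elim
    case (elim n)
    hence "0 \<le> t / a n" using t by simp
    hence "t / a n - 1 \<le> real (nat \<lfloor>t / a n\<rfloor>)" "real (nat \<lfloor>t / a n\<rfloor>) \<le> t / a n" by linarith+
    thus ?case using elim by (simp add: field_simps)
  qed
  show "(\<lambda>n. real (nat \<lfloor>t / a n\<rfloor>) * a n) \<longlonglongrightarrow> t"
    by (rule tendsto_sandwich[OF _ _ 1 tendsto_const]) (use b in \<open>auto elim: eventually_mono\<close>)
  show "filterlim (\<lambda>n. nat \<lfloor>t / a n\<rfloor>) at_top sequentially" unfolding filterlim_at_top
  proof
    fix Z :: nat
    have "eventually (\<lambda>n. a n < t / (real Z + 1)) sequentially" using order_tendstoD(2)[OF a(2)] t by simp
    with a(1) show "eventually (\<lambda>n. Z \<le> nat \<lfloor>t / a n\<rfloor>) sequentially"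
    proof eventually_elim
      case (elim n)
      hence "real Z + 1 < t / a n" using t by (simp add: field_simps)
      thus ?case by linarith
    qed
  qed
qed

lemma floor_scale_limit:
  fixes s :: real
  assumes "0 < s"
  shows "(\<lambda>n. real (nat \<lfloor>s * real n\<rfloor>) / real n) \<longlonglongrightarrow> s" and "filterlim (\<lambda>n. nat \<lfloor>s * real n\<rfloor>) at_top sequentially"
  using floor_divide_limit[OF assms _ lim_1_over_n] eventually_gt_at_top[of "0::nat"] by simp_all

section \<open>One-parameter subgroups and Trotter's formula\<close>

context local_group
begin

lemma \<psi>_zero: "\<psi> 0 = \<one>"
  using \<psi>_\<phi>[OF one_U] \<phi>_one by simp

lemma lexp_zero: "lexp 0 = 0"
  using lexp_E(2)[of 0] subspace_0[OF subspace_E] \<delta>_pos by simp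

lemma Exp_zero [simp]: "Exp 0 = \<one>"
  using Exp_small(3)[of 0] subspace_0[OF subspace_E] \<delta>_pos lexp_zero \<psi>_zero by simp

lemma eventually_norm_less:
  assumes "(f \<longlongrightarrow> 0) F" "0 < (e::real)"
  shows "eventually (\<lambda>i. norm (f i) < e) F"
  using tendsto_norm[OF assms(1)] assms(2) by (intro order_tendstoD(2)[of _ "norm 0"]) auto

text \<open>The remainder of the group law is bounded by
  \<open>C * norm (\<phi> g) * norm (\<phi> h)\<close>. Multiplied by \<open>k\<close> it still
  tends to 0, since \<open>k * norm (\<phi> g)\<close> converges and \<open>\<phi> h\<close> tends
  to 0.\<close>

lemma chart_prod_limit:
  assumes k: "filterlim k at_top F"
    and g: "eventually (\<lambda>i. g i \<in> U) F" "((\<lambda>i. real (k i) *\<^sub>R \<phi> (g i)) \<longlongrightarrow> X) F"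
    and h: "eventually (\<lambda>i. h i \<in> U) F" "((\<lambda>i. real (k i) *\<^sub>R \<phi> (h i)) \<longlongrightarrow> Y) F"
  shows "eventually (\<lambda>i. g i \<otimes> h i \<in> U) F"
    "((\<lambda>i. real (k i) *\<^sub>R \<phi> (g i \<otimes> h i)) \<longlongrightarrow> X + Y) F"
proof -
  note g0 = scaled_limit_null[OF k g(2)] and h0 = scaled_limit_null[OF k h(2)]
  note ev = eventually_norm_less[OF g0 r_pos] eventually_norm_less[OF h0 r_pos] g(1) h(1)
  show "eventually (\<lambda>i. g i \<otimes> h i \<in> U) F" using ev by eventually_elim (rule mult_U)
  have "((\<lambda>i. real (k i) *\<^sub>R (\<phi> (g i \<otimes> h i) - \<phi> (g i) - \<phi> (h i))) \<longlongrightarrow> 0) F"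
  proof (rule Lim_null_comparison)
    show "eventually (\<lambda>i. norm (real (k i) *\<^sub>R (\<phi> (g i \<otimes> h i) - \<phi> (g i) - \<phi> (h i)))
        \<le> C * norm (real (k i) *\<^sub>R \<phi> (g i)) * norm (\<phi> (h i))) F" using ev
    proof eventually_elim
      case (elim i)
      have "real (k i) * norm (\<phi> (g i \<otimes> h i) - \<phi> (g i) - \<phi> (h i)) \<le> real (k i) * (C * norm (\<phi> (g i)) * norm (\<phi> (h i)))"
        using elim by (intro mult_left_mono mult_est0) auto
      thus ?case by (simp add: mult_ac)
    qed
    have "((\<lambda>i. C * norm (real (k i) *\<^sub>R \<phi> (g i)) * norm (\<phi> (h i))) \<longlongrightarrow> C * norm X * norm (0::'e)) F"
      by (intro tendsto_mult tendsto_const tendsto_norm g h0)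
    thus "((\<lambda>i. C * norm (real (k i) *\<^sub>R \<phi> (g i)) * norm (\<phi> (h i))) \<longlongrightarrow> 0) F" by simp
  qed
  from tendsto_add[OF this tendsto_add[OF g(2) h(2)]]
  show "((\<lambda>i. real (k i) *\<^sub>R \<phi> (g i \<otimes> h i)) \<longlongrightarrow> X + Y) F" by (simp add: scaleR_add_right[symmetric])
qed

lemma chart_inv_limit:
  assumes k: "filterlim k at_top F"
    and g: "eventually (\<lambda>i. g i \<in> U) F" "((\<lambda>i. real (k i) *\<^sub>R \<phi> (g i)) \<longlongrightarrow> X) F"
  shows "eventually (\<lambda>i. inv (g i) \<in> U) F"
    "((\<lambda>i. real (k i) *\<^sub>R \<phi> (inv (g i))) \<longlongrightarrow> - X) F"
proof -
  note g0 = scaled_limit_null[OF k g(2)]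
  have "limitin T g \<one> F" using limitin_one[OF g(1) g0] .
  hence lim: "limitin T (\<lambda>i. inv (g i)) \<one> F" using limitin_inv by fastforce
  show 1: "eventually (\<lambda>i. inv (g i) \<in> U) F" by (rule limitin_eventually_U[OF lim one_U])
  have h0: "((\<lambda>i. \<phi> (inv (g i))) \<longlongrightarrow> 0) F" using tendsto_chart[OF lim one_U] \<phi>_one by simp
  note ev = eventually_norm_less[OF g0 r_pos] eventually_norm_less[OF h0 r_pos] g(1) 1
  have "((\<lambda>i. real (k i) *\<^sub>R (\<phi> (inv (g i))) + real (k i) *\<^sub>R \<phi> (g i)) \<longlongrightarrow> 0) F"
  proof (rule Lim_null_comparison)
    show "eventually (\<lambda>i. norm (real (k i) *\<^sub>R \<phi> (inv (g i)) + real (k i) *\<^sub>R \<phi> (g i))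
        \<le> C * norm (real (k i) *\<^sub>R \<phi> (g i)) * norm (\<phi> (inv (g i)))) F" using ev
    proof eventually_elim
      case (elim i)
      have "\<phi> (g i \<otimes> inv (g i)) = 0" using elim(3) U_closed \<phi>_one by simp
      hence "norm (- \<phi> (g i) - \<phi> (inv (g i))) \<le> C * norm (\<phi> (g i)) * norm (\<phi> (inv (g i)))"
        using mult_est0[OF elim(3,4,1,2)] by simp
      moreover have "norm (- \<phi> (g i) - \<phi> (inv (g i))) = norm (\<phi> (inv (g i)) + \<phi> (g i))"
        by (metis add.commute minus_add_distrib norm_minus_cancel uminus_add_conv_diff diff_conv_add_uminus)
      ultimately have "real (k i) * norm (\<phi> (inv (g i)) + \<phi> (g i)) \<le> real (k i) * (C * norm (\<phi> (g i)) * norm (\<phi> (inv (g i))))"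
        by (intro mult_left_mono) auto
      thus ?case by (simp add: mult_ac scaleR_add_right[symmetric])
    qed
    have "((\<lambda>i. C * norm (real (k i) *\<^sub>R \<phi> (g i)) * norm (\<phi> (inv (g i)))) \<longlongrightarrow> C * norm X * norm (0::'e)) F"
      by (intro tendsto_mult tendsto_const tendsto_norm g h0)
    thus "((\<lambda>i. C * norm (real (k i) *\<^sub>R \<phi> (g i)) * norm (\<phi> (inv (g i)))) \<longlongrightarrow> 0) F" by simp
  qed
  from tendsto_diff[OF this g(2)] show "((\<lambda>i. real (k i) *\<^sub>R \<phi> (inv (g i))) \<longlongrightarrow> - X) F" by simp
qed

lemma inv_pow: "x \<in> carrier G \<Longrightarrow> inv x [^] (n::nat) = inv (x [^] n)"
  using nat_pow_inv by auto

lemma Exp_minus: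
  assumes X: "X \<in> E"
  shows "Exp (- X) = inv (Exp X)"
proof -
  let ?g = "\<lambda>n. \<psi> (X /\<^sub>R real n)"
  note g = \<psi>_div_limit[OF X]
  have "- X \<in> E" using X subspace_E by (simp add: subspace_neg)
  hence 1: "limitin T (\<lambda>n. inv (?g n) [^] n) (Exp (- X)) sequentially"
    by (rule Exp_limit[OF filterlim_ident chart_inv_limit[OF filterlim_ident g]])
  have "eventually (\<lambda>n. inv (?g n [^] n) = inv (?g n) [^] n) sequentially"
    using g(1) by eventually_elim (simp add: inv_pow U_closed)
  hence "limitin T (\<lambda>n. inv (?g n) [^] n) (inv (Exp X)) sequentially"
    using limitin_inv[OF Exp_limit_\<psi>[OF X]] by (rule limitin_transform_eventually)
  from limitin_unique[OF 1 this] show ?thesis by simp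
qed

text \<open>All three exponentials are limits of powers of the same element, the one with
  coordinates \<open>X / n\<close>, with exponents \<open>\<lfloor>s n\<rfloor>\<close>,
  \<open>\<lfloor>t n\<rfloor>\<close> and their sum; and exponents add.\<close>

lemma Exp_add_pos:
  assumes X: "X \<in> E" and s: "0 < s" and t: "0 < t"
  shows "Exp ((s + t) *\<^sub>R X) = Exp (s *\<^sub>R X) \<otimes> Exp (t *\<^sub>R X)"
proof -
  let ?g = "\<lambda>n. \<psi> (X /\<^sub>R real n)"
  define k where "k s n = nat \<lfloor>s * real n\<rfloor>" for s n
  note g = \<psi>_div_limit[OF X]
  have E: "c *\<^sub>R X \<in> E" for c using X subspace_E by (simp add: subspace_scale)
  have kl: "(\<lambda>n. real (k u n) *\<^sub>R \<phi> (?g n)) \<longlonglongrightarrow> u *\<^sub>R X" if u: "0 < u" for u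
  proof -
    have "(\<lambda>n. (real (k u n) / real n) *\<^sub>R (real n *\<^sub>R \<phi> (?g n))) \<longlonglongrightarrow> u *\<^sub>R X"
      unfolding k_def by (intro tendsto_scaleR floor_scale_limit u g)
    thus ?thesis by (rule Lim_transform_eventually) (use eventually_gt_at_top[of 0] in \<open>eventually_elim, simp\<close>)
  qed
  have kt: "filterlim (k u) at_top sequentially" if "0 < u" for u
    unfolding k_def using floor_scale_limit(2)[OF that] by simp
  have 1: "limitin T (\<lambda>n. ?g n [^] k s n \<otimes> ?g n [^] k t n) (Exp (s *\<^sub>R X) \<otimes> Exp (t *\<^sub>R X)) sequentially"
    by (intro limitin_mult Exp_limit kt kl g s t E)
  have 2: "limitin T (\<lambda>n. ?g n [^] (k s n + k t n)) (Exp ((s + t) *\<^sub>R X)) sequentially"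
  proof (rule Exp_limit[OF _ g(1) _ E])
    show "filterlim (\<lambda>n. k s n + k t n) at_top sequentially"
      using filterlim_at_top_mono[OF kt[OF s], of "\<lambda>n. k s n + k t n"] by simp
    show "(\<lambda>n. real (k s n + k t n) *\<^sub>R \<phi> (?g n)) \<longlonglongrightarrow> (s + t) *\<^sub>R X"
      using tendsto_add[OF kl[OF s] kl[OF t]] by (simp add: scaleR_add_left)
  qed
  have "eventually (\<lambda>n. ?g n [^] k s n \<otimes> ?g n [^] k t n = ?g n [^] (k s n + k t n)) sequentially"
    using g(1) by eventually_elim (simp add: nat_pow_mult U_closed)
  hence "limitin T (\<lambda>n. ?g n [^] (k s n + k t n)) (Exp (s *\<^sub>R X) \<otimes> Exp (t *\<^sub>R X)) sequentially"
    using 1 by (rule limitin_transform_eventually)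
  from limitin_unique[OF 2 this] show ?thesis by simp
qed

lemma scale_E [simp, intro]: "X \<in> E \<Longrightarrow> c *\<^sub>R X \<in> E"
  using subspace_E by (simp add: subspace_scale)

lemma add_E [intro]: "X \<in> E \<Longrightarrow> Y \<in> E \<Longrightarrow> X + Y \<in> E"
  using subspace_E by (simp add: subspace_add)

lemma minus_E [intro]: "X \<in> E \<Longrightarrow> - X \<in> E"
  using subspace_E by (simp add: subspace_neg)

lemma diff_E [intro]: "X \<in> E \<Longrightarrow> Y \<in> E \<Longrightarrow> X - Y \<in> E"
  using subspace_E by (simp add: subspace_diff)

lemma zero_E [simp, intro]: "0 \<in> E"
  using subspace_E by (simp add: subspace_0)

lemma Exp_add_nonneg:
  assumes X: "X \<in> E" and "0 \<le> s" "0 \<le> t"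
  shows "Exp ((s + t) *\<^sub>R X) = Exp (s *\<^sub>R X) \<otimes> Exp (t *\<^sub>R X)"
  using Exp_add_pos[OF X, of s t] assms by (cases "s = 0"; cases "t = 0") auto

lemma Exp_add_same_sign:
  assumes X: "X \<in> E" and st: "0 \<le> s \<and> 0 \<le> t \<or> s \<le> 0 \<and> t \<le> 0"
  shows "Exp ((s + t) *\<^sub>R X) = Exp (s *\<^sub>R X) \<otimes> Exp (t *\<^sub>R X)" using st
proof
  assume "s \<le> 0 \<and> t \<le> 0"
  thus ?thesis using Exp_add_nonneg[OF minus_E[OF X], of "- s" "- t"] by (simp add: algebra_simps)
qed (use Exp_add_nonneg[OF X] in auto)

theorem Exp_add:
  assumes X: "X \<in> E"
  shows "Exp ((s + t) *\<^sub>R X) = Exp (s *\<^sub>R X) \<otimes> Exp (t *\<^sub>R X)"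
proof -
  have m: "Exp ((- u) *\<^sub>R X) = inv (Exp (u *\<^sub>R X))" for u using Exp_minus[OF scale_E[OF X]] by simp
  \<comment> \<open>One of the pairs \<open>(s, t)\<close>, \<open>(s + t, - t)\<close>,
    \<open>(- s, s + t)\<close> has no sign change; the identity for that pair is the wanted one
    with a factor moved to the other side.\<close>
  consider "0 \<le> s \<and> 0 \<le> t \<or> s \<le> 0 \<and> t \<le> 0" | "0 \<le> s + t \<and> 0 \<le> - t \<or> s + t \<le> 0 \<and> - t \<le> 0"
    | "0 \<le> - s \<and> 0 \<le> s + t \<or> - s \<le> 0 \<and> s + t \<le> 0" by linarith
  thus ?thesis
  proof cases
    case 2
    from Exp_add_same_sign[OF X this]
    have "Exp (s *\<^sub>R X) = Exp ((s + t) *\<^sub>R X) \<otimes> inv (Exp (t *\<^sub>R X))" using m by simp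
    thus ?thesis using X by (simp add: m_assoc)
  next
    case 3
    from Exp_add_same_sign[OF X this]
    have "Exp (t *\<^sub>R X) = inv (Exp (s *\<^sub>R X)) \<otimes> Exp ((s + t) *\<^sub>R X)" using m[of s] by simp
    thus ?thesis using X by (simp add: m_assoc[symmetric])
  qed (rule Exp_add_same_sign[OF X])
qed

lemma Exp_pow:
  assumes X: "X \<in> E"
  shows "Exp X [^] (n::nat) = Exp (real n *\<^sub>R X)"
proof (induction n)
  case (Suc n)
  have "Exp ((real n + 1) *\<^sub>R X) = Exp (real n *\<^sub>R X) \<otimes> Exp (1 *\<^sub>R X)" by (rule Exp_add[OF X])
  thus ?case using Suc by (simp add: add.commute)
qed simp

lemma Exp_prod_limit:
  assumes k: "filterlim k at_top F" and E: "X \<in> E" "Y \<in> E" "\<And>i. u i \<in> E" "\<And>i. v i \<in> E"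
    and u: "((\<lambda>i. real (k i) *\<^sub>R u i) \<longlongrightarrow> X) F" and v: "((\<lambda>i. real (k i) *\<^sub>R v i) \<longlongrightarrow> Y) F"
  shows "limitin T (\<lambda>i. (Exp (u i) \<otimes> Exp (v i)) [^] k i) (Exp (X + Y)) F"
  by (rule Exp_limit[OF k chart_prod_limit[OF k Exp_limit_seq(1,2)[OF E(1) k E(3) u] Exp_limit_seq(1,2)[OF E(2) k E(4) v]]])
    (use E in auto)

lemma div_limit: "(\<lambda>n. real n *\<^sub>R (X /\<^sub>R real n)) \<longlonglongrightarrow> (X::'a::real_normed_vector)"
  by (rule tendsto_eventually) (use eventually_gt_at_top[of 0] in \<open>eventually_elim, simp\<close>)

theorem trotter:
  assumes "X \<in> E" "Y \<in> E"
  shows "limitin T (\<lambda>n. (Exp (X /\<^sub>R real n) \<otimes> Exp (Y /\<^sub>R real n)) [^] n) (Exp (X + Y)) sequentially"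
  by (rule Exp_prod_limit[OF filterlim_ident assms _ _ div_limit div_limit]) (use assms in auto)

lemma limitin_Exp_small:
  assumes X: "X \<in> E" "norm X < \<delta>" and f: "eventually (\<lambda>i. f i \<in> E) F" "(f \<longlongrightarrow> X) F"
  shows "limitin T (\<lambda>i. Exp (f i)) (Exp X) F"
proof (rule limitin_chart)
  show "Exp X \<in> U" using Exp_small X by blast
  have ev: "eventually (\<lambda>i. norm (f i) < \<delta>) F" by (rule order_tendstoD(2)[OF tendsto_norm[OF f(2)] X(2)])
  show "eventually (\<lambda>i. Exp (f i) \<in> U) F" using ev f(1) by eventually_elim (rule Exp_small)
  have "((\<lambda>i. lexp (f i) - lexp X) \<longlongrightarrow> 0) F"
  proof (rule Lim_null_comparison)
    show "eventually (\<lambda>i. norm (lexp (f i) - lexp X) \<le> 2 * norm (f i - X)) F" using ev f(1)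
    proof eventually_elim
      case (elim i)
      show ?case using lexp_near_identity2[OF elim(2,1) X] norm_triangle_sub[of "lexp (f i) - lexp X" "f i - X"]
          norm_ge_zero[of "f i - X"] by linarith
    qed
    show "((\<lambda>i. 2 * norm (f i - X)) \<longlongrightarrow> 0) F"
      using f(2) by (simp add: LIM_zero tendsto_mult_right_zero tendsto_norm_zero)
  qed
  hence "((\<lambda>i. lexp (f i)) \<longlongrightarrow> lexp X) F" by (rule LIM_zero_cancel)
  hence "((\<lambda>i. lexp (f i)) \<longlongrightarrow> \<phi> (Exp X)) F" using Exp_small(2)[OF X] by simp
  thus "((\<lambda>i. \<phi> (Exp (f i))) \<longlongrightarrow> \<phi> (Exp X)) F"
    by (rule Lim_transform_eventually) (use ev f(1) in \<open>eventually_elim, simp add: Exp_small(2)\<close>)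
qed

theorem limitin_Exp:
  assumes X: "X \<in> E" and f: "eventually (\<lambda>i. f i \<in> E) F" "(f \<longlongrightarrow> X) F"
  shows "limitin T (\<lambda>i. Exp (f i)) (Exp X) F"
proof -
  define N where "N = Suc (nat \<lceil>norm X / \<delta>\<rceil>)"
  have N: "0 < N" by (simp add: N_def)
  have "norm X / \<delta> < real N" unfolding N_def by linarith
  hence XN: "norm (X /\<^sub>R real N) < \<delta>" using \<delta>_pos N by (simp add: divide_simps mult_ac)
  have "limitin T (\<lambda>i. Exp (f i /\<^sub>R real N)) (Exp (X /\<^sub>R real N)) F"
    by (rule limitin_Exp_small[OF _ XN]) (use X f in \<open>auto intro!: tendsto_intros elim: eventually_mono\<close>)
  from limitin_pow[OF this, of N]
  have "limitin T (\<lambda>i. Exp (f i /\<^sub>R real N) [^] N) (Exp (X /\<^sub>R real N) [^] N) F" .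
  moreover have "Exp (Y /\<^sub>R real N) [^] N = Exp Y" if "Y \<in> E" for Y
    using Exp_pow[of "Y /\<^sub>R real N" N] that N by simp
  moreover from this have "eventually (\<lambda>i. Exp (f i /\<^sub>R real N) [^] N = Exp (f i)) F"
    using f(1) by (auto elim: eventually_mono)
  ultimately show ?thesis using X limitin_transform_eventually by fastforce
qed

lemma continuous_map_Exp:
  assumes "continuous_on S f" "f ` S \<subseteq> E"
  shows "continuous_map (top_of_set S) T (\<lambda>x. Exp (f x))" unfolding continuous_map_top_of_set
proof
  fix x assume x: "x \<in> S"
  show "limitin T (\<lambda>x. Exp (f x)) (Exp (f x)) (at x within S)"
  proof (rule limitin_Exp)
    show "f x \<in> E" using x assms by blast
    show "(f \<longlongrightarrow> f x) (at x within S)" using x assms by (simp add: continuous_on_def)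
    show "eventually (\<lambda>x. f x \<in> E) (at x within S)"
      using assms(2) by (simp add: eventually_at_filter image_subset_iff)
  qed
qed

text \<open>Near 0 the points \<open>c t\<close> have logarithms \<open>Y t\<close> shorter than
  \<open>\<delta> / 2\<close>, so that doubling stays where \<open>Exp\<close> is injective and
  \<open>Y (2 * s) = 2 *\<^sub>R Y s\<close>. This fixes the direction \<open>X\<close> along the
  dyadic times \<open>a j\<close>; multiples of these times and continuity give all positive
  \<open>t\<close>.\<close>

theorem one_parameter_subgroup:
  assumes c: "continuous_map euclideanreal T c" and add: "\<And>s t. c (s + t) = c s \<otimes> c t"
  shows "\<exists>X\<in>E. \<forall>t. c t = Exp (t *\<^sub>R X)"
proof -
  have cc: "c t \<in> carrier G" for t using funcset_mem[OF continuous_map_funspace[OF c], of t] by simp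
  have c0: "c 0 = \<one>" using add[of 0 0] cc[of 0] by (metis add_0 r_cancel_one)
  have cinv: "c (- t) = inv (c t)" for t using add[of "- t" t] cc c0 inv_equality by auto
  have cpow: "c (real n * t) = c t [^] n" for n :: nat and t
  proof (induction n)
    case (Suc n)
    have "c (real (Suc n) * t) = c (real n * t + t)" by (simp add: algebra_simps)
    thus ?case using Suc add by simp
  qed (use c0 in simp)
  have lim: "limitin T c (c t) (at t)" for t
    using c by (metis UNIV_I atin_top_of_set continuous_map_atin subtopology_UNIV topspace_euclidean)
  have "eventually (\<lambda>t. c t \<in> U) (at 0)" using lim[of 0] c0 one_U limitin_eventually_U by metis
  moreover have "((\<lambda>t. \<phi> (c t)) \<longlongrightarrow> 0) (at 0)" using tendsto_chart[OF lim[of 0]] c0 one_U \<phi>_one by simp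
  ultimately have "eventually (\<lambda>t. c t \<in> U \<and> norm (\<phi> (c t)) < \<delta> / 8) (at 0)"
    using eventually_norm_less[of "\<lambda>t. \<phi> (c t)" "at 0" "\<delta> / 8"] \<delta>_pos eventually_conj by simp
  then obtain d where d: "0 < d" "\<And>t. t \<noteq> 0 \<Longrightarrow> \<bar>t\<bar> < d \<Longrightarrow> c t \<in> U \<and> norm (\<phi> (c t)) < \<delta> / 8"
    by (auto simp: eventually_at dist_real_def)
  have small: "\<exists>X\<in>E. norm X < \<delta> / 2 \<and> Exp X = c t" if "\<bar>t\<bar> < d" for t
  proof -
    have "c t \<in> U \<and> norm (\<phi> (c t)) < \<delta> / 8" using d that c0 one_U \<phi>_one \<delta>_pos by (cases "t = 0") auto
    hence c: "c t \<in> U" "norm (\<phi> (c t)) < \<delta> / 4" "2 * norm (\<phi> (c t)) < \<delta> / 2" using \<delta>_pos by auto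
    show ?thesis using Exp_onto[OF c(1,2)] c(3) by (metis order_le_less_trans)
  qed
  then obtain Y where Y: "\<And>t. \<bar>t\<bar> < d \<Longrightarrow> Y t \<in> E \<and> norm (Y t) < \<delta> / 2 \<and> Exp (Y t) = c t" by metis
  have dbl: "Y (2 * s) = 2 *\<^sub>R Y s" if s: "\<bar>2 * s\<bar> < d" for s
  proof (rule Exp_inj)
    have s': "\<bar>s\<bar> < d" using s by linarith
    have "Exp (2 *\<^sub>R Y s) = Exp (Y s) \<otimes> Exp (Y s)" using Exp_add[of "Y s" 1 1] Y[OF s'] by simp
    thus "Exp (Y (2 * s)) = Exp (2 *\<^sub>R Y s)" using Y[OF s] Y[OF s'] add[of s s] by simp
    show "Y (2 * s) \<in> E" "norm (Y (2 * s)) < \<delta>" "2 *\<^sub>R Y s \<in> E" "norm (2 *\<^sub>R Y s) < \<delta>"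
      using Y[OF s] Y[OF s'] \<delta>_pos by auto
  qed
  define a where "a j = d / 2 / 2 ^ j" for j :: nat
  have a: "0 < a j" "a j < d" for j
  proof -
    show "0 < a j" using d(1) by (simp add: a_def)
    have "d / 2 / 2 ^ j \<le> d / 2 / 1" by (rule divide_left_mono) (use d(1) in simp_all)
    thus "a j < d" using d(1) by (simp add: a_def)
  qed
  define X where "X = Y (a 0) /\<^sub>R a 0"
  have XE: "X \<in> E" using Y[of "a 0"] a[of 0] by (simp add: X_def)
  have Ya: "Y (a j) = a j *\<^sub>R X" for j
  proof (induction j)
    case (Suc j)
    have h: "2 * a (Suc j) = a j" by (simp add: a_def)
    have "2 *\<^sub>R Y (a (Suc j)) = (2 * a (Suc j)) *\<^sub>R X" using dbl[of "a (Suc j)"] a[of j] Suc unfolding h by simp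
    thus ?case by (metis scaleR_scaleR scaleR_cancel_left zero_neq_numeral)
  qed (use a(1)[of 0] in \<open>simp add: X_def\<close>)
  have ca: "c (a j) = Exp (a j *\<^sub>R X)" for j using Y[of "a j"] a[of j] Ya by simp
  have pos: "c t = Exp (t *\<^sub>R X)" if t: "0 < t" for t
  proof -
    have "a \<longlonglongrightarrow> 0" unfolding a_def by (rule LIMSEQ_divide_realpow_zero) simp
    from floor_divide_limit(1)[OF t _ this]
    have kt: "(\<lambda>n. real (nat \<lfloor>t / a n\<rfloor>) * a n) \<longlonglongrightarrow> t" using a(1) by simp
    have "c (real k * a n) = Exp ((real k * a n) *\<^sub>R X)" for k n using cpow[of k "a n"] ca Exp_pow XE by simp
    hence "limitin T (\<lambda>n. Exp ((real (nat \<lfloor>t / a n\<rfloor>) * a n) *\<^sub>R X)) (c t) sequentially"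
      using continuous_map_limit[OF c, of _ t sequentially] kt by (force simp: o_def)
    moreover have "limitin T (\<lambda>n. Exp ((real (nat \<lfloor>t / a n\<rfloor>) * a n) *\<^sub>R X)) (Exp (t *\<^sub>R X)) sequentially"
      by (rule limitin_Exp) (use XE kt in \<open>auto intro!: tendsto_intros\<close>)
    ultimately show ?thesis using limitin_unique by fastforce
  qed
  have "c t = Exp (t *\<^sub>R X)" for t
  proof (cases "0 < t")
    case False
    show ?thesis
    proof (cases "t = 0")
      case False
      hence "c (- t) = Exp ((- t) *\<^sub>R X)" using pos[of "- t"] \<open>\<not> 0 < t\<close> by simp
      hence "inv (c t) = inv (Exp (t *\<^sub>R X))" using cinv Exp_minus[OF scale_E[OF XE]] by simp
      thus ?thesis using cc XE by (metis inv_inv Exp_carrier scale_E)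
    qed (use c0 in simp)
  qed (rule pos)
  thus ?thesis using XE by blast
qed

section \<open>The adjoint representation in exponential coordinates\<close>

lemma limitin_const: "x \<in> carrier G \<Longrightarrow> limitin T (\<lambda>_. x) x F"
  by (simp add: limitin_def)

lemma limitin_conj:
  assumes "limitin T f a F" "limitin T g b F"
  shows "limitin T (\<lambda>i. g i \<otimes> f i \<otimes> inv (g i)) (b \<otimes> a \<otimes> inv b) F" by (intro limitin_mult limitin_inv assms)

lemma Exp_scale_inj:
  assumes X: "X \<in> E" and Y: "Y \<in> E" and eq: "\<And>t. Exp (t *\<^sub>R X) = Exp (t *\<^sub>R Y)"
  shows "X = Y"
proof -
  define t where "t = \<delta> / (2 * (1 + norm X + norm Y))"
  have t: "0 < t" using \<delta>_pos norm_ge_zero[of X] norm_ge_zero[of Y] by (simp add: t_def add_pos_nonneg)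
  have *: "norm (t *\<^sub>R Z) < \<delta>" if "norm Z \<le> norm X + norm Y" for Z :: 'e
  proof -
    have "norm (t *\<^sub>R Z) \<le> t * (1 + norm X + norm Y)" using t that by (simp add: mult_left_mono)
    also have "\<dots> = \<delta> / 2"
      using norm_ge_zero[of X] norm_ge_zero[of Y] by (simp add: t_def field_simps add_nonneg_eq_0_iff)
    finally show ?thesis using \<delta>_pos by linarith
  qed
  have "t *\<^sub>R X = t *\<^sub>R Y" by (rule Exp_inj) (use X Y eq * in auto)
  thus ?thesis using t by simp
qed

text \<open>The generator of the conjugated one-parameter subgroup. Its agreement with
  \<open>Ad\<close>, which acts on derivations, is established only for Lie groups, in
  \<open>Ad_dv\<close>.\<close>

definition Adj :: "'g \<Rightarrow> 'e \<Rightarrow> 'e" where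
  "Adj g X = (THE Y. Y \<in> E \<and> (\<forall>t. g \<otimes> Exp (t *\<^sub>R X) \<otimes> inv g = Exp (t *\<^sub>R Y)))"

lemma inv_cancel [simp]:
  assumes "x \<in> carrier G" "y \<in> carrier G"
  shows "inv x \<otimes> (x \<otimes> y) = y" "x \<otimes> (inv x \<otimes> y) = y" using assms by (simp_all add: m_assoc[symmetric])

lemma conj_mult:
  "\<lbrakk>g \<in> carrier G; x \<in> carrier G; y \<in> carrier G\<rbrakk> \<Longrightarrow> g \<otimes> (x \<otimes> y) \<otimes> inv g = (g \<otimes> x \<otimes> inv g) \<otimes> (g \<otimes> y \<otimes> inv g)"
  by (simp add: m_assoc)

lemma conj_pow:
  assumes "g \<in> carrier G" "x \<in> carrier G"
  shows "(g \<otimes> x \<otimes> inv g) [^] (n::nat) = g \<otimes> x [^] n \<otimes> inv g"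
proof (induction n)
  case (Suc n)
  thus ?case using conj_mult[of g "x [^] n" x] assms by simp
qed (use assms in simp)

lemma Adj_ex1:
  assumes g: "g \<in> carrier G" and X: "X \<in> E"
  shows "\<exists>!Y. Y \<in> E \<and> (\<forall>t. g \<otimes> Exp (t *\<^sub>R X) \<otimes> inv g = Exp (t *\<^sub>R Y))"
proof -
  have "\<exists>Y\<in>E. \<forall>t. g \<otimes> Exp (t *\<^sub>R X) \<otimes> inv g = Exp (t *\<^sub>R Y)"
  proof (rule one_parameter_subgroup)
    have "limitin T (\<lambda>t. g \<otimes> Exp (t *\<^sub>R X) \<otimes> inv g) (g \<otimes> Exp (s *\<^sub>R X) \<otimes> inv g) (at s)" for s
      by (intro limitin_conj limitin_const g limitin_Exp) (use X in \<open>auto intro!: tendsto_intros\<close>)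
    thus "continuous_map euclideanreal T (\<lambda>t. g \<otimes> Exp (t *\<^sub>R X) \<otimes> inv g)"
      by (simp add: continuous_map_top_of_set[of UNIV, simplified])
    show "g \<otimes> Exp ((s + t) *\<^sub>R X) \<otimes> inv g = g \<otimes> Exp (s *\<^sub>R X) \<otimes> inv g \<otimes> (g \<otimes> Exp (t *\<^sub>R X) \<otimes> inv g)" for s t
      using conj_mult g X by (simp add: Exp_add[OF X])
  qed
  then obtain Y where Y: "Y \<in> E" "\<forall>t. g \<otimes> Exp (t *\<^sub>R X) \<otimes> inv g = Exp (t *\<^sub>R Y)" by blast
  show ?thesis
  proof (rule ex1I[of _ Y])
    fix Z assume "Z \<in> E \<and> (\<forall>t. g \<otimes> Exp (t *\<^sub>R X) \<otimes> inv g = Exp (t *\<^sub>R Z))"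
    thus "Z = Y" using Y by (intro Exp_scale_inj) auto
  qed (use Y in blast)
qed

lemma Adj:
  assumes "g \<in> carrier G" "X \<in> E"
  shows "Adj g X \<in> E" "g \<otimes> Exp (t *\<^sub>R X) \<otimes> inv g = Exp (t *\<^sub>R Adj g X)"
proof -
  have "Adj g X \<in> E \<and> (\<forall>t. g \<otimes> Exp (t *\<^sub>R X) \<otimes> inv g = Exp (t *\<^sub>R Adj g X))"
    unfolding Adj_def by (rule theI'[OF Adj_ex1[OF assms]])
  thus "Adj g X \<in> E" "g \<otimes> Exp (t *\<^sub>R X) \<otimes> inv g = Exp (t *\<^sub>R Adj g X)" by (rule conjunct1, rule spec[OF conjunct2])
qed

lemma Adj_unique:
  assumes "g \<in> carrier G" "X \<in> E" "Y \<in> E" "\<And>t. g \<otimes> Exp (t *\<^sub>R X) \<otimes> inv g = Exp (t *\<^sub>R Y)"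
  shows "Adj g X = Y" unfolding Adj_def by (rule the1_equality[OF Adj_ex1[OF assms(1,2)]]) (simp add: assms(3,4))

lemma Exp_Adj: "g \<in> carrier G \<Longrightarrow> X \<in> E \<Longrightarrow> Exp (Adj g X) = g \<otimes> Exp X \<otimes> inv g"
  using Adj(2)[of g X 1] by simp

lemma Adj_scale:
  assumes "g \<in> carrier G" "X \<in> E"
  shows "Adj g (c *\<^sub>R X) = c *\<^sub>R Adj g X" by (rule Adj_unique) (use Adj[OF assms] assms in auto)

text \<open>Conjugation by \<open>g\<close> maps the products in Trotter's formula for
  \<open>X\<close>, \<open>Y\<close> to those for \<open>Adj g X\<close>, \<open>Adj g Y\<close>,
  and it is continuous.\<close>

lemma Adj_add:
  assumes g: "g \<in> carrier G" and X: "X \<in> E" and Y: "Y \<in> E"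
  shows "Adj g (X + Y) = Adj g X + Adj g Y"
proof (rule Adj_unique)
  fix t
  let ?P = "\<lambda>n. (Exp (t *\<^sub>R Adj g X /\<^sub>R real n) \<otimes> Exp (t *\<^sub>R Adj g Y /\<^sub>R real n)) [^] n"
  have s: "t *\<^sub>R X /\<^sub>R real n = (t / real n) *\<^sub>R X" for n and X :: 'e by (simp add: field_simps)
  have "limitin T (\<lambda>n. g \<otimes> (Exp (t *\<^sub>R X /\<^sub>R real n) \<otimes> Exp (t *\<^sub>R Y /\<^sub>R real n)) [^] n \<otimes> inv g)
      (g \<otimes> Exp (t *\<^sub>R X + t *\<^sub>R Y) \<otimes> inv g) sequentially"
    by (intro limitin_conj trotter limitin_const g) (use X Y in auto)
  moreover have "g \<otimes> (Exp (t *\<^sub>R X /\<^sub>R real n) \<otimes> Exp (t *\<^sub>R Y /\<^sub>R real n)) [^] n \<otimes> inv g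
     = ?P n" for n
  proof -
    have "Exp (t *\<^sub>R X /\<^sub>R real n) \<in> carrier G" "Exp (t *\<^sub>R Y /\<^sub>R real n) \<in> carrier G" using X Y by auto
    thus ?thesis using conj_mult[OF g] conj_pow[OF g] Adj(2)[OF g X] Adj(2)[OF g Y] unfolding s by (metis m_closed)
  qed
  ultimately have "limitin T ?P
      (g \<otimes> Exp (t *\<^sub>R X + t *\<^sub>R Y) \<otimes> inv g) sequentially" by simp
  moreover have "limitin T ?P
      (Exp (t *\<^sub>R Adj g X + t *\<^sub>R Adj g Y)) sequentially" by (rule trotter) (use Adj g X Y in auto)
  ultimately show "g \<otimes> Exp (t *\<^sub>R (X + Y)) \<otimes> inv g = Exp (t *\<^sub>R (Adj g X + Adj g Y))"
    using limitin_unique[OF _ _ trivial_limit_sequentially] by (simp add: scaleR_add_right)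
qed (use Adj assms in auto)

lemma Adj_mult:
  assumes g: "g \<in> carrier G" "h \<in> carrier G" and X: "X \<in> E"
  shows "Adj (g \<otimes> h) X = Adj g (Adj h X)"
proof (rule Adj_unique)
  fix t
  have "Exp (t *\<^sub>R Adj g (Adj h X)) = g \<otimes> (h \<otimes> Exp (t *\<^sub>R X) \<otimes> inv h) \<otimes> inv g" using Adj(2) Adj(1) g X by simp
  thus "g \<otimes> h \<otimes> Exp (t *\<^sub>R X) \<otimes> inv (g \<otimes> h) = Exp (t *\<^sub>R Adj g (Adj h X))"
    using g X by (simp add: m_assoc inv_mult_group)
qed (use Adj assms in auto)

lemma Adj_one: "X \<in> E \<Longrightarrow> Adj \<one> X = X"
  by (rule Adj_unique) auto

text \<open>With \<open>x = Exp (X / n)\<close> and \<open>z = Exp (Adj k X / n)\<close> one has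
  \<open>z k = k x\<close>. Comparing the coordinates of the two products, multiplying by
  \<open>n\<close> and passing to the limit gives the bound. It still contains
  \<open>Adj k X\<close> on the right; this term is absorbed once \<open>C * norm (\<phi> k)\<close>
  is at most 1/2.\<close>

lemma Adj_near_one:
  assumes k: "k \<in> U" "norm (\<phi> k) < r" and X: "X \<in> E"
  shows "norm (Adj k X - X) \<le> C * norm (\<phi> k) * (norm (Adj k X) + norm X)"
proof (rule tendsto_le[OF trivial_limit_sequentially])
  have kc: "k \<in> carrier G" using k U_closed by blast
  let ?Y = "Adj k X"
  have Y: "?Y \<in> E" using Adj kc X by blast
  let ?x = "\<lambda>n. Exp (X /\<^sub>R real n)" and ?z = "\<lambda>n. Exp (?Y /\<^sub>R real n)"
  let ?a = "\<lambda>n. real n *\<^sub>R \<phi> (?x n)" and ?b = "\<lambda>n. real n *\<^sub>R \<phi> (?z n)"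
  note x = Exp_limit_seq[OF X filterlim_ident _ div_limit] and z = Exp_limit_seq[OF Y filterlim_ident _ div_limit]
  have x1: "eventually (\<lambda>n. ?x n \<in> U) sequentially" "?a \<longlonglongrightarrow> X"
    and z1: "eventually (\<lambda>n. ?z n \<in> U) sequentially" "?b \<longlonglongrightarrow> ?Y" using x z X Y by auto
  show "(\<lambda>n. norm (?b n - ?a n)) \<longlonglongrightarrow> norm (?Y - X)" by (intro tendsto_norm tendsto_diff x1 z1)
  show "(\<lambda>n. C * norm (\<phi> k) * (norm (?b n) + norm (?a n)))
      \<longlonglongrightarrow> C * norm (\<phi> k) * (norm ?Y + norm X)" by (intro tendsto_mult tendsto_add tendsto_norm tendsto_const x1 z1)
  note ev = x1(1) z1(1) eventually_norm_less[OF scaled_limit_null[OF filterlim_ident x1(2)] r_pos]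
    eventually_norm_less[OF scaled_limit_null[OF filterlim_ident z1(2)] r_pos]
  show "eventually (\<lambda>n. norm (?b n - ?a n)
     \<le> C * norm (\<phi> k) * (norm (?b n) + norm (?a n))) sequentially" using ev
  proof eventually_elim
    case (elim n)
    have "?z n = k \<otimes> ?x n \<otimes> inv k" using Adj(2)[OF kc X, of "inverse (real n)"] by simp
    hence zk: "?z n \<otimes> k = k \<otimes> ?x n" using kc X by (simp add: m_assoc)
    have a: "norm (\<phi> (?z n \<otimes> k) - \<phi> (?z n) - \<phi> k) \<le> C * norm (\<phi> (?z n)) * norm (\<phi> k)"
      by (rule mult_est0) (use elim k in auto)
    have b: "norm (\<phi> (k \<otimes> ?x n) - \<phi> k - \<phi> (?x n)) \<le> C * norm (\<phi> k) * norm (\<phi> (?x n))"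
      by (rule mult_est0) (use elim k in auto)
    have zx: "\<phi> (?z n) - \<phi> (?x n) = (\<phi> (k \<otimes> ?x n) - \<phi> k - \<phi> (?x n)) - (\<phi> (?z n \<otimes> k) - \<phi> (?z n) - \<phi> k)"
      using zk by simp
    have "norm (\<phi> (?z n) - \<phi> (?x n))
      \<le> norm (\<phi> (k \<otimes> ?x n) - \<phi> k - \<phi> (?x n)) + norm (\<phi> (?z n \<otimes> k) - \<phi> (?z n) - \<phi> k)"
      unfolding zx by (rule norm_triangle_ineq4)
    with a b have "norm (\<phi> (?z n) - \<phi> (?x n)) \<le> C * norm (\<phi> k) * norm (\<phi> (?x n)) + C * norm (\<phi> (?z n)) * norm (\<phi> k)"
      by linarith
    hence "real n * norm (\<phi> (?z n) - \<phi> (?x n)) \<le> real n * (C * norm (\<phi> k) * norm (\<phi> (?x n)) + C * norm (\<phi> (?z n)) * norm (\<phi> k))"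
      by (intro mult_left_mono) auto
    moreover have "?b n - ?a n = real n *\<^sub>R (\<phi> (?z n) - \<phi> (?x n))" by (simp add: scaleR_diff_right)
    ultimately show ?case by (simp add: distrib_left mult_ac add.commute)
  qed
qed

lemma Adj_linear: "g \<in> carrier G \<Longrightarrow> linear (\<lambda>X. Adj g (oproj E X))"
  by (rule linear_on_subspace_bound[OF subspace_E]) (simp_all add: Adj_add Adj_scale)

text \<open>Write \<open>g\<close> as \<open>a\<close> times \<open>inv a \<otimes> g\<close>. The
  second factor tends to the identity, where \<open>Adj_near_one\<close> applies, and
  \<open>Adj a\<close> is linear on a finite-dimensional space, hence continuous.\<close>

lemma tendsto_Adj:
  assumes g: "limitin T g a F" and gc: "\<And>i. g i \<in> carrier G" and X: "X \<in> E"
  shows "((\<lambda>i. Adj (g i) X) \<longlongrightarrow> Adj a X) F"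
proof -
  have a: "a \<in> carrier G" using g by (simp add: limitin_def)
  let ?k = "\<lambda>i. inv a \<otimes> g i"
  let ?A = "\<lambda>i. Adj (?k i) X" and ?B = "\<lambda>i. C * norm (\<phi> (?k i)) * (4 * norm X)"
  have k1: "limitin T ?k \<one> F" using limitin_mult[OF limitin_const[of "inv a"] g] a by simp
  note ku = limitin_eventually_U[OF k1 one_U]
  have k0: "((\<lambda>i. \<phi> (?k i)) \<longlongrightarrow> 0) F" using tendsto_chart[OF k1 one_U] \<phi>_one by simp
  have s: "0 < 1 / (2 * (C + 1))" using C_nonneg by simp
  have "((\<lambda>i. ?A i - X) \<longlongrightarrow> 0) F"
  proof (rule Lim_null_comparison)
    show "eventually (\<lambda>i. norm (?A i - X) \<le> ?B i) F"
      using ku eventually_norm_less[OF k0 r_pos] eventually_norm_less[OF k0 s]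
    proof eventually_elim
      case (elim i)
      let ?c = "C * norm (\<phi> (?k i))"
      note n = Adj_near_one[OF elim(1,2) X]
      have "?c \<le> (C + 1) * norm (\<phi> (?k i))" by (intro mult_right_mono) auto
      also have "\<dots> < (C + 1) * (1 / (2 * (C + 1)))" using elim(3) C_nonneg by (intro mult_strict_left_mono) auto
      also have "(C + 1) * (1 / (2 * (C + 1))) = 1 / 2" using C_nonneg by (simp add: field_simps)
      finally have c: "?c \<le> 1 / 2" by simp
      have "?c * (norm (?A i) + norm X) \<le> 1/2 * (norm (?A i) + norm X)" using c by (intro mult_right_mono) auto
      with n have "norm (?A i - X) \<le> 1/2 * (norm (?A i) + norm X)" by (rule order_trans)
      hence "norm (?A i) \<le> 3 * norm X" using norm_triangle_sub[of "?A i" X] by (simp add: field_simps)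
      hence "?c * (norm (?A i) + norm X) \<le> ?c * (4 * norm X)" using C_nonneg by (intro mult_left_mono) auto
      with n show ?case by (rule order_trans)
    qed
    have "(?B \<longlongrightarrow> C * norm (0::'e) * (4 * norm X)) F" by (intro tendsto_mult tendsto_const tendsto_norm k0)
    thus "(?B \<longlongrightarrow> 0) F" by simp
  qed
  hence kX: "(?A \<longlongrightarrow> X) F" by (rule LIM_zero_cancel)
  have "((\<lambda>i. Adj a (oproj E (?A i))) \<longlongrightarrow> Adj a (oproj E X)) F"
    by (rule bounded_linear.tendsto[OF Adj_linear[OF a, THEN linear_conv_bounded_linear[THEN iffD1]] kX])
  moreover have "Adj a (oproj E (?A i)) = Adj (g i) X" for i
  proof -
    have k: "?k i \<in> carrier G" using a gc by simp
    have "a \<otimes> ?k i = g i" using a gc by simp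
    thus ?thesis using Adj_mult[OF a k X] oproj_id[OF subspace_E Adj(1)[OF k X]] by simp
  qed
  ultimately show ?thesis using oproj_id[OF subspace_E X] by simp
qed

lemma continuous_map_Adj:
  assumes X: "X \<in> E"
  shows "continuous_map T euclidean (\<lambda>g. Adj g X)"
proof -
  have "((\<lambda>g. Adj g X) \<longlongrightarrow> Adj a X) (atin T a)" if a: "a \<in> carrier G" for a
  proof -
    have "limitin T (\<lambda>g. if g \<in> carrier G then g else \<one>) a (atin T a)" unfolding limitin_def
    proof (intro conjI allI impI)
      fix V assume V: "openin T V \<and> a \<in> V"
      hence "V \<subseteq> carrier G" using openin_subset by fastforce
      thus "eventually (\<lambda>g. (if g \<in> carrier G then g else \<one>) \<in> V) (atin T a)"
        unfolding eventually_atin using V by auto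
    qed (use a in simp)
    hence "((\<lambda>g. Adj (if g \<in> carrier G then g else \<one>) X) \<longlongrightarrow> Adj a X) (atin T a)"
      by (rule tendsto_Adj) (use X in auto)
    thus ?thesis by (rule Lim_transform_eventually)
        (use a openin_topspace[of T] in \<open>auto simp: eventually_atin intro!: exI[of _ "carrier G"]\<close>)
  qed
  thus ?thesis by (simp add: continuous_map_atin)
qed

section \<open>Closed subgroups and their Lie algebras\<close>

definition Lie :: "'g set \<Rightarrow> 'e set" where
  "Lie A = {X \<in> E. \<forall>t. Exp (t *\<^sub>R X) \<in> A}"

lemma LieD: "X \<in> Lie A \<Longrightarrow> X \<in> E" "X \<in> Lie A \<Longrightarrow> Exp (t *\<^sub>R X) \<in> A"
  by (auto simp: Lie_def)

lemma Lie_scale: "X \<in> Lie A \<Longrightarrow> c *\<^sub>R X \<in> Lie A"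
  by (simp add: Lie_def)

lemma Exp_Lie: "X \<in> Lie A \<Longrightarrow> Exp X \<in> A"
  using LieD(2)[of X A 1] by simp

lemma subgroup_pow: "subgroup A G \<Longrightarrow> x \<in> A \<Longrightarrow> x [^] (n::nat) \<in> A"
  by (induction n) (simp_all add: subgroup.one_closed subgroup.m_closed)

lemma closed_limit:
  assumes "closedin T A" "limitin T f l F" "eventually (\<lambda>i. f i \<in> A) F" "F \<noteq> bot"
  shows "l \<in> A" using limitin_closedin[OF assms(2,1,3,4)] .

lemma subspace_Lie:
  assumes A: "subgroup A G" and cl: "closedin T A"
  shows "subspace (Lie A)"
proof (rule subspaceI)
  show "0 \<in> Lie A" using A by (simp add: Lie_def subgroup.one_closed)
  show "c *\<^sub>R X \<in> Lie A" if "X \<in> Lie A" for c X using that by (simp add: Lie_def)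
  fix X Y assume X: "X \<in> Lie A" and Y: "Y \<in> Lie A"
  have "Exp (t *\<^sub>R (X + Y)) \<in> A" for t
  proof (rule closed_limit[OF cl])
    show "limitin T (\<lambda>n. (Exp (t *\<^sub>R X /\<^sub>R real n) \<otimes> Exp (t *\<^sub>R Y /\<^sub>R real n)) [^] n) (Exp (t *\<^sub>R (X + Y))) sequentially"
      unfolding scaleR_add_right by (rule trotter) (use X Y LieD in auto)
    show "eventually (\<lambda>n. (Exp (t *\<^sub>R X /\<^sub>R real n) \<otimes> Exp (t *\<^sub>R Y /\<^sub>R real n)) [^] n \<in> A) sequentially"
    proof (intro always_eventually allI subgroup_pow[OF A] subgroup.m_closed[OF A])
      fix n
      show "Exp (t *\<^sub>R X /\<^sub>R real n) \<in> A" using LieD(2)[OF X, of "t / real n"] by (simp add: field_simps)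
      show "Exp (t *\<^sub>R Y /\<^sub>R real n) \<in> A" using LieD(2)[OF Y, of "t / real n"] by (simp add: field_simps)
    qed
  qed simp
  thus "X + Y \<in> Lie A" using LieD(1)[OF X] LieD(1)[OF Y] by (simp add: Lie_def add_E)
qed

text \<open>\<open>mult_est\<close> compares the product of \<open>Exp (- Y)\<close> and
  \<open>Exp X\<close> with that of \<open>Exp (- Y)\<close> and \<open>Exp Y\<close>, which is the
  identity. The constant 5 is 4 from this comparison, where two norms are each estimated with a
  factor 2, plus 1 from \<open>lexp_near_identity\<close>.\<close>

lemma Exp_quotient_est:
  assumes X: "X \<in> E" "norm X < \<delta>" and Y: "Y \<in> E" "norm Y < \<delta>"
  shows "Exp (- Y) \<otimes> Exp X \<in> U" "norm (\<phi> (Exp (- Y) \<otimes> Exp X) - (X - Y)) \<le> 5 * C * (norm X + norm Y) * norm (X - Y)"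
proof -
  let ?x = "Exp (- Y)" and ?d = "\<phi> (Exp X) - \<phi> (Exp Y)" and ?n = "norm (X - Y)"
  have Y': "- Y \<in> E" "norm (- Y) < \<delta>" using Y minus_E by auto
  note S = Exp_small(1)[OF X] Exp_small(1)[OF Y] Exp_small(1)[OF Y']
  have r: "norm (\<phi> ?x) < r" "norm (\<phi> (Exp X)) < r" "norm (\<phi> (Exp Y)) < r"
    using Exp_small_est(2)[OF X] Exp_small_est(2)[OF Y] Exp_small_est(2)[OF Y'] X Y \<delta>_r \<delta>_pos unfolding norm_minus_cancel by linarith+
  show "?x \<otimes> Exp X \<in> U" by (rule mult_U[OF S(3,1) r(1,2)])
  have "?x \<otimes> Exp Y = \<one>" using Exp_minus[OF Y(1)] Y by simp
  hence 1: "norm (\<phi> (?x \<otimes> Exp X) - ?d) \<le> C * (norm (\<phi> ?x) * norm ?d)"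
    using mult_est[OF S(3,1,3,2) r(1,2,1,3)] by (simp add: \<phi>_one algebra_simps)
  have 2: "norm (?d - (X - Y)) \<le> C * (norm X + norm Y) * ?n"
    using lexp_near_identity[OF X Y] Exp_small(2) X Y by simp
  have "C * (norm X + norm Y) \<le> C * (2 * \<delta>)" using X Y C_nonneg by (intro mult_left_mono) auto
  hence "C * (norm X + norm Y) * ?n \<le> 1 * ?n"
    using \<delta>_C mult_nonneg_nonneg[OF C_nonneg less_imp_le[OF \<delta>_pos]] by (intro mult_right_mono) auto
  hence 3: "norm ?d \<le> 2 * ?n" using 2 norm_triangle_sub[of ?d "X - Y"] by linarith
  have "norm (\<phi> ?x) * norm ?d \<le> (2 * (norm X + norm Y)) * (2 * ?n)"
    using Exp_small_est(2)[OF Y'] 3 by (intro mult_mono) (simp_all add: add_increasing)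
  hence "norm (\<phi> (?x \<otimes> Exp X) - ?d) \<le> C * ((2 * (norm X + norm Y)) * (2 * ?n))"
    using mult_left_mono[OF _ C_nonneg] 1 by (meson order_trans)
  note e = norm_triangle_mono[OF this 2]
  have "\<phi> (?x \<otimes> Exp X) - ?d + (?d - (X - Y)) = \<phi> (?x \<otimes> Exp X) - (X - Y)" by simp
  thus "norm (\<phi> (?x \<otimes> Exp X) - (X - Y)) \<le> 5 * C * (norm X + norm Y) * ?n" using e by (simp only:)
qed

text \<open>If \<open>Exp X\<close> lies in \<open>A\<close>, then so does \<open>Exp (- p X) Exp X\<close>, where \<open>p\<close> is the projection to the Lie algebra
  of \<open>A\<close>; its logarithm is \<open>X - p X\<close> up to an error of smaller order. Thus the directions of \<open>X - p X\<close> would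
  accumulate at a vector of the Lie algebra.\<close>

theorem closed_subgroup_log:
  assumes A: "subgroup A G" and cl: "closedin T A"
  shows "\<exists>\<epsilon>>0. \<forall>X\<in>E. norm X < \<epsilon> \<longrightarrow> Exp X \<in> A \<longrightarrow> X \<in> Lie A"
proof (rule ccontr)
  assume neg: "\<not> ?thesis"
  have sub: "subspace (Lie A)" by (rule subspace_Lie[OF A cl])
  let ?p = "oproj (Lie A)"
  have "\<forall>n. \<exists>X. X \<in> E \<and> norm X < min \<delta> (1 / real (Suc n)) \<and> Exp X \<in> A \<and> X \<notin> Lie A"
  proof
    fix n
    have "0 < min \<delta> (1 / real (Suc n))" using \<delta>_pos by simp
    thus "\<exists>X. X \<in> E \<and> norm X < min \<delta> (1 / real (Suc n)) \<and> Exp X \<in> A \<and> X \<notin> Lie A" using neg by blast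
  qed
  from choice[OF this] obtain X where X: "\<And>n. X n \<in> E" "\<And>n. norm (X n) < \<delta>" "\<And>n. norm (X n) < 1 / real (Suc n)"
    "\<And>n. Exp (X n) \<in> A" "\<And>n. X n \<notin> Lie A" by auto
  define u where "u n = X n - ?p (X n)" for n
  define g where "g n = Exp (- ?p (X n)) \<otimes> Exp (X n)" for n
  have pL: "?p (X n) \<in> Lie A" for n by (rule oproj_in[OF sub])
  have uE: "u n \<in> E" for n unfolding u_def by (rule diff_E[OF X(1) LieD(1)[OF pL]])
  have u0: "u n \<noteq> 0" for n
  proof
    assume "u n = 0"
    hence "?p (X n) = X n" by (simp add: u_def)
    thus False using pL[of n] X(5)[of n] by simp
  qed
  have gA: "g n \<in> A" for n
    unfolding g_def by (rule subgroup.m_closed[OF A Exp_Lie[OF subspace_neg[OF sub pL]] X(4)])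
  have pn: "norm (?p (X n)) < \<delta>" "norm (?p (X n)) < 1 / real (Suc n)" for n
    using norm_oproj(1)[OF sub, of "X n"] X(2,3)[of n] by linarith+
  have est: "g n \<in> U" "norm (\<phi> (g n) - u n) \<le> 5 * C * (norm (X n) + norm (?p (X n))) * norm (u n)" for n
    unfolding g_def u_def by (rule Exp_quotient_est[OF X(1,2) LieD(1)[OF pL] pn(1)])+
  have gu: "norm (\<phi> (g n) - u n) \<le> (10 * C / real (Suc n)) * norm (u n)" for n
  proof -
    have "5 * C * (norm (X n) + norm (?p (X n))) \<le> 5 * C * (1 / real (Suc n) + 1 / real (Suc n))"
      using X(3)[of n] pn(2)[of n] C_nonneg by (intro mult_left_mono) auto
    hence "5 * C * (norm (X n) + norm (?p (X n))) * norm (u n) \<le> (10 * C / real (Suc n)) * norm (u n)"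
      by (intro mult_right_mono) (simp_all add: field_simps)
    thus ?thesis using est(2)[of n] by linarith
  qed
  have sph: "\<forall>n. u n /\<^sub>R norm (u n) \<in> sphere 0 1" using u0 by simp
  obtain V s where V: "V \<in> sphere 0 1" "strict_mono s" "((\<lambda>n. u n /\<^sub>R norm (u n)) \<circ> s) \<longlonglongrightarrow> V"
    by (rule seq_compactE[OF compact_imp_seq_compact[OF compact_sphere] sph])
  let ?u = "\<lambda>n. u (s n)"
  have Vlim: "(\<lambda>n. ?u n /\<^sub>R norm (?u n)) \<longlonglongrightarrow> V" using V(3) by (simp add: o_def)
  have VE: "V \<in> E"
    by (rule Lim_in_closed_set[OF closed_subspace[OF subspace_E] _ trivial_limit_sequentially Vlim]) (use uE in auto)
  \<comment> \<open>The contradiction is prepared here: the unit vector \<open>V\<close> is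
    orthogonal to \<open>Lie A\<close>, but will turn out to belong to it.\<close>
  have Vorth: "V \<bullet> w = 0" if w: "w \<in> Lie A" for w
  proof -
    have "(\<lambda>n. (?u n /\<^sub>R norm (?u n)) \<bullet> w) \<longlonglongrightarrow> V \<bullet> w" by (intro tendsto_inner Vlim tendsto_const)
    thus ?thesis using oproj_orth[OF sub w] by (simp add: u_def LIMSEQ_const_iff)
  qed
  have null: "(\<lambda>n. 1 / real (Suc (s n))) \<longlonglongrightarrow> 0"
    using LIMSEQ_subseq_LIMSEQ[OF LIMSEQ_inverse_real_of_nat V(2)] by (simp add: o_def divide_inverse)
  have Z0: "(\<lambda>n. norm (?u n)) \<longlonglongrightarrow> 0"
  proof (rule tendsto_sandwich[OF _ _ tendsto_const null])
    show "\<forall>\<^sub>F n in sequentially. norm (?u n) \<le> 1 / real (Suc (s n))"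
      using norm_oproj(2)[OF sub] X(3) unfolding u_def by (meson always_eventually less_imp_le order_trans)
  qed simp
  have pos: "Exp (t *\<^sub>R V) \<in> A" if t: "0 < t" for t
  proof -
    define k where "k n = nat \<lfloor>t / norm (?u n)\<rfloor>" for n
    have k: "(\<lambda>n. real (k n) * norm (?u n)) \<longlonglongrightarrow> t" "filterlim k at_top sequentially"
      unfolding k_def using floor_divide_limit[OF t _ Z0] u0 by simp_all
    have "(\<lambda>n. (real (k n) * norm (?u n)) *\<^sub>R (?u n /\<^sub>R norm (?u n))) \<longlonglongrightarrow> t *\<^sub>R V" by (intro tendsto_scaleR k Vlim)
    hence ku: "(\<lambda>n. real (k n) *\<^sub>R ?u n) \<longlonglongrightarrow> t *\<^sub>R V" using u0 by (simp add: mult.assoc)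
    have "(\<lambda>n. real (k n) *\<^sub>R (\<phi> (g (s n)) - ?u n)) \<longlonglongrightarrow> 0"
    proof (rule Lim_null_comparison)
      have "norm (real (k n) *\<^sub>R (\<phi> (g (s n)) - ?u n)) \<le> (real (k n) * norm (?u n)) * (10 * C * (1 / real (Suc (s n))))" for n
        using mult_left_mono[OF gu[of "s n"], of "real (k n)"] by (simp add: mult_ac)
      thus "\<forall>\<^sub>F n in sequentially. norm (real (k n) *\<^sub>R (\<phi> (g (s n)) - ?u n)) \<le> (real (k n) * norm (?u n)) * (10 * C * (1 / real (Suc (s n))))"
        by simp
      show "(\<lambda>n. (real (k n) * norm (?u n)) * (10 * C * (1 / real (Suc (s n))))) \<longlonglongrightarrow> 0"
        using tendsto_mult[OF k(1) tendsto_mult_right_zero[OF null, of "10 * C"]] by simp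
    qed
    from tendsto_add[OF this ku] have "(\<lambda>n. real (k n) *\<^sub>R \<phi> (g (s n))) \<longlonglongrightarrow> t *\<^sub>R V" by (simp add: scaleR_diff_right)
    from Exp_limit[OF k(2) _ this] have "limitin T (\<lambda>n. g (s n) [^] k n) (Exp (t *\<^sub>R V)) sequentially"
      using est(1) VE by simp
    thus ?thesis by (rule closed_limit[OF cl]) (use gA subgroup_pow[OF A] in auto)
  qed
  have "Exp (t *\<^sub>R V) \<in> A" for t
  proof -
    consider "t = 0" | "0 < t" | "0 < - t" by linarith
    thus ?thesis
    proof cases
      case 3
      have "Exp (t *\<^sub>R V) = inv (Exp ((- t) *\<^sub>R V))" using Exp_minus[OF scale_E[OF VE], of "- t"] by simp
      thus ?thesis using pos[OF 3] subgroup.m_inv_closed[OF A] by simp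
    qed (use pos A in \<open>auto simp: subgroup.one_closed\<close>)
  qed
  hence "V \<in> Lie A" using VE by (simp add: Lie_def)
  from Vorth[OF this] V(1) show False by simp
qed

lemma openin_translate:
  assumes x: "x \<in> carrier G" and W: "openin T W"
  shows "openin T ((\<lambda>w. x \<otimes> w) ` W)"
proof -
  have WG: "W \<subseteq> carrier G" using openin_subset[OF W] by simp
  have "continuous_map T T (\<lambda>y. inv x \<otimes> y)"
    using continuous_map_compose[OF continuous_map_pairedI[of T T "\<lambda>_. inv x" T "\<lambda>y. y"] mult_cont] x
    by (simp add: o_def)
  from openin_continuous_map_preimage[OF this W]
  have "openin T {y \<in> carrier G. inv x \<otimes> y \<in> W}" by simp
  moreover have "{y \<in> carrier G. inv x \<otimes> y \<in> W} = (\<lambda>w. x \<otimes> w) ` W"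
  proof (intro equalityI subsetI)
    fix y assume "y \<in> {y \<in> carrier G. inv x \<otimes> y \<in> W}"
    thus "y \<in> (\<lambda>w. x \<otimes> w) ` W" using x by (intro image_eqI[of _ _ "inv x \<otimes> y"]) auto
  next
    fix y assume "y \<in> (\<lambda>w. x \<otimes> w) ` W"
    thus "y \<in> {y \<in> carrier G. inv x \<otimes> y \<in> W}" using x WG by auto
  qed
  ultimately show ?thesis by simp
qed

text \<open>The translate \<open>x W\<close> is a neighbourhood of \<open>x\<close>, so it contains
  some \<open>h = x w\<close> of \<open>H\<close>. Then \<open>w = inv x \<otimes> h\<close> lies in
  \<open>W \<inter> A\<close>, hence in \<open>H\<close>, and so does \<open>x\<close>.\<close>

lemma subgroup_relatively_closed:
  assumes A: "subgroup A G" and H: "subgroup H G" "H \<subseteq> A"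
    and W: "openin T W" "\<one> \<in> W" "W \<inter> A \<subseteq> H" and x: "x \<in> A" "x \<in> T closure_of H"
  shows "x \<in> H"
proof -
  have xG: "x \<in> carrier G" using subgroup.mem_carrier[OF A x(1)] .
  have "x \<in> (\<lambda>w. x \<otimes> w) ` W" using W(2) xG by (intro image_eqI[of _ _ \<one>]) auto
  then obtain h where h: "h \<in> H" "h \<in> (\<lambda>w. x \<otimes> w) ` W"
    using x(2) openin_translate[OF xG W(1)] unfolding in_closure_of by blast
  then obtain w where w: "w \<in> W" "h = x \<otimes> w" by blast
  have wG: "w \<in> carrier G" using w openin_subset[OF W(1)] by auto
  have "w = inv x \<otimes> h" using w xG wG by simp
  hence "w \<in> A" using subgroup.m_closed[OF A subgroup.m_inv_closed[OF A x(1)] subsetD[OF H(2) h(1)]] by simp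
  hence "w \<in> H" using W(3) w by blast
  moreover have "x = h \<otimes> inv w" using w xG wG by (simp add: m_assoc)
  ultimately show ?thesis using subgroup.m_closed[OF H(1) h(1) subgroup.m_inv_closed[OF H(1)]] by simp
qed

lemma closure_subgroup:
  assumes H: "subgroup H G"
  shows "subgroup (T closure_of H) G"
proof (rule subgroupI)
  have HG: "H \<subseteq> carrier G" using subgroup.subset[OF H] .
  show "T closure_of H \<subseteq> carrier G" using closure_of_subset_topspace[of T H] by simp
  have sub: "H \<subseteq> T closure_of H" using HG by (intro closure_of_subset) simp
  thus "T closure_of H \<noteq> {}" using subgroup.one_closed[OF H] by auto
  fix a assume a: "a \<in> T closure_of H"
  have "(\<lambda>x. inv x) ` (T closure_of H) \<subseteq> T closure_of ((\<lambda>x. inv x) ` H)"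
    using inv_cont by (rule continuous_map_image_closure_subset)
  also have "\<dots> \<subseteq> T closure_of H" using H by (intro closure_of_mono) (auto simp: subgroup.m_inv_closed)
  finally show "inv a \<in> T closure_of H" using a by blast
  fix b assume b: "b \<in> T closure_of H"
  have "(\<lambda>(x, y). x \<otimes> y) ` (prod_topology T T closure_of (H \<times> H)) \<subseteq> T closure_of ((\<lambda>(x, y). x \<otimes> y) ` (H \<times> H))"
    using mult_cont by (rule continuous_map_image_closure_subset)
  also have "\<dots> \<subseteq> T closure_of H" using H by (intro closure_of_mono) (auto simp: subgroup.m_closed)
  finally show "a \<otimes> b \<in> T closure_of H" using a b by (force simp: closure_of_Times)
qed

lemma closedin_closure: "closedin T (T closure_of H)" by (rule closedin_closure_of)

lemma Exp_neighbourhood: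
  assumes "0 < \<epsilon>"
  shows "\<exists>W. openin T W \<and> \<one> \<in> W \<and> (\<forall>w\<in>W. \<exists>X\<in>E. norm X < \<epsilon> \<and> Exp X = w)"
proof -
  define e where "e = min (\<epsilon> / 2) (\<delta> / 4)"
  have e: "0 < e" "2 * e \<le> \<epsilon>" "e \<le> \<delta> / 4" using assms \<delta>_pos by (auto simp: e_def)
  define W where "W = {x \<in> topspace (subtopology T U). \<phi> x \<in> \<phi> ` U \<inter> ball 0 e}"
  have "continuous_map (subtopology T U) (top_of_set (\<phi> ` U)) \<phi>"
    using homeo_\<phi> by (rule homeomorphic_imp_continuous_map)
  moreover have "openin (top_of_set (\<phi> ` U)) (\<phi> ` U \<inter> ball 0 e)" by auto
  ultimately have "openin (subtopology T U) W" unfolding W_def by (rule openin_continuous_map_preimage)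
  hence "openin T W" using open_U openin_open_subtopology by blast
  moreover have "\<one> \<in> W" using one_U \<phi>_one e by (auto simp: W_def intro!: image_eqI[of 0 \<phi> \<one>])
  moreover have "\<exists>X\<in>E. norm X < \<epsilon> \<and> Exp X = w" if "w \<in> W" for w
  proof -
    have w: "w \<in> U" "norm (\<phi> w) < e" using that by (auto simp: W_def)
    hence "norm (\<phi> w) < \<delta> / 4" using e by linarith
    from Exp_onto[OF w(1) this] obtain X where "X \<in> E" "norm X \<le> 2 * norm (\<phi> w)" "Exp X = w" by blast
    thus ?thesis using w(2) e by (intro bexI[of _ X]) auto
  qed
  ultimately show ?thesis by blast
qed

lemma closed_subgroup_neighbourhood:
  assumes A: "subgroup A G" "closedin T A" and e: "0 < e"
  shows "\<exists>W. openin T W \<and> \<one> \<in> W \<and> (\<forall>w\<in>W \<inter> A. \<exists>X\<in>Lie A. norm X < e \<and> Exp X = w)"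
proof -
  obtain \<epsilon> where \<epsilon>: "\<epsilon> > 0" "\<And>X. X \<in> E \<Longrightarrow> norm X < \<epsilon> \<Longrightarrow> Exp X \<in> A \<Longrightarrow> X \<in> Lie A"
    using closed_subgroup_log[OF A] by blast
  obtain W where W: "openin T W" "\<one> \<in> W" "\<And>w. w \<in> W \<Longrightarrow> \<exists>X\<in>E. norm X < min \<epsilon> e \<and> Exp X = w"
    using Exp_neighbourhood[of "min \<epsilon> e"] \<epsilon>(1) e by (metis min_less_iff_conj)
  have "\<exists>X\<in>Lie A. norm X < e \<and> Exp X = w" if "w \<in> W \<inter> A" for w using W(3)[of w] \<epsilon>(2) that by auto
  thus ?thesis using W(1,2) by blast
qed

section \<open>Subgroups generated by exponentials\<close>

text \<open>For a Lie subalgebra \<open>V\<close> this is the connected immersed subgroup with Lie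
  algebra \<open>V\<close>. The equation \<open>expgen (Lie A) = A\<close> serves throughout as the
  form in which connectedness of \<open>A\<close> is used.\<close>

definition expgen :: "'e set \<Rightarrow> 'g set" where "expgen V = generate G (Exp ` V)"

lemma subgroup_expgen:
  assumes "V \<subseteq> E"
  shows "subgroup (expgen V) G" unfolding expgen_def
proof (rule generate_is_subgroup, rule image_subsetI)
  fix X assume "X \<in> V"
  thus "Exp X \<in> carrier G" using assms by (intro Exp_carrier) (rule subsetD)
qed

lemma expgen_least: "subgroup A G \<Longrightarrow> Exp ` V \<subseteq> A \<Longrightarrow> expgen V \<subseteq> A"
  unfolding expgen_def by (rule generate_subgroup_incl)

lemma Exp_expgen: "X \<in> V \<Longrightarrow> Exp X \<in> expgen V"
  unfolding expgen_def by (rule generate.incl) simp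

lemma expgen_Lie_induct [consumes 1, case_names subgroup Exp mult]:
  assumes x: "x \<in> expgen (Lie A)" and A: "subgroup A G" and P: "\<And>X. X \<in> Lie A \<Longrightarrow> P (Exp X)"
    "\<And>x y. x \<in> expgen (Lie A) \<Longrightarrow> y \<in> expgen (Lie A) \<Longrightarrow> P x \<Longrightarrow> P y \<Longrightarrow> P (x \<otimes> y)"
  shows "P x" using x unfolding expgen_def
proof (induction rule: generate.induct)
  case one
  have "0 \<in> Lie A" using subgroup.one_closed[OF A] by (simp add: Lie_def)
  thus ?case using P(1) Exp_zero by metis
next
  case (inv h)
  then obtain X where X: "X \<in> Lie A" "h = Exp X" by blast
  have "- X \<in> Lie A" using Lie_scale[OF X(1), of "- 1"] by simp
  thus ?case using P(1) Exp_minus[OF LieD(1)[OF X(1)]] X(2) by metis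
qed (use P in \<open>auto simp: expgen_def\<close>)

text \<open>By \<open>closed_subgroup_neighbourhood\<close>, \<open>expgen (Lie A)\<close> contains
  a neighbourhood of the identity in \<open>A\<close>, so it is relatively closed in
  \<open>A\<close>; being dense there as well, it is everything.\<close>

lemma expgen_Lie_eq:
  assumes A: "subgroup A G" "closedin T A" and gen: "A \<subseteq> T closure_of (expgen (Lie A))"
  shows "expgen (Lie A) = A"
proof
  have LE: "Lie A \<subseteq> E" by (rule subsetI) (rule LieD(1))
  show sub: "expgen (Lie A) \<subseteq> A" by (intro expgen_least A(1) image_subsetI Exp_Lie)
  obtain W where W: "openin T W" "\<one> \<in> W" "\<forall>w\<in>W \<inter> A. \<exists>X\<in>Lie A. norm X < 1 \<and> Exp X = w"
    using closed_subgroup_neighbourhood[OF A, of 1] by auto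
  show "A \<subseteq> expgen (Lie A)"
  proof
    fix x assume x: "x \<in> A"
    show "x \<in> expgen (Lie A)" by (rule subgroup_relatively_closed[OF A(1) subgroup_expgen[OF LE] sub W(1,2)])
        (use W(3) Exp_expgen x gen in \<open>auto dest!: bspec\<close>)
  qed
qed

lemma connected_generated:
  assumes "connected_space T"
  shows "expgen E = carrier G"
proof -
  let ?H = "expgen E"
  have H: "subgroup ?H G" by (rule subgroup_expgen) simp
  have HG: "?H \<subseteq> carrier G" using subgroup.subset[OF H] .
  obtain W where W: "openin T W" "\<one> \<in> W" "\<forall>w\<in>W. \<exists>X\<in>E. norm X < 1 \<and> Exp X = w" using Exp_neighbourhood[of 1] by auto
  have WH: "W \<subseteq> ?H" using W(3) Exp_expgen by (auto dest!: bspec)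
  have "openin T ?H"
  proof (subst openin_subopen, intro ballI)
    fix x assume x: "x \<in> ?H"
    hence xG: "x \<in> carrier G" using HG by blast
    show "\<exists>V. openin T V \<and> x \<in> V \<and> V \<subseteq> ?H"
    proof (intro exI[of _ "(\<lambda>w. x \<otimes> w) ` W"] conjI)
      show "openin T ((\<lambda>w. x \<otimes> w) ` W)" by (rule openin_translate[OF xG W(1)])
      show "x \<in> (\<lambda>w. x \<otimes> w) ` W" using W(2) xG by (intro image_eqI[of _ _ \<one>]) auto
      show "(\<lambda>w. x \<otimes> w) ` W \<subseteq> ?H" using x WH H by (auto simp: subgroup.m_closed)
    qed
  qed
  moreover have "closedin T ?H"
  proof -
    have "T closure_of ?H \<subseteq> ?H"
    proof
      fix x assume x: "x \<in> T closure_of ?H"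
      show "x \<in> ?H" by (rule subgroup_relatively_closed[OF subgroup_self H HG W(1,2) _ _ x])
          (use WH x closure_of_subset_topspace[of T ?H] in auto)
    qed
    thus ?thesis using HG by (intro closure_of_subset_eq[THEN iffD1]) simp
  qed
  moreover have "?H \<noteq> {}" using subgroup.one_closed[OF H] by blast
  ultimately show ?thesis using assms by (auto simp: connected_space_clopen_in)
qed

end

text \<open>A maximal independent subset of \<open>D\<close> is a basis of its span, and rounding
  the coordinates down to integers gives an element of \<open>D\<close>. The set \<open>D\<close> is
  an arbitrary additive subgroup, possibly dense in its span.\<close>

lemma span_lattice_bounded:
  fixes D :: "'a::euclidean_space set"
  assumes zero: "0 \<in> D" and add: "\<And>x y. x \<in> D \<Longrightarrow> y \<in> D \<Longrightarrow> x + y \<in> D" and neg: "\<And>x. x \<in> D \<Longrightarrow> - x \<in> D"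
  shows "\<exists>R. \<forall>x\<in>span D. \<exists>y\<in>D. norm (x - y) \<le> R"
proof -
  obtain B where B: "B \<subseteq> D" "independent B" "D \<subseteq> span B" using maximal_independent_subset by blast
  have fin: "finite B" using B(2) independent_imp_finite by blast
  have nat: "real n *\<^sub>R x \<in> D" if "x \<in> D" for n x
    by (induction n) (use zero add that in \<open>auto simp: scaleR_add_left\<close>)
  have int: "of_int k *\<^sub>R x \<in> D" if "x \<in> D" for k x
  proof (cases "0 \<le> k")
    case True
    thus ?thesis using nat[OF that, of "nat k"] by simp
  next
    case False
    thus ?thesis using neg[OF nat[OF that, of "nat (- k)"]] by simp
  qed
  have sum: "(\<Sum>b\<in>B'. of_int (k b) *\<^sub>R b) \<in> D" if "B' \<subseteq> B" for B' and k :: "'a \<Rightarrow> int"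
  proof -
    have "finite B'" using that fin finite_subset by blast
    thus ?thesis using that by (induction B') (use zero add int B(1) in auto)
  qed
  show ?thesis
  proof (intro exI ballI)
    fix x assume "x \<in> span D"
    hence "x \<in> span B" using B(3) span_mono[OF B(3)] by (auto simp: span_span)
    then obtain c where c: "x = (\<Sum>b\<in>B. c b *\<^sub>R b)" unfolding span_finite[OF fin] by blast
    let ?y = "\<Sum>b\<in>B. of_int \<lfloor>c b\<rfloor> *\<^sub>R b"
    have "x - ?y = (\<Sum>b\<in>B. (c b - of_int \<lfloor>c b\<rfloor>) *\<^sub>R b)" by (simp add: c scaleR_diff_left sum_subtractf)
    also have "norm \<dots> \<le> (\<Sum>b\<in>B. norm b)"
    proof (rule order_trans[OF norm_sum sum_mono])
      fix b
      have "\<bar>c b - of_int \<lfloor>c b\<rfloor>\<bar> \<le> 1" by linarith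
      thus "norm ((c b - of_int \<lfloor>c b\<rfloor>) *\<^sub>R b) \<le> norm b"
        using mult_right_mono[of "\<bar>c b - of_int \<lfloor>c b\<rfloor>\<bar>" 1 "norm b"] by simp
    qed
    finally show "\<exists>y\<in>D. norm (x - y) \<le> (\<Sum>b\<in>B. norm b)" by (rule bexI) (rule sum[OF order_refl])
  qed
qed

section \<open>Products with compact sets\<close>

context local_group
begin

lemma set_mult_iff: "x \<in> A <#> K \<longleftrightarrow> (\<exists>a\<in>A. \<exists>k\<in>K. x = a \<otimes> k)"
  by (auto simp: set_mult_def)

lemma compactin_set_mult:
  assumes "compactin T K" "compactin T L"
  shows "compactin T (K <#> L)"
proof -
  have "compactin (prod_topology T T) (K \<times> L)" using assms by (simp add: compactin_Times)
  from image_compactin[OF this mult_cont]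
  have "compactin T ((\<lambda>(x, y). x \<otimes> y) ` (K \<times> L))" .
  moreover have "(\<lambda>(x, y). x \<otimes> y) ` (K \<times> L) = K <#> L" by (auto simp: set_mult_def)
  ultimately show ?thesis by simp
qed

lemma compactin_carrier: "compactin T K \<Longrightarrow> K \<subseteq> carrier G"
  using compactin_subset_topspace by fastforce

lemma closedin_carrier: "closedin T A \<Longrightarrow> A \<subseteq> carrier G"
  using closedin_subset by fastforce

text \<open>\<open>A <#> K\<close> is the projection of the closed set of pairs
  \<open>(x, k)\<close> with \<open>x \<otimes> inv k \<in> A\<close>, and projection along a
  compact factor is a closed map.\<close>

lemma closedin_set_mult:
  assumes A: "closedin T A" and K: "compactin T K"
  shows "closedin T (A <#> K)"
proof -
  have KG: "K \<subseteq> carrier G" and AG: "A \<subseteq> carrier G" using compactin_carrier[OF K] closedin_carrier[OF A] .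
  let ?TK = "subtopology T K"
  have comp: "compact_space ?TK" using K by (simp add: compact_space_subtopology)
  have "continuous_map (prod_topology T ?TK) T (\<lambda>p. inv (snd p))"
    using continuous_map_compose[OF continuous_map_into_fulltopology[OF continuous_map_snd] inv_cont]
    by (simp add: o_def)
  from continuous_map_compose[OF continuous_map_pairedI[OF continuous_map_fst this] mult_cont]
  have "continuous_map (prod_topology T ?TK) T (\<lambda>p. fst p \<otimes> inv (snd p))" by (simp add: o_def)
  from closedin_continuous_map_preimage[OF this A]
  have "closedin (prod_topology T ?TK) {p \<in> topspace (prod_topology T ?TK). fst p \<otimes> inv (snd p) \<in> A}" .
  hence "closedin T (fst ` {p \<in> topspace (prod_topology T ?TK). fst p \<otimes> inv (snd p) \<in> A})"
    using closed_map_fst[OF comp, of T] unfolding closed_map_def by blast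
  moreover have "fst ` {p \<in> topspace (prod_topology T ?TK). fst p \<otimes> inv (snd p) \<in> A} = A <#> K"
  proof (intro equalityI subsetI)
    fix x assume "x \<in> fst ` {p \<in> topspace (prod_topology T ?TK). fst p \<otimes> inv (snd p) \<in> A}"
    then obtain k where "x \<in> carrier G" "k \<in> K" "x \<otimes> inv k \<in> A" by auto
    thus "x \<in> A <#> K" using KG unfolding set_mult_iff
      by (intro bexI[of _ "x \<otimes> inv k"] bexI[of _ k]) (auto simp: m_assoc)
  next
    fix x assume "x \<in> A <#> K"
    then obtain a k where "a \<in> A" "k \<in> K" "x = a \<otimes> k" by (auto simp: set_mult_iff)
    thus "x \<in> fst ` {p \<in> topspace (prod_topology T ?TK). fst p \<otimes> inv (snd p) \<in> A}"
      using KG AG by (intro image_eqI[of _ _ "(x, k)"]) (auto simp: m_assoc subset_iff)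
  qed
  ultimately show ?thesis by simp
qed

lemma compactin_Exp:
  assumes "compact S" "S \<subseteq> E"
  shows "compactin T (Exp ` S)"
proof -
  have "continuous_map (top_of_set S) T Exp" using continuous_map_Exp[of S "\<lambda>x. x"] assms by simp
  moreover have "compactin (top_of_set S) S" using assms(1) by (simp add: compactin_subtopology)
  ultimately show ?thesis using image_compactin by blast
qed

lemma continuous_map_filterI:
  assumes A: "A \<subseteq> carrier G"
    and lim: "\<And>a (F :: 'g filter). a \<in> A \<Longrightarrow> eventually (\<lambda>x. x \<in> A) F \<Longrightarrow> limitin T (\<lambda>x. x) a F \<Longrightarrow> (h \<longlongrightarrow> h a) F"
  shows "continuous_map (subtopology T A) euclidean h" unfolding continuous_map_atin
proof
  fix a assume a: "a \<in> topspace (subtopology T A)"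
  let ?F = "atin (subtopology T A) a"
  have aA: "a \<in> A" using a by simp
  have "eventually (\<lambda>x. x \<in> A) ?F"
    unfolding eventually_atin using a openin_topspace[of "subtopology T A"] by (auto intro!: exI[of _ "topspace (subtopology T A)"])
  moreover have "limitin T (\<lambda>x. x) a ?F" unfolding limitin_def
  proof (intro conjI allI impI)
    show "a \<in> topspace T" using a by simp
    fix V assume V: "openin T V \<and> a \<in> V"
    hence "openin (subtopology T A) (V \<inter> A)" by (auto simp: openin_subtopology)
    thus "eventually (\<lambda>x. x \<in> V) ?F" unfolding eventually_atin using V aA by (intro disjI2 exI[of _ "V \<inter> A"]) auto
  qed
  ultimately have "(h \<longlongrightarrow> h a) ?F" by (rule lim[OF aA])
  thus "limitin euclidean h (h a) ?F" by simp
qed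

lemma continuous_map_tendsto:
  assumes "continuous_map (subtopology T A) euclidean h" "limitin T f a F" "eventually (\<lambda>i. f i \<in> A) F" "a \<in> A"
  shows "((\<lambda>i. h (f i)) \<longlongrightarrow> h a) F"
  using continuous_map_limit[OF assms(1), of f a F] assms(2-4) by (simp add: limitin_subtopology o_def)

end

section \<open>The logarithm of an abelian quotient\<close>

text \<open>By \<open>comm\<close> the group \<open>A / \<Lambda>\<close> is abelian, and by
  \<open>gen\<close> it is generated by classes of exponentials, hence consists of them. The
  quotient itself is not formed: \<open>cong\<close> is equality in it.\<close>

locale abelian_quotient = local_group +
  fixes A \<Lambda> :: "'a set"
  assumes A: "subgroup A G" "closedin T A"
    and \<Lambda>: "subgroup \<Lambda> G" "closedin T \<Lambda>" "\<Lambda> \<subseteq> A"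
    and comm: "\<And>a b. a \<in> A \<Longrightarrow> b \<in> A \<Longrightarrow> a \<otimes> b \<otimes> inv a \<otimes> inv b \<in> \<Lambda>"
    and gen: "expgen (Lie A) = A"
begin

lemma A_carrier: "a \<in> A \<Longrightarrow> a \<in> carrier G" using subgroup.mem_carrier[OF A(1)] .
lemma A_mult: "a \<in> A \<Longrightarrow> b \<in> A \<Longrightarrow> a \<otimes> b \<in> A" using subgroup.m_closed[OF A(1)] .
lemma A_inv: "a \<in> A \<Longrightarrow> inv a \<in> A" using subgroup.m_inv_closed[OF A(1)] .
lemma \<Lambda>_A: "a \<in> \<Lambda> \<Longrightarrow> a \<in> A" using \<Lambda>(3) by blast
lemma \<Lambda>_carrier: "a \<in> \<Lambda> \<Longrightarrow> a \<in> carrier G" using A_carrier \<Lambda>_A by blast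
lemma \<Lambda>_mult: "a \<in> \<Lambda> \<Longrightarrow> b \<in> \<Lambda> \<Longrightarrow> a \<otimes> b \<in> \<Lambda>" using subgroup.m_closed[OF \<Lambda>(1)] .
lemma \<Lambda>_inv: "a \<in> \<Lambda> \<Longrightarrow> inv a \<in> \<Lambda>" using subgroup.m_inv_closed[OF \<Lambda>(1)] .
lemma \<Lambda>_one: "\<one> \<in> \<Lambda>" using subgroup.one_closed[OF \<Lambda>(1)] .

lemma \<Lambda>_normal:
  assumes "a \<in> A" "x \<in> \<Lambda>"
  shows "a \<otimes> x \<otimes> inv a \<in> \<Lambda>"
proof -
  have "a \<otimes> x \<otimes> inv a = (a \<otimes> x \<otimes> inv a \<otimes> inv x) \<otimes> x"
    using A_carrier[OF assms(1)] \<Lambda>_carrier[OF assms(2)] by (simp add: m_assoc)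
  thus ?thesis using \<Lambda>_mult[OF comm[OF assms(1) \<Lambda>_A[OF assms(2)]] assms(2)] by simp
qed

definition cong :: "'a \<Rightarrow> 'a \<Rightarrow> bool" where
  "cong x y \<longleftrightarrow> x \<in> A \<and> y \<in> A \<and> inv x \<otimes> y \<in> \<Lambda>"

lemma cong_refl: "x \<in> A \<Longrightarrow> cong x x"
  using \<Lambda>_one by (simp add: cong_def A_carrier)

lemma cong_sym:
  assumes "cong x y" shows "cong y x"
proof -
  have xy: "x \<in> A" "y \<in> A" "inv x \<otimes> y \<in> \<Lambda>" using assms by (auto simp: cong_def)
  have "inv (inv x \<otimes> y) = inv y \<otimes> x" using A_carrier xy by (simp add: inv_mult_group)
  thus ?thesis using xy \<Lambda>_inv[OF xy(3)] by (simp add: cong_def)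
qed

lemma cong_trans:
  assumes "cong x y" "cong y z" shows "cong x z"
proof -
  have *: "x \<in> A" "y \<in> A" "z \<in> A" "inv x \<otimes> y \<in> \<Lambda>" "inv y \<otimes> z \<in> \<Lambda>" using assms by (auto simp: cong_def)
  have "(inv x \<otimes> y) \<otimes> (inv y \<otimes> z) = inv x \<otimes> z"
    using A_carrier[OF *(1)] A_carrier[OF *(2)] A_carrier[OF *(3)] by (simp add: m_assoc)
  thus ?thesis using * \<Lambda>_mult[OF *(4,5)] by (simp add: cong_def)
qed

lemma cong_mult:
  assumes "cong x y" "cong x' y'" shows "cong (x \<otimes> x') (y \<otimes> y')"
proof -
  have *: "x \<in> A" "y \<in> A" "x' \<in> A" "y' \<in> A" "inv x \<otimes> y \<in> \<Lambda>" "inv x' \<otimes> y' \<in> \<Lambda>" using assms by (auto simp: cong_def)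
  note c = A_carrier[OF *(1)] A_carrier[OF *(2)] A_carrier[OF *(3)] A_carrier[OF *(4)]
  have "inv x' \<otimes> (inv x \<otimes> y) \<otimes> inv (inv x') \<in> \<Lambda>" by (rule \<Lambda>_normal[OF A_inv[OF *(3)] *(5)])
  from \<Lambda>_mult[OF this *(6)]
  have "inv x' \<otimes> (inv x \<otimes> y) \<otimes> inv (inv x') \<otimes> (inv x' \<otimes> y') \<in> \<Lambda>" .
  moreover have "inv x' \<otimes> (inv x \<otimes> y) \<otimes> inv (inv x') \<otimes> (inv x' \<otimes> y') = inv (x \<otimes> x') \<otimes> (y \<otimes> y')"
    using c by (simp add: m_assoc inv_mult_group)
  ultimately show ?thesis using * A_mult by (simp add: cong_def)
qed

lemma cong_commute:
  assumes "x \<in> A" "y \<in> A" shows "cong (x \<otimes> y) (y \<otimes> x)"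
proof -
  have "inv y \<otimes> inv x \<otimes> inv (inv y) \<otimes> inv (inv x) \<in> \<Lambda>" by (rule comm[OF A_inv A_inv]) fact+
  thus ?thesis using assms A_carrier A_mult by (simp add: cong_def inv_mult_group m_assoc)
qed

lemma A_pow: "a \<in> A \<Longrightarrow> a [^] (n::nat) \<in> A"
  using subgroup_pow[OF A(1)] .

lemma cong_pow:
  assumes a: "a \<in> A" and b: "b \<in> A"
  shows "cong ((a \<otimes> b) [^] (n::nat)) (a [^] n \<otimes> b [^] n)"
proof (induction n)
  case 0
  thus ?case using cong_refl \<Lambda>_A[OF \<Lambda>_one] by simp
next
  case (Suc n)
  note c = A_carrier[OF a] A_carrier[OF b]
  have 1: "cong ((a \<otimes> b) [^] n \<otimes> (a \<otimes> b)) (a [^] n \<otimes> b [^] n \<otimes> (a \<otimes> b))"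
    by (rule cong_mult[OF Suc cong_refl[OF A_mult[OF a b]]])
  have "cong (a [^] n \<otimes> (b [^] n \<otimes> a) \<otimes> b) (a [^] n \<otimes> (a \<otimes> b [^] n) \<otimes> b)"
    by (intro cong_mult cong_refl cong_commute A_pow a b)
  moreover have "a [^] n \<otimes> (b [^] n \<otimes> a) \<otimes> b = a [^] n \<otimes> b [^] n \<otimes> (a \<otimes> b)" using c by (simp add: m_assoc)
  moreover have "a [^] n \<otimes> (a \<otimes> b [^] n) \<otimes> b = a [^] Suc n \<otimes> b [^] Suc n" using c by (simp add: m_assoc)
  ultimately show ?case using cong_trans[OF 1] by simp
qed

lemma Lie_A_E: "X \<in> Lie A \<Longrightarrow> X \<in> E" using LieD(1) .

lemma subspace_LA: "subspace (Lie A)" using subspace_Lie[OF A] .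

lemma Exp_LA: "X \<in> Lie A \<Longrightarrow> Exp X \<in> A" using Exp_Lie .

text \<open>In an abelian quotient \<open>(a b)^n\<close> and \<open>a^n b^n\<close> agree, so the
  products in Trotter's formula for \<open>X + Y\<close> are all congruent to
  \<open>Exp X \<otimes> Exp Y\<close>; \<open>\<Lambda>\<close> being closed, their limit is as
  well.\<close>

lemma cong_Exp_add:
  assumes X: "X \<in> Lie A" and Y: "Y \<in> Lie A"
  shows "cong (Exp X \<otimes> Exp Y) (Exp (X + Y))"
proof -
  let ?f = "\<lambda>n. (Exp (X /\<^sub>R real n) \<otimes> Exp (Y /\<^sub>R real n)) [^] n"
  have sc: "Z /\<^sub>R real n \<in> Lie A" if "Z \<in> Lie A" for Z n using subspace_LA that by (simp add: subspace_scale)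
  have XY: "Exp X \<otimes> Exp Y \<in> A" by (intro A_mult Exp_LA X Y)
  have lim: "limitin T ?f (Exp (X + Y)) sequentially" by (intro trotter Lie_A_E X Y)
  have "inv (Exp X \<otimes> Exp Y) \<otimes> Exp (X + Y) \<in> \<Lambda>"
  proof (rule closed_limit[OF \<Lambda>(2) limitin_mult[OF limitin_const lim]])
    show "inv (Exp X \<otimes> Exp Y) \<in> carrier G" using A_carrier[OF XY] by simp
    show "eventually (\<lambda>n. inv (Exp X \<otimes> Exp Y) \<otimes> ?f n \<in> \<Lambda>) sequentially" using eventually_gt_at_top[of 0]
    proof eventually_elim
      case (elim n)
      have pw: "Exp (Z /\<^sub>R real n) [^] n = Exp Z" if "Z \<in> Lie A" for Z
        using Exp_pow[OF Lie_A_E[OF sc[OF that]], of n n] elim by simp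
      have "cong (?f n) (Exp (X /\<^sub>R real n) [^] n \<otimes> Exp (Y /\<^sub>R real n) [^] n)" by (intro cong_pow Exp_LA sc X Y)
      hence "cong (Exp X \<otimes> Exp Y) (?f n)" using pw[OF X] pw[OF Y] cong_sym by simp
      thus ?case by (simp add: cong_def)
    qed
  qed simp
  moreover have "Exp (X + Y) \<in> A" by (intro Exp_LA subspace_add[OF subspace_LA] X Y)
  ultimately show ?thesis using XY by (simp add: cong_def)
qed

lemma cong_Exp_ex:
  assumes "a \<in> A"
  shows "\<exists>X\<in>Lie A. cong (Exp X) a"
proof -
  have "a \<in> expgen (Lie A)" using assms gen by simp
  thus ?thesis
  proof (induction a rule: expgen_Lie_induct)
    case subgroup
    show ?case by (rule A(1))
  next
    case (Exp X)
    thus ?case using cong_refl Exp_LA by blast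
  next
    case (mult x y)
    then obtain X Y where X: "X \<in> Lie A" "cong (Exp X) x" and Y: "Y \<in> Lie A" "cong (Exp Y) y" by blast
    have "cong (Exp (X + Y)) (x \<otimes> y)"
      using cong_trans[OF cong_sym[OF cong_Exp_add[OF X(1) Y(1)]] cong_mult[OF X(2) Y(2)]] .
    thus ?case using subspace_add[OF subspace_LA X(1) Y(1)] by blast
  qed
qed

text \<open>The kernel of the map from \<open>Lie A\<close> to \<open>A / \<Lambda>\<close>. It
  contains the subspace \<open>Lie \<Lambda>\<close>, so in general it is not discrete.\<close>

definition lattice :: "'c set" where "lattice = {X \<in> Lie A. Exp X \<in> \<Lambda>}"

definition W :: "'c set" where "W = span lattice"

lemma W_Lie: "W \<subseteq> Lie A"
  unfolding W_def by (rule span_minimal[OF _ subspace_LA]) (auto simp: lattice_def)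

lemma subspace_W: "subspace W" unfolding W_def by simp

lemma cong_Lambda: "a \<in> \<Lambda> \<Longrightarrow> cong a b \<Longrightarrow> b \<in> \<Lambda>"
proof -
  assume a: "a \<in> \<Lambda>" and c: "cong a b"
  hence "b \<in> A" "inv a \<otimes> b \<in> \<Lambda>" by (auto simp: cong_def)
  thus "b \<in> \<Lambda>" using \<Lambda>_mult[OF a, of "inv a \<otimes> b"] A_carrier \<Lambda>_carrier[OF a] by simp
qed

lemma lattice_add: "X \<in> lattice \<Longrightarrow> Y \<in> lattice \<Longrightarrow> X + Y \<in> lattice"
  using cong_Lambda[OF \<Lambda>_mult cong_Exp_add] subspace_add[OF subspace_LA] by (simp add: lattice_def)

lemma lattice_minus: "X \<in> lattice \<Longrightarrow> - X \<in> lattice"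
  using subspace_neg[OF subspace_LA] \<Lambda>_inv Exp_minus[OF Lie_A_E] by (simp add: lattice_def)

lemma lattice_zero: "0 \<in> lattice"
  using subspace_0[OF subspace_LA] \<Lambda>_one by (simp add: lattice_def)

lemma cong_Exp_diff:
  assumes X: "X \<in> Lie A" and Y: "Y \<in> Lie A" and c: "cong (Exp X) (Exp Y)"
  shows "Y - X \<in> lattice"
proof -
  have mX: "- X \<in> Lie A" using subspace_neg[OF subspace_LA X] .
  have "inv (Exp X) \<otimes> Exp Y \<in> \<Lambda>" using c by (simp add: cong_def)
  hence "Exp (- X) \<otimes> Exp Y \<in> \<Lambda>" using Exp_minus[OF Lie_A_E[OF X]] by simp
  from cong_Lambda[OF this cong_Exp_add[OF mX Y]]
  show ?thesis using subspace_diff[OF subspace_LA Y X] by (simp add: lattice_def)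
qed

text \<open>The logarithm on \<open>A / \<Lambda>\<close> is determined up to
  \<open>lattice\<close>; modulo the span \<open>W\<close> it becomes single-valued. The quotient of
  \<open>Lie A\<close> by \<open>W\<close> is realised as the orthogonal complement of
  \<open>W\<close>, so that \<open>F\<close> takes values in the type of the model space.\<close>

definition F :: "'a \<Rightarrow> 'c" where
  "F a = (let X = SOME X. X \<in> Lie A \<and> cong (Exp X) a in X - oproj W X)"

lemma F_eq:
  assumes X: "X \<in> Lie A" and c: "cong (Exp X) a"
  shows "F a = X - oproj W X"
proof -
  define Y where "Y = (SOME Y. Y \<in> Lie A \<and> cong (Exp Y) a)"
  have Y: "Y \<in> Lie A \<and> cong (Exp Y) a" unfolding Y_def by (rule someI[of _ X]) (use assms in simp)
  have "X - Y \<in> lattice" using cong_Exp_diff[of Y X] Y X cong_trans cong_sym c by blast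
  hence "X - Y \<in> W" unfolding W_def by (rule span_base)
  hence "oproj W X - oproj W Y = X - Y" using oproj_id[OF subspace_W] linear_diff[OF linear_oproj] by metis
  thus ?thesis by (simp add: F_def Y_def[symmetric] Let_def algebra_simps)
qed

lemma F_Exp: "X \<in> Lie A \<Longrightarrow> F (Exp X) = X - oproj W X"
  by (rule F_eq) (simp_all add: cong_refl Exp_LA)

lemma F_mult:
  assumes "a \<in> A" "b \<in> A"
  shows "F (a \<otimes> b) = F a + F b"
proof -
  obtain X Y where X: "X \<in> Lie A" "cong (Exp X) a" and Y: "Y \<in> Lie A" "cong (Exp Y) b"
    using cong_Exp_ex assms by blast
  have "cong (Exp (X + Y)) (a \<otimes> b)"
    using cong_trans[OF cong_sym[OF cong_Exp_add[OF X(1) Y(1)]] cong_mult[OF X(2) Y(2)]] .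
  thus ?thesis
    using F_eq[OF subspace_add[OF subspace_LA X(1) Y(1)]] F_eq[OF X] F_eq[OF Y] by (simp add: linear_add[OF linear_oproj])
qed

lemma F_Lambda:
  assumes "a \<in> \<Lambda>" shows "F a = 0"
proof -
  have "cong (Exp 0) a" using \<Lambda>_A[OF \<Lambda>_one] \<Lambda>_A[OF assms] assms \<Lambda>_carrier[OF assms] by (simp add: cong_def)
  thus ?thesis using F_eq[OF subspace_0[OF subspace_LA]] linear_0[OF linear_oproj] by simp
qed

lemma F_inv:
  assumes "a \<in> A" shows "F (inv a) = - F a"
proof -
  have "F (inv a \<otimes> a) = F (inv a) + F a" by (rule F_mult[OF A_inv[OF assms] assms])
  thus ?thesis using F_Lambda[OF \<Lambda>_one] A_carrier[OF assms] by (simp add: eq_neg_iff_add_eq_0)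
qed

lemma F_orth:
  assumes "a \<in> A" shows "F a \<in> Lie A" "w \<in> W \<Longrightarrow> F a \<bullet> w = 0"
proof -
  obtain X where X: "X \<in> Lie A" "cong (Exp X) a" using cong_Exp_ex assms by blast
  show "F a \<in> Lie A" unfolding F_eq[OF X] using oproj_in[OF subspace_W] W_Lie by (intro subspace_diff[OF subspace_LA X(1)]) blast
  show "w \<in> W \<Longrightarrow> F a \<bullet> w = 0" unfolding F_eq[OF X] by (rule oproj_orth[OF subspace_W])
qed

lemma F_continuous: "continuous_map (subtopology T A) euclidean F"
proof (rule continuous_map_filterI)
  show "A \<subseteq> carrier G" using A_carrier by blast
  fix a and Fl :: "'a filter"
  assume a: "a \<in> A" and ev: "eventually (\<lambda>x. x \<in> A) Fl" and lim: "limitin T (\<lambda>x. x) a Fl"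
  have l1: "limitin T (\<lambda>x. inv a \<otimes> x) \<one> Fl"
    using limitin_mult[OF limitin_const[of "inv a"] lim] A_carrier[OF a] by simp
  show "(F \<longlongrightarrow> F a) Fl"
  proof (rule tendstoI)
    fix e :: real assume e: "0 < e"
    obtain V where V: "openin T V" "\<one> \<in> V" "\<forall>w\<in>V \<inter> A. \<exists>X\<in>Lie A. norm X < e \<and> Exp X = w"
      using closed_subgroup_neighbourhood[OF A e] by blast
    have "eventually (\<lambda>x. inv a \<otimes> x \<in> V) Fl" using l1 V unfolding limitin_def by blast
    with ev show "eventually (\<lambda>x. dist (F x) (F a) < e) Fl"
    proof eventually_elim
      case (elim x)
      hence ax: "inv a \<otimes> x \<in> V \<inter> A" using A_mult[OF A_inv[OF a]] by simp
      then obtain X where X: "X \<in> Lie A" "norm X < e" "Exp X = inv a \<otimes> x" using V(3) by blast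
      have "F x - F a = F (inv a \<otimes> x)" using F_mult[OF A_inv[OF a] elim(1)] F_inv[OF a] by simp
      also have "\<dots> = X - oproj W X" using F_Exp[OF X(1)] X(3) by simp
      finally show ?case using norm_oproj(2)[OF subspace_W, of X] X(2) by (simp add: dist_norm)
    qed
  qed
qed

text \<open>An element with \<open>F a = 0\<close> is congruent to some \<open>Exp X\<close> with
  \<open>X \<in> W\<close>. Subtracting a vector of \<open>lattice\<close> changes
  \<open>Exp X\<close> only by a factor in \<open>\<Lambda>\<close> and brings \<open>X\<close> into
  a fixed ball of \<open>W\<close>, whose image under \<open>Exp\<close> is compact.\<close>

lemma kernel_F:
  "\<exists>K. compactin T K \<and> K \<subseteq> A \<and> {a \<in> A. F a = 0} \<subseteq> \<Lambda> <#> K"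
proof -
  obtain R where R: "\<forall>x\<in>W. \<exists>y\<in>lattice. norm (x - y) \<le> R"
    unfolding W_def using span_lattice_bounded[OF lattice_zero lattice_add lattice_minus] by blast
  let ?K = "Exp ` (W \<inter> cball 0 R)"
  have WE: "W \<subseteq> E" using W_Lie Lie_A_E by blast
  have "compact (W \<inter> cball 0 R)" using closed_subspace[OF subspace_W] by (simp add: closed_Int_compact)
  hence "compactin T ?K" using WE by (intro compactin_Exp) auto
  moreover have "?K \<subseteq> A" using W_Lie Exp_LA by blast
  moreover have "{a \<in> A. F a = 0} \<subseteq> \<Lambda> <#> ?K"
  proof clarify
    fix a assume a: "a \<in> A" "F a = 0"
    obtain X where X: "X \<in> Lie A" "cong (Exp X) a" using cong_Exp_ex a by blast
    have "X = oproj W X" using F_eq[OF X] a by simp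
    hence XW: "X \<in> W" using oproj_in[OF subspace_W] by metis
    then obtain Y where Y: "Y \<in> lattice" "norm (X - Y) \<le> R" using R by blast
    let ?Z = "X - Y"
    have YW: "Y \<in> W" unfolding W_def using Y(1) by (rule span_base)
    have Z: "?Z \<in> W" by (rule subspace_diff[OF subspace_W XW YW])
    have L: "?Z \<in> Lie A" "Y \<in> Lie A" using Z YW W_Lie by auto
    have "cong (Exp Y \<otimes> Exp ?Z) (Exp X)" using cong_Exp_add[OF L(2,1)] by simp
    from cong_trans[OF this X(2)] have c: "cong (Exp Y \<otimes> Exp ?Z) a" .
    have eZ: "Exp ?Z \<in> A" "Exp Y \<in> \<Lambda>" using Exp_LA L Y(1) by (auto simp: lattice_def)
    let ?y = "inv (Exp Y \<otimes> Exp ?Z) \<otimes> a"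
    have y: "?y \<in> \<Lambda>" using c by (simp add: cong_def)
    note cc = A_carrier[OF eZ(1)] \<Lambda>_carrier[OF eZ(2)] A_carrier[OF a(1)]
    \<comment> \<open>The congruence yields a factor of \<open>\<Lambda>\<close> to the right of
      \<open>Exp ?Z\<close>; conjugation moves it to the left, where \<open>\<Lambda> <#> ?K\<close>
      has it.\<close>
    have "Exp ?Z \<otimes> ?y \<otimes> inv (Exp ?Z) \<in> \<Lambda>" by (rule \<Lambda>_normal[OF eZ(1) y])
    hence 1: "Exp Y \<otimes> (Exp ?Z \<otimes> ?y \<otimes> inv (Exp ?Z)) \<in> \<Lambda>" by (rule \<Lambda>_mult[OF eZ(2)])
    have "a = Exp Y \<otimes> (Exp ?Z \<otimes> ?y \<otimes> inv (Exp ?Z)) \<otimes> Exp ?Z" using cc by (simp add: m_assoc inv_mult_group)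
    thus "a \<in> \<Lambda> <#> ?K" unfolding set_mult_iff using 1 Z Y(2) by (intro bexI[OF _ 1] bexI[of _ "Exp ?Z"]) auto
  qed
  ultimately show ?thesis by blast
qed

end

section \<open>Polynomial functions of the adjoint representation\<close>

lemma riesz_subspace:
  fixes f :: "'a::euclidean_space \<Rightarrow> real"
  assumes W: "subspace W"
    and add: "\<And>x y. x \<in> W \<Longrightarrow> y \<in> W \<Longrightarrow> f (x + y) = f x + f y"
    and scale: "\<And>c x. x \<in> W \<Longrightarrow> f (c *\<^sub>R x) = c * f x"
  shows "\<exists>\<theta>. \<forall>x\<in>W. f x = \<theta> \<bullet> x"
proof -
  have lin: "linear (\<lambda>x. f (oproj W x))" by (rule linear_on_subspace_bound[OF W]) (simp_all add: add scale)
  show ?thesis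
  proof (intro exI ballI)
    fix x assume "x \<in> W"
    thus "f x = adjoint (\<lambda>x. f (oproj W x)) 1 \<bullet> x"
      using adjoint_works[OF lin, of x 1] oproj_id[OF W] by (simp add: inner_commute)
  qed
qed

section \<open>Continuous homomorphisms to the reals\<close>

context local_group
begin

definition cont_hom :: "'g set \<Rightarrow> ('g \<Rightarrow> real) \<Rightarrow> bool" where
  "cont_hom A l \<longleftrightarrow> continuous_map (subtopology T A) euclideanreal l \<and> (\<forall>a\<in>A. \<forall>b\<in>A. l (a \<otimes> b) = l a + l b)"

lemma cont_hom_mult: "cont_hom A l \<Longrightarrow> a \<in> A \<Longrightarrow> b \<in> A \<Longrightarrow> l (a \<otimes> b) = l a + l b"
  by (simp add: cont_hom_def)

lemma cont_hom_limit:
  assumes "cont_hom A l" "limitin T f a F" "eventually (\<lambda>i. f i \<in> A) F" "a \<in> A"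
  shows "((\<lambda>i. l (f i)) \<longlongrightarrow> l a) F"
  by (rule continuous_map_tendsto[OF _ assms(2-4)]) (use assms(1) in \<open>simp add: cont_hom_def\<close>)

lemma cont_hom_one:
  assumes l: "cont_hom A l" and A: "subgroup A G"
  shows "l \<one> = 0" using cont_hom_mult[OF l subgroup.one_closed[OF A] subgroup.one_closed[OF A]] by simp

lemma cont_hom_inv:
  assumes l: "cont_hom A l" and A: "subgroup A G" and a: "a \<in> A"
  shows "l (inv a) = - l a"
  using cont_hom_mult[OF l subgroup.m_inv_closed[OF A a] a] cont_hom_one[OF l A] subgroup.mem_carrier[OF A a]
  by simp

lemma cont_hom_pow:
  assumes l: "cont_hom A l" and A: "subgroup A G" and a: "a \<in> A"
  shows "l (a [^] (n::nat)) = real n * l a"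
  by (induction n) (simp_all add: cont_hom_one[OF l A] cont_hom_mult[OF l subgroup_pow[OF A a] a] algebra_simps)

lemma Exp_div_pow: "X \<in> E \<Longrightarrow> 0 < n \<Longrightarrow> Exp (X /\<^sub>R real n) [^] n = Exp X"
  using Exp_pow[of "X /\<^sub>R real n" n] by simp

lemma cont_hom_Exp_add:
  assumes l: "cont_hom A l" and A: "subgroup A G" "closedin T A" and X: "X \<in> Lie A" and Y: "Y \<in> Lie A"
  shows "l (Exp (X + Y)) = l (Exp X) + l (Exp Y)"
proof -
  let ?f = "\<lambda>n. (Exp (X /\<^sub>R real n) \<otimes> Exp (Y /\<^sub>R real n)) [^] n"
  have XA: "Exp (X /\<^sub>R real n) \<in> A" and YA: "Exp (Y /\<^sub>R real n) \<in> A" for n by (intro Exp_Lie Lie_scale X Y)+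
  have XY: "Exp (X + Y) \<in> A" using Exp_Lie subspace_add[OF subspace_Lie[OF A] X Y] by blast
  have fA: "?f n \<in> A" for n by (intro subgroup_pow[OF A(1)] subgroup.m_closed[OF A(1)] XA YA)
  have "(\<lambda>n. l (?f n)) \<longlonglongrightarrow> l (Exp (X + Y))"
    by (rule cont_hom_limit[OF l trotter[OF LieD(1)[OF X] LieD(1)[OF Y]] _ XY]) (use fA in simp)
  moreover have "(\<lambda>n. l (?f n)) \<longlonglongrightarrow> l (Exp X) + l (Exp Y)"
  proof (rule tendsto_eventually)
    show "eventually (\<lambda>n. l (?f n) = l (Exp X) + l (Exp Y)) sequentially" using eventually_gt_at_top[of 0]
    proof eventually_elim
      case (elim n)
      have "l (?f n) = real n * (l (Exp (X /\<^sub>R real n)) + l (Exp (Y /\<^sub>R real n)))"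
        using cont_hom_pow[OF l A(1) subgroup.m_closed[OF A(1) XA YA]] cont_hom_mult[OF l XA YA] by simp
      moreover have "real n * l (Exp (X /\<^sub>R real n)) = l (Exp X)" "real n * l (Exp (Y /\<^sub>R real n)) = l (Exp Y)"
        using cont_hom_pow[OF l A(1) XA, of n n] cont_hom_pow[OF l A(1) YA, of n n]
          Exp_div_pow[OF LieD(1)[OF X] elim] Exp_div_pow[OF LieD(1)[OF Y] elim] by simp_all
      ultimately show ?case by (simp add: distrib_left)
    qed
  qed
  ultimately show ?thesis by (rule LIMSEQ_unique)
qed

lemma cont_hom_Exp_scale_pos:
  assumes l: "cont_hom A l" and A: "subgroup A G" "closedin T A" and X: "X \<in> Lie A" and t: "0 < t"
  shows "l (Exp (t *\<^sub>R X)) = t * l (Exp X)"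
proof -
  define k where "k n = nat \<lfloor>t * real n\<rfloor>" for n
  let ?Y = "\<lambda>n. (real (k n) / real n) *\<^sub>R X"
  note k = floor_scale_limit[OF t, folded k_def]
  have kX: "?Y \<longlonglongrightarrow> t *\<^sub>R X" by (intro tendsto_scaleR k tendsto_const)
  have lim: "limitin T (\<lambda>n. Exp (?Y n)) (Exp (t *\<^sub>R X)) sequentially"
    by (rule limitin_Exp[OF _ _ kX]) (use LieD(1)[OF X] in auto)
  have inA: "Exp (c *\<^sub>R X) \<in> A" for c by (rule LieD(2)[OF X])
  have "(\<lambda>n. l (Exp (?Y n))) \<longlonglongrightarrow> l (Exp (t *\<^sub>R X))" by (rule cont_hom_limit[OF l lim]) (use inA in auto)
  moreover have "(\<lambda>n. l (Exp (?Y n))) \<longlonglongrightarrow> t * l (Exp X)"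
  proof (rule Lim_transform_eventually)
    show "(\<lambda>n. (real (k n) / real n) * l (Exp X)) \<longlonglongrightarrow> t * l (Exp X)" by (intro tendsto_mult k tendsto_const)
    show "eventually (\<lambda>n. (real (k n) / real n) * l (Exp X) = l (Exp (?Y n))) sequentially"
      using eventually_gt_at_top[of 0]
    proof eventually_elim
      case (elim n)
      let ?a = "Exp (X /\<^sub>R real n)"
      have a: "?a \<in> A" by (rule inA)
      have "Exp (?Y n) = ?a [^] k n"
        using Exp_pow[of "X /\<^sub>R real n" "k n"] LieD(1)[OF X] by (simp add: divide_inverse)
      hence "l (Exp (?Y n)) = real (k n) * l ?a" using cont_hom_pow[OF l A(1) a] by simp
      moreover have "real n * l ?a = l (Exp X)"
        using cont_hom_pow[OF l A(1) a, of n] Exp_div_pow[OF LieD(1)[OF X] elim] by simp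
      ultimately show ?case using elim by (simp add: field_simps)
    qed
  qed
  ultimately show ?thesis by (rule LIMSEQ_unique)
qed

lemma cont_hom_Exp_scale:
  assumes l: "cont_hom A l" and A: "subgroup A G" "closedin T A" and X: "X \<in> Lie A"
  shows "l (Exp (t *\<^sub>R X)) = t * l (Exp X)"
proof -
  consider "t = 0" | "0 < t" | "0 < - t" by linarith
  thus ?thesis
  proof cases
    case 3
    have "l (Exp ((- t) *\<^sub>R X)) = - l (Exp (t *\<^sub>R X))"
      using cont_hom_inv[OF l A(1) LieD(2)[OF X, of t]] Exp_minus[OF scale_E[OF LieD(1)[OF X], of t]] by simp
    thus ?thesis using cont_hom_Exp_scale_pos[OF l A X 3] by simp
  qed (use cont_hom_Exp_scale_pos[OF l A X] cont_hom_one[OF l A(1)] in auto)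
qed

text \<open>This equals the product of the conjugates \<open>a^k b a^-k\<close> for \<open>k\<close>
  from 1 to \<open>n\<close>. For \<open>a = Exp (X / n)\<close> and \<open>b = Exp (Z / n)\<close>
  it tends to \<open>Exp (X + Z) \<otimes> Exp (- X)\<close>: a discrete form of the integral
  formula for the differential of the exponential map.\<close>

definition conj_prod :: "'g \<Rightarrow> 'g \<Rightarrow> nat \<Rightarrow> 'g" where
  "conj_prod a b n = (a \<otimes> b) [^] n \<otimes> inv (a [^] n)"

lemma conj_prod_Suc:
  assumes "a \<in> carrier G" "b \<in> carrier G"
  shows "conj_prod a b (Suc n) = conj_prod a b n \<otimes> (a [^] Suc n \<otimes> b \<otimes> inv (a [^] Suc n))"
  unfolding conj_prod_def using assms by (simp add: m_assoc inv_mult_group)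

lemma conj_prod_limit:
  assumes X: "X \<in> E" and Z: "Z \<in> E"
  shows "limitin T (\<lambda>n. conj_prod (Exp (X /\<^sub>R real n)) (Exp (Z /\<^sub>R real n)) n) (Exp (X + Z) \<otimes> Exp (- X)) sequentially"
proof -
  have "limitin T (\<lambda>n. (Exp (X /\<^sub>R real n) \<otimes> Exp (Z /\<^sub>R real n)) [^] n \<otimes> Exp (- X)) (Exp (X + Z) \<otimes> Exp (- X)) sequentially"
    by (intro limitin_mult trotter limitin_const X Z Exp_carrier minus_E)
  moreover have "eventually (\<lambda>n. (Exp (X /\<^sub>R real n) \<otimes> Exp (Z /\<^sub>R real n)) [^] n \<otimes> Exp (- X)
    = conj_prod (Exp (X /\<^sub>R real n)) (Exp (Z /\<^sub>R real n)) n) sequentially" using eventually_gt_at_top[of 0]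
    by eventually_elim (simp add: conj_prod_def Exp_div_pow[OF X] Exp_minus[OF X])
  ultimately show ?thesis using limitin_transform_eventually by fast
qed

lemma conj_prod_in:
  assumes B: "subgroup B G" and a: "a \<in> carrier G" and b: "b \<in> carrier G"
    and conj: "\<And>k. a [^] k \<otimes> b \<otimes> inv (a [^] (k::nat)) \<in> B"
  shows "conj_prod a b n \<in> B"
proof (induction n)
  case 0
  thus ?case using subgroup.one_closed[OF B] by (simp add: conj_prod_def)
next
  case (Suc n)
  thus ?case unfolding conj_prod_Suc[OF a b] by (rule subgroup.m_closed[OF B]) (rule conj)
qed

lemma Adj_Lie:
  assumes h: "h \<in> carrier G" and conj: "\<And>b. b \<in> A \<Longrightarrow> h \<otimes> b \<otimes> inv h \<in> A" and Z: "Z \<in> Lie A"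
  shows "Adj h Z \<in> Lie A" unfolding Lie_def using Adj[OF h LieD(1)[OF Z]] conj[OF LieD(2)[OF Z]] by auto

lemma Exp_perturb_in:
  assumes B: "subgroup B G" "closedin T B" and H: "subgroup H G" and X: "X \<in> Lie H" and Z: "Z \<in> Lie B"
    and conj: "\<And>h b. h \<in> H \<Longrightarrow> b \<in> B \<Longrightarrow> h \<otimes> b \<otimes> inv h \<in> B"
  shows "Exp (X + Z) \<otimes> Exp (- X) \<in> B"
proof (rule closed_limit[OF B(2) conj_prod_limit[OF LieD(1)[OF X] LieD(1)[OF Z]]])
  show "eventually (\<lambda>n. conj_prod (Exp (X /\<^sub>R real n)) (Exp (Z /\<^sub>R real n)) n \<in> B) sequentially"
  proof (intro always_eventually allI conj_prod_in[OF B(1)] conj subgroup_pow[OF H])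
    fix n
    show "Exp (X /\<^sub>R real n) \<in> carrier G" "Exp (Z /\<^sub>R real n) \<in> carrier G" using LieD(1)[OF X] LieD(1)[OF Z] by auto
    show "Exp (X /\<^sub>R real n) \<in> H" "Exp (Z /\<^sub>R real n) \<in> B" by (rule LieD(2)[OF X], rule LieD(2)[OF Z])
  qed
qed simp

text \<open>Applied to the product of conjugates in \<open>conj_prod\<close>, \<open>l\<close> gives
  the Riemann sum \<open>c n Z\<close> of \<open>l (Exp (Adj (a n [^] Suc k) (Z / n)))\<close>. Each
  summand is linear in \<open>Z\<close>, because \<open>Adj\<close> preserves \<open>Lie A\<close>
  and \<open>l\<close> composed with \<open>Exp\<close> is linear there; hence so is the limit, and
  it is represented by a vector \<open>\<theta>\<close>.\<close>

lemma cont_hom_perturb_linear: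
  assumes A: "subgroup A G" "closedin T A" and H: "subgroup H G" and X: "X \<in> Lie H"
    and conj: "\<And>h b. h \<in> H \<Longrightarrow> b \<in> A \<Longrightarrow> h \<otimes> b \<otimes> inv h \<in> A" and l: "cont_hom A l"
  shows "\<exists>\<theta>. \<forall>Z\<in>Lie A. l (Exp (X + Z) \<otimes> Exp (- X)) = \<theta> \<bullet> Z"
proof -
  define a where "a n = Exp (X /\<^sub>R real n)" for n
  define th where "th Z = l (Exp (X + Z) \<otimes> Exp (- X))" for Z
  define c where "c n Z = (\<Sum>k<n. l (Exp (Adj (a n [^] Suc k) (Z /\<^sub>R real n))))" for n Z
  note XE = LieD(1)[OF X]
  have aH: "a n [^] (k::nat) \<in> H" for n k unfolding a_def by (intro subgroup_pow[OF H] LieD(2)[OF X])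
  have aG: "a n \<in> carrier G" "a n [^] (k::nat) \<in> carrier G" for n k using XE by (auto simp: a_def)
  have AdjA: "Adj (a n [^] (k::nat)) Z \<in> Lie A" if "Z \<in> Lie A" for n k Z
    by (rule Adj_Lie[OF aG(2) conj[OF aH] that])
  have lp: "l (conj_prod (a n) (Exp Z) m) = (\<Sum>k<m. l (Exp (Adj (a n [^] Suc k) Z)))" if Z: "Z \<in> Lie A" for n m Z
  proof (induction m)
    case 0
    thus ?case using cont_hom_one[OF l A(1)] by (simp add: conj_prod_def)
  next
    case (Suc m)
    have ZG: "Exp Z \<in> carrier G" and ZA: "Exp Z \<in> A" using LieD(1)[OF Z] Exp_Lie[OF Z] by auto
    have "conj_prod (a n) (Exp Z) m \<in> A" by (intro conj_prod_in A aG ZG conj aH ZA)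
    moreover have e: "a n [^] Suc m \<otimes> Exp Z \<otimes> inv (a n [^] Suc m) = Exp (Adj (a n [^] Suc m) Z)"
      by (rule Exp_Adj[OF aG(2) LieD(1)[OF Z], symmetric])
    moreover have "Exp (Adj (a n [^] Suc m) Z) \<in> A" by (intro Exp_Lie AdjA Z)
    ultimately show ?case unfolding conj_prod_Suc[OF aG(1) ZG] e using Suc cont_hom_mult[OF l] by simp
  qed
  have lim: "(\<lambda>n. c n Z) \<longlonglongrightarrow> th Z" if Z: "Z \<in> Lie A" for Z
  proof -
    have inA: "conj_prod (a n) (Exp (Z /\<^sub>R real n)) n \<in> A" for n
      by (intro conj_prod_in A aG Exp_carrier scale_E LieD(1)[OF Z] conj aH LieD(2)[OF Z])
    have "(\<lambda>n. l (conj_prod (a n) (Exp (Z /\<^sub>R real n)) n)) \<longlonglongrightarrow> th Z" unfolding th_def a_def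
      by (rule cont_hom_limit[OF l conj_prod_limit[OF XE LieD(1)[OF Z]]])
        (use inA Exp_perturb_in[OF A H X Z conj] in \<open>auto simp: a_def\<close>)
    thus ?thesis unfolding c_def lp[OF Lie_scale[OF Z]] .
  qed
  have sub: "subspace (Lie A)" using subspace_Lie[OF A] .
  have cadd: "c n (Z + Z') = c n Z + c n Z'" if Z: "Z \<in> Lie A" "Z' \<in> Lie A" for n Z Z'
  proof -
    have "l (Exp (Adj (a n [^] Suc k) ((Z + Z') /\<^sub>R real n)))
      = l (Exp (Adj (a n [^] Suc k) (Z /\<^sub>R real n))) + l (Exp (Adj (a n [^] Suc k) (Z' /\<^sub>R real n)))" for k
      unfolding scaleR_add_right Adj_add[OF aG(2) scale_E[OF LieD(1)[OF Z(1)]] scale_E[OF LieD(1)[OF Z(2)]]]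
      by (intro cont_hom_Exp_add[OF l A] AdjA Lie_scale Z)
    thus ?thesis by (simp add: c_def sum.distrib)
  qed
  have cscale: "c n (t *\<^sub>R Z) = t * c n Z" if Z: "Z \<in> Lie A" for n t Z
  proof -
    have "l (Exp (Adj (a n [^] Suc k) ((t *\<^sub>R Z) /\<^sub>R real n)))
      = t * l (Exp (Adj (a n [^] Suc k) (Z /\<^sub>R real n)))" for k
    proof -
      have e: "Adj (a n [^] Suc k) ((t *\<^sub>R Z) /\<^sub>R real n) = t *\<^sub>R Adj (a n [^] Suc k) (Z /\<^sub>R real n)"
        using Adj_scale[OF aG(2) scale_E[OF LieD(1)[OF Z]], of n "Suc k" t "inverse (real n)"]
        by (simp only: scaleR_scaleR mult.commute)
      show ?thesis unfolding e by (rule cont_hom_Exp_scale[OF l A AdjA[OF Lie_scale[OF Z]]])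
    qed
    thus ?thesis by (simp add: c_def sum_distrib_left)
  qed
  have "\<exists>\<theta>. \<forall>Z\<in>Lie A. th Z = \<theta> \<bullet> Z"
  proof (rule riesz_subspace[OF sub])
    fix Z Z' assume Z: "Z \<in> Lie A" "Z' \<in> Lie A"
    have "(\<lambda>n. c n (Z + Z')) \<longlonglongrightarrow> th Z + th Z'" unfolding cadd[OF Z] by (intro tendsto_add lim Z)
    thus "th (Z + Z') = th Z + th Z'" using LIMSEQ_unique lim[OF subspace_add[OF sub Z]] by blast
  next
    fix t Z assume Z: "Z \<in> Lie A"
    have "(\<lambda>n. c n (t *\<^sub>R Z)) \<longlonglongrightarrow> t * th Z" unfolding cscale[OF Z] by (intro tendsto_mult tendsto_const lim Z)
    thus "th (t *\<^sub>R Z) = t * th Z" using LIMSEQ_unique lim[OF Lie_scale[OF Z]] by blast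
  qed
  thus ?thesis by (simp add: th_def)
qed

section \<open>Polynomial functions on the group and Zariski density\<close>

inductive_set Poly0 :: "('g \<Rightarrow> real) set" where
  const: "(\<lambda>_. c) \<in> Poly0"
| coef: "X \<in> E \<Longrightarrow> (\<lambda>g. w \<bullet> Adj g X) \<in> Poly0"
| add: "f \<in> Poly0 \<Longrightarrow> h \<in> Poly0 \<Longrightarrow> (\<lambda>g. f g + h g) \<in> Poly0"
| mult: "f \<in> Poly0 \<Longrightarrow> h \<in> Poly0 \<Longrightarrow> (\<lambda>g. f g * h g) \<in> Poly0"

text \<open>Algebraic density speaks of \<open>Poly0\<close>, whose generators are the coefficients
  of \<open>Adj g\<close>. Adding those of \<open>Adj (inv g)\<close> makes the class stable under
  substitution of words in \<open>g\<close>, commutators in particular.\<close>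

inductive_set Poly :: "('g \<Rightarrow> real) set" where
  const: "(\<lambda>_. c) \<in> Poly"
| coef: "X \<in> E \<Longrightarrow> (\<lambda>g. w \<bullet> Adj g X) \<in> Poly"
| icoef: "X \<in> E \<Longrightarrow> (\<lambda>g. w \<bullet> Adj (inv g) X) \<in> Poly"
| add: "f \<in> Poly \<Longrightarrow> h \<in> Poly \<Longrightarrow> (\<lambda>g. f g + h g) \<in> Poly"
| mult: "f \<in> Poly \<Longrightarrow> h \<in> Poly \<Longrightarrow> (\<lambda>g. f g * h g) \<in> Poly"

lemma Poly_sum: "(\<And>i. i \<in> I \<Longrightarrow> f i \<in> Poly) \<Longrightarrow> (\<lambda>g. \<Sum>i\<in>I. f i g) \<in> Poly"
  by (induction I rule: infinite_finite_induct) (simp_all add: Poly.const Poly.add)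

lemma continuous_map_inner_right: "continuous_map euclidean euclideanreal (\<lambda>x. w \<bullet> x)"
  by (intro continuous_map_iff_continuous2[THEN iffD2] continuous_intros)

lemma continuous_map_Poly:
  assumes "f \<in> Poly" shows "continuous_map T euclideanreal f" using assms
proof induction
  case (coef X w)
  from continuous_map_compose[OF continuous_map_Adj[OF coef] continuous_map_inner_right] show ?case by (simp add: o_def)
next
  case (icoef X w)
  from continuous_map_compose[OF continuous_map_compose[OF inv_cont continuous_map_Adj[OF icoef]] continuous_map_inner_right]
  show ?case by (simp add: o_def)
qed (auto intro!: continuous_intros)

lemma Poly_zero_closure:
  assumes f: "f \<in> Poly" and z: "\<And>x. x \<in> B \<Longrightarrow> f x = 0" and x: "x \<in> T closure_of B"
  shows "f x = 0"
proof -
  have "f ` (T closure_of B) \<subseteq> euclideanreal closure_of (f ` B)"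
    using continuous_map_Poly[OF f] by (rule continuous_map_image_closure_subset)
  also have "\<dots> \<subseteq> euclideanreal closure_of {0}" by (rule closure_of_mono) (use z in auto)
  also have "\<dots> = {0}" by simp
  finally show ?thesis using x by blast
qed

lemma conj_cont_hom:
  assumes l: "cont_hom A l" and A: "subgroup A G" and h: "h \<in> carrier G" and conj: "\<And>b. b \<in> A \<Longrightarrow> h \<otimes> b \<otimes> inv h \<in> A"
  shows "cont_hom A (\<lambda>a. l (h \<otimes> a \<otimes> inv h))" unfolding cont_hom_def
proof (intro conjI ballI)
  show "continuous_map (subtopology T A) euclideanreal (\<lambda>a. l (h \<otimes> a \<otimes> inv h))"
  proof (rule continuous_map_filterI)
    show "A \<subseteq> carrier G" using subgroup.subset[OF A] .
    fix a and F :: "'g filter" assume a: "a \<in> A" "eventually (\<lambda>x. x \<in> A) F" "limitin T (\<lambda>x. x) a F"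
    show "((\<lambda>x. l (h \<otimes> x \<otimes> inv h)) \<longlongrightarrow> l (h \<otimes> a \<otimes> inv h)) F"
      by (rule cont_hom_limit[OF l limitin_conj[OF a(3) limitin_const[OF h]]])
        (use a conj in \<open>auto elim: eventually_mono\<close>)
  qed
  fix a b assume ab: "a \<in> A" "b \<in> A"
  show "l (h \<otimes> (a \<otimes> b) \<otimes> inv h) = l (h \<otimes> a \<otimes> inv h) + l (h \<otimes> b \<otimes> inv h)"
    using conj_mult[OF h subgroup.mem_carrier[OF A ab(1)] subgroup.mem_carrier[OF A ab(2)]]
      cont_hom_mult[OF l conj[OF ab(1)] conj[OF ab(2)]] by simp
qed

text \<open>By Trotter's formula, \<open>Exp (t (Adj g X - X))\<close> is the limit of the
  \<open>n\<close>-th powers of the commutators of \<open>g\<close> with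
  \<open>Exp ((t / n) X)\<close>.\<close>

lemma commutator_diff_Lie:
  assumes A: "subgroup A G" "closedin T A" and H: "subgroup H G" and g: "g \<in> H" and X: "X \<in> Lie H"
    and comm: "\<And>h. h \<in> H \<Longrightarrow> g \<otimes> h \<otimes> inv g \<otimes> inv h \<in> A"
  shows "Adj g X - X \<in> Lie A"
proof -
  note gG = subgroup.mem_carrier[OF H g] and XE = LieD(1)[OF X]
  have "Exp (t *\<^sub>R (Adj g X - X)) \<in> A" for t
  proof (rule closed_limit[OF A(2)])
    let ?c = "\<lambda>n. Exp (t *\<^sub>R Adj g X /\<^sub>R real n) \<otimes> Exp (- (t *\<^sub>R X) /\<^sub>R real n)"
    have "t *\<^sub>R (Adj g X - X) = t *\<^sub>R Adj g X + - (t *\<^sub>R X)" by (simp add: scaleR_diff_right)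
    thus "limitin T (\<lambda>n. ?c n [^] n) (Exp (t *\<^sub>R (Adj g X - X))) sequentially"
      using trotter[of "t *\<^sub>R Adj g X" "- (t *\<^sub>R X)"] Adj(1)[OF gG XE] XE minus_E by simp
    show "eventually (\<lambda>n. ?c n [^] n \<in> A) sequentially"
    proof (intro always_eventually allI subgroup_pow[OF A(1)])
      fix n
      have 1: "Exp (t *\<^sub>R Adj g X /\<^sub>R real n) = g \<otimes> Exp ((t / real n) *\<^sub>R X) \<otimes> inv g"
        using Adj(2)[OF gG XE, of "t / real n"] by (simp add: divide_inverse mult.commute)
      have 2: "Exp (- (t *\<^sub>R X) /\<^sub>R real n) = inv (Exp ((t / real n) *\<^sub>R X))"
        using Exp_minus[OF scale_E[OF XE], of "t / real n"] by (simp add: divide_inverse mult.commute)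
      show "?c n \<in> A" unfolding 1 2 by (rule comm[OF LieD(2)[OF X]])
    qed
  qed simp
  thus ?thesis using Adj(1)[OF gG XE] XE by (simp add: Lie_def diff_E)
qed

text \<open>For \<open>h = Exp X\<close> the commutator is
  \<open>Exp (X + Z) \<otimes> Exp (- X)\<close> with \<open>Z = Adj g X - X \<in> Lie A\<close>, so
  \<open>l\<close> of it is affine in \<open>Adj g X\<close>. The general case follows from
  \<open>[g, h1 h2] = [g, h1] (h1 [g, h2] h1^-1)\<close>; the induction runs over all
  \<open>l\<close>, since the second factor calls for \<open>l\<close> composed with conjugation by
  \<open>h1\<close>.\<close>

lemma commutator_poly:
  assumes A: "subgroup A G" "closedin T A" and H: "subgroup H G" and gen: "expgen (Lie H) = H"
    and conj: "\<And>h b. h \<in> H \<Longrightarrow> b \<in> A \<Longrightarrow> h \<otimes> b \<otimes> inv h \<in> A"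
    and comm: "\<And>g h. g \<in> H \<Longrightarrow> h \<in> H \<Longrightarrow> g \<otimes> h \<otimes> inv g \<otimes> inv h \<in> A"
    and l: "cont_hom A l" and h: "h \<in> H"
  shows "\<exists>f\<in>Poly. \<forall>g\<in>H. l (g \<otimes> h \<otimes> inv g \<otimes> inv h) = f g"
proof -
  have HG: "x \<in> carrier G" if "x \<in> H" for x using subgroup.mem_carrier[OF H that] .
  have base: "\<exists>f\<in>Poly. \<forall>g\<in>H. l (g \<otimes> Exp X \<otimes> inv g \<otimes> inv (Exp X)) = f g"
    if l: "cont_hom A l" and X: "X \<in> Lie H" for l X
  proof -
    note XE = LieD(1)[OF X]
    obtain \<theta> where \<theta>: "\<forall>Z\<in>Lie A. l (Exp (X + Z) \<otimes> Exp (- X)) = \<theta> \<bullet> Z"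
      using cont_hom_perturb_linear[OF A H X conj l] by blast
    show ?thesis
    proof (intro bexI[of _ "\<lambda>g. \<theta> \<bullet> Adj g X + - (\<theta> \<bullet> X)"] ballI)
      show "(\<lambda>g. \<theta> \<bullet> Adj g X + - (\<theta> \<bullet> X)) \<in> Poly" by (intro Poly.add Poly.coef Poly.const XE)
      fix g assume g: "g \<in> H"
      have 1: "g \<otimes> Exp X \<otimes> inv g \<otimes> inv (Exp X) = Exp (X + (Adj g X - X)) \<otimes> Exp (- X)"
        using Exp_Adj[OF HG[OF g] XE] Exp_minus[OF XE] by simp
      have 2: "l (Exp (X + (Adj g X - X)) \<otimes> Exp (- X)) = \<theta> \<bullet> (Adj g X - X)"
        by (rule bspec[OF \<theta> commutator_diff_Lie[OF A H g X comm[OF g]]])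
      show "l (g \<otimes> Exp X \<otimes> inv g \<otimes> inv (Exp X)) = \<theta> \<bullet> Adj g X + - (\<theta> \<bullet> X)"
        unfolding 1 2 by (simp add: inner_diff_right)
    qed
  qed
  have "h \<in> expgen (Lie H)" using h gen by simp
  thus ?thesis using l
  proof (induction h arbitrary: l rule: expgen_Lie_induct)
    case subgroup
    show ?case by (rule H)
  next
    case (Exp X)
    thus ?case using base by blast
  next
    case (mult h1 h2)
    note h = mult.hyps[unfolded gen]
    have l': "cont_hom A (\<lambda>a. l (h1 \<otimes> a \<otimes> inv h1))"
      by (rule conj_cont_hom[OF mult.prems A(1) HG[OF h(1)] conj[OF h(1)]])
    obtain f1 where f1: "f1 \<in> Poly" "\<forall>g\<in>H. l (g \<otimes> h1 \<otimes> inv g \<otimes> inv h1) = f1 g"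
      using mult.IH(1)[OF mult.prems] by blast
    obtain f2 where f2: "f2 \<in> Poly" "\<forall>g\<in>H. l (h1 \<otimes> (g \<otimes> h2 \<otimes> inv g \<otimes> inv h2) \<otimes> inv h1) = f2 g"
      using mult.IH(2)[OF l'] by blast
    show ?case
    proof (intro bexI[of _ "\<lambda>g. f1 g + f2 g"] ballI)
      show "(\<lambda>g. f1 g + f2 g) \<in> Poly" by (rule Poly.add[OF f1(1) f2(1)])
      fix g assume g: "g \<in> H"
      have "g \<otimes> (h1 \<otimes> h2) \<otimes> inv g \<otimes> inv (h1 \<otimes> h2)
        = (g \<otimes> h1 \<otimes> inv g \<otimes> inv h1) \<otimes> (h1 \<otimes> (g \<otimes> h2 \<otimes> inv g \<otimes> inv h2) \<otimes> inv h1)"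
        using HG[OF g] HG[OF h(1)] HG[OF h(2)] by (simp add: m_assoc inv_mult_group)
      thus "l (g \<otimes> (h1 \<otimes> h2) \<otimes> inv g \<otimes> inv (h1 \<otimes> h2)) = f1 g + f2 g"
        using cont_hom_mult[OF mult.prems comm[OF g h(1)] conj[OF h(1) comm[OF g h(2)]]] f1(2) f2(2) g by simp
    qed
  qed
qed

lemma Adj_expand:
  assumes g: "g \<in> carrier G" and Y: "Y \<in> E"
  shows "w \<bullet> Adj g Y = (\<Sum>b\<in>onb E. (b \<bullet> Y) * (w \<bullet> Adj g b))"
proof -
  have "Adj g Y = Adj g (oproj E (\<Sum>b\<in>onb E. (Y \<bullet> b) *\<^sub>R b))"
    using oproj_id[OF subspace_E] Y by (simp add: oproj_def[symmetric])
  also have "\<dots> = (\<Sum>b\<in>onb E. (Y \<bullet> b) *\<^sub>R Adj g (oproj E b))"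
    by (simp add: linear_sum[OF Adj_linear[OF g]] linear_scale[OF Adj_linear[OF g]])
  also have "\<dots> = (\<Sum>b\<in>onb E. (Y \<bullet> b) *\<^sub>R Adj g b)"
    using oproj_id[OF subspace_E] onb(1)[OF subspace_E] by (intro sum.cong) auto
  finally show ?thesis by (simp add: inner_sum_right inner_commute)
qed

text \<open>Maps of \<open>G\<close> that pull \<open>Poly\<close> back to \<open>Poly\<close>, up
  to equality on \<open>G\<close>. Both \<open>Adj (u x)\<close> and the adjoint of the inverse
  appear, so that the class is closed under inversion as well as products.\<close>

definition polymap :: "('g \<Rightarrow> 'g) \<Rightarrow> bool" where
  "polymap u \<longleftrightarrow> (\<forall>x\<in>carrier G. u x \<in> carrier G) \<and>
     (\<forall>w. \<forall>X\<in>E. (\<exists>f\<in>Poly. \<forall>x\<in>carrier G. f x = w \<bullet> Adj (u x) X) \<and>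
                (\<exists>f\<in>Poly. \<forall>x\<in>carrier G. f x = w \<bullet> Adj (inv (u x)) X))"

lemma polymap_carrier: "polymap u \<Longrightarrow> x \<in> carrier G \<Longrightarrow> u x \<in> carrier G"
  by (simp add: polymap_def)

lemma polymap_id: "polymap (\<lambda>x. x)"
  unfolding polymap_def by (auto intro: Poly.coef Poly.icoef)

lemma polymap_const: "a \<in> carrier G \<Longrightarrow> polymap (\<lambda>_. a)"
  unfolding polymap_def by (auto intro: Poly.const)

lemma polymap_inv:
  assumes "polymap u" shows "polymap (\<lambda>x. inv (u x))"
proof -
  have "inv (inv (u x)) = u x" if "x \<in> carrier G" for x using polymap_carrier[OF assms that] by simp
  thus ?thesis using assms unfolding polymap_def by simp
qed

lemma Adj_mult_poly:
  assumes u: "\<forall>x\<in>carrier G. u x \<in> carrier G" "\<And>w X. X \<in> E \<Longrightarrow> \<exists>f\<in>Poly. \<forall>x\<in>carrier G. f x = w \<bullet> Adj (u x) X"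
    and v: "\<forall>x\<in>carrier G. v x \<in> carrier G" "\<And>w X. X \<in> E \<Longrightarrow> \<exists>f\<in>Poly. \<forall>x\<in>carrier G. f x = w \<bullet> Adj (v x) X"
    and X: "X \<in> E"
  shows "\<exists>f\<in>Poly. \<forall>x\<in>carrier G. f x = w \<bullet> Adj (u x \<otimes> v x) X"
proof -
  have bE: "b \<in> E" if "b \<in> onb E" for b using onb(1)[OF subspace_E] that by blast
  have "\<forall>b\<in>onb E. \<exists>f. f \<in> Poly \<and> (\<forall>x\<in>carrier G. f x = w \<bullet> Adj (u x) b)" using u(2)[OF bE] by blast
  from bchoice[OF this] obtain fu where fu: "\<forall>b\<in>onb E. fu b \<in> Poly \<and> (\<forall>x\<in>carrier G. fu b x = w \<bullet> Adj (u x) b)" ..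
  have "\<forall>b\<in>onb E. \<exists>f. f \<in> Poly \<and> (\<forall>x\<in>carrier G. f x = b \<bullet> Adj (v x) X)" using v(2)[OF X] by blast
  from bchoice[OF this] obtain fv where fv: "\<forall>b\<in>onb E. fv b \<in> Poly \<and> (\<forall>x\<in>carrier G. fv b x = b \<bullet> Adj (v x) X)" ..
  show ?thesis
  proof (intro bexI[of _ "\<lambda>x. \<Sum>b\<in>onb E. fv b x * fu b x"] ballI)
    show "(\<lambda>x. \<Sum>b\<in>onb E. fv b x * fu b x) \<in> Poly" by (intro Poly_sum Poly.mult) (use fu fv in auto)
    fix x assume x: "x \<in> carrier G"
    have ux: "u x \<in> carrier G" and vx: "v x \<in> carrier G" using u v x by auto
    show "(\<Sum>b\<in>onb E. fv b x * fu b x) = w \<bullet> Adj (u x \<otimes> v x) X"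
      unfolding Adj_mult[OF ux vx X] Adj_expand[OF ux Adj(1)[OF vx X]] using fu fv x by simp
  qed
qed

lemma polymap_mult:
  assumes u: "polymap u" and v: "polymap v"
  shows "polymap (\<lambda>x. u x \<otimes> v x)"
proof -
  have c: "\<forall>x\<in>carrier G. u x \<in> carrier G" "\<forall>x\<in>carrier G. v x \<in> carrier G"
     "\<forall>x\<in>carrier G. inv (u x) \<in> carrier G" "\<forall>x\<in>carrier G. inv (v x) \<in> carrier G"
    using u v by (auto simp: polymap_def)
  have p: "\<And>w X. X \<in> E \<Longrightarrow> \<exists>f\<in>Poly. \<forall>x\<in>carrier G. f x = w \<bullet> Adj (u x) X"
    "\<And>w X. X \<in> E \<Longrightarrow> \<exists>f\<in>Poly. \<forall>x\<in>carrier G. f x = w \<bullet> Adj (v x) X"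
    "\<And>w X. X \<in> E \<Longrightarrow> \<exists>f\<in>Poly. \<forall>x\<in>carrier G. f x = w \<bullet> Adj (inv (u x)) X"
    "\<And>w X. X \<in> E \<Longrightarrow> \<exists>f\<in>Poly. \<forall>x\<in>carrier G. f x = w \<bullet> Adj (inv (v x)) X" using u v by (auto simp: polymap_def)
  have 1: "\<exists>f\<in>Poly. \<forall>x\<in>carrier G. f x = w \<bullet> Adj (u x \<otimes> v x) X" if "X \<in> E" for w X
    by (rule Adj_mult_poly[OF c(1) p(1) c(2) p(2) that])
  have 2: "\<exists>f\<in>Poly. \<forall>x\<in>carrier G. f x = w \<bullet> Adj (inv (v x) \<otimes> inv (u x)) X" if "X \<in> E" for w X
    by (rule Adj_mult_poly[OF c(4) p(4) c(3) p(3) that])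
  have 3: "inv (u x \<otimes> v x) = inv (v x) \<otimes> inv (u x)" if "x \<in> carrier G" for x
    using c that by (simp add: inv_mult_group)
  show ?thesis unfolding polymap_def
  proof (intro conjI ballI allI)
    fix w X assume X: "X \<in> E"
    show "\<exists>f\<in>Poly. \<forall>x\<in>carrier G. f x = w \<bullet> Adj (u x \<otimes> v x) X" by (rule 1[OF X])
    show "\<exists>f\<in>Poly. \<forall>x\<in>carrier G. f x = w \<bullet> Adj (inv (u x \<otimes> v x)) X" using 2[OF X, of w] 3 by simp
  qed (use c in auto)
qed

lemma Poly_polymap:
  assumes u: "polymap u" and f: "f \<in> Poly"
  shows "\<exists>f'\<in>Poly. \<forall>x\<in>carrier G. f' x = f (u x)" using f
proof induction
  case (const c)
  thus ?case by (intro bexI[of _ "\<lambda>_. c"]) (auto intro: Poly.const)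
next
  case (add f h)
  then obtain f' h' where f': "f' \<in> Poly" "\<forall>x\<in>carrier G. f' x = f (u x)" and h': "h' \<in> Poly" "\<forall>x\<in>carrier G. h' x = h (u x)" by blast
  show ?case by (rule bexI[OF _ Poly.add[OF f'(1) h'(1)]]) (use f' h' in simp)
next
  case (mult f h)
  then obtain f' h' where f': "f' \<in> Poly" "\<forall>x\<in>carrier G. f' x = f (u x)" and h': "h' \<in> Poly" "\<forall>x\<in>carrier G. h' x = h (u x)" by blast
  show ?case by (rule bexI[OF _ Poly.mult[OF f'(1) h'(1)]]) (use f' h' in simp)
qed (use u in \<open>auto simp: polymap_def\<close>)

definition dense_in :: "'g set \<Rightarrow> 'g set \<Rightarrow> bool" where
  "dense_in P Q \<longleftrightarrow> (\<forall>f\<in>Poly. (\<forall>x\<in>P. f x = 0) \<longrightarrow> (\<forall>x\<in>Q. f x = 0))"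

lemma dense_inD: "dense_in P Q \<Longrightarrow> f \<in> Poly \<Longrightarrow> (\<And>x. x \<in> P \<Longrightarrow> f x = 0) \<Longrightarrow> x \<in> Q \<Longrightarrow> f x = 0"
  by (auto simp: dense_in_def)

lemma dense_polymap:
  assumes d: "dense_in P Q" and PQ: "P \<subseteq> carrier G" "Q \<subseteq> carrier G" and u: "polymap u" and f: "f \<in> Poly"
    and z: "\<And>x. x \<in> P \<Longrightarrow> f (u x) = 0" and x: "x \<in> Q"
  shows "f (u x) = 0"
proof -
  obtain f' where f': "f' \<in> Poly" "\<forall>x\<in>carrier G. f' x = f (u x)" using Poly_polymap[OF u f] by blast
  have "f' x = 0" by (rule dense_inD[OF d f'(1) _ x]) (use f'(2) z PQ in auto)
  thus ?thesis using f'(2) PQ x by auto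
qed

lemma derived_subgroup: "H \<subseteq> carrier G \<Longrightarrow> subgroup (derived G H) G"
  unfolding derived_def by (rule generate_is_subgroup) auto

lemma commutator_derived: "a \<in> H \<Longrightarrow> b \<in> H \<Longrightarrow> a \<otimes> b \<otimes> inv a \<otimes> inv b \<in> derived G H"
  unfolding derived_def by (rule generate.incl) blast

text \<open>The arguments are varied one at a time. For \<open>q \<in> P\<close> the map
  \<open>x \<mapsto> [x, q]\<close> is polynomial and sends \<open>P\<close> into \<open>D\<close>,
  hence \<open>Q\<close> into the Zariski closure \<open>Z\<close> of \<open>D\<close>; then
  \<open>y \<mapsto> [x, y]\<close> for fixed \<open>x \<in> Q\<close> sends \<open>P\<close>, and
  so \<open>Q\<close>, into \<open>Z\<close>. The same device shows that \<open>Z\<close> is a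
  subgroup.\<close>

lemma dense_derived:
  assumes P: "subgroup P G" and Q: "subgroup Q G" and d: "dense_in P Q"
  shows "dense_in (derived G P) (derived G Q)"
proof -
  have PG: "P \<subseteq> carrier G" and QG: "Q \<subseteq> carrier G" using subgroup.subset P Q by blast+
  define D where "D = derived G P"
  have D: "subgroup D G" unfolding D_def by (rule derived_subgroup[OF PG])
  have DG: "D \<subseteq> carrier G" using subgroup.subset[OF D] .
  define Z where "Z = {x \<in> carrier G. \<forall>f\<in>Poly. (\<forall>y\<in>D. f y = 0) \<longrightarrow> f x = 0}"
  have dZ: "dense_in D Z" by (auto simp: dense_in_def Z_def)
  have ZG: "Z \<subseteq> carrier G" by (auto simp: Z_def)
  have ZI: "x \<in> Z" if "x \<in> carrier G" "\<And>f. f \<in> Poly \<Longrightarrow> (\<And>y. y \<in> D \<Longrightarrow> f y = 0) \<Longrightarrow> f x = 0" for x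
    using that by (auto simp: Z_def)
  have comm: "x \<otimes> y \<otimes> inv x \<otimes> inv y \<in> Z" if x: "x \<in> Q" and y: "y \<in> Q" for x y
  proof (rule ZI)
    have xG: "x \<in> carrier G" and "y \<in> carrier G" using x y QG by auto
    thus "x \<otimes> y \<otimes> inv x \<otimes> inv y \<in> carrier G" by simp
    fix f assume f: "f \<in> Poly" "\<And>y. y \<in> D \<Longrightarrow> f y = 0"
    have 1: "f (x \<otimes> q \<otimes> inv x \<otimes> inv q) = 0" if x: "x \<in> Q" and q: "q \<in> P" for x q
    proof (rule dense_polymap[OF d PG QG _ f(1) _ x, of "\<lambda>x. x \<otimes> q \<otimes> inv x \<otimes> inv q"])
      show "polymap (\<lambda>x. x \<otimes> q \<otimes> inv x \<otimes> inv q)"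
        by (intro polymap_mult polymap_inv polymap_id polymap_const) (use q PG in auto)
      show "f (p \<otimes> q \<otimes> inv p \<otimes> inv q) = 0" if "p \<in> P" for p
        by (rule f(2)) (use commutator_derived[OF that q] D_def in simp)
    qed
    show "f (x \<otimes> y \<otimes> inv x \<otimes> inv y) = 0"
    proof (rule dense_polymap[OF d PG QG _ f(1) _ y, of "\<lambda>y. x \<otimes> y \<otimes> inv x \<otimes> inv y"])
      show "polymap (\<lambda>y. x \<otimes> y \<otimes> inv x \<otimes> inv y)"
        by (intro polymap_mult polymap_inv polymap_id polymap_const) (use xG in auto)
    qed (rule 1[OF x])
  qed
  have one: "\<one> \<in> Z" by (rule ZI) (use subgroup.one_closed[OF D] in auto)
  have inv: "inv x \<in> Z" if x: "x \<in> Z" for x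
  proof (rule ZI)
    show "inv x \<in> carrier G" using x ZG by auto
    fix f assume f: "f \<in> Poly" "\<And>y. y \<in> D \<Longrightarrow> f y = 0"
    show "f (inv x) = 0" by (rule dense_polymap[OF dZ DG ZG polymap_inv[OF polymap_id] f(1) _ x])
        (use f(2) subgroup.m_inv_closed[OF D] in auto)
  qed
  have mult: "x \<otimes> y \<in> Z" if x: "x \<in> Z" and y: "y \<in> Z" for x y
  proof (rule ZI)
    have xG: "x \<in> carrier G" using x ZG by auto
    thus "x \<otimes> y \<in> carrier G" using y ZG by auto
    fix f assume f: "f \<in> Poly" "\<And>y. y \<in> D \<Longrightarrow> f y = 0"
    have 1: "f (x \<otimes> c) = 0" if c: "c \<in> D" for c
    proof (rule dense_polymap[OF dZ DG ZG _ f(1) _ x, of "\<lambda>x. x \<otimes> c"])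
      show "polymap (\<lambda>x. x \<otimes> c)" by (intro polymap_mult polymap_id polymap_const) (use c DG in auto)
      show "f (d \<otimes> c) = 0" if "d \<in> D" for d by (rule f(2)[OF subgroup.m_closed[OF D that c]])
    qed
    show "f (x \<otimes> y) = 0"
    proof (rule dense_polymap[OF dZ DG ZG _ f(1) _ y, of "\<lambda>y. x \<otimes> y"])
      show "polymap (\<lambda>y. x \<otimes> y)" by (intro polymap_mult polymap_id polymap_const xG)
    qed (rule 1)
  qed
  have "derived G Q \<subseteq> Z" unfolding derived_def
  proof
    fix x assume "x \<in> generate G (\<Union>h1\<in>Q. \<Union>h2\<in>Q. {h1 \<otimes> h2 \<otimes> inv h1 \<otimes> inv h2})"
    thus "x \<in> Z" by (induction rule: generate.induct) (use one comm inv mult in auto)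
  qed
  thus ?thesis using dZ by (auto simp: dense_in_def D_def)
qed

lemma Poly0_sum: "(\<And>i. i \<in> I \<Longrightarrow> f i \<in> Poly0) \<Longrightarrow> (\<lambda>g. \<Sum>i\<in>I. f i g) \<in> Poly0"
  by (induction I rule: infinite_finite_induct) (simp_all add: Poly0.const Poly0.add)

lemma Poly0_prod: "(\<And>i. i \<in> I \<Longrightarrow> f i \<in> Poly0) \<Longrightarrow> (\<lambda>g. \<Prod>i\<in>I. f i g) \<in> Poly0"
  by (induction I rule: infinite_finite_induct) (simp_all add: Poly0.const Poly0.mult)

lemma Poly0_pow: "f \<in> Poly0 \<Longrightarrow> (\<lambda>g. f g ^ n) \<in> Poly0"
  by (induction n) (simp_all add: Poly0.const Poly0.mult)

lemma Poly0_cmult: "f \<in> Poly0 \<Longrightarrow> (\<lambda>g. c * f g) \<in> Poly0"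
  by (intro Poly0.mult Poly0.const)

lemma Poly0_det:
  assumes "\<And>i j. i < n \<Longrightarrow> j < n \<Longrightarrow> (\<lambda>g. a g i j) \<in> Poly0"
  shows "(\<lambda>g. Determinant.det (Matrix.mat n n (\<lambda>(i, j). a g i j))) \<in> Poly0"
proof -
  have *: "Determinant.det (Matrix.mat n n (\<lambda>(i, j). a g i j)) =
      (\<Sum>p\<in>{p. p permutes {0..<n}}. signof p * (\<Prod>i=0..<n. a g i (p i)))" for g
  proof -
    have "Determinant.det (Matrix.mat n n (\<lambda>(i, j). a g i j)) =
      (\<Sum>p\<in>{p. p permutes {0..<n}}. signof p * (\<Prod>i=0..<n. Matrix.mat n n (\<lambda>(i, j). a g i j) $$ (i, p i)))"
      by (rule det_def') simp
    also have "\<dots> = (\<Sum>p\<in>{p. p permutes {0..<n}}. signof p * (\<Prod>i=0..<n. a g i (p i)))"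
    proof (intro sum.cong refl arg_cong2[of _ _ _ _ "(*)"] prod.cong)
      fix p i assume "p \<in> {p. p permutes {0..<n}}" "i \<in> {0..<n}"
      hence "i < n" "p i < n" using permutes_in_image[of p "{0..<n}" i] by auto
      thus "Matrix.mat n n (\<lambda>(i, j). a g i j) $$ (i, p i) = a g i (p i)" by simp
    qed
    finally show ?thesis .
  qed
  show ?thesis unfolding *
  proof (intro Poly0_sum Poly0_cmult Poly0_prod)
    fix p i assume "p \<in> {p. p permutes {0..<n}}" "i \<in> {0..<n}"
    hence "i < n" "p i < n" using permutes_in_image[of p "{0..<n}" i] by auto
    thus "(\<lambda>g. a g i (p i)) \<in> Poly0" by (rule assms)
  qed
qed

text \<open>Coefficients of \<open>Ad (g\<inverse>)\<close> become polynomial after multiplication by \<open>det (Ad g)\<close> (Cramer).\<close>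

lemma Adj_inv_poly:
  "\<exists>d\<in>Poly0. (\<forall>g\<in>carrier G. d g \<noteq> 0) \<and>
     (\<forall>w. \<forall>X\<in>E. \<exists>q\<in>Poly0. \<forall>g\<in>carrier G. q g = d g * (w \<bullet> Adj (inv g) X))"
proof -
  obtain es where es: "set es = onb E" "distinct es" using finite_distinct_list[OF onb(6)[OF subspace_E]] by blast
  define n where "n = length es"
  define e where "e i = es ! i" for i
  have eE: "e i \<in> onb E" "e i \<in> E" if "i < n" for i
    using that es onb(1)[OF subspace_E] nth_mem[of i es] unfolding e_def n_def by auto
  have sum_e: "(\<Sum>b\<in>onb E. f b) = (\<Sum>k = 0..<n. f (e k))" for f :: "'e \<Rightarrow> real"
  proof -
    have "bij_betw (\<lambda>i. es ! i) {0..<n} (onb E)"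
      using bij_betw_nth[OF es(2), of "{0..<n}"] es(1) by (auto simp: n_def atLeast0LessThan)
    from sum.reindex_bij_betw[OF this, of f] show ?thesis by (simp add: e_def)
  qed
  define M where "M g = Matrix.mat n n (\<lambda>(i, j). e i \<bullet> Adj g (e j))" for g
  have M: "M g \<in> carrier_mat n n" for g by (simp add: M_def)
  have M_mult: "M (g \<otimes> h) = M g * M h" if g: "g \<in> carrier G" and h: "h \<in> carrier G" for g h
  proof (rule eq_matI)
    fix i j assume "i < dim_row (M g * M h)" "j < dim_col (M g * M h)"
    hence ij: "i < n" "j < n" by (auto simp: M_def)
    have "(M g * M h) $$ (i, j) = (\<Sum>k = 0..<n. (e i \<bullet> Adj g (e k)) * (e k \<bullet> Adj h (e j)))"
      using ij by (simp add: M_def scalar_prod_def)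
    also have "\<dots> = e i \<bullet> Adj g (Adj h (e j))"
      unfolding Adj_expand[OF g Adj(1)[OF h eE(2)[OF ij(2)]]] sum_e by (simp add: mult.commute)
    finally show "M (g \<otimes> h) $$ (i, j) = (M g * M h) $$ (i, j)"
      using ij Adj_mult[OF g h eE(2)[OF ij(2)]] by (simp add: M_def)
  qed (simp_all add: M_def)
  have M_one: "M \<one> = 1\<^sub>m n"
  proof (rule eq_matI)
    fix i j assume "i < dim_row (1\<^sub>m n :: real mat)" "j < dim_col (1\<^sub>m n :: real mat)"
    hence ij: "i < n" "j < n" by auto
    have "e i \<bullet> e j = (if i = j then 1 else 0)"
    proof (cases "i = j")
      case True
      thus ?thesis using onb(3)[OF subspace_E eE(1)[OF ij(1)]] by (simp add: norm_eq_1)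
    next
      case False
      hence "e i \<noteq> e j" using es(2) ij by (simp add: e_def n_def nth_eq_iff_index_eq)
      thus ?thesis using onb(2)[OF subspace_E] eE(1)[OF ij(1)] eE(1)[OF ij(2)] False
        by (auto simp: pairwise_def Linear_Algebra.orthogonal_def)
    qed
    thus "M \<one> $$ (i, j) = 1\<^sub>m n $$ (i, j)" using ij eE by (simp add: M_def Adj_one)
  qed (simp_all add: M_def)
  have M_inv: "M g * M (inv g) = 1\<^sub>m n" if "g \<in> carrier G" for g
    using M_mult[OF that inv_closed[OF that]] M_one that by simp
  define d where "d g = Determinant.det (M g)" for g
  have coefP: "(\<lambda>g. e i \<bullet> Adj g (e j)) \<in> Poly0" if "j < n" for i j by (rule Poly0.coef) (rule eE(2)[OF that])
  have dP: "d \<in> Poly0" unfolding d_def[abs_def] M_def by (rule Poly0_det) (rule coefP)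
  have d0: "d g \<noteq> 0" if "g \<in> carrier G" for g
  proof -
    have "d g * Determinant.det (M (inv g)) = 1"
      using det_mult[OF M M, of g "inv g"] M_inv[OF that] by (simp add: d_def)
    thus ?thesis by auto
  qed
  have adj: "adj_mat (M g) $$ (i, j) = d g * (e i \<bullet> Adj (inv g) (e j))"
    if g: "g \<in> carrier G" and ij: "i < n" "j < n" for g i j
  proof -
    have "adj_mat (M g) = adj_mat (M g) * (M g * M (inv g))" using adj_mat(1)[OF M, of g] M_inv[OF g] by simp
    also have "\<dots> = (adj_mat (M g) * M g) * M (inv g)"
      using adj_mat(1)[OF M, of g] M by (simp add: assoc_mult_mat[of _ n n _ n _ n])
    also have "\<dots> = (d g \<cdot>\<^sub>m 1\<^sub>m n) * M (inv g)" using adj_mat(3)[OF M, of g] by (simp add: d_def)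
    also have "\<dots> = d g \<cdot>\<^sub>m M (inv g)"
      by (subst mult_smult_assoc_mat[OF one_carrier_mat M]) (simp add: left_mult_one_mat[OF M])
    finally show ?thesis using ij by (simp add: M_def)
  qed
  have adjP: "(\<lambda>g. adj_mat (M g) $$ (i, j)) \<in> Poly0" if ij: "i < n" "j < n" for i j
  proof -
    let ?N = "\<lambda>g. Matrix.mat (n - 1) (n - 1)
        (\<lambda>(i', j'). e (if i' < j then i' else Suc i') \<bullet> Adj g (e (if j' < i then j' else Suc j')))"
    have "adj_mat (M g) $$ (i, j) = (-1) ^ (j + i) * Determinant.det (?N g)" for g
    proof -
      have "mat_delete (M g) j i = ?N g" unfolding mat_delete_def using ij by (intro eq_matI) (auto simp: M_def)
      thus ?thesis using ij by (simp add: adj_mat_def cofactor_def M_def)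
    qed
    moreover have "(\<lambda>g. (-1) ^ (j + i) * Determinant.det (?N g)) \<in> Poly0"
      by (intro Poly0_cmult Poly0_det coefP) auto
    ultimately show ?thesis by simp
  qed
  have "\<exists>q\<in>Poly0. \<forall>g\<in>carrier G. q g = d g * (w \<bullet> Adj (inv g) X)" if X: "X \<in> E" for w X
  proof -
    let ?q = "\<lambda>g. \<Sum>j=0..<n. (e j \<bullet> X) * (\<Sum>i=0..<n. (e i \<bullet> w) * adj_mat (M g) $$ (i, j))"
    show ?thesis
    proof (intro bexI[of _ ?q] ballI)
      show "?q \<in> Poly0" by (intro Poly0_sum Poly0_cmult adjP) auto
      fix g assume g: "g \<in> carrier G"
      have wA: "w \<bullet> Adj (inv g) Y = (\<Sum>i=0..<n. (e i \<bullet> w) * (e i \<bullet> Adj (inv g) Y))" if Y: "Y \<in> E" for Y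
      proof -
        have "Adj (inv g) Y \<in> E" using Adj(1) g Y by simp
        hence "w \<bullet> Adj (inv g) Y = w \<bullet> (\<Sum>b\<in>onb E. (Adj (inv g) Y \<bullet> b) *\<^sub>R b)"
          using oproj_id[OF subspace_E] by (simp add: oproj_def[symmetric])
        also have "\<dots> = (\<Sum>b\<in>onb E. (b \<bullet> w) * (b \<bullet> Adj (inv g) Y))"
          by (simp add: inner_sum_right inner_commute mult.commute)
        finally show ?thesis unfolding sum_e .
      qed
      have "d g * (w \<bullet> Adj (inv g) X) = (\<Sum>j=0..<n. (e j \<bullet> X) * (d g * (w \<bullet> Adj (inv g) (e j))))"
        unfolding Adj_expand[OF inv_closed[OF g] X] sum_e by (simp add: sum_distrib_left mult_ac)
      also have "\<dots> = ?q g"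
      proof (intro sum.cong refl arg_cong2[of _ _ _ _ "(*)"])
        fix j assume "j \<in> {0..<n}"
        hence j: "j < n" by simp
        have "d g * (w \<bullet> Adj (inv g) (e j)) = (\<Sum>i=0..<n. (e i \<bullet> w) * (d g * (e i \<bullet> Adj (inv g) (e j))))"
          unfolding wA[OF eE(2)[OF j]] by (simp add: sum_distrib_left mult_ac)
        thus "d g * (w \<bullet> Adj (inv g) (e j)) = (\<Sum>i=0..<n. (e i \<bullet> w) * adj_mat (M g) $$ (i, j))"
          using adj[OF g _ j] by simp
      qed
      finally show "?q g = d g * (w \<bullet> Adj (inv g) X)" by simp
    qed
  qed
  thus ?thesis using dP d0 by blast
qed

text \<open>Every function of \<open>Poly\<close> becomes one of \<open>Poly0\<close>, on
  \<open>G\<close>, after multiplication by a power of the determinant \<open>d\<close>, which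
  vanishes nowhere on \<open>G\<close>. The two functions therefore have the same zeros.\<close>

lemma dense_in_Poly0:
  assumes d0: "\<And>f. f \<in> Poly0 \<Longrightarrow> (\<And>x. x \<in> P \<Longrightarrow> f x = 0) \<Longrightarrow> (\<And>x. x \<in> Q \<Longrightarrow> f x = 0)"
    and P: "P \<subseteq> carrier G" and Q: "Q \<subseteq> carrier G"
  shows "dense_in P Q"
proof -
  obtain d where d: "d \<in> Poly0" "\<forall>g\<in>carrier G. d g \<noteq> 0"
     "\<forall>w. \<forall>X\<in>E. \<exists>q\<in>Poly0. \<forall>g\<in>carrier G. q g = d g * (w \<bullet> Adj (inv g) X)" using Adj_inv_poly by blast
  have *: "\<exists>m. \<exists>q\<in>Poly0. \<forall>g\<in>carrier G. q g = d g ^ m * f g" if "f \<in> Poly" for f using that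
  proof induction
    case (const c)
    show ?case by (intro exI[of _ 0] bexI[of _ "\<lambda>_. c"]) (auto intro: Poly0.const)
  next
    case (coef X w)
    show ?case by (intro exI[of _ 0] bexI[of _ "\<lambda>g. w \<bullet> Adj g X"]) (auto intro: Poly0.coef coef)
  next
    case (icoef X w)
    thus ?case using d(3) by (intro exI[of _ 1]) auto
  next
    case (add f h)
    then obtain m k qf qh where q: "qf \<in> Poly0" "\<forall>g\<in>carrier G. qf g = d g ^ m * f g" "qh \<in> Poly0" "\<forall>g\<in>carrier G. qh g = d g ^ k * h g"
      by blast
    show ?case
      by (intro exI[of _ "m + k"] bexI[of _ "\<lambda>g. d g ^ k * qf g + d g ^ m * qh g"] Poly0.add Poly0.mult Poly0_pow d q)
        (use q in \<open>simp add: power_add algebra_simps\<close>)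
  next
    case (mult f h)
    then obtain m k qf qh where q: "qf \<in> Poly0" "\<forall>g\<in>carrier G. qf g = d g ^ m * f g" "qh \<in> Poly0" "\<forall>g\<in>carrier G. qh g = d g ^ k * h g"
      by blast
    show ?case by (intro exI[of _ "m + k"] bexI[of _ "\<lambda>g. qf g * qh g"] Poly0.mult q)
        (use q in \<open>simp add: power_add mult_ac\<close>)
  qed
  show ?thesis unfolding dense_in_def
  proof (intro ballI impI)
    fix f x assume f: "f \<in> Poly" "\<forall>x\<in>P. f x = 0" and x: "x \<in> Q"
    obtain m q where q: "q \<in> Poly0" "\<forall>g\<in>carrier G. q g = d g ^ m * f g" using *[OF f(1)] by blast
    have "q x = 0" by (rule d0[OF q(1) _ x]) (use q(2) f(2) P in auto)
    hence "d x ^ m * f x = 0" using q(2) x Q by auto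
    thus "f x = 0" using d(2) x Q by auto
  qed
qed

section \<open>Conjugation, commutators and closures\<close>

lemma expgen_conj:
  assumes g: "g \<in> carrier G" and A: "subgroup A G" and inv: "\<And>X. X \<in> Lie A \<Longrightarrow> Adj g X \<in> Lie A"
    and x: "x \<in> expgen (Lie A)"
  shows "g \<otimes> x \<otimes> inv g \<in> expgen (Lie A)"
proof -
  have S: "subgroup (expgen (Lie A)) G" by (intro subgroup_expgen subsetI LieD(1))
  show ?thesis using x
  proof (induction rule: expgen_Lie_induct)
    case subgroup
    show ?case by (rule A)
  next
    case (Exp X)
    thus ?case using Exp_Adj[OF g LieD(1)] Exp_expgen[OF inv] by simp
  next
    case (mult h1 h2)
    thus ?case using subgroup.mem_carrier[OF S] conj_mult[OF g] subgroup.m_closed[OF S] by simp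
  qed
qed

lemma continuous_map_conj:
  assumes g: "g \<in> carrier G"
  shows "continuous_map T T (\<lambda>x. g \<otimes> x \<otimes> inv g)"
proof -
  have c: "continuous_map T T (\<lambda>_. a)" if "a \<in> carrier G" for a using that by simp
  have m: "continuous_map T T (\<lambda>x. u x \<otimes> v x)" if "continuous_map T T u" "continuous_map T T v" for u v
    using continuous_map_compose[OF continuous_map_pairedI[OF that] mult_cont] by (simp add: o_def)
  have "continuous_map T T (\<lambda>x. x)" using continuous_map_id[of T] by (simp add: id_def)
  thus ?thesis by (intro m c g inv_closed)
qed

lemma closure_conj:
  assumes g: "g \<in> carrier G" and B: "\<And>x. x \<in> B \<Longrightarrow> g \<otimes> x \<otimes> inv g \<in> B" and x: "x \<in> T closure_of B"
  shows "g \<otimes> x \<otimes> inv g \<in> T closure_of B"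
proof -
  have "(\<lambda>x. g \<otimes> x \<otimes> inv g) ` (T closure_of B) \<subseteq> T closure_of ((\<lambda>x. g \<otimes> x \<otimes> inv g) ` B)"
    by (rule continuous_map_image_closure_subset[OF continuous_map_conj[OF g]])
  also have "\<dots> \<subseteq> T closure_of B" by (rule closure_of_mono) (use B in auto)
  finally show ?thesis using x by blast
qed

lemma closure_commutator:
  assumes B: "\<And>x y. x \<in> B \<Longrightarrow> y \<in> B \<Longrightarrow> x \<otimes> y \<otimes> inv x \<otimes> inv y \<in> D"
    and x: "x \<in> T closure_of B" "y \<in> T closure_of B"
  shows "x \<otimes> y \<otimes> inv x \<otimes> inv y \<in> T closure_of D"
proof -
  let ?P = "prod_topology T T"
  let ?c = "\<lambda>p. fst p \<otimes> snd p \<otimes> inv (fst p) \<otimes> inv (snd p)"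
  have m: "continuous_map ?P T (\<lambda>x. u x \<otimes> v x)" if "continuous_map ?P T u" "continuous_map ?P T v" for u v
    using continuous_map_compose[OF continuous_map_pairedI[OF that] mult_cont] by (simp add: o_def)
  have i: "continuous_map ?P T (\<lambda>x. inv (u x))" if "continuous_map ?P T u" for u
    using continuous_map_compose[OF that inv_cont] by (simp add: o_def)
  have "continuous_map ?P T ?c" by (intro m i continuous_map_fst continuous_map_snd)
  hence "?c ` (?P closure_of (B \<times> B)) \<subseteq> T closure_of (?c ` (B \<times> B))" by (rule continuous_map_image_closure_subset)
  also have "\<dots> \<subseteq> T closure_of D" by (rule closure_of_mono) (use B in auto)
  finally have *: "?c ` (?P closure_of (B \<times> B)) \<subseteq> T closure_of D" .
  have "(x, y) \<in> ?P closure_of (B \<times> B)" using x by (simp add: closure_of_Times)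
  thus ?thesis using * by force
qed

text \<open>Integrates the infinitesimal condition on \<open>Adj g X - X\<close>: the case
  \<open>h = Exp X\<close> is \<open>Exp_perturb_in\<close>, and products are handled by
  \<open>[g, h1 h2] = [g, h1] (h1 [g, h2] h1^-1)\<close>.\<close>

lemma commutator_in:
  assumes B: "subgroup B G" "closedin T B" and H: "subgroup H G" and gen: "expgen (Lie H) = H"
    and conj: "\<And>h b. h \<in> H \<Longrightarrow> b \<in> B \<Longrightarrow> h \<otimes> b \<otimes> inv h \<in> B"
    and g: "g \<in> H" and Adj: "\<And>X. X \<in> Lie H \<Longrightarrow> Adj g X - X \<in> Lie B" and h: "h \<in> H"
  shows "g \<otimes> h \<otimes> inv g \<otimes> inv h \<in> B"
proof -
  have HG: "x \<in> carrier G" if "x \<in> H" for x using subgroup.mem_carrier[OF H that] .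
  have base: "g \<otimes> Exp X \<otimes> inv g \<otimes> inv (Exp X) \<in> B" if X: "X \<in> Lie H" for X
  proof -
    have "Exp (X + (Adj g X - X)) \<otimes> Exp (- X) \<in> B" by (rule Exp_perturb_in[OF B H X Adj[OF X] conj])
    thus ?thesis using Exp_Adj[OF HG[OF g] LieD(1)[OF X]] Exp_minus[OF LieD(1)[OF X]] by simp
  qed
  have "h \<in> expgen (Lie H)" using h gen by simp
  thus ?thesis
  proof (induction h rule: expgen_Lie_induct)
    case subgroup
    show ?case by (rule H)
  next
    case (Exp X)
    thus ?case by (rule base)
  next
    case (mult h1 h2)
    note h = mult.hyps[unfolded gen]
    have "g \<otimes> (h1 \<otimes> h2) \<otimes> inv g \<otimes> inv (h1 \<otimes> h2)
        = (g \<otimes> h1 \<otimes> inv g \<otimes> inv h1) \<otimes> (h1 \<otimes> (g \<otimes> h2 \<otimes> inv g \<otimes> inv h2) \<otimes> inv h1)"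
      using HG[OF g] HG[OF h(1)] HG[OF h(2)] by (simp add: m_assoc inv_mult_group)
    thus ?case using subgroup.m_closed[OF B(1) mult.IH(1) conj[OF h(1) mult.IH(2)]] by simp
  qed
qed

text \<open>The closure \<open>B\<close> of \<open>expgen (Lie A)\<close> is normalised by
  \<open>H\<close>, and its Lie algebra contains \<open>Lie A\<close>, hence all
  \<open>Adj g X - X\<close>; so \<open>commutator_in\<close> applies to \<open>B\<close>. The point
  is that commutators can be reached from exponentials within \<open>A\<close>, which makes the
  closed derived groups connected.\<close>

lemma commutator_in_expgen_closure:
  assumes A: "subgroup A G" "closedin T A" and H: "subgroup H G" and gen: "expgen (Lie H) = H"
    and conj: "\<And>h b. h \<in> H \<Longrightarrow> b \<in> A \<Longrightarrow> h \<otimes> b \<otimes> inv h \<in> A"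
    and comm: "\<And>g h. g \<in> H \<Longrightarrow> h \<in> H \<Longrightarrow> g \<otimes> h \<otimes> inv g \<otimes> inv h \<in> A"
    and g: "g \<in> H" and h: "h \<in> H"
  shows "g \<otimes> h \<otimes> inv g \<otimes> inv h \<in> T closure_of (expgen (Lie A))"
proof -
  define B where "B = T closure_of (expgen (Lie A))"
  have LE: "Lie A \<subseteq> E" by (rule subsetI) (rule LieD(1))
  have B: "subgroup B G" "closedin T B"
    unfolding B_def by (rule closure_subgroup[OF subgroup_expgen[OF LE]], rule closedin_closure)
  have HG: "x \<in> carrier G" if "x \<in> H" for x using subgroup.mem_carrier[OF H that] .
  have conjB: "h \<otimes> b \<otimes> inv h \<in> B" if h: "h \<in> H" and b: "b \<in> B" for h b
  proof -
    have V: "Adj h X \<in> Lie A" if "X \<in> Lie A" for X by (rule Adj_Lie[OF HG[OF h] conj[OF h] that])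
    have "h \<otimes> x \<otimes> inv h \<in> expgen (Lie A)" if "x \<in> expgen (Lie A)" for x
      by (rule expgen_conj[OF HG[OF h] A(1) V that])
    from closure_conj[OF HG[OF h] this] b show ?thesis unfolding B_def by blast
  qed
  have LB: "Z \<in> Lie B" if Z: "Z \<in> Lie A" for Z
  proof -
    have "expgen (Lie A) \<subseteq> B" unfolding B_def using subgroup.subset[OF subgroup_expgen[OF LE]] by (intro closure_of_subset) simp
    thus ?thesis using Exp_expgen[OF Lie_scale[OF Z]] LieD(1)[OF Z] unfolding Lie_def[of B] by blast
  qed
  have "g \<otimes> h \<otimes> inv g \<otimes> inv h \<in> B"
    by (rule commutator_in[OF B H gen conjB g LB[OF commutator_diff_Lie[OF A H g _ comm[OF g]]] h])
  thus ?thesis by (simp add: B_def)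
qed

lemma path_expgen:
  assumes V: "subspace V" "V \<subseteq> E" and x: "x \<in> expgen V"
  shows "\<exists>c. continuous_map (top_of_set {0..1::real}) T c \<and> c 0 = \<one> \<and> c 1 = x \<and> (\<forall>t\<in>{0..1}. c t \<in> expgen V)"
proof -
  let ?I = "top_of_set {0..1::real}" and ?H = "expgen V"
  note H = subgroup_expgen[OF V(2)]
  define P where "P = {x \<in> carrier G. \<exists>c. continuous_map ?I T c \<and> c 0 = \<one> \<and> c 1 = x \<and> (\<forall>t\<in>{0..1}. c t \<in> ?H)}"
  have PI: "c 1 \<in> P" if "continuous_map ?I T c" "c 0 = \<one>" "\<And>t. t \<in> {0..1} \<Longrightarrow> c t \<in> ?H" for c
    using that subgroup.mem_carrier[OF H that(3)[of 1]] unfolding P_def by auto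
  have PE: "\<exists>c. continuous_map ?I T c \<and> c 0 = \<one> \<and> c 1 = x \<and> (\<forall>t\<in>{0..1}. c t \<in> ?H)" if "x \<in> P" for x
    using that by (simp add: P_def)
  have "subgroup P G"
  proof (rule subgroupI)
    show "P \<subseteq> carrier G" by (auto simp: P_def)
    have "\<one> \<in> P" using PI[of "\<lambda>t. \<one>"] subgroup.one_closed[OF H] by simp
    thus "P \<noteq> {}" by blast
  next
    fix x assume "x \<in> P"
    then obtain c where c: "continuous_map ?I T c" "c 0 = \<one>" "c 1 = x" "\<forall>t\<in>{0..1}. c t \<in> ?H" using PE by blast
    have i: "continuous_map ?I T (\<lambda>t. inv (c t))" using continuous_map_compose[OF c(1) inv_cont] by (simp add: o_def)
    show "inv x \<in> P" using PI[OF i] c subgroup.m_inv_closed[OF H] by simp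
    fix y assume "y \<in> P"
    then obtain d where d: "continuous_map ?I T d" "d 0 = \<one>" "d 1 = y" "\<forall>t\<in>{0..1}. d t \<in> ?H" using PE by blast
    have m: "continuous_map ?I T (\<lambda>t. c t \<otimes> d t)"
      using continuous_map_compose[OF continuous_map_pairedI[OF c(1) d(1)] mult_cont] by (simp add: o_def)
    show "x \<otimes> y \<in> P" using PI[OF m] c d subgroup.m_closed[OF H] by simp
  qed
  moreover have "Exp ` V \<subseteq> P"
  proof
    fix x assume "x \<in> Exp ` V"
    then obtain X where X: "X \<in> V" "x = Exp X" by blast
    have XV: "t *\<^sub>R X \<in> V" for t by (rule subspace_scale[OF V(1) X(1)])
    have "continuous_map ?I T (\<lambda>t. Exp (t *\<^sub>R X))"
      by (rule continuous_map_Exp) (use XV V(2) in \<open>auto intro!: continuous_intros\<close>)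
    from PI[OF this] show "x \<in> P" using X(2) Exp_expgen[OF XV] Exp_zero by simp
  qed
  ultimately have "?H \<subseteq> P" by (rule expgen_least)
  thus ?thesis using PE x by blast
qed

lemma subgroup_set_mult:
  assumes P: "subgroup P G" and N: "subgroup N G" and conj: "\<And>p x. p \<in> P \<Longrightarrow> x \<in> N \<Longrightarrow> p \<otimes> x \<otimes> inv p \<in> N"
  shows "subgroup (P <#> N) G"
proof (rule subgroupI)
  have PG: "p \<in> carrier G" if "p \<in> P" for p using subgroup.mem_carrier[OF P that] .
  have NG: "p \<in> carrier G" if "p \<in> N" for p using subgroup.mem_carrier[OF N that] .
  have conj': "inv p \<otimes> x \<otimes> p \<in> N" if "p \<in> P" "x \<in> N" for p x
    using conj[OF subgroup.m_inv_closed[OF P that(1)] that(2)] PG[OF that(1)] by simp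
  show "P <#> N \<subseteq> carrier G" using PG NG by (auto simp: set_mult_def)
  show "P <#> N \<noteq> {}" using subgroup.one_closed[OF P] subgroup.one_closed[OF N] by (auto simp: set_mult_def)
  fix a assume "a \<in> P <#> N"
  then obtain p x where px: "p \<in> P" "x \<in> N" "a = p \<otimes> x" by (auto simp: set_mult_iff)
  have "inv a = inv p \<otimes> (inv (inv p) \<otimes> inv x \<otimes> inv p)"
    using PG[OF px(1)] NG[OF px(2)] px(3) by (simp add: inv_mult_group m_assoc)
  moreover have "inv (inv p) \<otimes> inv x \<otimes> inv p \<in> N"
    by (rule conj'[OF subgroup.m_inv_closed[OF P px(1)] subgroup.m_inv_closed[OF N px(2)]])
  ultimately show "inv a \<in> P <#> N" unfolding set_mult_iff using subgroup.m_inv_closed[OF P px(1)] by blast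
  fix b assume "b \<in> P <#> N"
  then obtain q y where qy: "q \<in> P" "y \<in> N" "b = q \<otimes> y" by (auto simp: set_mult_iff)
  have "a \<otimes> b = (p \<otimes> q) \<otimes> ((inv q \<otimes> x \<otimes> q) \<otimes> y)"
    using PG[OF px(1)] NG[OF px(2)] px(3) PG[OF qy(1)] NG[OF qy(2)] qy(3) by (simp add: m_assoc)
  thus "a \<otimes> b \<in> P <#> N" unfolding set_mult_iff
    using subgroup.m_closed[OF P px(1) qy(1)] subgroup.m_closed[OF N conj'[OF qy(1) px(2)] qy(2)] by blast
qed

lemma set_mult_assoc_subset:
  assumes P: "subgroup P G" and K: "compactin T K" "compactin T L" and A: "A \<subseteq> \<Lambda> <#> L" and L: "\<Lambda> \<subseteq> P <#> K"
  shows "A \<subseteq> P <#> (K <#> L)"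
proof
  fix a assume "a \<in> A"
  hence "a \<in> \<Lambda> <#> L" using A by blast
  then obtain x l where xl: "x \<in> \<Lambda>" "l \<in> L" "a = x \<otimes> l" unfolding set_mult_iff by blast
  hence "x \<in> P <#> K" using L by blast
  then obtain p k where pk: "p \<in> P" "k \<in> K" "x = p \<otimes> k" unfolding set_mult_iff by blast
  have "a = p \<otimes> (k \<otimes> l)"
    using xl pk subgroup.mem_carrier[OF P] compactin_carrier[OF K(1)] compactin_carrier[OF K(2)] by (simp add: m_assoc subset_iff)
  moreover have "k \<otimes> l \<in> K <#> L" unfolding set_mult_iff using pk(2) xl(2) by blast
  ultimately show "a \<in> P <#> (K <#> L)" unfolding set_mult_iff[of a] using pk(1) by blast
qed

end

section \<open>Algebraically dense subgroups of solvable groups\<close>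

text \<open>The hypothesis \<open>dens\<close> is algebraic density written in terms of
  \<open>Adj\<close>; for a Lie group it is derived from \<open>Ad\<close> in
  \<open>Poly0_dense\<close>.\<close>

locale dense_subgroup = local_group +
  fixes \<Gamma> :: "'a set"
  assumes conn: "connected_space T" and solv: "solvable G"
    and \<Gamma>: "subgroup \<Gamma> G" "closedin T \<Gamma>"
    and dens: "\<And>f x. f \<in> Poly0 \<Longrightarrow> (\<And>x. x \<in> \<Gamma> \<Longrightarrow> f x = 0) \<Longrightarrow> x \<in> carrier G \<Longrightarrow> f x = 0"
begin

definition D :: "nat \<Rightarrow> 'a set" where "D i = (derived G ^^ i) (carrier G)"
definition P :: "nat \<Rightarrow> 'a set" where "P i = (derived G ^^ i) \<Gamma>"
text \<open>The derived groups are formed algebraically and may fail to be closed, while Lie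
  algebras and continuous homomorphisms call for closed subgroups.\<close>

definition cl :: "nat \<Rightarrow> 'a set" where "cl i = T closure_of (D i)"

lemma D_subgroup: "subgroup (D i) G" unfolding D_def by (rule exp_of_derived_is_subgroup[OF subgroup_self])
lemma P_subgroup: "subgroup (P i) G" unfolding P_def by (rule exp_of_derived_is_subgroup[OF \<Gamma>(1)])
lemma D_Suc: "D (Suc i) = derived G (D i)" by (simp add: D_def)
lemma P_Suc: "P (Suc i) = derived G (P i)" by (simp add: P_def)
lemma D_carrier: "D i \<subseteq> carrier G" using subgroup.subset[OF D_subgroup] .
lemma P_D: "P i \<subseteq> D i" unfolding P_def D_def by (rule mono_exp_of_derived[OF subgroup.subset[OF \<Gamma>(1)]])

lemma P_Gamma: "P i \<subseteq> \<Gamma>"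
proof (induction i)
  case (Suc i)
  thus ?case unfolding P_Suc by (rule derived_incl[OF _ \<Gamma>(1)])
qed (simp add: P_def)

lemma D_normal: "D i \<lhd> G"
  by (induction i) (simp_all add: D_Suc derived_is_normal, simp add: D_def normal_self)

lemma D_conj: "g \<in> carrier G \<Longrightarrow> x \<in> D i \<Longrightarrow> g \<otimes> x \<otimes> inv g \<in> D i"
  using normal.inv_op_closed2[OF D_normal] .

lemma cl_subgroup: "subgroup (cl i) G" unfolding cl_def by (rule closure_subgroup[OF D_subgroup])
lemma cl_closed: "closedin T (cl i)" unfolding cl_def by (rule closedin_closure)
lemma D_cl: "D i \<subseteq> cl i" unfolding cl_def using D_carrier by (intro closure_of_subset) simp
lemma cl_conj: "g \<in> carrier G \<Longrightarrow> x \<in> cl i \<Longrightarrow> g \<otimes> x \<otimes> inv g \<in> cl i"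
  unfolding cl_def by (rule closure_conj[OF _ D_conj])
lemma cl_carrier: "x \<in> cl i \<Longrightarrow> x \<in> carrier G" using subgroup.mem_carrier[OF cl_subgroup] .

lemma cl_comm: "x \<in> cl i \<Longrightarrow> y \<in> cl i \<Longrightarrow> x \<otimes> y \<otimes> inv x \<otimes> inv y \<in> cl (Suc i)"
  unfolding cl_def by (rule closure_commutator) (simp_all add: D_Suc commutator_derived)

lemma cl_Suc: "cl (Suc i) \<subseteq> cl i"
  unfolding cl_def D_Suc by (intro closure_of_mono derived_incl[OF order_refl D_subgroup])

lemma cl_zero: "cl 0 = carrier G"
  using D_cl[of 0] cl_carrier[of _ 0] by (auto simp: D_def)

lemma Lie_carrier: "Lie (carrier G) = E" by (auto simp: Lie_def)

text \<open>If \<open>cl i\<close> is generated by exponentials,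
  \<open>commutator_in_expgen_closure\<close> places the commutators of \<open>D i\<close> in the
  closure of \<open>expgen (Lie (cl (Suc i)))\<close>. So that subgroup is dense in
  \<open>cl (Suc i)\<close>, and \<open>expgen_Lie_eq\<close> removes the closure.\<close>

lemma cl_gen: "expgen (Lie (cl i)) = cl i"
proof (induction i)
  case 0
  thus ?case unfolding cl_zero Lie_carrier by (rule connected_generated[OF conn])
next
  case (Suc i)
  let ?L = "T closure_of (expgen (Lie (cl (Suc i))))"
  have "D (Suc i) \<subseteq> ?L" unfolding D_Suc derived_def
  proof (rule generate_subgroup_incl)
    have "Lie (cl (Suc i)) \<subseteq> E" by (rule subsetI) (rule LieD(1))
    thus "subgroup ?L G" by (intro closure_subgroup subgroup_expgen)
    show "(\<Union>h1\<in>D i. \<Union>h2\<in>D i. {h1 \<otimes> h2 \<otimes> inv h1 \<otimes> inv h2}) \<subseteq> ?L"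
    proof clarify
      fix x y assume "x \<in> D i" "y \<in> D i"
      hence xy: "x \<in> cl i" "y \<in> cl i" using D_cl by auto
      show "x \<otimes> y \<otimes> inv x \<otimes> inv y \<in> ?L"
      proof (rule commutator_in_expgen_closure[OF cl_subgroup cl_closed cl_subgroup Suc _ _ xy])
        show "h \<otimes> b \<otimes> inv h \<in> cl (Suc i)" if "h \<in> cl i" "b \<in> cl (Suc i)" for h b
          by (rule cl_conj[OF cl_carrier[OF that(1)] that(2)])
        show "g \<otimes> h \<otimes> inv g \<otimes> inv h \<in> cl (Suc i)" if "g \<in> cl i" "h \<in> cl i" for g h by (rule cl_comm[OF that])
      qed
    qed
  qed
  hence "cl (Suc i) \<subseteq> ?L" unfolding cl_def[of "Suc i"] using closure_of_minimal closedin_closure by blast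
  thus ?case by (rule expgen_Lie_eq[OF cl_subgroup cl_closed])
qed

lemma dense_P_D: "dense_in (P i) (D i)"
proof (induction i)
  case 0
  show ?case unfolding P_def D_def funpow_0
  proof (rule dense_in_Poly0[OF _ subgroup.subset[OF \<Gamma>(1)]])
    show "f x = 0" if "f \<in> Poly0" "\<And>x. x \<in> \<Gamma> \<Longrightarrow> f x = 0" "x \<in> carrier G" for f x by (rule dens[OF that])
  qed simp
next
  case (Suc i)
  show ?case unfolding P_Suc D_Suc by (rule dense_derived[OF P_subgroup D_subgroup Suc])
qed

lemma Poly_zero_cl:
  assumes "f \<in> Poly" "\<And>x. x \<in> P i \<Longrightarrow> f x = 0" "x \<in> cl i"
  shows "f x = 0"
  by (rule Poly_zero_closure[OF assms(1) dense_inD[OF dense_P_D assms(1,2)] assms(3)[unfolded cl_def]])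

text \<open>The function \<open>l [g, h]\<close> is polynomial in each variable. It vanishes for
  \<open>g\<close>, \<open>h\<close> in \<open>P i\<close>, so by density for
  \<open>g \<in> cl i\<close> and \<open>h \<in> P i\<close>; inverting the commutator exchanges the
  variables, and density applied once more gives all of \<open>cl i\<close>. Hence \<open>l\<close>
  is zero on \<open>D (Suc i)\<close>, and by continuity on its closure.\<close>

lemma cont_hom_vanish:
  assumes l: "cont_hom (cl (Suc i)) l" and z: "\<And>x. x \<in> P (Suc i) \<Longrightarrow> l x = 0" and x: "x \<in> cl (Suc i)"
  shows "l x = 0"
proof -
  have cp: "\<exists>f\<in>Poly. \<forall>g\<in>cl i. l (g \<otimes> h \<otimes> inv g \<otimes> inv h) = f g" if "h \<in> cl i" for h
  proof (rule commutator_poly[OF cl_subgroup cl_closed cl_subgroup cl_gen _ _ l that])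
    show "h \<otimes> b \<otimes> inv h \<in> cl (Suc i)" if "h \<in> cl i" "b \<in> cl (Suc i)" for h b
      by (rule cl_conj[OF cl_carrier[OF that(1)] that(2)])
    show "g \<otimes> h \<otimes> inv g \<otimes> inv h \<in> cl (Suc i)" if "g \<in> cl i" "h \<in> cl i" for g h by (rule cl_comm[OF that])
  qed
  have Pcl: "x \<in> cl i" if "x \<in> P i" for x using that P_D D_cl by blast
  have c1: "l (g \<otimes> p \<otimes> inv g \<otimes> inv p) = 0" if p: "p \<in> P i" and g: "g \<in> cl i" for p g
  proof -
    obtain f where f: "f \<in> Poly" "\<forall>g\<in>cl i. l (g \<otimes> p \<otimes> inv g \<otimes> inv p) = f g" using cp[OF Pcl[OF p]] by blast
    have "f g = 0"
    proof (rule Poly_zero_cl[OF f(1) _ g])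
      fix q assume q: "q \<in> P i"
      have "q \<otimes> p \<otimes> inv q \<otimes> inv p \<in> P (Suc i)" unfolding P_Suc by (rule commutator_derived[OF q p])
      from z[OF this] show "f q = 0" using bspec[OF f(2) Pcl[OF q]] by simp
    qed
    thus ?thesis using f(2) g by simp
  qed
  have c2: "l (h \<otimes> g \<otimes> inv h \<otimes> inv g) = 0" if g: "g \<in> cl i" and h: "h \<in> cl i" for g h
  proof -
    obtain f where f: "f \<in> Poly" "\<forall>h\<in>cl i. l (h \<otimes> g \<otimes> inv h \<otimes> inv g) = f h" using cp[OF g] by blast
    have "f h = 0"
    proof (rule Poly_zero_cl[OF f(1) _ h])
      fix p assume p: "p \<in> P i"
      have pg: "p \<in> carrier G" "g \<in> carrier G" using cl_carrier g Pcl[OF p] by auto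
      have "p \<otimes> g \<otimes> inv p \<otimes> inv g = inv (g \<otimes> p \<otimes> inv g \<otimes> inv p)" using pg by (simp add: inv_mult_group m_assoc)
      hence "l (p \<otimes> g \<otimes> inv p \<otimes> inv g) = 0"
        using cont_hom_inv[OF l cl_subgroup cl_comm[OF g Pcl[OF p]]] c1[OF p g] by simp
      thus "f p = 0" using f(2) Pcl[OF p] by simp
    qed
    thus ?thesis using f(2) h by simp
  qed
  have DG: "D (Suc i) \<subseteq> cl (Suc i)" by (rule D_cl)
  have D0: "l x = 0" if "x \<in> D (Suc i)" for x
  proof -
    have "x \<in> generate G (\<Union>h1\<in>D i. \<Union>h2\<in>D i. {h1 \<otimes> h2 \<otimes> inv h1 \<otimes> inv h2})"
      using that by (simp add: D_Suc derived_def)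
    thus ?thesis
    proof (induction rule: generate.induct)
      case one
      show ?case by (rule cont_hom_one[OF l cl_subgroup])
    next
      case (incl h)
      then obtain x y where "x \<in> D i" "y \<in> D i" "h = x \<otimes> y \<otimes> inv x \<otimes> inv y" by auto
      thus ?case using c2 D_cl by blast
    next
      case (inv h)
      then obtain x y where xy: "x \<in> D i" "y \<in> D i" "h = x \<otimes> y \<otimes> inv x \<otimes> inv y" by auto
      hence xy': "x \<in> cl i" "y \<in> cl i" using D_cl by auto
      have "h \<in> cl (Suc i)" using cl_comm[OF xy'] xy(3) by simp
      moreover have "l h = 0" using c2[OF xy'(2,1)] xy(3) by simp
      ultimately show ?case using cont_hom_inv[OF l cl_subgroup] by simp
    next
      case (eng h1 h2)
      have "h1 \<in> cl (Suc i)" "h2 \<in> cl (Suc i)" using eng.hyps DG by (auto simp: D_Suc derived_def)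
      thus ?case using cont_hom_mult[OF l] eng.IH by simp
    qed
  qed
  have "l ` (subtopology T (cl (Suc i)) closure_of (D (Suc i))) \<subseteq> euclideanreal closure_of (l ` D (Suc i))"
    by (rule continuous_map_image_closure_subset) (use l in \<open>simp add: cont_hom_def\<close>)
  also have "\<dots> \<subseteq> euclideanreal closure_of {0}" by (rule closure_of_mono) (use D0 in auto)
  also have "\<dots> = {0}" by simp
  finally have *: "l ` (subtopology T (cl (Suc i)) closure_of (D (Suc i))) \<subseteq> {0}" .
  have "x \<in> subtopology T (cl (Suc i)) closure_of (D (Suc i))"
    using x DG by (simp add: closure_of_subtopology Int_absorb1) (simp add: cl_def)
  thus ?thesis using * by blast
qed

lemma cl_trivial: "\<exists>n. \<forall>j\<ge>n. cl j = {\<one>}"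
proof -
  obtain n where n: "(derived G ^^ n) (carrier G) = {\<one>}"
    using solvable_iff_trivial_derived_seq[THEN iffD1, OF solv] by blast
  have "D j = {\<one>}" if "n \<le> j" for j using that
  proof (induction j rule: dec_induct)
    case base
    thus ?case using n by (simp add: D_def)
  next
    case (step j)
    have "D (Suc j) \<subseteq> {\<one>}" unfolding D_Suc step by (rule derived_incl[OF order_refl triv_subgroup])
    thus ?case using subgroup.one_closed[OF D_subgroup] by blast
  qed
  moreover have "T closure_of {\<one>} = {\<one>}"
    by (rule closure_of_eq[THEN iffD2]) (simp add: closedin_Hausdorff_singleton[OF hausdorff])
  ultimately show ?thesis by (intro exI[of _ n]) (simp add: cl_def)
qed

text \<open>With \<open>L\<close> the closure of \<open>P (Suc i)\<close> times
  \<open>cl (Suc (Suc i))\<close>, the quotient of \<open>cl (Suc i)\<close> by \<open>L\<close> is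
  abelian. Each coordinate \<open>v \<bullet> Q.F\<close> of its logarithm is a homomorphism that
  vanishes on \<open>P (Suc i)\<close>, hence everywhere; so \<open>kernel_F\<close> makes
  \<open>cl (Suc i)\<close> compact modulo \<open>L\<close>. Finally
  \<open>L \<subseteq> \<Gamma> <#> K\<close>, because the latter is closed.\<close>

lemma cl_cocompact_step:
  assumes K: "compactin T K" "cl (Suc (Suc i)) \<subseteq> \<Gamma> <#> K"
  shows "\<exists>K. compactin T K \<and> cl (Suc i) \<subseteq> \<Gamma> <#> K"
proof -
  define L where "L = T closure_of (P (Suc i) <#> cl (Suc (Suc i)))"
  have sub: "subgroup (P (Suc i) <#> cl (Suc (Suc i))) G"
    by (rule subgroup_set_mult[OF P_subgroup cl_subgroup cl_conj[OF subgroup.mem_carrier[OF P_subgroup]]])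
  have L: "subgroup L G" "closedin T L" unfolding L_def by (rule closure_subgroup[OF sub], rule closedin_closure)
  have subL: "P (Suc i) <#> cl (Suc (Suc i)) \<subseteq> L"
    unfolding L_def using subgroup.subset[OF sub] by (intro closure_of_subset) simp
  have PL: "x \<in> L" if "x \<in> P (Suc i)" for x
  proof -
    have "x \<otimes> \<one> \<in> P (Suc i) <#> cl (Suc (Suc i))"
      unfolding set_mult_iff using that subgroup.one_closed[OF cl_subgroup] by blast
    thus ?thesis using subL subgroup.mem_carrier[OF P_subgroup that] by auto
  qed
  have clL: "x \<in> L" if "x \<in> cl (Suc (Suc i))" for x
  proof -
    have "\<one> \<otimes> x \<in> P (Suc i) <#> cl (Suc (Suc i))"
      unfolding set_mult_iff using that subgroup.one_closed[OF P_subgroup] by blast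
    thus ?thesis using subL cl_carrier[OF that] by auto
  qed
  have "P (Suc i) <#> cl (Suc (Suc i)) \<subseteq> cl (Suc i)"
  proof
    fix x assume "x \<in> P (Suc i) <#> cl (Suc (Suc i))"
    then obtain p y where "p \<in> P (Suc i)" "y \<in> cl (Suc (Suc i))" "x = p \<otimes> y" unfolding set_mult_iff by blast
    moreover from this have "p \<in> cl (Suc i)" "y \<in> cl (Suc i)"
      using P_D[of "Suc i"] D_cl[of "Suc i"] cl_Suc[of "Suc i"] by blast+
    ultimately show "x \<in> cl (Suc i)" using subgroup.m_closed[OF cl_subgroup] by simp
  qed
  hence LA: "L \<subseteq> cl (Suc i)" unfolding L_def by (rule closure_of_minimal[OF _ cl_closed])
  interpret Q: abelian_quotient G T E \<phi> U r C "cl (Suc i)" L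
    by (rule abelian_quotient.intro[OF local_group_axioms abelian_quotient_axioms.intro])
      (fact cl_subgroup cl_closed L LA clL[OF cl_comm] cl_gen)+
  have "Q.F a = 0" if a: "a \<in> cl (Suc i)" for a
  proof -
    have "v \<bullet> Q.F a = 0" for v
    proof (rule cont_hom_vanish[OF _ _ a, where l = "\<lambda>a. v \<bullet> Q.F a"])
      have "continuous_map euclidean euclideanreal (\<lambda>x. v \<bullet> x)"
        by (intro continuous_map_iff_continuous2[THEN iffD2] continuous_intros)
      from continuous_map_compose[OF Q.F_continuous this]
      show "cont_hom (cl (Suc i)) (\<lambda>a. v \<bullet> Q.F a)" by (simp add: cont_hom_def o_def Q.F_mult inner_add_right)
      show "v \<bullet> Q.F x = 0" if "x \<in> P (Suc i)" for x using Q.F_Lambda[OF PL[OF that]] by simp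
    qed
    from this[of "Q.F a"] show ?thesis by simp
  qed
  then obtain K' where K': "compactin T K'" "cl (Suc i) \<subseteq> L <#> K'" using Q.kernel_F by fastforce
  have "P (Suc i) <#> cl (Suc (Suc i)) \<subseteq> \<Gamma> <#> K"
  proof
    fix x assume "x \<in> P (Suc i) <#> cl (Suc (Suc i))"
    then obtain p y where py: "p \<in> P (Suc i)" "y \<in> cl (Suc (Suc i))" "x = p \<otimes> y" by (auto simp: set_mult_iff)
    hence "y \<in> \<Gamma> <#> K" using K(2) by blast
    then obtain g k where gk: "g \<in> \<Gamma>" "k \<in> K" "y = g \<otimes> k" unfolding set_mult_iff by blast
    have p: "p \<in> \<Gamma>" using py(1) P_Gamma by blast
    have "x = (p \<otimes> g) \<otimes> k" using py gk subgroup.mem_carrier[OF \<Gamma>(1)] p compactin_carrier[OF K(1)] by (simp add: m_assoc subset_iff)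
    thus "x \<in> \<Gamma> <#> K" unfolding set_mult_iff using subgroup.m_closed[OF \<Gamma>(1) p gk(1)] gk(2) by blast
  qed
  hence "L \<subseteq> \<Gamma> <#> K" unfolding L_def by (rule closure_of_minimal[OF _ closedin_set_mult[OF \<Gamma>(2) K(1)]])
  from set_mult_assoc_subset[OF \<Gamma>(1) K(1) K'(1) K'(2) this] show ?thesis
    using compactin_set_mult[OF K(1) K'(1)] by blast
qed

lemma cl_one_cocompact: "\<exists>K. compactin T K \<and> cl (Suc 0) \<subseteq> \<Gamma> <#> K"
proof -
  obtain n where n: "\<forall>j\<ge>n. cl j = {\<one>}" using cl_trivial by blast
  \<comment> \<open>The index runs downwards: \<open>k = 0\<close> is the trivial group
    \<open>cl (Suc (Suc n))\<close>, and \<open>k = Suc n\<close> is \<open>cl (Suc 0)\<close>. It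
    stops there because the step concerns derived groups only, not
    \<open>cl 0 = carrier G\<close>.\<close>
  have "\<exists>K. compactin T K \<and> cl (Suc (Suc n - k)) \<subseteq> \<Gamma> <#> K" if "k \<le> Suc n" for k using that
  proof (induction k)
    case 0
    have "cl (Suc (Suc n)) \<subseteq> \<Gamma> <#> {\<one>}"
      using n subgroup.one_closed[OF \<Gamma>(1)] by (auto simp: set_mult_def intro!: bexI[of _ \<one>])
    moreover have "compactin T {\<one>}" by simp
    ultimately show ?case by (intro exI[of _ "{\<one>}"]) simp
  next
    case (Suc k)
    then obtain K where K: "compactin T K" "cl (Suc (Suc n - k)) \<subseteq> \<Gamma> <#> K" by auto
    have "Suc (Suc n - k) = Suc (Suc (Suc n - Suc k))" using Suc.prems by simp
    thus ?case using cl_cocompact_step[OF K(1)] K(2) by simp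
  qed
  from this[of "Suc n"] show ?thesis by simp
qed

definition \<Lambda>0 :: "'a set" where "\<Lambda>0 = T closure_of (\<Gamma> <#> cl (Suc 0))"

lemma Gamma_cl_subgroup: "subgroup (\<Gamma> <#> cl (Suc 0)) G"
  by (rule subgroup_set_mult[OF \<Gamma>(1) cl_subgroup cl_conj[OF subgroup.mem_carrier[OF \<Gamma>(1)]]])

lemma \<Lambda>0_subgroup: "subgroup \<Lambda>0 G" unfolding \<Lambda>0_def by (rule closure_subgroup[OF Gamma_cl_subgroup])
lemma \<Lambda>0_closed: "closedin T \<Lambda>0" unfolding \<Lambda>0_def by (rule closedin_closure)

lemma Gamma_cl_\<Lambda>0: "\<Gamma> <#> cl (Suc 0) \<subseteq> \<Lambda>0"
  unfolding \<Lambda>0_def using subgroup.subset[OF Gamma_cl_subgroup] by (intro closure_of_subset) simp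

lemma Gamma_\<Lambda>0: "x \<in> \<Gamma> \<Longrightarrow> x \<in> \<Lambda>0"
proof -
  assume x: "x \<in> \<Gamma>"
  have "x \<otimes> \<one> \<in> \<Gamma> <#> cl (Suc 0)" unfolding set_mult_iff using x subgroup.one_closed[OF cl_subgroup] by blast
  thus "x \<in> \<Lambda>0" using Gamma_cl_\<Lambda>0 subgroup.mem_carrier[OF \<Gamma>(1) x] by auto
qed

lemma cl_\<Lambda>0: "x \<in> cl (Suc 0) \<Longrightarrow> x \<in> \<Lambda>0"
proof -
  assume x: "x \<in> cl (Suc 0)"
  have "\<one> \<otimes> x \<in> \<Gamma> <#> cl (Suc 0)" unfolding set_mult_iff using x subgroup.one_closed[OF \<Gamma>(1)] by blast
  thus "x \<in> \<Lambda>0" using Gamma_cl_\<Lambda>0 cl_carrier[OF x] by auto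
qed

lemma \<Lambda>0_cocompact: "\<exists>K. compactin T K \<and> \<Lambda>0 \<subseteq> \<Gamma> <#> K"
proof -
  obtain K where K: "compactin T K" "cl (Suc 0) \<subseteq> \<Gamma> <#> K" using cl_one_cocompact by blast
  have "\<Gamma> <#> cl (Suc 0) \<subseteq> \<Gamma> <#> K"
  proof
    fix x assume "x \<in> \<Gamma> <#> cl (Suc 0)"
    then obtain p y where py: "p \<in> \<Gamma>" "y \<in> cl (Suc 0)" "x = p \<otimes> y" by (auto simp: set_mult_iff)
    hence "y \<in> \<Gamma> <#> K" using K(2) by blast
    then obtain g k where gk: "g \<in> \<Gamma>" "k \<in> K" "y = g \<otimes> k" unfolding set_mult_iff by blast
    have "x = (p \<otimes> g) \<otimes> k" using py gk subgroup.mem_carrier[OF \<Gamma>(1)] compactin_carrier[OF K(1)] by (simp add: m_assoc subset_iff)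
    thus "x \<in> \<Gamma> <#> K" unfolding set_mult_iff using subgroup.m_closed[OF \<Gamma>(1) py(1) gk(1)] gk(2) by blast
  qed
  hence "\<Lambda>0 \<subseteq> \<Gamma> <#> K" unfolding \<Lambda>0_def by (rule closure_of_minimal[OF _ closedin_set_mult[OF \<Gamma>(2) K(1)]])
  thus ?thesis using K(1) by blast
qed

sublocale Q: abelian_quotient G T E \<phi> U r C "carrier G" \<Lambda>0
proof (rule abelian_quotient.intro[OF local_group_axioms abelian_quotient_axioms.intro])
  show "closedin T (carrier G)" using closedin_topspace[of T] by simp
  show "expgen (Lie (carrier G)) = carrier G" unfolding Lie_carrier by (rule connected_generated[OF conn])
  show "a \<otimes> b \<otimes> inv a \<otimes> inv b \<in> \<Lambda>0" if "a \<in> carrier G" "b \<in> carrier G" for a b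
    by (rule cl_\<Lambda>0) (rule cl_comm, use that cl_zero in auto)
qed (fact subgroup_self \<Lambda>0_subgroup \<Lambda>0_closed subgroup.subset[OF \<Lambda>0_subgroup])+

definition S :: "'a set" where "S = {g \<in> carrier G. Q.F g = 0}"

lemma S_cocompact: "\<exists>K. compactin T K \<and> S \<subseteq> \<Gamma> <#> K"
proof -
  obtain K where K: "compactin T K" "S \<subseteq> \<Lambda>0 <#> K" using Q.kernel_F unfolding S_def by blast
  obtain K' where K': "compactin T K'" "\<Lambda>0 \<subseteq> \<Gamma> <#> K'" using \<Lambda>0_cocompact by blast
  from set_mult_assoc_subset[OF \<Gamma>(1) K'(1) K(1) K(2) K'(2)] show ?thesis
    using compactin_set_mult[OF K'(1) K(1)] by blast
qed

end

section \<open>Smooth functions and manifolds\<close>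

lemma frechet_eq: "(f has_derivative f') (at x) \<Longrightarrow> frechet_derivative f (at x) = f'"
  by (rule frechet_derivative_at[symmetric])

lemma differentiable_frechet: "f differentiable (at x) \<Longrightarrow> (f has_derivative frechet_derivative f (at x)) (at x)"
  using frechet_derivative_works by blast

lemma Ck_cong_imp:
  assumes "open U" "\<And>x. x \<in> U \<Longrightarrow> f x = g x" "Ck_on k U f"
  shows "Ck_on k U g" using assms(2,3)
proof (induction k arbitrary: f g)
  case 0
  thus ?case using continuous_on_cong by fastforce
next
  case (Suc k)
  have d: "(g has_derivative frechet_derivative f (at x)) (at x)" if x: "x \<in> U" for x
  proof -
    have "(f has_derivative frechet_derivative f (at x)) (at x)"
      using Suc.prems(2) x by (intro differentiable_frechet) simp
    thus ?thesis using assms(1) x Suc.prems(1) by (rule has_derivative_transform_within_open)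
  qed
  show ?case
  proof (simp, intro conjI ballI allI)
    show "g differentiable (at x)" if "x \<in> U" for x using d[OF that] by (rule differentiableI)
    fix v
    show "Ck_on k U (\<lambda>x. frechet_derivative g (at x) v)"
    proof (rule Suc.IH)
      show "frechet_derivative f (at x) v = frechet_derivative g (at x) v" if "x \<in> U" for x
        using frechet_eq[OF d[OF that]] by simp
      show "Ck_on k U (\<lambda>x. frechet_derivative f (at x) v)" using Suc.prems(2) by simp
    qed
  qed
qed

lemma Ck_subset: "V \<subseteq> U \<Longrightarrow> Ck_on k U f \<Longrightarrow> Ck_on k V f"
proof (induction k arbitrary: f)
  case 0
  thus ?case using continuous_on_subset by simp blast
next
  case (Suc k)
  thus ?case by auto
qed

lemma Ck_local:
  assumes "\<And>x. x \<in> U \<Longrightarrow> \<exists>V. open V \<and> x \<in> V \<and> Ck_on k V f"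
  shows "Ck_on k U f" using assms
proof (induction k arbitrary: f)
  case 0
  have "continuous (at x within U) f" if x: "x \<in> U" for x
  proof -
    obtain V where V: "open V" "x \<in> V" "continuous_on V f" using 0[OF x] by auto
    hence "isCont f x" by (simp add: continuous_on_eq_continuous_at)
    thus ?thesis using continuous_at_imp_continuous_at_within by blast
  qed
  thus ?case by (simp add: continuous_on_eq_continuous_within)
next
  case (Suc k)
  show ?case
  proof (simp, intro conjI ballI allI)
    show "f differentiable (at x)" if "x \<in> U" for x using Suc.prems[OF that] by auto
    fix v
    show "Ck_on k U (\<lambda>x. frechet_derivative f (at x) v)" by (rule Suc.IH) (use Suc.prems in fastforce)
  qed
qed

lemma Ck_SucI:
  assumes "open U" "\<And>x. x \<in> U \<Longrightarrow> (f has_derivative f' x) (at x)" "\<And>v. Ck_on k U (\<lambda>x. f' x v)"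
  shows "Ck_on (Suc k) U f"
proof (simp, intro conjI ballI allI)
  show "f differentiable (at x)" if "x \<in> U" for x using assms(2)[OF that] by (rule differentiableI)
  fix v
  show "Ck_on k U (\<lambda>x. frechet_derivative f (at x) v)"
    by (rule Ck_cong_imp[OF assms(1) _ assms(3)[of v]]) (simp add: frechet_eq[OF assms(2)])
qed

lemma Ck_SucD:
  assumes "Ck_on (Suc k) U f"
  shows "x \<in> U \<Longrightarrow> (f has_derivative frechet_derivative f (at x)) (at x)"
    "Ck_on k U (\<lambda>x. frechet_derivative f (at x) v)" using assms by (auto intro: differentiable_frechet)

lemma Ck_Suc_imp: "Ck_on (Suc k) U f \<Longrightarrow> Ck_on k U f"
proof (induction k arbitrary: f)
  case 0
  hence "\<forall>x\<in>U. f differentiable (at x)" by simp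
  hence "continuous (at x within U) f" if "x \<in> U" for x
    using that differentiable_imp_continuous_within continuous_at_imp_continuous_at_within by blast
  thus ?case by (simp add: continuous_on_eq_continuous_within)
next
  case (Suc k)
  show ?case
  proof (subst Ck_on.simps, intro conjI ballI allI)
    show "f differentiable (at x)" if "x \<in> U" for x using Suc.prems that by simp
    fix v
    show "Ck_on k U (\<lambda>x. frechet_derivative f (at x) v)" by (rule Suc.IH) (rule Ck_SucD(2)[OF Suc.prems])
  qed
qed

lemma Ck_linear:
  assumes "bounded_linear L" "open U" shows "Ck_on k U L"
proof (cases k)
  case 0
  thus ?thesis using assms(1) by (simp add: linear_continuous_on)
next
  case (Suc m)
  have c: "Ck_on j U (\<lambda>x. c)" for j and c :: 'b
    by (induction j arbitrary: c) (auto simp: frechet_eq[OF has_derivative_const])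
  show ?thesis unfolding Suc by (rule Ck_SucI[OF assms(2) bounded_linear_imp_has_derivative[OF assms(1)] c])
qed

lemma Ck_const: "Ck_on k U (\<lambda>x. c)"
  by (induction k arbitrary: c) (auto simp: frechet_eq[OF has_derivative_const])

lemma Ck_add:
  assumes U: "open U" shows "Ck_on k U f \<Longrightarrow> Ck_on k U g \<Longrightarrow> Ck_on k U (\<lambda>x. f x + g x)"
proof (induction k arbitrary: f g)
  case 0
  thus ?case by (simp add: continuous_on_add)
next
  case (Suc k)
  show ?case by (rule Ck_SucI[OF U has_derivative_add[OF Ck_SucD(1)[OF Suc.prems(1)] Ck_SucD(1)[OF Suc.prems(2)]]])
      (auto intro: Suc.IH Ck_SucD(2)[OF Suc.prems(1)] Ck_SucD(2)[OF Suc.prems(2)])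
qed

lemma Ck_sum:
  assumes U: "open U" shows "(\<And>i. i \<in> I \<Longrightarrow> Ck_on k U (f i)) \<Longrightarrow> Ck_on k U (\<lambda>x. \<Sum>i\<in>I. f i x)"
  by (induction I rule: infinite_finite_induct) (auto intro: Ck_const Ck_add[OF U])

lemma Ck_bilinear:
  assumes U: "open U" and B: "bounded_bilinear B"
  shows "Ck_on k U f \<Longrightarrow> Ck_on k U g \<Longrightarrow> Ck_on k U (\<lambda>x. B (f x) (g x))"
proof (induction k arbitrary: f g)
  case 0
  thus ?case using bounded_bilinear.continuous_on[OF B] by auto
next
  case (Suc k)
  show ?case
  proof (rule Ck_SucI[OF U])
    show "((\<lambda>x. B (f x) (g x)) has_derivative (\<lambda>v. B (f x) (frechet_derivative g (at x) v) + B (frechet_derivative f (at x) v) (g x))) (at x)"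
      if "x \<in> U" for x
      by (rule bounded_bilinear.FDERIV[OF B Ck_SucD(1)[OF Suc.prems(1) that] Ck_SucD(1)[OF Suc.prems(2) that]])
    show "Ck_on k U (\<lambda>x. B (f x) (frechet_derivative g (at x) v) + B (frechet_derivative f (at x) v) (g x))" for v
      by (intro Ck_add[OF U] Suc.IH Ck_Suc_imp[OF Suc.prems(1)] Ck_Suc_imp[OF Suc.prems(2)]
          Ck_SucD(2)[OF Suc.prems(1)] Ck_SucD(2)[OF Suc.prems(2)])
  qed
qed

lemma Ck_linear_comp:
  assumes U: "open U" and L: "bounded_linear L"
  shows "Ck_on k U f \<Longrightarrow> Ck_on k U (\<lambda>x. L (f x))"
proof (induction k arbitrary: f)
  case 0
  thus ?case using bounded_linear.continuous_on[OF L] by auto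
next
  case (Suc k)
  show ?case by (rule Ck_SucI[OF U bounded_linear.has_derivative[OF L Ck_SucD(1)[OF Suc.prems]]])
      (auto intro: Suc.IH Ck_SucD(2)[OF Suc.prems])
qed

lemma linear_expand: "linear f \<Longrightarrow> f v = (\<Sum>b\<in>Basis. (v \<bullet> b) *\<^sub>R f b)"
  using linear_sum[of f "\<lambda>b. (v \<bullet> b) *\<^sub>R b" Basis] by (simp add: euclidean_representation linear_cmul)

lemma Ck_apply:
  fixes L :: "'a::real_normed_vector \<Rightarrow> 'b::euclidean_space \<Rightarrow> 'c::real_normed_vector"
  assumes U: "open U" and lin: "\<And>x. x \<in> U \<Longrightarrow> linear (L x)" and L: "\<And>b. Ck_on k U (\<lambda>x. L x b)" and h: "Ck_on k U h"
  shows "Ck_on k U (\<lambda>x. L x (h x))"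
proof (rule Ck_cong_imp[OF U])
  show "Ck_on k U (\<lambda>x. \<Sum>b\<in>Basis. (h x \<bullet> b) *\<^sub>R L x b)"
    by (intro Ck_sum[OF U] Ck_bilinear[OF U bounded_bilinear_scaleR] Ck_linear_comp[OF U bounded_linear_inner_left] L h)
qed (rule linear_expand[OF lin, symmetric])

lemma Ck_comp:
  fixes g :: "'a::real_normed_vector \<Rightarrow> 'b::euclidean_space"
  assumes U: "open U" and gU: "\<And>x. x \<in> U \<Longrightarrow> g x \<in> V"
  shows "Ck_on k U g \<Longrightarrow> Ck_on k V f \<Longrightarrow> Ck_on k U (\<lambda>x. f (g x))"
proof (induction k arbitrary: f)
  case 0
  have "continuous_on U (f \<circ> g)" by (rule continuous_on_compose) (use 0 gU in \<open>auto intro: continuous_on_subset\<close>)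
  thus ?case by (simp add: o_def)
next
  case (Suc k)
  note df = Ck_SucD(1)[OF Suc.prems(2) gU]
  show ?case by (rule Ck_SucI[OF U has_derivative_compose[OF Ck_SucD(1)[OF Suc.prems(1)] df]])
      (auto intro!: Ck_apply[OF U] has_derivative_linear[OF df] Suc.IH Ck_Suc_imp[OF Suc.prems(1)] Ck_SucD(2)[OF Suc.prems(1)] Ck_SucD(2)[OF Suc.prems(2)])
qed

definition Cinf :: "'a::real_normed_vector set \<Rightarrow> ('a \<Rightarrow> 'b::real_normed_vector) \<Rightarrow> bool" where
  "Cinf U f \<longleftrightarrow> (\<forall>k. Ck_on k U f)"

lemma Cinf_cong: "open U \<Longrightarrow> (\<And>x. x \<in> U \<Longrightarrow> f x = g x) \<Longrightarrow> Cinf U f \<Longrightarrow> Cinf U g"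
  unfolding Cinf_def by (intro allI) (rule Ck_cong_imp[of U f g]; simp)

lemma Cinf_subset: "V \<subseteq> U \<Longrightarrow> Cinf U f \<Longrightarrow> Cinf V f"
  unfolding Cinf_def by (intro allI) (rule Ck_subset[of V U]; simp)

lemma Cinf_local: "(\<And>x. x \<in> U \<Longrightarrow> \<exists>V. open V \<and> x \<in> V \<and> Cinf V f) \<Longrightarrow> Cinf U f"
  unfolding Cinf_def by (intro allI, rule Ck_local) meson

lemma Cinf_const: "Cinf U (\<lambda>x. c)" by (simp add: Cinf_def Ck_const)
lemma Cinf_linear: "open U \<Longrightarrow> bounded_linear L \<Longrightarrow> Cinf U L" by (simp add: Cinf_def Ck_linear)
lemma Cinf_id: "open U \<Longrightarrow> Cinf U (\<lambda>x. x)" by (rule Cinf_linear) (simp_all add: bounded_linear_ident)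
lemma Cinf_add: "open U \<Longrightarrow> Cinf U f \<Longrightarrow> Cinf U g \<Longrightarrow> Cinf U (\<lambda>x. f x + g x)" by (simp add: Cinf_def Ck_add)
lemma Cinf_bilinear: "open U \<Longrightarrow> bounded_bilinear B \<Longrightarrow> Cinf U f \<Longrightarrow> Cinf U g \<Longrightarrow> Cinf U (\<lambda>x. B (f x) (g x))"
  by (simp add: Cinf_def Ck_bilinear)
lemma Cinf_linear_comp: "open U \<Longrightarrow> bounded_linear L \<Longrightarrow> Cinf U f \<Longrightarrow> Cinf U (\<lambda>x. L (f x))"
  by (simp add: Cinf_def Ck_linear_comp)

lemma Cinf_diff: "open U \<Longrightarrow> Cinf U f \<Longrightarrow> Cinf U g \<Longrightarrow> Cinf U (\<lambda>x. f x - g x)"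
  using Cinf_add[of U f "\<lambda>x. - g x"] Cinf_linear_comp[OF _ bounded_linear_minus[OF bounded_linear_ident], of U g] by simp

lemma Cinf_Pair: "open U \<Longrightarrow> Cinf U f \<Longrightarrow> Cinf U g \<Longrightarrow> Cinf U (\<lambda>x. (f x, g x))"
proof -
  assume U: "open U" and f: "Cinf U f" and g: "Cinf U g"
  have "bounded_linear (\<lambda>x::'b. (x, 0::'c))" "bounded_linear (\<lambda>x::'c. (0::'b, x))"
    by (intro bounded_linear_Pair bounded_linear_ident bounded_linear_zero)+
  from Cinf_add[OF U Cinf_linear_comp[OF U this(1) f] Cinf_linear_comp[OF U this(2) g]]
  show ?thesis by simp
qed

lemma Cinf_comp:
  fixes g :: "'a::real_normed_vector \<Rightarrow> 'b::euclidean_space"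
  shows "open U \<Longrightarrow> (\<And>x. x \<in> U \<Longrightarrow> g x \<in> V) \<Longrightarrow> Cinf U g \<Longrightarrow> Cinf V f \<Longrightarrow> Cinf U (\<lambda>x. f (g x))"
  unfolding Cinf_def by (intro allI) (rule Ck_comp[where V = V]; simp)

lemma Cinf_derivative:
  assumes "Cinf U f"
  shows "x \<in> U \<Longrightarrow> (f has_derivative frechet_derivative f (at x)) (at x)"
    "Cinf U (\<lambda>x. frechet_derivative f (at x) v)" "continuous_on U f"
proof -
  show "x \<in> U \<Longrightarrow> (f has_derivative frechet_derivative f (at x)) (at x)"
    using Ck_SucD(1)[of 0 U f] assms by (auto simp: Cinf_def simp del: Ck_on.simps)
  show "Cinf U (\<lambda>x. frechet_derivative f (at x) v)" unfolding Cinf_def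
  proof
    fix k
    have "Ck_on (Suc k) U f" using assms unfolding Cinf_def by blast
    thus "Ck_on k U (\<lambda>x. frechet_derivative f (at x) v)" by (rule Ck_SucD(2))
  qed
  have "Ck_on 0 U f" using assms unfolding Cinf_def by blast
  thus "continuous_on U f" by simp
qed

lemma CinfI:
  assumes "open U" "\<And>x. x \<in> U \<Longrightarrow> (f has_derivative f' x) (at x)" "\<And>v. Cinf U (\<lambda>x. f' x v)"
  shows "Cinf U f" unfolding Cinf_def
proof
  fix k
  have "Ck_on (Suc k) U f" by (rule Ck_SucI[OF assms(1,2)]) (use assms(3) in \<open>auto simp: Cinf_def\<close>)
  thus "Ck_on k U f" by (rule Ck_Suc_imp)
qed

lemma smooth_on_iff: "smooth_on X f \<longleftrightarrow>
     (\<forall>x\<in>X. \<exists>U F. open U \<and> x \<in> U \<and> Cinf U F \<and> (\<forall>y\<in>U \<inter> X. F y = f y))" by (simp add: smooth_on_def Cinf_def)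

text \<open>Near each point \<open>f\<close> may be replaced by a smooth extension without changing
  the composite. In this way smoothness on subsets of a subspace is always brought back to honest
  smoothness on an open set.\<close>

lemma smooth_on_comp:
  fixes g :: "'a::real_normed_vector \<Rightarrow> 'b::euclidean_space"
  assumes X: "smooth_on X f" and U: "open U" and gU: "\<And>x. x \<in> U \<Longrightarrow> g x \<in> X" and g: "Cinf U g"
  shows "Cinf U (\<lambda>x. f (g x))"
proof (rule Cinf_local)
  fix x assume x: "x \<in> U"
  obtain V F where V: "open V" "g x \<in> V" "Cinf V F" "\<forall>y\<in>V \<inter> X. F y = f y"
    using X gU[OF x] unfolding smooth_on_iff by blast
  let ?W = "U \<inter> g -` V"
  have W: "open ?W" using continuous_open_preimage[OF Cinf_derivative(3)[OF g] U V(1)] .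
  have "Cinf ?W (\<lambda>x. F (g x))" by (rule Cinf_comp[OF W _ Cinf_subset[OF _ g] V(3)]) auto
  hence "Cinf ?W (\<lambda>x. f (g x))" by (rule Cinf_cong[OF W, rotated]) (use V(4) gU in auto)
  thus "\<exists>V. open V \<and> x \<in> V \<and> Cinf V (\<lambda>x. f (g x))" using W x V(2) by blast
qed

lemma smooth_onI:
  assumes "open V" "X \<subseteq> V" "Cinf V F" "\<And>y. y \<in> X \<Longrightarrow> F y = f y"
  shows "smooth_on X f" unfolding smooth_on_iff using assms by blast

lemma open_vimage_oproj:
  assumes E: "subspace E" and X: "openin (top_of_set E) X"
  shows "open (oproj E -` X)"
proof -
  obtain O' where O': "open O'" "X = E \<inter> O'" using X by (auto simp: openin_open)
  have "oproj E -` X = oproj E -` O'" using O' oproj_in[OF E] by auto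
  moreover have "open (oproj E -` O')"
    by (rule open_vimage[OF O'(1) linear_continuous_on[OF bounded_linear_oproj]])
  ultimately show ?thesis by simp
qed

lemma Cinf_oproj: "open U \<Longrightarrow> Cinf U (oproj E)" by (rule Cinf_linear[OF _ bounded_linear_oproj])

lemma Cinf_smooth_on:
  assumes E: "subspace E" and X: "openin (top_of_set E) X" and f: "Cinf (oproj E -` X) (\<lambda>x. f (oproj E x))"
  shows "smooth_on X f"
proof (rule smooth_onI[OF open_vimage_oproj[OF E X] _ f])
  have XE: "X \<subseteq> E" using openin_imp_subset[OF X] by simp
  show "X \<subseteq> oproj E -` X" using XE oproj_id[OF E] by auto
  show "f (oproj E y) = f y" if "y \<in> X" for y using that XE oproj_id[OF E] by auto
qed

section \<open>Bump functions\<close>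

text \<open>The powers of \<open>t\<close> in the denominator make the family closed under
  differentiation: the derivative of \<open>flat n\<close> is a combination of
  \<open>flat (n + 2)\<close> and \<open>flat (n + 1)\<close>, so all orders follow from one
  induction.\<close>

definition flat :: "nat \<Rightarrow> real \<Rightarrow> real" where
  "flat n t = (if t > 0 then exp (- (1 / t)) / t ^ n else 0)"

lemma flat_tendsto: "((\<lambda>t. exp (- (1 / t)) / t ^ n) \<longlongrightarrow> 0) (at_right (0::real))"
proof -
  have "((\<lambda>t. (inverse t) ^ n / exp (inverse t)) \<longlongrightarrow> (0::real)) (at_right 0)"
    by (rule filterlim_compose[OF tendsto_power_div_exp_0 filterlim_inverse_at_top_right])
  thus ?thesis by (simp add: exp_minus inverse_eq_divide power_divide field_simps)
qed

lemma has_derivative_flat: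
  "(flat n has_derivative (\<lambda>v. v * (flat (n + 2) t - real n * flat (n + 1) t))) (at t)"
proof -
  consider "t > 0" | "t < 0" | "t = 0" by linarith
  hence "(flat n has_real_derivative (flat (n + 2) t - real n * flat (n + 1) t)) (at t)"
  proof cases
    case 1
    have "((\<lambda>t. exp (- (1 / t)) * inverse (t ^ n)) has_real_derivative
       (flat (n + 2) t - real n * flat (n + 1) t)) (at t)"
      using 1 by (auto intro!: derivative_eq_intros simp: flat_def field_simps power2_eq_square power_Suc[symmetric]
          simp del: power_Suc) (cases n; simp add: field_simps)
    thus ?thesis
      by (rule has_field_derivative_transform_within_open[where S = "{0<..}"]) (use 1 in \<open>auto simp: flat_def divide_inverse\<close>)
  next
    case 2
    have "((\<lambda>t. 0) has_real_derivative (flat (n + 2) t - real n * flat (n + 1) t)) (at t)"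
      using 2 by (simp add: flat_def)
    thus ?thesis
      by (rule has_field_derivative_transform_within_open[where S = "{..<0}"]) (use 2 in \<open>auto simp: flat_def\<close>)
  next
    case 3
    let ?q = "\<lambda>h. (flat n (0 + h) - flat n 0) / h"
    have "(?q \<longlongrightarrow> 0) (at 0)"
    proof (rule filterlim_split_at)
      have "eventually (\<lambda>h::real. h < 0) (at_left 0)" by (simp add: eventually_at_filter)
      thus "(?q \<longlongrightarrow> 0) (at_left 0)" by (intro tendsto_eventually) (auto elim!: eventually_mono simp: flat_def)
      have "eventually (\<lambda>h::real. h > 0) (at_right 0)" by (simp add: eventually_at_filter)
      thus "(?q \<longlongrightarrow> 0) (at_right 0)" by (intro Lim_transform_eventually[OF flat_tendsto[of "Suc n"]])
          (auto elim!: eventually_mono simp: flat_def)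
    qed
    thus ?thesis using 3 by (simp add: DERIV_def flat_def)
  qed
  thus ?thesis by (simp add: has_field_derivative_def mult.commute[of "flat (n + 2) t - real n * flat (n + 1) t"] mult_commute_abs)
qed

lemma Ck_flat: "Ck_on k UNIV (flat n)"
proof (induction k arbitrary: n)
  case 0
  have "isCont (flat n) t" for t using has_derivative_continuous[OF has_derivative_flat] .
  thus ?case by (simp add: continuous_at_imp_continuous_on)
next
  case (Suc k)
  show ?case
  proof (rule Ck_SucI[OF open_UNIV has_derivative_flat])
    fix v
    have "Ck_on k UNIV (\<lambda>t. flat (n + 2) t + (- real n) * flat (n + 1) t)"
      by (intro Ck_add Ck_bilinear[OF _ bounded_bilinear_mult] Ck_const Suc) simp_all
    from Ck_bilinear[OF open_UNIV bounded_bilinear_mult Ck_const[of _ _ v] this]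
    show "Ck_on k UNIV (\<lambda>t. v * (flat (n + 2) t - real n * flat (n + 1) t))" by simp
  qed
qed

text \<open>It has the value 1 at the origin only, not on a neighbourhood; the arguments that use it
  therefore apply the Leibniz rule at the centre.\<close>

definition bump :: "real \<Rightarrow> 'a::euclidean_space \<Rightarrow> real" where
  "bump R x = flat 0 (R\<^sup>2 - x \<bullet> x) / flat 0 (R\<^sup>2)"

lemma Cinf_bump: "Cinf UNIV (bump R)"
proof -
  have "Cinf UNIV (\<lambda>x::'a. x \<bullet> x)" by (rule Cinf_bilinear[OF open_UNIV bounded_bilinear_inner Cinf_id[OF open_UNIV] Cinf_id[OF open_UNIV]])
  from Cinf_diff[OF open_UNIV Cinf_const this]
  have "Cinf UNIV (\<lambda>x::'a. flat 0 (R\<^sup>2 - x \<bullet> x))"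
    by (rule Cinf_comp[OF open_UNIV, of _ UNIV, rotated]) (simp_all add: Cinf_def Ck_flat)
  from Cinf_linear_comp[OF open_UNIV bounded_linear_mult_right this, of "1 / flat 0 (R\<^sup>2)"]
  show ?thesis by (simp add: bump_def[abs_def])
qed

lemma bump_zero: "0 < R \<Longrightarrow> bump R 0 = 1"
  by (simp add: bump_def flat_def)

lemma bump_support: "R \<le> norm x \<Longrightarrow> 0 < R \<Longrightarrow> bump R x = 0"
proof -
  assume "R \<le> norm x" "0 < R"
  hence "R\<^sup>2 \<le> x \<bullet> x" by (simp add: power2_norm_eq_inner[symmetric] power_mono)
  thus ?thesis by (simp add: bump_def flat_def)
qed

section \<open>Hadamard's lemma and smoothness of inverse functions\<close>

text \<open>Differentiation under the integral sign turns \<open>t ^ m * h\<close> into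
  \<open>t ^ Suc m\<close> times a derivative of \<open>h\<close>; the power is there to make the
  induction close.\<close>

lemma Ck_integral:
  fixes h :: "'a::euclidean_space \<Rightarrow> real"
  assumes R: "0 < R" and h: "Cinf (ball 0 R) h"
  shows "Ck_on k (ball 0 R) (\<lambda>x. integral {0..1} (\<lambda>t. t ^ m * h (t *\<^sub>R x)))" using h
proof (induction k arbitrary: h m)
  case 0
  have inball: "t *\<^sub>R x \<in> ball 0 R" if "x \<in> ball 0 R" "t \<in> {0..1}" for x :: 'a and t
  proof -
    have "norm (t *\<^sub>R x) \<le> 1 * norm x" unfolding norm_scaleR using that by (intro mult_right_mono) auto
    thus ?thesis using that by simp
  qed
  have "continuous_on (ball 0 R \<times> cbox (0::real) 1) (\<lambda>p. snd p ^ m * h (snd p *\<^sub>R fst p))"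
    by (intro continuous_intros continuous_on_compose2[OF Cinf_derivative(3)[OF 0]]) (use inball in auto)
  hence "continuous_on (ball 0 R) (\<lambda>x. integral (cbox 0 1) (\<lambda>t. t ^ m * h (t *\<^sub>R x)))"
    by (intro integral_continuous_on_param) (simp add: split_beta)
  thus ?case by simp
next
  case (Suc k)
  let ?B = "ball (0::'a) R"
  have inball: "t *\<^sub>R x \<in> ?B" if "x \<in> ?B" "t \<in> {0..1}" for x t
  proof -
    have "norm (t *\<^sub>R x) \<le> 1 * norm x" unfolding norm_scaleR using that by (intro mult_right_mono) auto
    thus ?thesis using that by simp
  qed
  let ?D = "\<lambda>y v. frechet_derivative h (at y) v"
  have der: "((\<lambda>x. t ^ m * h (t *\<^sub>R x)) has_derivative (\<lambda>v. t ^ Suc m * ?D (t *\<^sub>R x) v)) (at x)"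
    if x: "x \<in> ?B" "t \<in> {0..1}" for x t
  proof -
    note d = Cinf_derivative(1)[OF Suc.prems inball[OF x]]
    have lin: "linear (?D (t *\<^sub>R x))" using d has_derivative_linear by blast
    have "((\<lambda>x. t *\<^sub>R x) has_derivative (\<lambda>v. t *\<^sub>R v)) (at x)" by (auto intro!: derivative_eq_intros)
    from has_derivative_mult_right[OF has_derivative_compose[OF this d], of "t ^ m"]
    show ?thesis by (simp add: linear_scale[OF lin] mult_ac)
  qed
  define fx where "fx x t = Blinfun (\<lambda>v. t ^ Suc m * ?D (t *\<^sub>R x) v)" for x t
  have fx: "blinfun_apply (fx x t) = (\<lambda>v. t ^ Suc m * ?D (t *\<^sub>R x) v)" if "x \<in> ?B" "t \<in> {0..1}" for x t
    unfolding fx_def by (rule bounded_linear_Blinfun_apply) (rule has_derivative_bounded_linear[OF der[OF that]])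
  have cD: "continuous_on (?B \<times> {0..1}) (\<lambda>p. (snd p) ^ j * ?D (snd p *\<^sub>R fst p) v)" for v j
    by (intro continuous_intros continuous_on_compose2[OF Cinf_derivative(3)[OF Cinf_derivative(2)[OF Suc.prems]]])
      (use inball in auto)
  have ch: "continuous_on {0..1} (\<lambda>t. t ^ m * h (t *\<^sub>R x))" if "x \<in> ?B" for x
    by (intro continuous_intros continuous_on_compose2[OF Cinf_derivative(3)[OF Suc.prems]]) (use inball[OF that] in auto)
  have cfx: "continuous_on (?B \<times> cbox 0 1) (\<lambda>(x, t). fx x t)"
  proof (rule continuous_on_blinfun_componentwise)
    fix i :: 'a
    show "continuous_on (?B \<times> cbox 0 1) (\<lambda>x. blinfun_apply (case x of (x, t) \<Rightarrow> fx x t) i)"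
      by (rule continuous_on_eq[OF cD[of "Suc m" i, folded cbox_interval[of 0 1, unfolded box_real(2)]]])
        (auto simp: fx)
  qed
  show ?case
  proof (rule Ck_SucI[OF open_ball])
    fix x assume x: "x \<in> ?B"
    have "((\<lambda>x. integral (cbox 0 1) (\<lambda>t. t ^ m * h (t *\<^sub>R x))) has_derivative blinfun_apply (integral (cbox 0 1) (fx x))) (at x within ?B)"
    proof (rule leibniz_rule[OF _ _ cfx x convex_ball])
      show "((\<lambda>x. t ^ m * h (t *\<^sub>R x)) has_derivative blinfun_apply (fx y t)) (at y within ?B)" if "y \<in> ?B" "t \<in> cbox 0 1" for y t
        using der[of y t] fx[of y t] that by (simp add: has_derivative_at_withinI)
      show "(\<lambda>t. t ^ m * h (t *\<^sub>R y)) integrable_on cbox 0 1" if "y \<in> ?B" for y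
        using integrable_continuous_real[OF ch[OF that]] by simp
    qed
    moreover have "blinfun_apply (integral (cbox 0 1) (fx x)) = (\<lambda>v. integral {0..1} (\<lambda>t. t ^ Suc m * ?D (t *\<^sub>R x) v))"
    proof
      fix v
      have "continuous_on (cbox 0 1) (fx x)"
      proof (rule continuous_on_blinfun_componentwise)
        fix i :: 'a
        have "continuous_on {0..1} (\<lambda>t. t ^ Suc m * ?D (t *\<^sub>R x) i)"
          by (intro continuous_intros continuous_on_compose2[OF Cinf_derivative(3)[OF Cinf_derivative(2)[OF Suc.prems]]])
            (use inball[OF x] in auto)
        thus "continuous_on (cbox 0 1) (\<lambda>t. blinfun_apply (fx x t) i)"
          by (rule continuous_on_cong[THEN iffD2, rotated -1]) (auto simp: fx[OF x])
      qed
      hence "fx x integrable_on cbox 0 1" by (rule integrable_continuous)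
      from blinfun_apply_integral[OF this, of v]
      have "blinfun_apply (integral (cbox 0 1) (fx x)) v = integral (cbox 0 1) (\<lambda>t. blinfun_apply (fx x t) v)" .
      also have "\<dots> = integral {0..1} (\<lambda>t. t ^ Suc m * ?D (t *\<^sub>R x) v)"
        by (simp, rule integral_cong) (use fx[OF x] in simp)
      finally show "blinfun_apply (integral (cbox 0 1) (fx x)) v = integral {0..1} (\<lambda>t. t ^ Suc m * ?D (t *\<^sub>R x) v)" .
    qed
    ultimately show "((\<lambda>x. integral {0..1} (\<lambda>t. t ^ m * h (t *\<^sub>R x))) has_derivative (\<lambda>v. integral {0..1} (\<lambda>t. t ^ Suc m * ?D (t *\<^sub>R x) v))) (at x)"
      using at_within_open[OF x open_ball] by simp
  next
    fix v
    show "Ck_on k ?B (\<lambda>x. integral {0..1} (\<lambda>t. t ^ Suc m * ?D (t *\<^sub>R x) v))"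
      by (rule Suc.IH[OF Cinf_derivative(2)[OF Suc.prems]])
  qed
qed

text \<open>\<open>g b x\<close> is the integral over \<open>t\<close> of the derivative of
  \<open>f\<close> at \<open>t x\<close> in direction \<open>b\<close>. The lemma will show that a
  derivation is determined by its values on coordinate functions.\<close>

lemma hadamard:
  fixes f :: "'a::euclidean_space \<Rightarrow> real"
  assumes R: "0 < R" and f: "Cinf (ball 0 R) f"
  shows "\<exists>g. (\<forall>b. Cinf (ball 0 R) (g b)) \<and> (\<forall>b. g b 0 = frechet_derivative f (at 0) b) \<and>
    (\<forall>x\<in>ball 0 R. f x = f 0 + (\<Sum>b\<in>Basis. (x \<bullet> b) * g b x))"
proof (intro exI conjI allI ballI)
  let ?D = "\<lambda>y v. frechet_derivative f (at y) v"
  let ?g = "\<lambda>b x. integral {0..1} (\<lambda>t. t ^ 0 * ?D (t *\<^sub>R x) b)"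
  show "Cinf (ball 0 R) (?g b)" for b unfolding Cinf_def using Ck_integral[OF R Cinf_derivative(2)[OF f]] by blast
  show "?g b 0 = ?D 0 b" for b by simp
  fix x :: 'a assume x: "x \<in> ball 0 R"
  have inball: "t *\<^sub>R x \<in> ball 0 R" if "t \<in> {0..1}" for t
  proof -
    have "norm (t *\<^sub>R x) \<le> 1 * norm x" unfolding norm_scaleR using that by (intro mult_right_mono) auto
    thus ?thesis using x by simp
  qed
  have "((\<lambda>t. ?D (t *\<^sub>R x) x) has_integral (f (1 *\<^sub>R x) - f (0 *\<^sub>R x))) {0..1}"
  proof (rule fundamental_theorem_of_calculus)
    fix t :: real assume t: "t \<in> {0..1}"
    note d = Cinf_derivative(1)[OF f inball[OF t]]
    have lin: "linear (?D (t *\<^sub>R x))" using d has_derivative_linear by blast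
    have "((\<lambda>t. t *\<^sub>R x) has_derivative (\<lambda>s. s *\<^sub>R x)) (at t)" by (auto intro!: derivative_eq_intros)
    from has_derivative_compose[OF this d]
    have "((\<lambda>t. f (t *\<^sub>R x)) has_vector_derivative ?D (t *\<^sub>R x) x) (at t)"
      by (simp add: has_vector_derivative_def linear_scale[OF lin])
    thus "((\<lambda>t. f (t *\<^sub>R x)) has_vector_derivative ?D (t *\<^sub>R x) x) (at t within {0..1})"
      by (rule has_vector_derivative_at_within)
  qed simp
  hence "f x = f 0 + integral {0..1} (\<lambda>t. ?D (t *\<^sub>R x) x)" by (simp add: integral_unique)
  also have "integral {0..1} (\<lambda>t. ?D (t *\<^sub>R x) x) = integral {0..1} (\<lambda>t. \<Sum>b\<in>Basis. (x \<bullet> b) * ?D (t *\<^sub>R x) b)"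
  proof (rule integral_cong)
    fix t :: real assume t: "t \<in> {0..1}"
    have lin: "linear (?D (t *\<^sub>R x))" using Cinf_derivative(1)[OF f inball[OF t]] has_derivative_linear by blast
    have "?D (t *\<^sub>R x) x = ?D (t *\<^sub>R x) (\<Sum>b\<in>Basis. (x \<bullet> b) *\<^sub>R b)" by (simp add: euclidean_representation)
    also have "\<dots> = (\<Sum>b\<in>Basis. (x \<bullet> b) * ?D (t *\<^sub>R x) b)" by (simp add: linear_sum[OF lin] linear_scale[OF lin])
    finally show "?D (t *\<^sub>R x) x = (\<Sum>b\<in>Basis. (x \<bullet> b) * ?D (t *\<^sub>R x) b)" .
  qed
  also have "\<dots> = (\<Sum>b\<in>Basis. (x \<bullet> b) * ?g b x)"
  proof -
    have "(\<lambda>t. ?D (t *\<^sub>R x) b) integrable_on {0..1}" for b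
      by (intro integrable_continuous_real continuous_on_compose2[OF Cinf_derivative(3)[OF Cinf_derivative(2)[OF f]]] continuous_intros)
        (use inball in auto)
    thus ?thesis by (simp add: integral_sum integrable_on_mult_right)
  qed
  finally show "f x = f 0 + (\<Sum>b\<in>Basis. (x \<bullet> b) * ?g b x)" .
qed

text \<open>A product rule in which \<open>c\<close> is merely continuous: its increment is
  multiplied by \<open>q\<close>, which is of first order at \<open>x\<close>. This is what allows
  differentiability of an inverse matrix to be deduced from its continuity.\<close>

lemma has_derivative_mult_zero:
  fixes c :: "'a::real_normed_vector \<Rightarrow> real" and q :: "'a \<Rightarrow> 'b::real_normed_vector"
  assumes q: "(q has_derivative q') (at x)" and q0: "q x = 0" and c: "isCont c x"
  shows "((\<lambda>y. c y *\<^sub>R q y) has_derivative (\<lambda>v. c x *\<^sub>R q' v)) (at x)"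
proof -
  have "((\<lambda>y. norm (q y - q' (y - x)) / norm (y - x)) \<longlongrightarrow> 0) (at x)" and bl: "bounded_linear q'"
    using q q0 by (auto simp: has_derivative_at' has_derivative_iff_norm)
  have 1: "((\<lambda>y. c x *\<^sub>R q y) has_derivative (\<lambda>v. c x *\<^sub>R q' v)) (at x)"
    using q by (rule has_derivative_scaleR_right)
  obtain K where K: "\<And>v. norm (q' v) \<le> norm v * K" using bounded_linear.bounded[OF bl] by blast
  have "((\<lambda>y. (c y - c x) *\<^sub>R q y) has_derivative (\<lambda>v. 0)) (at x)"
  proof (rule has_derivativeI_sandwich[of 1])
    let ?e = "\<lambda>y. norm (q y - q' (y - x)) / norm (y - x)"
    have e0: "(?e \<longlongrightarrow> 0) (at x)" using q q0 by (simp add: has_derivative_iff_norm)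
    have "((\<lambda>y. \<bar>c y - c x\<bar>) \<longlongrightarrow> 0) (at x)" using c by (simp add: isCont_def LIM_zero_iff tendsto_rabs_zero_iff)
    from tendsto_mult[OF this tendsto_add[OF e0 tendsto_const[of K]]]
    show "((\<lambda>y. \<bar>c y - c x\<bar> * (?e y + K)) \<longlongrightarrow> 0) (at x)" by simp
    fix y assume "y \<in> UNIV" "y \<noteq> x" "dist y x < 1"
    hence n: "0 < norm (y - x)" by simp
    have "norm (q y) \<le> norm (q y - q' (y - x)) + norm (q' (y - x))" using norm_triangle_sub[of "q y" "q' (y - x)"] by simp
    also have "\<dots> \<le> norm (q y - q' (y - x)) + norm (y - x) * K" using K by simp
    finally have "norm (q y) / norm (y - x) \<le> (norm (q y - q' (y - x)) + norm (y - x) * K) / norm (y - x)"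
      by (rule divide_right_mono) simp
    also have "\<dots> = ?e y + K" using n by (simp add: add_divide_distrib)
    finally have "\<bar>c y - c x\<bar> * (norm (q y) / norm (y - x)) \<le> \<bar>c y - c x\<bar> * (?e y + K)" by (rule mult_left_mono) simp
    thus "norm ((c y - c x) *\<^sub>R q y - (c x - c x) *\<^sub>R q x - 0) / norm (y - x) \<le> \<bar>c y - c x\<bar> * (?e y + K)" by simp
  qed auto
  from has_derivative_add[OF 1 this] show ?thesis by (simp add: scaleR_diff_left)
qed

text \<open>\<open>g' y\<close> is the inverse of \<open>L y\<close>, the derivative of
  \<open>f\<close> at \<open>g y\<close>. The resolvent identity \<open>ident\<close> first yields
  continuity of \<open>g'\<close>, then its differentiability, with a derivative made of
  \<open>g'\<close> and second derivatives of \<open>f\<close> at \<open>g y\<close>; from there on,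
  regularity of \<open>g\<close> and \<open>g'\<close> rises by induction.\<close>

lemma Cinf_inverse:
  fixes f g :: "'a::euclidean_space \<Rightarrow> 'a"
  assumes U: "open U" and V: "open V" and f: "Cinf U f" and gU: "\<And>y. y \<in> V \<Longrightarrow> g y \<in> U"
    and g: "\<And>y. y \<in> V \<Longrightarrow> (g has_derivative g' y) (at y)"
    and inv: "\<And>y u. y \<in> V \<Longrightarrow> frechet_derivative f (at (g y)) (g' y u) = u"
      "\<And>y u. y \<in> V \<Longrightarrow> g' y (frechet_derivative f (at (g y)) u) = u"
  shows "Cinf V g"
proof -
  define L where "L y = frechet_derivative f (at (g y))" for y
  let ?D2 = "\<lambda>y a b. frechet_derivative (\<lambda>x. frechet_derivative f (at x) a) (at (g y)) b"
  have g'bl: "bounded_linear (g' y)" if "y \<in> V" for y using g[OF that] by (rule has_derivative_bounded_linear)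
  have Lder: "((\<lambda>y. L y a) has_derivative (\<lambda>w. ?D2 y a (g' y w))) (at y)" if "y \<in> V" for y a unfolding L_def
    by (rule has_derivative_compose[OF g[OF that] Cinf_derivative(1)[OF Cinf_derivative(2)[OF f] gU[OF that]]])
  have Llin: "linear (L y)" if "y \<in> V" for y
    unfolding L_def using Cinf_derivative(1)[OF f gU[OF that]] has_derivative_linear by blast
  have g'lin: "linear (g' y)" if "y \<in> V" for y using g'bl[OF that] bounded_linear.linear by blast
  have D2lin: "linear (?D2 y a)" if "y \<in> V" for y a
    using Cinf_derivative(1)[OF Cinf_derivative(2)[OF f, of a] gU[OF that]] has_derivative_linear by blast
  have ident: "g' y u = g' y0 u - (\<Sum>b\<in>Basis. (g' y u \<bullet> b) *\<^sub>R g' y0 (L y b - L y0 b))"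
    if y: "y \<in> V" and y0: "y0 \<in> V" for y y0 u
  proof -
    have "linear (\<lambda>v. g' y0 (L y v - L y0 v))"
      using linear_compose[OF linear_compose_sub[OF Llin[OF y] Llin[OF y0]] g'lin[OF y0]] by (simp add: o_def)
    from linear_expand[OF this, of "g' y u"]
    have "(\<Sum>b\<in>Basis. (g' y u \<bullet> b) *\<^sub>R g' y0 (L y b - L y0 b)) = g' y0 u - g' y u"
      using inv(1)[OF y, of u] inv(2)[OF y0, of "g' y u"] by (simp add: linear_diff[OF g'lin[OF y0]] L_def)
    thus ?thesis by simp
  qed
  have cont: "isCont (\<lambda>y. g' y u) y0" if y0: "y0 \<in> V" for y0 u
  proof -
    define s where "s y = (\<Sum>b\<in>Basis. norm (g' y0 (L y b - L y0 b)))" for y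
    have "((\<lambda>y. L y b - L y0 b) \<longlongrightarrow> 0) (at y0)" for b
      using has_derivative_continuous[OF Lder[OF y0, of b]] by (simp add: isCont_def LIM_zero)
    hence "((\<lambda>y. norm (g' y0 (L y b - L y0 b))) \<longlongrightarrow> 0) (at y0)" for b
      using bounded_linear.tendsto_zero[OF g'bl[OF y0]] tendsto_norm_zero by blast
    hence s0: "(s \<longlongrightarrow> 0) (at y0)" unfolding s_def by (intro tendsto_null_sum)
    have Vev: "eventually (\<lambda>y. y \<in> V) (at y0)" using V y0 by (simp add: eventually_at_topological) blast
    have est: "norm (g' y u - g' y0 u) \<le> norm (g' y u) * s y" if y: "y \<in> V" for y
    proof -
      have "norm (g' y u - g' y0 u) = norm (\<Sum>b\<in>Basis. (g' y u \<bullet> b) *\<^sub>R g' y0 (L y b - L y0 b))"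
        using ident[OF y y0, of u] by (metis add_diff_cancel_left' diff_add_cancel norm_minus_commute)
      also have "\<dots> \<le> (\<Sum>b\<in>Basis. norm (g' y u) * norm (g' y0 (L y b - L y0 b)))"
        by (rule order_trans[OF norm_sum sum_mono]) (auto intro!: mult_right_mono Basis_le_norm)
      finally show ?thesis by (simp add: s_def sum_distrib_left)
    qed
    have "eventually (\<lambda>y. s y < 1/2) (at y0)" using order_tendstoD(2)[OF s0, of "1/2"] by simp
    with Vev have "eventually (\<lambda>y. norm (g' y u - g' y0 u) \<le> 2 * norm (g' y0 u) * s y) (at y0)"
    proof eventually_elim
      case (elim y)
      have s: "0 \<le> s y" by (simp add: s_def sum_nonneg)
      have "norm (g' y u) * s y \<le> norm (g' y u) * (1/2)" using elim(2) by (intro mult_left_mono) auto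
      hence "norm (g' y u) \<le> 2 * norm (g' y0 u)"
        using est[OF elim(1)] norm_triangle_sub[of "g' y u" "g' y0 u"] by linarith
      hence "norm (g' y u) * s y \<le> 2 * norm (g' y0 u) * s y" using s by (rule mult_right_mono)
      thus ?case using est[OF elim(1)] by linarith
    qed
    moreover have "((\<lambda>y. 2 * norm (g' y0 u) * s y) \<longlongrightarrow> 0) (at y0)" using tendsto_mult_right_zero[OF s0] .
    ultimately have "((\<lambda>y. g' y u - g' y0 u) \<longlongrightarrow> 0) (at y0)" by (rule Lim_null_comparison)
    thus ?thesis by (simp add: isCont_def LIM_zero_cancel)
  qed
  have der: "((\<lambda>y. g' y u) has_derivative (\<lambda>w. - (\<Sum>b\<in>Basis. (g' y0 u \<bullet> b) *\<^sub>R g' y0 (?D2 y0 b (g' y0 w))))) (at y0)"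
    if y0: "y0 \<in> V" for y0 u
  proof -
    have "((\<lambda>y. (g' y u \<bullet> b) *\<^sub>R g' y0 (L y b - L y0 b)) has_derivative
       (\<lambda>w. (g' y0 u \<bullet> b) *\<^sub>R g' y0 (?D2 y0 b (g' y0 w)))) (at y0)" for b
    proof (rule has_derivative_mult_zero)
      show "((\<lambda>y. g' y0 (L y b - L y0 b)) has_derivative (\<lambda>w. g' y0 (?D2 y0 b (g' y0 w)))) (at y0)"
        by (rule bounded_linear.has_derivative[OF g'bl[OF y0]])
          (use has_derivative_diff[OF Lder[OF y0, of b] has_derivative_const] in simp)
      show "g' y0 (L y0 b - L y0 b) = 0" using linear_0[OF bounded_linear.linear[OF g'bl[OF y0]]] by simp
      show "isCont (\<lambda>y. g' y u \<bullet> b) y0" using cont[OF y0] by (intro continuous_intros)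
    qed
    from has_derivative_diff[OF has_derivative_const[of "g' y0 u"] has_derivative_sum[of Basis, OF this]]
    have "((\<lambda>y. g' y0 u - (\<Sum>b\<in>Basis. (g' y u \<bullet> b) *\<^sub>R g' y0 (L y b - L y0 b))) has_derivative
      (\<lambda>w. - (\<Sum>b\<in>Basis. (g' y0 u \<bullet> b) *\<^sub>R g' y0 (?D2 y0 b (g' y0 w))))) (at y0)" by simp
    thus ?thesis by (rule has_derivative_transform_within_open[OF _ V y0]) (use ident[OF _ y0, of _ u] in simp)
  qed
  have main: "Ck_on k V g \<and> (\<forall>u. Ck_on k V (\<lambda>y. g' y u))" for k
  proof (induction k)
    case 0
    have "isCont g y" if "y \<in> V" for y using has_derivative_continuous[OF g[OF that]] .
    thus ?case using cont by (simp add: continuous_at_imp_continuous_on)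
  next
    case (Suc k)
    have 1: "Ck_on (Suc k) V g" by (rule Ck_SucI[OF V g]) (use Suc in auto)
    have "Ck_on (Suc k) V (\<lambda>y. g' y u)" for u
    proof (rule Ck_SucI[OF V der])
      fix w
      have D2C: "Ck_on k V (\<lambda>y. ?D2 y b c)" for b c
        by (rule Ck_comp[OF V, where V = U]) (use gU Suc Cinf_derivative(2)[OF Cinf_derivative(2)[OF f]] in \<open>auto simp: Cinf_def\<close>)
      have gC: "Ck_on k V (\<lambda>y. g' y u)" for u using Suc by blast
      have "Ck_on k V (\<lambda>y. g' y (?D2 y b (g' y w)))" for b
        by (rule Ck_apply[OF V g'lin gC Ck_apply[OF V D2lin D2C gC]])
      thus "Ck_on k V (\<lambda>y. - (\<Sum>b\<in>Basis. (g' y u \<bullet> b) *\<^sub>R g' y (?D2 y b (g' y w))))"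
        by (intro Ck_linear_comp[OF V bounded_linear_minus[OF bounded_linear_ident]] Ck_sum[OF V]
            Ck_bilinear[OF V bounded_bilinear_scaleR] Ck_linear_comp[OF V bounded_linear_inner_left] gC)
    qed
    thus ?case using 1 by blast
  qed
  thus ?thesis by (simp add: Cinf_def)
qed

lemma smooth_local_inverse:
  fixes f :: "'a::euclidean_space \<Rightarrow> 'a"
  assumes U: "open U" "0 \<in> U" and f: "Cinf U f" and f0: "f 0 = 0" and d: "(f has_derivative (\<lambda>v. v)) (at 0)"
  shows "\<exists>U' V g. open U' \<and> U' \<subseteq> U \<and> 0 \<in> U' \<and> open V \<and> 0 \<in> V \<and> homeomorphism U' V f g \<and> Cinf V g"
proof -
  define f' where "f' x = Blinfun (frechet_derivative f (at x))" for x
  have f': "blinfun_apply (f' x) = frechet_derivative f (at x)" if "x \<in> U" for x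
    unfolding f'_def by (rule bounded_linear_Blinfun_apply) (rule has_derivative_bounded_linear[OF Cinf_derivative(1)[OF f that]])
  have cont: "continuous_on U f'"
  proof (rule continuous_on_blinfun_componentwise)
    fix i :: 'a
    show "continuous_on U (\<lambda>x. blinfun_apply (f' x) i)"
      by (rule continuous_on_eq[OF Cinf_derivative(3)[OF Cinf_derivative(2)[OF f, of i]]]) (simp add: f')
  qed
  have id: "f' 0 = id_blinfun" by (rule blinfun_eqI) (simp add: f'[OF U(2)] frechet_eq[OF d])
  have fd: "(f has_derivative blinfun_apply (f' x)) (at x)" if "x \<in> U" for x
    using Cinf_derivative(1)[OF f that] f'[OF that] by simp
  obtain U' V g g' where *: "open U'" "U' \<subseteq> U" "0 \<in> U'" "open V" "0 \<in> V" "homeomorphism U' V f g"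
    "\<And>y. y \<in> V \<Longrightarrow> (g has_derivative (g' y)) (at y)"
    "\<And>y. y \<in> V \<Longrightarrow> g' y = inv_into UNIV (blinfun_apply (f'(g y)))"
    "\<And>y. y \<in> V \<Longrightarrow> bij (blinfun_apply (f'(g y)))"
    using inverse_function_theorem_scaled[OF U(1) fd cont U(2) f0 id] by metis
  have gU: "g y \<in> U" if "y \<in> V" for y using *(2,6) that by (auto simp: homeomorphism_def)
  have "Cinf V g"
  proof (rule Cinf_inverse[OF U(1) *(4) f gU *(7)])
    fix y u assume y: "y \<in> V"
    note b = *(9)[OF y, unfolded f'[OF gU[OF y]]] and e = *(8)[OF y, unfolded f'[OF gU[OF y]]]
    show "frechet_derivative f (at (g y)) (g' y u) = u" unfolding e using b by (simp add: bij_is_surj surj_f_inv_f)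
    show "g' y (frechet_derivative f (at (g y)) u) = u" unfolding e using b by (simp add: bij_is_inj)
  qed
  thus ?thesis using *(1-6) by blast
qed

section \<open>Smooth families of points of a manifold\<close>

text \<open>Smoothness of a map from an open set of a Euclidean space into \<open>M\<close>. Group
  operations and smooth functions are handled by their action on such families, so that derivatives
  are only ever taken on open subsets of a Euclidean space.\<close>

definition msmooth :: "('a, 'e::euclidean_space) manifold \<Rightarrow> 'x::euclidean_space set \<Rightarrow> ('x \<Rightarrow> 'a) \<Rightarrow> bool" where
  "msmooth M \<Omega> a \<longleftrightarrow> open \<Omega> \<and> continuous_map (top_of_set \<Omega>) (mtop M) a \<and>
     (\<forall>(V, \<psi>)\<in>atlas M. Cinf (\<Omega> \<inter> a -` V) (\<lambda>x. \<psi> (a x)))"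

lemma smooth_manifoldD:
  assumes "smooth_manifold M"
  shows "Hausdorff_space (mtop M)" "second_countable (mtop M)" "subspace (model M)"
    "topspace (mtop M) = (\<Union>c\<in>atlas M. fst c)" using assms by (auto simp: smooth_manifold_def)

lemma chart_at:
  assumes "smooth_manifold M" "p \<in> topspace (mtop M)"
  obtains U \<phi> where "(U, \<phi>) \<in> atlas M" "p \<in> U" using assms(2) unfolding smooth_manifoldD(4)[OF assms(1)] by force

lemma chart:
  assumes sm: "smooth_manifold M" and c: "(U, \<phi>) \<in> atlas M"
  shows "openin (mtop M) U" "U \<subseteq> topspace (mtop M)" "openin (top_of_set (model M)) (\<phi> ` U)" "\<phi> ` U \<subseteq> model M"
    "homeomorphic_map (subtopology (mtop M) U) (top_of_set (\<phi> ` U)) \<phi>" "inj_on \<phi> U"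
    "continuous_map (subtopology (mtop M) U) (top_of_set (\<phi> ` U)) \<phi>"
    "continuous_map (top_of_set (\<phi> ` U)) (mtop M) (inv_into U \<phi>)"
proof -
  have "is_chart (mtop M) (model M) (U, \<phi>)" using sm c by (auto simp: smooth_manifold_def)
  thus 1: "openin (mtop M) U" and 2: "openin (top_of_set (model M)) (\<phi> ` U)"
    and 3: "homeomorphic_map (subtopology (mtop M) U) (top_of_set (\<phi> ` U)) \<phi>" by (auto simp: is_chart_def)
  show U: "U \<subseteq> topspace (mtop M)" using openin_subset[OF 1] .
  show "\<phi> ` U \<subseteq> model M" using openin_imp_subset[OF 2] .
  have ts: "topspace (subtopology (mtop M) U) = U" using U by auto
  show inj: "inj_on \<phi> U" using homeomorphic_imp_injective_map[OF 3] unfolding ts .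
  show "continuous_map (subtopology (mtop M) U) (top_of_set (\<phi> ` U)) \<phi>" by (rule homeomorphic_imp_continuous_map[OF 3])
  obtain g where g: "homeomorphic_maps (subtopology (mtop M) U) (top_of_set (\<phi> ` U)) \<phi> g"
    using 3 homeomorphic_map_maps by blast
  have "continuous_map (top_of_set (\<phi> ` U)) (subtopology (mtop M) U) (inv_into U \<phi>)"
  proof (rule continuous_map_eq)
    show "continuous_map (top_of_set (\<phi> ` U)) (subtopology (mtop M) U) g" using g by (simp add: homeomorphic_maps_def)
    fix y assume "y \<in> topspace (top_of_set (\<phi> ` U))"
    then obtain x where x: "x \<in> U" "y = \<phi> x" by auto
    have "g (\<phi> x) = x" using g x ts by (auto simp: homeomorphic_maps_def)
    thus "g y = inv_into U \<phi> y" using x inj by simp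
  qed
  thus "continuous_map (top_of_set (\<phi> ` U)) (mtop M) (inv_into U \<phi>)" by (rule continuous_map_into_fulltopology)
qed

lemma chart_inv:
  assumes sm: "smooth_manifold M" and c: "(U, \<phi>) \<in> atlas M"
  shows "x \<in> U \<Longrightarrow> inv_into U \<phi> (\<phi> x) = x" "y \<in> \<phi> ` U \<Longrightarrow> inv_into U \<phi> y \<in> U" "y \<in> \<phi> ` U \<Longrightarrow> \<phi> (inv_into U \<phi> y) = y"
  using chart(6)[OF sm c] by (auto intro: inv_into_into f_inv_into_f)

lemma chart_open_image:
  assumes sm: "smooth_manifold M" and c: "(U, \<phi>) \<in> atlas M" and O: "openin (mtop M) O'"
  shows "openin (top_of_set (model M)) (\<phi> ` (U \<inter> O'))"
proof -
  have "openin (subtopology (mtop M) U) (U \<inter> O')" using O by (auto simp: openin_subtopology)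
  hence "openin (top_of_set (\<phi> ` U)) (\<phi> ` (U \<inter> O'))"
    using homeomorphic_imp_open_map[OF chart(5)[OF sm c]] by (simp add: open_map_def)
  thus ?thesis using chart(3)[OF sm c] by (rule openin_trans)
qed

lemma transition:
  assumes "smooth_manifold M" "(U, \<phi>) \<in> atlas M" "(V, \<psi>) \<in> atlas M"
  shows "smooth_on (\<phi> ` (U \<inter> V)) (\<lambda>x. \<psi> (inv_into U \<phi> x))"
  using assms by (fastforce simp: smooth_manifold_def o_def)

lemma open_preimage:
  assumes "open \<Omega>" "continuous_map (top_of_set \<Omega>) T a" "openin T V"
  shows "open (\<Omega> \<inter> a -` V)"
proof -
  have "openin (top_of_set \<Omega>) {x \<in> topspace (top_of_set \<Omega>). a x \<in> V}" by (rule openin_continuous_map_preimage[OF assms(2,3)])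
  moreover have "{x \<in> topspace (top_of_set \<Omega>). a x \<in> V} = \<Omega> \<inter> a -` V" by auto
  ultimately show ?thesis using assms(1) openin_open_eq by fastforce
qed

lemma msmoothD:
  assumes "msmooth M \<Omega> a"
  shows "open \<Omega>" "continuous_map (top_of_set \<Omega>) (mtop M) a" "(V, \<psi>) \<in> atlas M \<Longrightarrow> Cinf (\<Omega> \<inter> a -` V) (\<lambda>x. \<psi> (a x))"
    "x \<in> \<Omega> \<Longrightarrow> a x \<in> topspace (mtop M)" "openin (mtop M) O' \<Longrightarrow> open (\<Omega> \<inter> a -` O')"
proof -
  show 1: "open \<Omega>" "continuous_map (top_of_set \<Omega>) (mtop M) a" using assms by (auto simp: msmooth_def)
  show "(V, \<psi>) \<in> atlas M \<Longrightarrow> Cinf (\<Omega> \<inter> a -` V) (\<lambda>x. \<psi> (a x))" using assms unfolding msmooth_def by blast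
  show "x \<in> \<Omega> \<Longrightarrow> a x \<in> topspace (mtop M)" using funcset_mem[OF continuous_map_funspace[OF 1(2)]] by simp
  show "openin (mtop M) O' \<Longrightarrow> open (\<Omega> \<inter> a -` O')" by (rule open_preimage[OF 1])
qed

text \<open>One chart around each value suffices: the transition maps carry smoothness to all other
  charts, and continuity follows since charts are homeomorphisms onto open subsets of the
  model.\<close>

lemma msmoothI:
  assumes sm: "smooth_manifold M" and \<Omega>: "open \<Omega>"
    and loc: "\<And>x. x \<in> \<Omega> \<Longrightarrow> \<exists>V \<psi> W. (V, \<psi>) \<in> atlas M \<and> open W \<and> x \<in> W \<and> W \<subseteq> \<Omega> \<and> (\<forall>y\<in>W. a y \<in> V) \<and> Cinf W (\<lambda>y. \<psi> (a y))"
  shows "msmooth M \<Omega> a"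
proof -
  have cont: "continuous_map (top_of_set \<Omega>) (mtop M) a" unfolding continuous_map_def
  proof (intro conjI allI impI)
    show "a \<in> topspace (top_of_set \<Omega>) \<rightarrow> topspace (mtop M)" using loc chart(2)[OF sm] by fastforce
    fix O' assume O': "openin (mtop M) O'"
    have "\<exists>S. open S \<and> x \<in> S \<and> S \<subseteq> {x \<in> \<Omega>. a x \<in> O'}" if x: "x \<in> \<Omega>" "a x \<in> O'" for x
    proof -
      obtain V \<psi> W where c: "(V, \<psi>) \<in> atlas M" and W: "open W" "x \<in> W" "W \<subseteq> \<Omega>" "\<forall>y\<in>W. a y \<in> V" "Cinf W (\<lambda>y. \<psi> (a y))"
        using loc[OF x(1)] by blast
      obtain B where B: "open B" "\<psi> ` (V \<inter> O') = model M \<inter> B"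
        using chart_open_image[OF sm c O'] by (auto simp: openin_open)
      let ?S = "W \<inter> (\<lambda>y. \<psi> (a y)) -` B"
      have "open ?S" by (rule continuous_open_preimage[OF Cinf_derivative(3)[OF W(5)] W(1) B(1)])
      moreover have "x \<in> ?S" using W x B by blast
      moreover have "?S \<subseteq> {x \<in> \<Omega>. a x \<in> O'}"
      proof
        fix y assume y: "y \<in> ?S"
        hence "a y \<in> V" using W by blast
        hence "\<psi> (a y) \<in> \<psi> ` (V \<inter> O')" using y B(2) chart(4)[OF sm c] by blast
        hence "a y \<in> O'" using \<open>a y \<in> V\<close> chart(6)[OF sm c] by (auto dest: inj_onD)
        thus "y \<in> {x \<in> \<Omega>. a x \<in> O'}" using y W(3) by blast
      qed
      ultimately show ?thesis by blast
    qed
    hence "open {x \<in> \<Omega>. a x \<in> O'}" by (subst open_subopen) blast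
    thus "openin (top_of_set \<Omega>) {x \<in> topspace (top_of_set \<Omega>). a x \<in> O'}" by (intro open_subset) auto
  qed
  have "Cinf (\<Omega> \<inter> a -` V') (\<lambda>x. \<psi>' (a x))" if c': "(V', \<psi>') \<in> atlas M" for V' \<psi>'
  proof (rule Cinf_local)
    fix x assume x: "x \<in> \<Omega> \<inter> a -` V'"
    then obtain V \<psi> W where c: "(V, \<psi>) \<in> atlas M" and W: "open W" "x \<in> W" "W \<subseteq> \<Omega>" "\<forall>y\<in>W. a y \<in> V" "Cinf W (\<lambda>y. \<psi> (a y))"
      using loc by blast
    let ?W = "W \<inter> (\<Omega> \<inter> a -` V')"
    have oW: "open ?W" using W(1) open_preimage[OF \<Omega> cont chart(1)[OF sm c']] by blast
    have "Cinf ?W (\<lambda>y. \<psi>' (inv_into V \<psi> (\<psi> (a y))))"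
      by (rule smooth_on_comp[OF transition[OF sm c c'] oW _ Cinf_subset[OF _ W(5)]]) (use W(4) in auto)
    hence "Cinf ?W (\<lambda>y. \<psi>' (a y))" by (rule Cinf_cong[OF oW, rotated]) (use W(4) chart_inv(1)[OF sm c] in auto)
    thus "\<exists>V. open V \<and> x \<in> V \<and> Cinf V (\<lambda>x. \<psi>' (a x))" using oW W(2) x by blast
  qed
  thus ?thesis using cont \<Omega> by (auto simp: msmooth_def)
qed

lemma msmooth_chart_inv:
  assumes sm: "smooth_manifold M" and c: "(U, \<phi>) \<in> atlas M"
  shows "msmooth M (oproj (model M) -` (\<phi> ` U)) (\<lambda>x. inv_into U \<phi> (oproj (model M) x))"
proof -
  have o: "open (oproj (model M) -` (\<phi> ` U))" by (rule open_vimage_oproj[OF smooth_manifoldD(3)[OF sm] chart(3)[OF sm c]])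
  have "Cinf (oproj (model M) -` (\<phi> ` U)) (\<lambda>y. \<phi> (inv_into U \<phi> (oproj (model M) y)))"
    by (rule Cinf_cong[OF o _ Cinf_oproj[OF o, of "model M"]]) (auto simp: chart_inv(3)[OF sm c])
  thus ?thesis
    by (intro msmoothI[OF sm o] exI[of _ U] exI[of _ \<phi>] exI[of _ "oproj (model M) -` (\<phi> ` U)"] conjI c o ballI)
      (auto intro: chart_inv(2)[OF sm c])
qed

lemma msmooth_const:
  assumes sm: "smooth_manifold M" and p: "p \<in> topspace (mtop M)" and \<Omega>: "open \<Omega>"
  shows "msmooth M \<Omega> (\<lambda>x. p)"
proof -
  obtain U \<phi> where c: "(U, \<phi>) \<in> atlas M" "p \<in> U" using chart_at[OF sm p] .
  show ?thesis
    by (intro msmoothI[OF sm \<Omega>] exI[of _ U] exI[of _ \<phi>] exI[of _ \<Omega>]) (use c \<Omega> in \<open>auto intro: Cinf_const\<close>)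
qed

lemma msmooth_precomp:
  assumes sm: "smooth_manifold M" and a: "msmooth M \<Omega> a" and \<Omega>': "open \<Omega>'" and g: "Cinf \<Omega>' g" "\<And>x. x \<in> \<Omega>' \<Longrightarrow> g x \<in> \<Omega>"
  shows "msmooth M \<Omega>' (\<lambda>x. a (g x))"
proof (rule msmoothI[OF sm \<Omega>'])
  fix x assume x: "x \<in> \<Omega>'"
  obtain V \<psi> where c: "(V, \<psi>) \<in> atlas M" "a (g x) \<in> V" using chart_at[OF sm msmoothD(4)[OF a g(2)[OF x]]] .
  let ?W = "\<Omega>' \<inter> g -` (\<Omega> \<inter> a -` V)"
  have W: "open ?W"
    by (rule continuous_open_preimage[OF Cinf_derivative(3)[OF g(1)] \<Omega>' msmoothD(5)[OF a chart(1)[OF sm c(1)]]])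
  have "Cinf ?W (\<lambda>y. \<psi> (a (g y)))" by (rule Cinf_comp[OF W _ Cinf_subset[OF _ g(1)] msmoothD(3)[OF a c(1)]]) auto
  thus "\<exists>V \<psi> W. (V, \<psi>) \<in> atlas M \<and> open W \<and> x \<in> W \<and> W \<subseteq> \<Omega>' \<and> (\<forall>y\<in>W. a (g y) \<in> V) \<and> Cinf W (\<lambda>y. \<psi> (a (g y)))"
    by (intro exI[of _ V] exI[of _ \<psi>] exI[of _ ?W] conjI c W) (use x c g in auto)
qed

lemma msmooth_subset:
  "smooth_manifold M \<Longrightarrow> msmooth M \<Omega> a \<Longrightarrow> open \<Omega>' \<Longrightarrow> \<Omega>' \<subseteq> \<Omega> \<Longrightarrow> msmooth M \<Omega>' a"
  using msmooth_precomp[of M \<Omega> a \<Omega>' "\<lambda>x. x"] Cinf_id by blast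

lemma msmooth_comp:
  assumes sM: "smooth_manifold M" and sN: "smooth_manifold N" and f: "smooth_map M N f" and a: "msmooth M \<Omega> a"
  shows "msmooth N \<Omega> (\<lambda>x. f (a x))"
proof (rule msmoothI[OF sN msmoothD(1)[OF a]])
  have cf: "continuous_map (mtop M) (mtop N) f" using f by (simp add: smooth_map_def)
  have cfa: "continuous_map (top_of_set \<Omega>) (mtop N) (\<lambda>x. f (a x))"
    using continuous_map_compose[OF msmoothD(2)[OF a] cf] by (simp add: o_def)
  fix x assume x: "x \<in> \<Omega>"
  obtain U \<phi> where c: "(U, \<phi>) \<in> atlas M" "a x \<in> U" using chart_at[OF sM msmoothD(4)[OF a x]] .
  have "f (a x) \<in> topspace (mtop N)" using funcset_mem[OF continuous_map_funspace[OF cf] msmoothD(4)[OF a x]] .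
  then obtain V \<psi> where d: "(V, \<psi>) \<in> atlas N" "f (a x) \<in> V" using chart_at[OF sN] by blast
  let ?W = "(\<Omega> \<inter> a -` U) \<inter> (\<Omega> \<inter> (\<lambda>x. f (a x)) -` V)"
  have W: "open ?W" using msmoothD(5)[OF a chart(1)[OF sM c(1)]] open_preimage[OF msmoothD(1)[OF a] cfa chart(1)[OF sN d(1)]] by blast
  have "smooth_on (\<phi> ` (U \<inter> f -` V)) (\<psi> \<circ> f \<circ> inv_into U \<phi>)"
    using f c(1) d(1) unfolding smooth_map_def by fastforce
  from smooth_on_comp[OF this W _ Cinf_subset[OF _ msmoothD(3)[OF a c(1)]]]
  have "Cinf ?W (\<lambda>y. (\<psi> \<circ> f \<circ> inv_into U \<phi>) (\<phi> (a y)))" by auto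
  hence "Cinf ?W (\<lambda>y. \<psi> (f (a y)))" by (rule Cinf_cong[OF W, rotated]) (auto simp: chart_inv(1)[OF sM c(1)])
  thus "\<exists>V \<psi> W. (V, \<psi>) \<in> atlas N \<and> open W \<and> x \<in> W \<and> W \<subseteq> \<Omega> \<and> (\<forall>y\<in>W. f (a y) \<in> V) \<and> Cinf W (\<lambda>y. \<psi> (f (a y)))"
    by (intro exI[of _ V] exI[of _ \<psi>] exI[of _ ?W] conjI d W) (use x c d in auto)
qed

lemma msmooth_comp2:
  assumes sM: "smooth_manifold M" and sM': "smooth_manifold M'" and sN: "smooth_manifold N"
    and f: "smooth_map (prod_manifold M M') N f" and a: "msmooth M \<Omega> a" and b: "msmooth M' \<Omega> b"
  shows "msmooth N \<Omega> (\<lambda>x. f (a x, b x))"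
proof (rule msmoothI[OF sN msmoothD(1)[OF a]])
  have cf: "continuous_map (prod_topology (mtop M) (mtop M')) (mtop N) f" using f by (simp add: smooth_map_def prod_manifold_def)
  have cfa: "continuous_map (top_of_set \<Omega>) (mtop N) (\<lambda>x. f (a x, b x))"
    using continuous_map_compose[OF continuous_map_pairedI[OF msmoothD(2)[OF a] msmoothD(2)[OF b]] cf] by (simp add: o_def)
  fix x assume x: "x \<in> \<Omega>"
  obtain U \<phi> where c: "(U, \<phi>) \<in> atlas M" "a x \<in> U" using chart_at[OF sM msmoothD(4)[OF a x]] .
  obtain U' \<phi>' where c': "(U', \<phi>') \<in> atlas M'" "b x \<in> U'" using chart_at[OF sM' msmoothD(4)[OF b x]] .
  have "f (a x, b x) \<in> topspace (mtop N)" using funcset_mem[OF continuous_map_funspace[OF cfa]] x by simp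
  then obtain V \<psi> where d: "(V, \<psi>) \<in> atlas N" "f (a x, b x) \<in> V" using chart_at[OF sN] by blast
  let ?W = "(\<Omega> \<inter> a -` U) \<inter> (\<Omega> \<inter> b -` U') \<inter> (\<Omega> \<inter> (\<lambda>x. f (a x, b x)) -` V)"
  have W: "open ?W" using msmoothD(5)[OF a chart(1)[OF sM c(1)]] msmoothD(5)[OF b chart(1)[OF sM' c'(1)]]
      open_preimage[OF msmoothD(1)[OF a] cfa chart(1)[OF sN d(1)]] by blast
  let ?P = "map_prod \<phi> \<phi>'"
  have inj: "inj_on ?P (U \<times> U')" using chart(6)[OF sM c(1)] chart(6)[OF sM' c'(1)] by (auto simp: inj_on_def)
  have "(U \<times> U', ?P) \<in> atlas (prod_manifold M M')" using c c' by (auto simp: prod_manifold_def)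
  hence 1: "smooth_on (?P ` ((U \<times> U') \<inter> f -` V)) (\<psi> \<circ> f \<circ> inv_into (U \<times> U') ?P)"
    using f d(1) unfolding smooth_map_def by fastforce
  have 2: "Cinf ?W (\<lambda>y. (\<phi> (a y), \<phi>' (b y)))"
    by (intro Cinf_Pair[OF W] Cinf_subset[OF _ msmoothD(3)[OF a c(1)]] Cinf_subset[OF _ msmoothD(3)[OF b c'(1)]]) auto
  have 3: "(\<phi> (a y), \<phi>' (b y)) \<in> ?P ` ((U \<times> U') \<inter> f -` V)" if "y \<in> ?W" for y
    using that by (intro image_eqI[of _ _ "(a y, b y)"]) auto
  from smooth_on_comp[OF 1 W 3 2] have "Cinf ?W (\<lambda>y. \<psi> (f (a y, b y)))"
  proof (rule Cinf_cong[OF W, rotated])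
    fix y assume "y \<in> ?W"
    hence "inv_into (U \<times> U') ?P (?P (a y, b y)) = (a y, b y)" by (intro inv_into_f_f[OF inj]) auto
    thus "(\<psi> \<circ> f \<circ> inv_into (U \<times> U') ?P) (\<phi> (a y), \<phi>' (b y)) = \<psi> (f (a y, b y))" by simp
  qed
  thus "\<exists>V \<psi> W. (V, \<psi>) \<in> atlas N \<and> open W \<and> x \<in> W \<and> W \<subseteq> \<Omega> \<and> (\<forall>y\<in>W. f (a y, b y) \<in> V) \<and> Cinf W (\<lambda>y. \<psi> (f (a y, b y)))"
    by (intro exI[of _ V] exI[of _ \<psi>] exI[of _ ?W] conjI d W) (use x c c' d in auto)
qed

section \<open>Smooth functions and point derivations\<close>

lemma smooth_fun_msmooth:
  assumes sM: "smooth_manifold M" and f: "smooth_fun M f" and a: "msmooth M \<Omega> a"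
  shows "Cinf \<Omega> (\<lambda>x. f (a x))"
proof (rule Cinf_local)
  fix x assume x: "x \<in> \<Omega>"
  obtain U \<phi> where c: "(U, \<phi>) \<in> atlas M" "a x \<in> U" using chart_at[OF sM msmoothD(4)[OF a x]] .
  let ?W = "\<Omega> \<inter> a -` U"
  have W: "open ?W" by (rule msmoothD(5)[OF a chart(1)[OF sM c(1)]])
  have "smooth_on (\<phi> ` U) (f \<circ> inv_into U \<phi>)" using f c unfolding smooth_fun_def by blast
  from smooth_on_comp[OF this W _ msmoothD(3)[OF a c(1)]]
  have "Cinf ?W (\<lambda>y. (f \<circ> inv_into U \<phi>) (\<phi> (a y)))" by auto
  hence "Cinf ?W (\<lambda>y. f (a y))" by (rule Cinf_cong[OF W, rotated]) (auto simp: chart_inv(1)[OF sM c(1)])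
  thus "\<exists>V. open V \<and> x \<in> V \<and> Cinf V (\<lambda>x. f (a x))" using W x c by blast
qed

lemma smooth_funI:
  assumes sM: "smooth_manifold M"
    and f: "\<And>U \<phi>. (U, \<phi>) \<in> atlas M \<Longrightarrow> Cinf (oproj (model M) -` (\<phi> ` U)) (\<lambda>x. f (inv_into U \<phi> (oproj (model M) x)))"
  shows "smooth_fun M f" unfolding smooth_fun_def
proof clarify
  fix U \<phi> assume c: "(U, \<phi>) \<in> atlas M"
  show "smooth_on (\<phi> ` U) (f \<circ> inv_into U \<phi>)"
    by (rule Cinf_smooth_on[OF smooth_manifoldD(3)[OF sM] chart(3)[OF sM c]]) (use f[OF c] in simp)
qed

lemma smooth_fun_chart:
  assumes "smooth_manifold M" "smooth_fun M f" "(U, \<phi>) \<in> atlas M"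
  shows "Cinf (oproj (model M) -` (\<phi> ` U)) (\<lambda>x. f (inv_into U \<phi> (oproj (model M) x)))"
  by (rule smooth_fun_msmooth[OF assms(1,2) msmooth_chart_inv[OF assms(1,3)]])

lemma smooth_fun_const: "smooth_manifold M \<Longrightarrow> smooth_fun M (\<lambda>x. c)"
  by (rule smooth_funI) (simp_all add: Cinf_const)

lemma smooth_fun_add:
  assumes sM: "smooth_manifold M" and "smooth_fun M f" "smooth_fun M g"
  shows "smooth_fun M (\<lambda>x. f x + g x)"
proof (rule smooth_funI[OF sM])
  fix U \<phi> assume c: "(U, \<phi>) \<in> atlas M"
  show "Cinf (oproj (model M) -` (\<phi> ` U)) (\<lambda>x. f (inv_into U \<phi> (oproj (model M) x)) + g (inv_into U \<phi> (oproj (model M) x)))"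
    by (intro Cinf_add[OF msmoothD(1)[OF msmooth_chart_inv[OF sM c]]] smooth_fun_chart[OF sM _ c] assms(2,3))
qed

lemma smooth_fun_mult:
  assumes sM: "smooth_manifold M" and "smooth_fun M f" "smooth_fun M g"
  shows "smooth_fun M (\<lambda>x. f x * g x)"
proof (rule smooth_funI[OF sM])
  fix U \<phi> assume c: "(U, \<phi>) \<in> atlas M"
  show "Cinf (oproj (model M) -` (\<phi> ` U)) (\<lambda>x. f (inv_into U \<phi> (oproj (model M) x)) * g (inv_into U \<phi> (oproj (model M) x)))"
    by (intro Cinf_bilinear[OF msmoothD(1)[OF msmooth_chart_inv[OF sM c]] bounded_bilinear_mult] smooth_fun_chart[OF sM _ c] assms(2,3))
qed

lemma smooth_fun_lincomb:
  "smooth_manifold M \<Longrightarrow> smooth_fun M f \<Longrightarrow> smooth_fun M g \<Longrightarrow> smooth_fun M (\<lambda>x. a * f x + b * g x)"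
  by (intro smooth_fun_add smooth_fun_mult smooth_fun_const)

lemma smooth_fun_sum:
  "smooth_manifold M \<Longrightarrow> (\<And>i. i \<in> I \<Longrightarrow> smooth_fun M (f i)) \<Longrightarrow> smooth_fun M (\<lambda>x. \<Sum>i\<in>I. f i x)"
  by (induction I rule: infinite_finite_induct) (auto intro: smooth_fun_const smooth_fun_add)

lemma smooth_fun_comp:
  assumes sM: "smooth_manifold M" and sN: "smooth_manifold N" and f: "smooth_map M N f" and h: "smooth_fun N h"
  shows "smooth_fun M (\<lambda>x. h (f x))"
  by (rule smooth_funI[OF sM]) (rule smooth_fun_msmooth[OF sN h msmooth_comp[OF sM sN f msmooth_chart_inv[OF sM]]])

text \<open>Outside the set \<open>?K\<close>, the preimage of the closed ball, the function is
  zero. \<open>?K\<close> is compact and so closed by the Hausdorff property, which makes the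
  extension by zero smooth at points outside the chart.\<close>

lemma smooth_fun_localized:
  assumes sM: "smooth_manifold M" and c: "(U, \<phi>) \<in> atlas M" and R: "0 < R" and ball: "model M \<inter> cball p R \<subseteq> \<phi> ` U"
    and h: "Cinf (oproj (model M) -` (\<phi> ` U)) h"
  shows "smooth_fun M (\<lambda>x. if x \<in> U then bump R (\<phi> x - p) * h (\<phi> x) else 0)"
proof (rule smooth_funI[OF sM])
  let ?f = "\<lambda>x. if x \<in> U then bump R (\<phi> x - p) * h (\<phi> x) else 0"
  let ?K = "inv_into U \<phi> ` (model M \<inter> cball p R)"
  note E = smooth_manifoldD(3)[OF sM]
  have "compactin (top_of_set (\<phi> ` U)) (model M \<inter> cball p R)"
    using ball closed_subspace[OF E] by (simp add: compactin_subtopology closed_Int_compact)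
  from image_compactin[OF this chart(8)[OF sM c]] have "compactin (mtop M) ?K" .
  hence K: "closedin (mtop M) ?K" by (rule compactin_imp_closedin[OF smooth_manifoldD(1)[OF sM]])
  have outK: "?f x = 0" if "x \<notin> ?K" for x
  proof (cases "x \<in> U")
    case True
    have "\<phi> x \<notin> cball p R"
    proof
      assume "\<phi> x \<in> cball p R"
      hence "\<phi> x \<in> model M \<inter> cball p R" using chart(4)[OF sM c] True by blast
      hence "inv_into U \<phi> (\<phi> x) \<in> ?K" by (rule imageI)
      thus False using that chart_inv(1)[OF sM c True] by simp
    qed
    hence "R \<le> norm (\<phi> x - p)" by (simp add: dist_norm norm_minus_commute)
    thus ?thesis by (simp add: bump_support[OF _ R])
  qed simp
  fix V \<psi> assume d: "(V, \<psi>) \<in> atlas M"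
  let ?\<Omega> = "oproj (model M) -` (\<psi> ` V)" and ?a = "\<lambda>x. inv_into V \<psi> (oproj (model M) x)"
  note a = msmooth_chart_inv[OF sM d]
  show "Cinf ?\<Omega> (\<lambda>x. ?f (?a x))"
  proof (rule Cinf_local)
    fix y assume y: "y \<in> ?\<Omega>"
    show "\<exists>W. open W \<and> y \<in> W \<and> Cinf W (\<lambda>x. ?f (?a x))"
    proof (cases "?a y \<in> U")
      case True
      let ?W = "?\<Omega> \<inter> ?a -` U"
      have W: "open ?W" by (rule msmoothD(5)[OF a chart(1)[OF sM c]])
      note ph = msmoothD(3)[OF a c]
      have phE: "\<phi> (?a x) \<in> oproj (model M) -` (\<phi> ` U)" if "x \<in> ?W" for x
        using that oproj_id[OF E] chart(4)[OF sM c] by auto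
      have "Cinf ?W (\<lambda>x. bump R (\<phi> (?a x) - p) * h (\<phi> (?a x)))"
        by (intro Cinf_bilinear[OF W bounded_bilinear_mult] Cinf_comp[OF W _ _ h] Cinf_comp[OF W _ _ Cinf_bump] Cinf_diff[OF W] ph Cinf_const phE)
          auto
      hence "Cinf ?W (\<lambda>x. ?f (?a x))" by (rule Cinf_cong[OF W, rotated]) auto
      thus ?thesis using W y True by blast
    next
      case False
      let ?W = "?\<Omega> \<inter> ?a -` (topspace (mtop M) - ?K)"
      have W: "open ?W" using K by (intro msmoothD(5)[OF a]) (simp add: openin_diff)
      have "?K \<subseteq> U" using ball chart_inv(2)[OF sM c] by blast
      hence "y \<in> ?W" using y False msmoothD(4)[OF a y] by blast
      moreover have "Cinf ?W (\<lambda>x. ?f (?a x))" by (rule Cinf_cong[OF W _ Cinf_const[of _ 0]]) (use outK in auto)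
      ultimately show ?thesis using W by blast
    qed
  qed
qed

lemma ball_in_chart:
  assumes sM: "smooth_manifold M" and c: "(U, \<phi>) \<in> atlas M" and p: "p \<in> U" and O: "openin (mtop M) O'" "p \<in> O'"
  shows "\<exists>R>0. model M \<inter> cball (\<phi> p) R \<subseteq> \<phi> ` (U \<inter> O')"
proof -
  obtain B where B: "open B" "\<phi> ` (U \<inter> O') = model M \<inter> B"
    using chart_open_image[OF sM c O(1)] by (auto simp: openin_open)
  hence "\<phi> p \<in> B" using p O by blast
  then obtain R where "0 < R" "cball (\<phi> p) R \<subseteq> B" using B(1) open_contains_cball by blast
  thus ?thesis using B(2) by blast
qed

lemma tangentD:
  assumes "D \<in> tangent_space M p"
  shows "\<not> smooth_fun M f \<Longrightarrow> D f = 0"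
    "smooth_fun M f \<Longrightarrow> smooth_fun M g \<Longrightarrow> D (\<lambda>x. a * f x + b * g x) = a * D f + b * D g"
    "smooth_fun M f \<Longrightarrow> smooth_fun M g \<Longrightarrow> D (\<lambda>x. f x * g x) = D f * g p + f p * D g"
  using assms by (auto simp: tangent_space_def)

lemma tangent_add: "D \<in> tangent_space M p \<Longrightarrow> smooth_fun M f \<Longrightarrow> smooth_fun M g \<Longrightarrow> D (\<lambda>x. f x + g x) = D f + D g"
  using tangentD(2)[of D M p f g 1 1] by simp

lemma tangent_scale: "D \<in> tangent_space M p \<Longrightarrow> smooth_fun M f \<Longrightarrow> D (\<lambda>x. a * f x) = a * D f"
  using tangentD(2)[of D M p f f a 0] by simp

lemma tangent_zero:
  assumes "smooth_manifold M" "D \<in> tangent_space M p" shows "D (\<lambda>x. 0) = 0"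
  using tangent_scale[OF assms(2) smooth_fun_const[OF assms(1)], of 0 0] by simp

lemma tangent_sum:
  assumes "smooth_manifold M" "D \<in> tangent_space M p"
  shows "(\<And>i. i \<in> I \<Longrightarrow> smooth_fun M (f i)) \<Longrightarrow> D (\<lambda>x. \<Sum>i\<in>I. f i x) = (\<Sum>i\<in>I. D (f i))"
  by (induction I rule: infinite_finite_induct)
    (auto simp: tangent_zero[OF assms] tangent_add[OF assms(2)] smooth_fun_sum[OF assms(1)])

text \<open>A bump function \<open>?b\<close> supported in \<open>O'\<close> with value 1 at
  \<open>p\<close> satisfies \<open>?b * f = ?b * g\<close> everywhere; the Leibniz rule at
  \<open>p\<close> then gives the equality.\<close>

lemma tangent_local:
  assumes sM: "smooth_manifold M" and D: "D \<in> tangent_space M p" and f: "smooth_fun M f" and g: "smooth_fun M g"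
    and O: "openin (mtop M) O'" "p \<in> O'" and eq: "\<And>x. x \<in> O' \<Longrightarrow> f x = g x"
  shows "D f = D g"
proof -
  have "p \<in> topspace (mtop M)" using openin_subset[OF O(1)] O(2) by blast
  then obtain U \<phi> where c: "(U, \<phi>) \<in> atlas M" "p \<in> U" using chart_at[OF sM] by blast
  obtain R where R: "0 < R" "model M \<inter> cball (\<phi> p) R \<subseteq> \<phi> ` (U \<inter> O')" using ball_in_chart[OF sM c O] by blast
  let ?b = "\<lambda>x. if x \<in> U then bump R (\<phi> x - \<phi> p) * 1 else 0"
  have b: "smooth_fun M ?b" by (rule smooth_fun_localized[OF sM c(1) R(1) _ Cinf_const]) (use R in blast)
  have bz: "?b x = 0" if "x \<notin> O'" for x
  proof (cases "x \<in> U")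
    case True
    have "\<phi> x \<notin> cball (\<phi> p) R"
    proof
      assume "\<phi> x \<in> cball (\<phi> p) R"
      hence "\<phi> x \<in> \<phi> ` (U \<inter> O')" using R(2) chart(4)[OF sM c(1)] True by blast
      thus False using that True chart(6)[OF sM c(1)] by (auto dest: inj_onD)
    qed
    hence "R \<le> norm (\<phi> x - \<phi> p)" by (simp add: dist_norm norm_minus_commute)
    thus ?thesis by (simp add: bump_support[OF _ R(1)])
  qed simp
  have eq2: "(\<lambda>x. ?b x * f x) = (\<lambda>x. ?b x * g x)"
  proof
    fix x show "?b x * f x = ?b x * g x" using eq[of x] bz[of x] by (cases "x \<in> O'") auto
  qed
  have pO: "f p = g p" using eq[OF O(2)] .
  have bp: "?b p = 1" using c(2) bump_zero[OF R(1)] by simp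
  have "D ?b * f p + ?b p * D f = D ?b * g p + ?b p * D g"
    using tangentD(3)[OF D b f] tangentD(3)[OF D b g] eq2 by simp
  thus ?thesis using pO bp by simp
qed

text \<open>Since \<open>h (v, 0) = 0\<close> for all \<open>v\<close>, the derivative of
  \<open>h\<close> in the first variable vanishes at \<open>w = 0\<close>; being Lipschitz in
  \<open>w\<close>, it is bounded by a multiple of \<open>norm w\<close>. The mean value inequality
  in \<open>v\<close> gives the claim.\<close>

lemma mixed_lipschitz:
  fixes h :: "'a::euclidean_space \<times> 'b::euclidean_space \<Rightarrow> 'c::euclidean_space"
  assumes \<Omega>: "open \<Omega>" "(0, 0) \<in> \<Omega>" and h: "Cinf \<Omega> h" and z: "\<And>v. (v, 0) \<in> \<Omega> \<Longrightarrow> h (v, 0) = 0"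
  shows "\<exists>r>0. \<exists>C\<ge>0. \<forall>v v' w. norm v < r \<longrightarrow> norm v' < r \<longrightarrow> norm w < r \<longrightarrow>
     norm (h (v, w) - h (v', w)) \<le> C * (norm (v - v') * norm w)"
proof -
  obtain R where R: "0 < R" "cball (0, 0) R \<subseteq> \<Omega>" using \<Omega> open_contains_cball by blast
  let ?B = "cball (0::'a, 0::'b) R"
  define k where "k z p = frechet_derivative h (at p) z" for z p
  define k2 where "k2 z p = frechet_derivative (k z) (at p)" for z p
  have kC: "Cinf \<Omega> (k z)" for z unfolding k_def[abs_def] by (rule Cinf_derivative(2)[OF h])
  have hd: "(h has_derivative (\<lambda>z. k z p)) (at p)" if "p \<in> \<Omega>" for p
    using Cinf_derivative(1)[OF h that] by (simp add: k_def)
  have kd: "(k z has_derivative k2 z p) (at p)" if "p \<in> \<Omega>" for z p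
    unfolding k2_def by (rule Cinf_derivative(1)[OF kC that])
  have "\<exists>L\<ge>0. \<forall>p\<in>?B. \<forall>q\<in>?B. norm (k z p - k z q) \<le> L * norm (p - q)" for z
  proof -
    have "\<exists>b. \<forall>p\<in>?B. norm (k2 z p c) \<le> b" for c
    proof -
      have "continuous_on ?B (\<lambda>p. k2 z p c)"
        using Cinf_derivative(3)[OF Cinf_derivative(2)[OF kC]] R(2) unfolding k2_def by (rule continuous_on_subset)
      hence "bounded ((\<lambda>p. k2 z p c) ` ?B)" by (intro compact_imp_bounded compact_continuous_image) auto
      thus ?thesis by (auto simp: bounded_iff)
    qed
    hence "\<forall>c. \<exists>b. \<forall>p\<in>?B. norm (k2 z p c) \<le> b" by blast
    from choice[OF this] obtain b where b: "\<And>c p. p \<in> ?B \<Longrightarrow> norm (k2 z p c) \<le> b c" by blast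
    let ?L = "\<Sum>c\<in>Basis. \<bar>b c\<bar>"
    have "norm (k z p - k z q) \<le> ?L * norm (p - q)" if "p \<in> ?B" "q \<in> ?B" for p q
    proof (rule differentiable_bound[where S="?B" and f="k z" and f'="k2 z" and B="?L", OF convex_cball])
      fix x assume x: "x \<in> ?B"
      show "(k z has_derivative k2 z x) (at x within ?B)"
        by (rule has_derivative_at_withinI, rule kd) (use R(2) x in blast)
      have "bounded_linear (k2 z x)" using kd[of x z] R(2) x has_derivative_bounded_linear by blast
      thus "onorm (k2 z x) \<le> ?L"
        by (rule onorm_componentwise_le) (intro sum_mono order_trans[OF b[OF x] abs_ge_self])
    qed (use that in auto)
    thus ?thesis by (intro exI[of _ ?L]) (auto simp: sum_nonneg)
  qed
  hence "\<forall>z. \<exists>L. 0 \<le> L \<and> (\<forall>p\<in>?B. \<forall>q\<in>?B. norm (k z p - k z q) \<le> L * norm (p - q))" by blast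
  from choice[OF this] obtain L where L: "\<And>z. 0 \<le> L z" "\<And>z p q. p \<in> ?B \<Longrightarrow> q \<in> ?B \<Longrightarrow> norm (k z p - k z q) \<le> L z * norm (p - q)" by blast
  define C where "C = (\<Sum>b\<in>(Basis::'a set). L (b, 0))"
  have C: "0 \<le> C" unfolding C_def by (intro sum_nonneg L)
  have inB: "(v, w) \<in> ?B" if "norm v < R / 2" "norm w < R / 2" for v :: 'a and w :: 'b
    using that norm_Pair_le[of v w] by (simp flip: zero_prod_def)
  have k0: "k (b, 0) (v, 0) = 0" if v: "norm v < R / 2" for b v
  proof -
    have vO: "(v, 0) \<in> \<Omega>" using inB[OF v, of 0] R by auto
    have lin: "((\<lambda>u. (u, 0::'b)) has_derivative (\<lambda>u. (u, 0))) (at v)" by (auto intro!: derivative_eq_intros)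
    have 1: "((\<lambda>u. h (u, 0)) has_derivative (\<lambda>u. k (u, 0) (v, 0))) (at v)"
      by (rule has_derivative_compose[OF lin hd[OF vO]])
    have "open ((\<lambda>u. (u, 0::'b)) -` \<Omega>)" by (intro open_vimage \<Omega> continuous_intros)
    hence 2: "((\<lambda>u. h (u, 0)) has_derivative (\<lambda>u. 0)) (at v)"
      by (intro has_derivative_transform_within_open[OF has_derivative_const[of 0]]) (use vO z in auto)
    show ?thesis using has_derivative_unique[OF 1 2] by metis
  qed
  show ?thesis
  proof (rule exI[of _ "R / 2"], rule conjI)
    show "0 < R / 2" using R by simp
    show "\<exists>C\<ge>0. \<forall>v v' w. norm v < R / 2 \<longrightarrow> norm v' < R / 2 \<longrightarrow> norm w < R / 2 \<longrightarrow>
      norm (h (v, w) - h (v', w)) \<le> C * (norm (v - v') * norm w)"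
    proof (rule exI[of _ C], intro conjI allI impI C)
    have zR: "norm (0::'b) < R / 2" using R by simp
    fix v v' :: 'a and w :: 'b assume n: "norm v < R / 2" "norm v' < R / 2" "norm w < R / 2"
    have "norm (h (v, w) - h (v', w)) \<le> (C * norm w) * norm (v - v')"
    proof (rule differentiable_bound[where S="ball 0 (R / 2)" and f="\<lambda>v. h (v, w)" and f'="\<lambda>v u. k (u, 0) (v, w)" and B="C * norm w", OF convex_ball])
      fix x :: 'a assume "x \<in> ball 0 (R / 2)"
      hence x: "norm x < R / 2" by simp
      have xO: "(x, w) \<in> \<Omega>" using inB[OF x n(3)] R by auto
      have lin: "((\<lambda>u. (u, w)) has_derivative (\<lambda>u. (u, 0))) (at x)" by (auto intro!: derivative_eq_intros)
      have 1: "((\<lambda>u. h (u, w)) has_derivative (\<lambda>u. k (u, 0) (x, w))) (at x)"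
        by (rule has_derivative_compose[OF lin hd[OF xO]])
      thus "((\<lambda>v. h (v, w)) has_derivative (\<lambda>u. k (u, 0) (x, w))) (at x within ball 0 (R / 2))"
        by (rule has_derivative_at_withinI)
      have "norm (k (b, 0) (x, w)) \<le> L (b, 0) * norm w" for b :: 'a
        using L(2)[OF inB[OF x n(3)] inB[OF x zR], where z="(b, 0)"] k0[OF x] by simp
      hence "(\<Sum>b\<in>Basis. norm (k (b, 0) (x, w))) \<le> C * norm w" unfolding C_def sum_distrib_right by (intro sum_mono)
      with has_derivative_bounded_linear[OF 1] show "onorm (\<lambda>u. k (u, 0) (x, w)) \<le> C * norm w"
        by (rule onorm_componentwise_le)
    qed (use n in auto)
    thus "norm (h (v, w) - h (v', w)) \<le> C * (norm (v - v') * norm w)" by (simp add: mult_ac)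
    qed
  qed
qed

lemma homeomorphic_map_translation:
  "homeomorphic_map (top_of_set S) (top_of_set ((\<lambda>x. x - c) ` S)) (\<lambda>x. x - (c::'a::real_normed_vector))"
  unfolding homeomorphic_map_maps homeomorphic_maps_def
proof (intro exI[of _ "\<lambda>x. x + c"] conjI)
  show "continuous_map (top_of_set S) (top_of_set ((\<lambda>x. x - c) ` S)) (\<lambda>x. x - c)"
    by (auto simp: continuous_map_in_subtopology intro!: continuous_intros)
  show "continuous_map (top_of_set ((\<lambda>x. x - c) ` S)) (top_of_set S) (\<lambda>x. x + c)"
    by (auto simp: continuous_map_in_subtopology intro!: continuous_intros)
qed auto

section \<open>Lie groups as local groups\<close>

context lie_group
begin

lemma subspace_model: "subspace (model M)" using smooth_manifoldD(3)[OF manifold] .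

definition ch :: "'g set \<times> ('g \<Rightarrow> 'e)" where "ch = (SOME c. c \<in> atlas M \<and> \<one> \<in> fst c)"
definition U1 :: "'g set" where "U1 = fst ch"
definition ph :: "'g \<Rightarrow> 'e" where "ph x = snd ch x - snd ch \<one>"
text \<open>The inverse chart, centred at the identity and composed with the projection to the model
  space: it is thereby defined on \<open>dom\<close>, an open set of the whole type.\<close>

definition ps :: "'e \<Rightarrow> 'g" where "ps v = inv_into U1 (snd ch) (oproj (model M) v + snd ch \<one>)"

lemma ch: "(U1, snd ch) \<in> atlas M" "\<one> \<in> U1"
proof -
  have "\<one> \<in> topspace (mtop M)" using topspace_eq by simp
  hence "\<exists>c. c \<in> atlas M \<and> \<one> \<in> fst c" using chart_at[OF manifold] by (metis fst_conv)
  from someI_ex[OF this] show "(U1, snd ch) \<in> atlas M" "\<one> \<in> U1" by (auto simp: ch_def U1_def)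
qed

lemma ph_image: "ph ` U1 = (\<lambda>x. x - snd ch \<one>) ` (snd ch ` U1)"
  by (auto simp: ph_def)

lemma ph_model: "ph ` U1 \<subseteq> model M"
  using chart(4)[OF manifold ch(1)] ch(2) subspace_diff[OF subspace_model] unfolding ph_def by blast

lemma ch_one_model: "snd ch \<one> \<in> model M" using chart(4)[OF manifold ch(1)] ch(2) by blast

lemma ph_open: "openin (top_of_set (model M)) (ph ` U1)"
proof -
  obtain O' where O': "open O'" "snd ch ` U1 = model M \<inter> O'" using chart(3)[OF manifold ch(1)] by (auto simp: openin_open)
  have "ph ` U1 = model M \<inter> (\<lambda>x. x + snd ch \<one>) -` O'"
  proof (intro equalityI subsetI)
    fix y assume y: "y \<in> ph ` U1"
    hence "y + snd ch \<one> \<in> snd ch ` U1" by (auto simp: ph_def)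
    thus "y \<in> model M \<inter> (\<lambda>x. x + snd ch \<one>) -` O'" using O' ph_model y by blast
  next
    fix y assume y: "y \<in> model M \<inter> (\<lambda>x. x + snd ch \<one>) -` O'"
    hence "y + snd ch \<one> \<in> snd ch ` U1" using O' subspace_add[OF subspace_model _ ch_one_model] by auto
    then obtain x where "x \<in> U1" "y + snd ch \<one> = snd ch x" by blast
    thus "y \<in> ph ` U1" by (intro image_eqI[of _ _ x]) (auto simp: ph_def algebra_simps)
  qed
  moreover have "open ((\<lambda>x. x + snd ch \<one>) -` O')" by (intro open_vimage O' continuous_intros)
  ultimately show ?thesis by auto
qed

definition dom :: "'e set" where "dom = oproj (model M) -` (ph ` U1)"

lemma open_dom: "open dom" unfolding dom_def by (rule open_vimage_oproj[OF subspace_model ph_open])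

lemma dom_iff: "v \<in> dom \<longleftrightarrow> oproj (model M) v + snd ch \<one> \<in> snd ch ` U1"
  unfolding dom_def vimage_eq ph_image by (auto simp: algebra_simps)

lemma ps:
  assumes "v \<in> dom" shows "ps v \<in> U1" "ph (ps v) = oproj (model M) v"
  using chart_inv[OF manifold ch(1)] assms unfolding dom_iff ps_def ph_def by auto

lemma zero_dom: "0 \<in> dom" "ps 0 = \<one>"
proof -
  have 0: "oproj (model M) 0 = 0" by (rule linear_0[OF linear_oproj])
  show "0 \<in> dom" unfolding dom_iff 0 using ch(2) by simp
  show "ps 0 = \<one>" unfolding ps_def 0 using chart_inv(1)[OF manifold ch(1) ch(2)] by simp
qed

lemma msmooth_ps: "msmooth M dom ps"
proof -
  have "bounded_linear (oproj (model M))" by (rule bounded_linear_oproj)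
  have sh: "oproj (model M) (v + snd ch \<one>) = oproj (model M) v + snd ch \<one>" for v
    by (simp add: linear_add[OF linear_oproj] oproj_id[OF subspace_model ch_one_model])
  have "msmooth M dom (\<lambda>v. inv_into U1 (snd ch) (oproj (model M) (v + snd ch \<one>)))"
    by (rule msmooth_precomp[OF manifold msmooth_chart_inv[OF manifold ch(1)] open_dom])
      (use sh dom_iff in \<open>auto intro!: Cinf_add[OF open_dom] Cinf_id[OF open_dom] Cinf_const\<close>)
  thus ?thesis unfolding sh ps_def[abs_def] .
qed

lemma msmooth_mult: "msmooth M \<Omega> a \<Longrightarrow> msmooth M \<Omega> b \<Longrightarrow> msmooth M \<Omega> (\<lambda>x. a x \<otimes> b x)"
  using msmooth_comp2[OF manifold manifold manifold smooth_mult] by simp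

lemma msmooth_inv: "msmooth M \<Omega> a \<Longrightarrow> msmooth M \<Omega> (\<lambda>x. inv (a x))"
  using msmooth_comp[OF manifold manifold smooth_inv] .

lemma Cinf_ph:
  assumes "msmooth M \<Omega> a" "\<And>x. x \<in> \<Omega> \<Longrightarrow> a x \<in> U1"
  shows "Cinf \<Omega> (\<lambda>x. ph (a x))" unfolding ph_def
proof (rule Cinf_diff[OF msmoothD(1)[OF assms(1)] _ Cinf_const])
  have "\<Omega> \<inter> a -` U1 = \<Omega>" using assms(2) by auto
  thus "Cinf \<Omega> (\<lambda>x. snd ch (a x))" using msmoothD(3)[OF assms(1) ch(1)] by simp
qed

definition est_ok :: "real \<Rightarrow> real \<Rightarrow> bool" where
  "est_ok r C \<longleftrightarrow> 0 < r \<and> 0 \<le> C \<and> model M \<inter> ball 0 r \<subseteq> ph ` U1 \<and>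
    (\<forall>x\<in>U1. \<forall>y\<in>U1. norm (ph x) < r \<longrightarrow> norm (ph y) < r \<longrightarrow> x \<otimes> y \<in> U1) \<and>
    (\<forall>x\<in>U1. \<forall>y\<in>U1. \<forall>x'\<in>U1. \<forall>y'\<in>U1. norm (ph x) < r \<longrightarrow> norm (ph y) < r \<longrightarrow> norm (ph x') < r \<longrightarrow> norm (ph y') < r \<longrightarrow>
      norm ((ph (x \<otimes> y) - ph x - ph y) - (ph (x' \<otimes> y') - ph x' - ph y'))
          \<le> C * (norm (ph x - ph x') * norm (ph y) + norm (ph x') * norm (ph y - ph y')))"

text \<open>The remainder \<open>h (v, w)\<close> of the group law in coordinates vanishes for
  \<open>v = 0\<close> and for \<open>w = 0\<close>. \<open>mixed_lipschitz\<close> is applied in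
  each variable, the second time with the arguments exchanged, and the two estimates are joined at
  the intermediate pair \<open>(x', y)\<close>.\<close>

lemma mult_estimate:
  "\<exists>r C. est_ok r C"
proof -
  let ?p = "oproj (model M)"
  let ?D = "dom \<times> dom"
  have oD: "open ?D" using open_dom by (simp add: open_Times)
  have a: "msmooth M ?D (\<lambda>q. ps (fst q))" "msmooth M ?D (\<lambda>q. ps (snd q))"
    by (rule msmooth_precomp[OF manifold msmooth_ps oD Cinf_linear[OF oD bounded_linear_fst]], auto)
      (rule msmooth_precomp[OF manifold msmooth_ps oD Cinf_linear[OF oD bounded_linear_snd]], auto)
  let ?m = "\<lambda>q. ps (fst q) \<otimes> ps (snd q)"
  have m: "msmooth M ?D ?m" by (rule msmooth_mult[OF a])
  define \<Omega> where "\<Omega> = ?D \<inter> ?m -` U1"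
  have o\<Omega>: "open \<Omega>" unfolding \<Omega>_def by (rule msmoothD(5)[OF m chart(1)[OF manifold ch(1)]])
  have z\<Omega>: "(0, 0) \<in> \<Omega>" using zero_dom ch(2) by (simp add: \<Omega>_def)
  define h where "h q = ph (?m q) - ?p (fst q) - ?p (snd q)" for q
  have h: "Cinf \<Omega> h" unfolding h_def
    by (intro Cinf_diff[OF o\<Omega>] Cinf_ph msmooth_subset[OF manifold m o\<Omega>] Cinf_linear_comp[OF o\<Omega> bounded_linear_oproj]
        Cinf_linear[OF o\<Omega> bounded_linear_fst] Cinf_linear[OF o\<Omega> bounded_linear_snd]) (auto simp: \<Omega>_def)
  have psG: "ps v \<in> carrier G" if "v \<in> dom" for v
    using ps(1)[OF that] chart(2)[OF manifold ch(1)] topspace_eq by auto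
  have p0: "?p 0 = 0" by (rule linear_0[OF linear_oproj])
  have h1: "h (v, 0) = 0" if "(v, 0) \<in> \<Omega>" for v
  proof -
    have v: "v \<in> dom" using that by (simp add: \<Omega>_def)
    thus ?thesis using zero_dom psG[OF v] ps(2)[OF v] p0 by (simp add: h_def)
  qed
  have h2: "h (0, w) = 0" if "(0, w) \<in> \<Omega>" for w
  proof -
    have v: "w \<in> dom" using that by (simp add: \<Omega>_def)
    thus ?thesis using zero_dom psG[OF v] ps(2)[OF v] p0 by (simp add: h_def)
  qed
  let ?sw = "\<lambda>q. (snd q, fst q) :: 'e \<times> 'e"
  have sw: "bounded_linear ?sw" by (intro bounded_linear_Pair bounded_linear_fst bounded_linear_snd)
  have o\<Omega>': "open (?sw -` \<Omega>)" by (intro open_vimage o\<Omega> continuous_intros)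
  have h': "Cinf (?sw -` \<Omega>) (\<lambda>q. h (?sw q))" by (rule Cinf_comp[OF o\<Omega>' _ Cinf_linear[OF o\<Omega>' sw] h]) simp
  obtain r1 C1 where r1: "0 < r1" "0 \<le> C1" "\<And>v v' w. norm v < r1 \<Longrightarrow> norm v' < r1 \<Longrightarrow> norm w < r1 \<Longrightarrow>
     norm (h (v, w) - h (v', w)) \<le> C1 * (norm (v - v') * norm w)" using mixed_lipschitz[OF o\<Omega> z\<Omega> h h1] by blast
  obtain r2 C2 where r2: "0 < r2" "0 \<le> C2" "\<And>v v' w. norm v < r2 \<Longrightarrow> norm v' < r2 \<Longrightarrow> norm w < r2 \<Longrightarrow>
     norm (h (w, v) - h (w, v')) \<le> C2 * (norm (v - v') * norm w)" using mixed_lipschitz[OF o\<Omega>' _ h'] z\<Omega> h2 by auto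
  obtain R where R: "0 < R" "ball (0, 0) R \<subseteq> \<Omega>" using o\<Omega> z\<Omega> open_contains_ball by blast
  define r where "r = min (min r1 r2) (R / 2)"
  have r: "0 < r" "r \<le> r1" "r \<le> r2" "2 * r \<le> R" using r1 r2 R by (auto simp: r_def)
  have in\<Omega>: "(v, w) \<in> \<Omega>" if "norm v < r" "norm w < r" for v w
  proof -
    have "norm (v, w) < R" using norm_Pair_le[of v w] that r by linarith
    hence "(v, w) \<in> ball (0, 0) R" by (simp flip: zero_prod_def)
    thus ?thesis using R by blast
  qed
  have ps_ph: "ps (ph x) = x" if "x \<in> U1" for x
  proof -
    have "ph x \<in> model M" using ph_model that by blast
    hence "ps (ph x) = inv_into U1 (snd ch) (snd ch x)"
      unfolding ps_def by (simp add: oproj_id[OF subspace_model] ph_def)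
    thus ?thesis using chart_inv(1)[OF manifold ch(1) that] by simp
  qed
  have hU: "h (ph x, ph y) = ph (x \<otimes> y) - ph x - ph y" if "x \<in> U1" "y \<in> U1" for x y
    using that ph_model by (simp add: h_def ps_ph oproj_id[OF subspace_model] image_subset_iff)
  show ?thesis unfolding est_ok_def
  proof (rule exI[of _ r], rule exI[of _ "C1 + C2"], intro conjI ballI impI)
    show "0 < r" "0 \<le> C1 + C2" using r r1 r2 by auto
    show "model M \<inter> ball 0 r \<subseteq> ph ` U1"
    proof
      fix v assume v: "v \<in> model M \<inter> ball 0 r"
      hence "(v, 0) \<in> \<Omega>" using in\<Omega>[of v 0] r(1) by simp
      hence d: "v \<in> dom" by (simp add: \<Omega>_def)
      show "v \<in> ph ` U1" using ps[OF d] v oproj_id[OF subspace_model] by (intro image_eqI[of _ _ "ps v"]) auto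
    qed
    fix x y assume xy: "x \<in> U1" "y \<in> U1"
    show "x \<otimes> y \<in> U1" if "norm (ph x) < r" "norm (ph y) < r" using in\<Omega>[OF that] xy by (simp add: \<Omega>_def ps_ph)
    fix x' y' assume xy': "x' \<in> U1" "y' \<in> U1"
    assume n: "norm (ph x) < r" "norm (ph y) < r" "norm (ph x') < r" "norm (ph y') < r"
    have "norm (h (ph x, ph y) - h (ph x', ph y)) \<le> C1 * (norm (ph x - ph x') * norm (ph y))"
      by (rule r1(3)) (use n r in auto)
    moreover have "norm (h (ph x', ph y) - h (ph x', ph y')) \<le> C2 * (norm (ph y - ph y') * norm (ph x'))"
      by (rule r2(3)) (use n r in auto)
    moreover have "norm (h (ph x, ph y) - h (ph x', ph y')) \<le> norm (h (ph x, ph y) - h (ph x', ph y)) + norm (h (ph x', ph y) - h (ph x', ph y'))"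
      using norm_triangle_ineq[of "h (ph x, ph y) - h (ph x', ph y)" "h (ph x', ph y) - h (ph x', ph y')"] by simp
    moreover have "C1 * (norm (ph x - ph x') * norm (ph y)) \<le> (C1 + C2) * (norm (ph x - ph x') * norm (ph y))"
      "C2 * (norm (ph y - ph y') * norm (ph x')) \<le> (C1 + C2) * (norm (ph x') * norm (ph y - ph y'))"
      using r1 r2 by (simp_all add: mult.commute[of "norm (ph y - ph y')"] mult_right_mono)
    ultimately have "norm (h (ph x, ph y) - h (ph x', ph y')) \<le> (C1 + C2) * (norm (ph x - ph x') * norm (ph y) + norm (ph x') * norm (ph y - ph y'))"
      unfolding distrib_left[of "C1 + C2"] by linarith
    thus "norm ((ph (x \<otimes> y) - ph x - ph y) - (ph (x' \<otimes> y') - ph x' - ph y'))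
          \<le> (C1 + C2) * (norm (ph x - ph x') * norm (ph y) + norm (ph x') * norm (ph y - ph y'))"
      unfolding hU[OF xy] hU[OF xy'] .
  qed
qed

definition est :: "real \<times> real" where "est = (SOME p. est_ok (fst p) (snd p))"

lemma local_group: "local_group G (mtop M) (model M) ph U1 (fst est) (snd est)"
proof -
  have "\<exists>p. est_ok (fst p) (snd p)" using mult_estimate by simp
  note e = someI_ex[OF this, folded est_def, unfolded est_ok_def]
  show ?thesis
  proof (rule local_group.intro[OF is_group local_group_axioms.intro])
    show "topspace (mtop M) = carrier G" by (rule topspace_eq)
    show "continuous_map (prod_topology (mtop M) (mtop M)) (mtop M) (\<lambda>(x, y). x \<otimes> y)"
      using smooth_mult by (simp add: smooth_map_def prod_manifold_def)
    show "continuous_map (mtop M) (mtop M) (\<lambda>x. inv x)" using smooth_inv by (simp add: smooth_map_def)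
    show "Hausdorff_space (mtop M)" by (rule smooth_manifoldD(1)[OF manifold])
    show "subspace (model M)" by (rule subspace_model)
    show "openin (mtop M) U1" by (rule chart(1)[OF manifold ch(1)])
    show "\<one> \<in> U1" by (rule ch(2))
    have "homeomorphic_map (subtopology (mtop M) U1) (top_of_set ((\<lambda>x. x - snd ch \<one>) ` (snd ch ` U1))) ((\<lambda>x. x - snd ch \<one>) \<circ> snd ch)"
      by (rule homeomorphic_map_compose[OF chart(5)[OF manifold ch(1)] homeomorphic_map_translation])
    thus "homeomorphic_map (subtopology (mtop M) U1) (top_of_set (ph ` U1)) ph"
      unfolding ph_image by (simp add: o_def ph_def[abs_def])
    show "ph \<one> = 0" by (simp add: ph_def)
    show "ph ` U1 \<subseteq> model M" by (rule ph_model)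
    show "0 < fst est" by (rule e[THEN conjunct1])
    show "0 \<le> snd est" by (rule e[THEN conjunct2, THEN conjunct1])
    show "model M \<inter> ball 0 (fst est) \<subseteq> ph ` U1" by (rule e[THEN conjunct2, THEN conjunct2, THEN conjunct1])
    note e' = e[THEN conjunct2, THEN conjunct2, THEN conjunct2]
    show "x \<otimes> y \<in> U1" if "x \<in> U1" "y \<in> U1" "norm (ph x) < fst est" "norm (ph y) < fst est" for x y
      by (rule e'[THEN conjunct1, rule_format, OF that])
    show "norm ((ph (x \<otimes> y) - ph x - ph y) - (ph (x' \<otimes> y') - ph x' - ph y'))
          \<le> snd est * (norm (ph x - ph x') * norm (ph y) + norm (ph x') * norm (ph y - ph y'))"
      if "x \<in> U1" "y \<in> U1" "x' \<in> U1" "y' \<in> U1" "norm (ph x) < fst est" "norm (ph y) < fst est" "norm (ph x') < fst est" "norm (ph y') < fst est"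
      for x y x' y' by (rule e'[THEN conjunct2, rule_format, OF that])
  qed
qed

sublocale LG: local_group G "mtop M" "model M" ph U1 "fst est" "snd est" by (rule local_group)

abbreviation T where "T \<equiv> mtop M"

end

lemma Cinf_mult: "open U \<Longrightarrow> Cinf U f \<Longrightarrow> Cinf U g \<Longrightarrow> Cinf U (\<lambda>x. f x * g x :: real)"
  by (rule Cinf_bilinear[OF _ bounded_bilinear_mult])

lemma Cinf_bump_mult:
  fixes g :: "'a::euclidean_space \<Rightarrow> real"
  assumes R: "0 < R'" "R' < R" and g: "Cinf (ball 0 R) g"
  shows "Cinf UNIV (\<lambda>x. bump R' x * g x)"
proof (rule Cinf_local)
  fix x :: 'a
  show "\<exists>V. open V \<and> x \<in> V \<and> Cinf V (\<lambda>x. bump R' x * g x)"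
  proof (cases "norm x < R")
    case True
    thus ?thesis by (intro exI[of _ "ball 0 R"] conjI Cinf_mult g Cinf_subset[OF subset_UNIV Cinf_bump]) auto
  next
    case False
    have o: "open (- cball (0::'a) R')" by auto
    thus ?thesis
      using False R by (intro exI[of _ "- cball 0 R'"] conjI Cinf_cong[OF o _ Cinf_const[of _ 0]]) (auto simp: bump_support)
  qed
qed

section \<open>Tangent vectors at the identity as coordinate vectors\<close>

context lie_group
begin

lemma smooth_fun_pre:
  assumes "\<And>\<Omega> a. msmooth M (\<Omega>::'e set) a \<Longrightarrow> msmooth M \<Omega> (\<lambda>x. f (a x))" and h: "smooth_fun M h"
  shows "smooth_fun M (\<lambda>x. h (f x))"
  by (rule smooth_funI[OF manifold]) (rule smooth_fun_msmooth[OF manifold h assms(1)[OF msmooth_chart_inv[OF manifold]]])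

lemma msmooth_carrier: "msmooth M \<Omega> a \<Longrightarrow> x \<in> \<Omega> \<Longrightarrow> a x \<in> carrier G"
  using msmoothD(4) topspace_eq by blast

lemma msmooth_lmult: "g \<in> carrier G \<Longrightarrow> msmooth M \<Omega> a \<Longrightarrow> msmooth M \<Omega> (\<lambda>x. g \<otimes> a x)"
  by (rule msmooth_mult[OF msmooth_const[OF manifold]]) (simp_all add: topspace_eq msmoothD(1))

lemma msmooth_conj: "g \<in> carrier G \<Longrightarrow> msmooth M \<Omega> a \<Longrightarrow> msmooth M \<Omega> (\<lambda>x. g \<otimes> a x \<otimes> inv g)"
  by (rule msmooth_mult[OF msmooth_lmult msmooth_const[OF manifold]]) (simp_all add: topspace_eq msmoothD(1))

definition dv :: "'e \<Rightarrow> ('g \<Rightarrow> real) \<Rightarrow> real" where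
  "dv v f = (if smooth_fun M f then frechet_derivative (\<lambda>w. f (ps w)) (at 0) v else 0)"

lemma dv_derivative: "smooth_fun M f \<Longrightarrow> ((\<lambda>w. f (ps w)) has_derivative (\<lambda>v. dv v f)) (at 0)"
  using Cinf_derivative(1)[OF smooth_fun_msmooth[OF manifold _ msmooth_ps] zero_dom(1)] by (simp add: dv_def)

lemma dv_eq: "smooth_fun M f \<Longrightarrow> ((\<lambda>w. f (ps w)) has_derivative f') (at 0) \<Longrightarrow> dv v f = f' v"
  by (simp add: dv_def frechet_eq)

lemma dv_lincomb: "dv (a *\<^sub>R v + b *\<^sub>R w) f = a * dv v f + b * dv w f"
proof (cases "smooth_fun M f")
  case True
  have l: "linear (\<lambda>v. dv v f)" by (rule has_derivative_linear[OF dv_derivative[OF True]])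
  show ?thesis by (simp add: linear_add[OF l] linear_cmul[OF l])
qed (simp add: dv_def)

lemma dv_tangent: "dv v \<in> lie_algebra G M"
  unfolding lie_algebra_def tangent_space_def
proof (intro CollectI conjI allI impI)
  fix f show "\<not> smooth_fun M f \<Longrightarrow> dv v f = 0" by (simp add: dv_def)
  fix g assume f: "smooth_fun M f" and g: "smooth_fun M g"
  note d = dv_derivative[OF f] dv_derivative[OF g]
  show "dv v (\<lambda>x. a * f x + b * g x) = a * dv v f + b * dv v g" for a b
    by (rule dv_eq[OF smooth_fun_lincomb[OF manifold f g]]) (auto intro!: derivative_eq_intros d)
  show "dv v (\<lambda>x. f x * g x) = dv v f * g \<one> + f \<one> * dv v g"
    by (rule dv_eq[OF smooth_fun_mult[OF manifold f g]]) (auto intro!: derivative_eq_intros d simp: zero_dom(2))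
qed

definition rad :: real where "rad = (SOME R. 0 < R \<and> model M \<inter> cball (snd ch \<one>) R \<subseteq> snd ch ` U1 \<and> ball 0 R \<subseteq> dom)"

lemma rad: "0 < rad" "model M \<inter> cball (snd ch \<one>) rad \<subseteq> snd ch ` U1" "ball 0 rad \<subseteq> dom"
proof -
  obtain R1 where R1: "0 < R1" "model M \<inter> cball (snd ch \<one>) R1 \<subseteq> snd ch ` (U1 \<inter> U1)"
    using ball_in_chart[OF manifold ch chart(1)[OF manifold ch(1)] ch(2)] by blast
  obtain R2 where R2: "0 < R2" "ball 0 R2 \<subseteq> dom" using open_dom zero_dom(1) open_contains_ball by blast
  have "\<exists>R. 0 < R \<and> model M \<inter> cball (snd ch \<one>) R \<subseteq> snd ch ` U1 \<and> ball 0 R \<subseteq> dom"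
    using R1 R2 by (intro exI[of _ "min R1 R2"]) auto
  from someI_ex[OF this] show "0 < rad" "model M \<inter> cball (snd ch \<one>) rad \<subseteq> snd ch ` U1" "ball 0 rad \<subseteq> dom"
    by (auto simp: rad_def)
qed

text \<open>Makes a function of the coordinates into a smooth function on the manifold. The radius
  \<open>rad / 2\<close> keeps the support inside the ball on which the chart and \<open>ps\<close>
  are under control.\<close>

definition loc :: "('e \<Rightarrow> real) \<Rightarrow> 'g \<Rightarrow> real" where
  "loc h x = (if x \<in> U1 then bump (rad / 2) (ph x) * h (ph x) else 0)"

lemma smooth_loc:
  assumes "Cinf UNIV h" shows "smooth_fun M (loc h)"
proof -
  have "smooth_fun M (\<lambda>x. if x \<in> U1 then bump (rad / 2) (snd ch x - snd ch \<one>) * h (snd ch x - snd ch \<one>) else 0)"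
  proof (rule smooth_fun_localized[OF manifold ch(1), where h="\<lambda>y. h (y - snd ch \<one>)"])
    let ?U = "oproj (model M) -` (snd ch ` U1)"
    have o: "open ?U" by (rule open_vimage_oproj[OF subspace_model chart(3)[OF manifold ch(1)]])
    show "Cinf ?U (\<lambda>y. h (y - snd ch \<one>))"
      by (rule Cinf_comp[OF o _ Cinf_diff[OF o Cinf_id[OF o] Cinf_const] assms]) simp
    show "0 < rad / 2" "model M \<inter> cball (snd ch \<one>) (rad / 2) \<subseteq> snd ch ` U1" using rad by (auto simp: subset_iff)
  qed
  thus ?thesis unfolding loc_def[abs_def] ph_def .
qed

lemma loc_ps: "w \<in> dom \<Longrightarrow> loc h (ps w) = bump (rad / 2) (oproj (model M) w) * h (oproj (model M) w)"
  by (simp add: loc_def ps)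

lemma dv_loc:
  assumes h: "Cinf UNIV h"
  shows "dv v (loc h) = frechet_derivative (\<lambda>w. bump (rad / 2) w * h w) (at 0) (oproj (model M) v)"
proof (rule dv_eq[OF smooth_loc[OF h]])
  let ?k = "\<lambda>w. bump (rad / 2) w * h w" and ?p = "oproj (model M)"
  have k: "Cinf UNIV ?k" by (rule Cinf_mult[OF _ Cinf_bump h]) simp
  have "(?k has_derivative frechet_derivative ?k (at 0)) (at (?p 0))"
    using Cinf_derivative(1)[OF k, of 0] by (simp add: linear_0[OF linear_oproj])
  hence "((\<lambda>w. ?k (?p w)) has_derivative (\<lambda>v. frechet_derivative ?k (at 0) (?p v))) (at 0)"
    using has_derivative_compose[OF bounded_linear.has_derivative[OF bounded_linear_oproj has_derivative_ident]] by blast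
  thus "((\<lambda>w. loc h (ps w)) has_derivative (\<lambda>v. frechet_derivative ?k (at 0) (?p v))) (at 0)"
    by (rule has_derivative_transform_within_open[OF _ open_dom zero_dom(1)]) (simp add: loc_ps)
qed

lemma dv_coord:
  assumes v: "v \<in> model M"
  shows "dv v (loc (\<lambda>y. w \<bullet> y)) = w \<bullet> v"
proof -
  have "((\<lambda>y. bump (rad / 2) y *\<^sub>R (w \<bullet> y)) has_derivative (\<lambda>v. bump (rad / 2) (0::'e) *\<^sub>R (w \<bullet> v))) (at 0)"
    by (rule has_derivative_mult_zero)
      (auto intro!: derivative_eq_intros continuous_on_interior[OF Cinf_derivative(3)[OF Cinf_bump]])
  hence "((\<lambda>y. bump (rad / 2) y * (w \<bullet> y)) has_derivative (\<lambda>v. w \<bullet> v)) (at 0)"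
    using rad(1) by (simp add: bump_zero)
  thus ?thesis
    using dv_loc[OF Cinf_linear[OF open_UNIV bounded_linear_inner_right], of v w] by (simp add: frechet_eq oproj_id[OF subspace_model v])
qed

lemma Exp_derivative:
  assumes X: "X \<in> model M"
  shows "((\<lambda>t. ph (LG.Exp (t *\<^sub>R X))) has_vector_derivative X) (at 0)"
  unfolding has_vector_derivative_def has_derivative_at
proof (intro conjI bounded_linear_scaleR_left)
  let ?C = "snd est * (norm X)\<^sup>2" and ?f = "\<lambda>t. ph (LG.Exp (t *\<^sub>R X)) - t *\<^sub>R X"
  have C: "0 \<le> ?C" using LG.C_nonneg by simp
  have "norm (norm (?f t) / norm t) \<le> \<bar>t\<bar> * ?C" if t: "\<bar>t\<bar> * norm X < LG.\<delta>" for t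
  proof -
    have "norm (?f t) \<le> snd est * (norm (t *\<^sub>R X))\<^sup>2"
      by (rule LG.Exp_small_est(1)) (use X t subspace_scale[OF subspace_model] in auto)
    also have "\<dots> = \<bar>t\<bar> * (\<bar>t\<bar> * ?C)" by (simp add: power2_eq_square)
    finally show ?thesis by (cases "t = 0") (auto simp: divide_simps mult_ac)
  qed
  moreover have "eventually (\<lambda>t. \<bar>t\<bar> * norm X < LG.\<delta>) (at 0)"
    by (rule order_tendstoD(2)[where y=0]) (auto intro!: tendsto_eq_intros simp: LG.\<delta>_pos)
  ultimately have "eventually (\<lambda>t. norm (norm (?f t) / norm t) \<le> \<bar>t\<bar> * ?C) (at 0)" by (auto elim: eventually_mono)
  hence "((\<lambda>t. norm (?f t) / norm t) \<longlongrightarrow> 0) (at 0)" by (rule Lim_null_comparison) (auto intro!: tendsto_eq_intros)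
  thus "((\<lambda>h. norm (ph (LG.Exp ((0 + h) *\<^sub>R X)) - ph (LG.Exp (0 *\<^sub>R X)) - h *\<^sub>R X) / norm h) \<longlongrightarrow> 0) (at 0)"
    by (simp add: LG.Exp_zero LG.\<phi>_one)
qed

lemma ps_ph: "x \<in> U1 \<Longrightarrow> ps (ph x) = x"
proof -
  assume x: "x \<in> U1"
  hence "ph x \<in> model M" using ph_model by blast
  hence "ps (ph x) = inv_into U1 (snd ch) (snd ch x)"
    unfolding ps_def by (simp add: oproj_id[OF subspace_model] ph_def)
  thus ?thesis using chart_inv(1)[OF manifold ch(1) x] by simp
qed

lemma dv_Exp:
  assumes X: "X \<in> model M" and f: "smooth_fun M f"
  shows "((\<lambda>t. f (LG.Exp (t *\<^sub>R X))) has_real_derivative dv X f) (at 0)"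
proof -
  have "((\<lambda>w. f (ps w)) has_derivative (\<lambda>v. dv v f)) (at (ph (LG.Exp (0 *\<^sub>R X))))"
    using dv_derivative[OF f] by (simp add: LG.Exp_zero LG.\<phi>_one)
  from has_derivative_compose[OF Exp_derivative[OF X, unfolded has_vector_derivative_def] this]
  have "((\<lambda>t. f (ps (ph (LG.Exp (t *\<^sub>R X))))) has_derivative (\<lambda>t. dv (t *\<^sub>R X) f)) (at 0)" .
  moreover have "dv (t *\<^sub>R X) f = dv X f * t" for t using dv_lincomb[of t X 0 X] by simp
  ultimately have *: "((\<lambda>t. f (ps (ph (LG.Exp (t *\<^sub>R X))))) has_derivative (*) (dv X f)) (at 0)" by simp
  have ev: "eventually (\<lambda>t. LG.Exp (t *\<^sub>R X) \<in> U1) (at 0)"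
  proof (rule LG.limitin_eventually_U)
    show "limitin T (\<lambda>t. LG.Exp (t *\<^sub>R X)) \<one> (at 0)" unfolding LG.Exp_zero[symmetric]
      by (rule LG.limitin_Exp) (auto intro!: tendsto_eq_intros simp: X subspace_scale[OF subspace_model] subspace_0[OF subspace_model])
  qed (rule ch(2))
  then obtain S where S: "open S" "0 \<in> S" "\<forall>t\<in>S. t \<noteq> 0 \<longrightarrow> LG.Exp (t *\<^sub>R X) \<in> U1"
    unfolding eventually_at_topological by blast
  show ?thesis unfolding has_field_derivative_def
    by (rule has_derivative_transform_within_open[OF * S(1,2)]) (use S(3) ch(2) LG.Exp_zero ps_ph in \<open>metis scaleR_zero_left\<close>)
qed

text \<open>Both sides are the derivative at \<open>t = 0\<close> of \<open>f\<close> along the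
  conjugated one-parameter subgroup. This identifies \<open>Adj\<close>, defined by exponentials,
  with \<open>Ad\<close>, defined on derivations.\<close>

lemma dv_Adj:
  assumes g: "g \<in> carrier G" and X: "X \<in> model M" and f: "smooth_fun M f"
  shows "dv (LG.Adj g X) f = dv X (\<lambda>x. f (g \<otimes> x \<otimes> inv g))"
proof (rule DERIV_unique)
  have s: "smooth_fun M (\<lambda>x. f (g \<otimes> x \<otimes> inv g))" by (rule smooth_fun_pre[OF msmooth_conj[OF g] f])
  show "((\<lambda>t. f (LG.Exp (t *\<^sub>R LG.Adj g X))) has_real_derivative dv (LG.Adj g X) f) (at 0)"
    by (rule dv_Exp[OF LG.Adj(1)[OF g X] f])
  show "((\<lambda>t. f (LG.Exp (t *\<^sub>R LG.Adj g X))) has_real_derivative dv X (\<lambda>x. f (g \<otimes> x \<otimes> inv g))) (at 0)"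
    using dv_Exp[OF X s] by (simp add: LG.Adj(2)[OF g X])
qed

text \<open>The vector \<open>v\<close> collects the values of \<open>D\<close> on the cut-off
  coordinate functions. It lies in the model space because coordinate functionals orthogonal to that
  space vanish on the chart. By Hadamard's lemma a smooth \<open>f\<close> is, after multiplication
  by a cut-off, a constant plus products of coordinates with smooth functions, on which the Leibniz
  rule evaluates \<open>D\<close>.\<close>

lemma tangent_dv:
  assumes D: "D \<in> lie_algebra G M"
  shows "\<exists>v\<in>model M. D = dv v"
proof -
  note D = D[unfolded lie_algebra_def]
  let ?p = "oproj (model M)" and ?l = "\<lambda>w. loc (\<lambda>y. w \<bullet> y)"
  have sl: "smooth_fun M (?l w)" for w by (rule smooth_loc[OF Cinf_linear[OF open_UNIV bounded_linear_inner_right]])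
  define v where "v = (\<Sum>b\<in>Basis. D (?l b) *\<^sub>R b)"
  have v: "w \<bullet> v = D (?l w)" for w
  proof -
    have "?l w = (\<lambda>x. \<Sum>b\<in>Basis. (w \<bullet> b) * ?l b x)"
    proof
      fix x
      have "w \<bullet> ph x = (\<Sum>b\<in>Basis. (w \<bullet> b) * (b \<bullet> ph x))" by (simp add: euclidean_inner[of w "ph x"] inner_commute)
      thus "?l w x = (\<Sum>b\<in>Basis. (w \<bullet> b) * ?l b x)" by (simp add: loc_def sum_distrib_left mult_ac)
    qed
    moreover have "smooth_fun M (\<lambda>x. (w \<bullet> b) * ?l b x)" for b
      by (rule smooth_fun_mult[OF manifold smooth_fun_const[OF manifold] sl])
    ultimately have "D (?l w) = (\<Sum>b\<in>Basis. D (\<lambda>x. (w \<bullet> b) * ?l b x))"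
      using tangent_sum[OF manifold D, of Basis "\<lambda>b x. (w \<bullet> b) * ?l b x"] by simp
    thus ?thesis by (simp add: v_def inner_sum_right tangent_scale[OF D sl] mult_ac)
  qed
  have vM: "v \<in> model M"
  proof -
    let ?u = "v - ?p v"
    have "?l ?u = (\<lambda>x. 0)"
    proof
      fix x show "?l ?u x = 0"
        using oproj_orth[OF subspace_model, of "ph x" v] ph_model by (cases "x \<in> U1") (auto simp: loc_def)
    qed
    hence "?u \<bullet> v = 0" using v[of ?u] tangent_zero[OF manifold D] by simp
    moreover have "?u \<bullet> ?p v = 0" by (rule oproj_orth[OF subspace_model oproj_in[OF subspace_model]])
    ultimately have "?u \<bullet> ?u = 0" by (simp add: inner_diff_right)
    hence "v = ?p v" by simp
    thus ?thesis using oproj_in[OF subspace_model] by metis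
  qed
  have "D f = dv v f" for f
  proof (cases "smooth_fun M f")
    case f: True
    let ?F = "\<lambda>w. f (ps w)"
    have F: "Cinf (ball 0 rad) ?F" by (rule Cinf_subset[OF rad(3) smooth_fun_msmooth[OF manifold f msmooth_ps]])
    obtain g where g: "\<And>b. Cinf (ball 0 rad) (g b)" "\<And>b. g b 0 = frechet_derivative ?F (at 0) b"
      "\<And>x. x \<in> ball 0 rad \<Longrightarrow> ?F x = ?F 0 + (\<Sum>b\<in>Basis. (x \<bullet> b) * g b x)" using hadamard[OF rad(1) F] by blast
    let ?\<beta> = "bump (rad / 2) :: 'e \<Rightarrow> real"
    have \<beta>g: "Cinf UNIV (\<lambda>x. ?\<beta> x * g b x)" for b by (rule Cinf_bump_mult[OF _ _ g(1)]) (use rad(1) in auto)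
    \<comment> \<open>Counting the factor hidden in \<open>loc\<close>, \<open>?c\<close> is the
      cube of the bump function; on the right of the identity below, one factor goes to the
      coordinate \<open>?l b\<close> and two to \<open>?G b\<close>.\<close>
    let ?G = "\<lambda>b. loc (\<lambda>x. ?\<beta> x * g b x)" and ?c = "loc (\<lambda>x. ?\<beta> x * ?\<beta> x)"
    have sG: "smooth_fun M (?G b)" for b by (rule smooth_loc[OF \<beta>g])
    have sc: "smooth_fun M ?c" by (rule smooth_loc[OF Cinf_mult[OF open_UNIV Cinf_bump Cinf_bump]])
    have eq: "(\<lambda>x. ?c x * f x) = (\<lambda>x. f \<one> * ?c x + 1 * (\<Sum>b\<in>Basis. ?l b x * ?G b x))"
    proof
      fix x
      consider "x \<in> U1" "norm (ph x) < rad" | "x \<notin> U1" | "x \<in> U1" "?\<beta> (ph x) = 0"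
        using bump_support[of "rad / 2" "ph x"] rad(1) by (cases "norm (ph x) < rad") auto
      thus "?c x * f x = f \<one> * ?c x + 1 * (\<Sum>b\<in>Basis. ?l b x * ?G b x)"
      proof cases
        case 1
        have "f x = f \<one> + (\<Sum>b\<in>Basis. (ph x \<bullet> b) * g b (ph x))"
          using g(3)[of "ph x"] 1 by (simp add: ps_ph zero_dom(2))
        thus ?thesis using 1 by (simp add: loc_def distrib_left sum_distrib_left inner_commute mult_ac)
      qed (auto simp: loc_def)
    qed
    have c1: "?c \<one> = 1" "?G b \<one> = g b 0" "?l b \<one> = 0" for b using ch(2) rad(1) by (simp_all add: loc_def LG.\<phi>_one bump_zero)
    have sGl: "smooth_fun M (\<lambda>x. ?l b x * ?G b x)" for b by (rule smooth_fun_mult[OF manifold sl sG])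
    have "D (\<lambda>x. ?c x * f x) = D ?c * f \<one> + D f" using tangentD(3)[OF D sc f] c1 by simp
    moreover have "D (\<lambda>x. ?c x * f x) = f \<one> * D ?c + (\<Sum>b\<in>Basis. D (\<lambda>x. ?l b x * ?G b x))"
      unfolding eq tangentD(2)[OF D sc smooth_fun_sum[OF manifold sGl]] tangent_sum[OF manifold D sGl] by simp
    moreover have "D (\<lambda>x. ?l b x * ?G b x) = (v \<bullet> b) * g b 0" for b
      using tangentD(3)[OF D sl sG, of b b] c1 v[of b] by (simp add: inner_commute[of v])
    ultimately have "D f = (\<Sum>b\<in>Basis. (v \<bullet> b) * frechet_derivative ?F (at 0) b)" by (simp add: g(2))
    thus ?thesis
      using linear_expand[OF has_derivative_linear[OF dv_derivative[OF f]], of v] f by (simp add: dv_def)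
  qed (use tangentD(1)[OF D] in \<open>simp add: dv_def\<close>)
  thus ?thesis using vM by blast
qed

lemma Ad_dv:
  assumes "g \<in> carrier G" "X \<in> model M"
  shows "Ad G M g (dv X) = dv (LG.Adj g X)"
proof
  fix f show "Ad G M g (dv X) f = dv (LG.Adj g X) f"
    using dv_Adj[OF assms] by (cases "smooth_fun M f") (auto simp: Ad_def dv_tangent differential_def o_def dv_def)
qed

section \<open>Left-invariant vector fields, the bracket and the adjoint representation\<close>

text \<open>The left-invariant vector field with value \<open>dv w\<close> at the identity, applied
  to \<open>f\<close>.\<close>

definition lder :: "'e \<Rightarrow> ('g \<Rightarrow> real) \<Rightarrow> 'g \<Rightarrow> real" where
  "lder w f x = dv w (\<lambda>y. f (x \<otimes> y))"

lemma smooth_fun_lmult: "g \<in> carrier G \<Longrightarrow> smooth_fun M f \<Longrightarrow> smooth_fun M (\<lambda>y. f (g \<otimes> y))"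
  by (rule smooth_fun_pre[OF msmooth_lmult])

text \<open>In a chart this is a partial derivative, at \<open>\<eta> = 0\<close> and in the
  direction \<open>w\<close>, of the function \<open>f (a x \<otimes> ps \<eta>)\<close>, which is
  jointly smooth.\<close>

lemma smooth_lder:
  assumes f: "smooth_fun M f" shows "smooth_fun M (lder w f)"
proof (rule smooth_funI[OF manifold])
  fix U \<phi> assume c: "(U, \<phi>) \<in> atlas M"
  let ?\<Omega> = "oproj (model M) -` (\<phi> ` U)" and ?a = "\<lambda>x. inv_into U \<phi> (oproj (model M) x)"
  note a = msmooth_chart_inv[OF manifold c]
  note o = msmoothD(1)[OF a]
  let ?D = "?\<Omega> \<times> dom"
  have oD: "open ?D" using o open_dom by (rule open_Times)
  let ?H = "\<lambda>q. f (?a (fst q) \<otimes> ps (snd q))"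
  have "msmooth M ?D (\<lambda>q. ?a (fst q))"
    by (rule msmooth_precomp[OF manifold a oD Cinf_linear[OF oD bounded_linear_fst]]) auto
  moreover have "msmooth M ?D (\<lambda>q. ps (snd q))"
    by (rule msmooth_precomp[OF manifold msmooth_ps oD Cinf_linear[OF oD bounded_linear_snd]]) auto
  ultimately have H: "Cinf ?D ?H" by (intro smooth_fun_msmooth[OF manifold f] msmooth_mult)
  have "Cinf ?\<Omega> (\<lambda>x. frechet_derivative ?H (at (x, 0)) (0, w))"
    by (rule Cinf_comp[OF o _ Cinf_Pair[OF o Cinf_id[OF o] Cinf_const] Cinf_derivative(2)[OF H]]) (use zero_dom in auto)
  thus "Cinf ?\<Omega> (\<lambda>x. lder w f (?a x))"
  proof (rule Cinf_cong[OF o, rotated])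
    fix x assume x: "x \<in> ?\<Omega>"
    have d: "(?H has_derivative frechet_derivative ?H (at (x, 0))) (at (x, 0))"
      by (rule Cinf_derivative(1)[OF H]) (use x zero_dom in auto)
    have "((\<lambda>\<eta>. (x, \<eta>)) has_derivative (\<lambda>\<eta>. (0, \<eta>))) (at 0)" by (auto intro!: derivative_eq_intros)
    from has_derivative_compose[OF this d]
    have "((\<lambda>\<eta>. f (?a x \<otimes> ps \<eta>)) has_derivative (\<lambda>\<eta>. frechet_derivative ?H (at (x, 0)) (0, \<eta>))) (at 0)" by simp
    thus "frechet_derivative ?H (at (x, 0)) (0, w) = lder w f (?a x)"
      unfolding lder_def by (rule dv_eq[OF smooth_fun_lmult[OF msmooth_carrier[OF a x] f], symmetric])
  qed
qed

lemma tangent_one_cong: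
  assumes D: "D \<in> lie_algebra G M" and "smooth_fun M f" "smooth_fun M g" "\<And>x. x \<in> carrier G \<Longrightarrow> f x = g x"
  shows "D f = D g"
  by (rule tangent_local[OF manifold D[unfolded lie_algebra_def] assms(2,3) openin_topspace]) (use assms topspace_eq in auto)

lemma lie_bracket_dv:
  "smooth_fun M f \<Longrightarrow> lie_bracket G M (dv v) (dv w) f = dv v (lder w f) - dv w (lder v f)"
  by (simp add: lie_bracket_def lder_def[abs_def])

lemma lder_one: "smooth_fun M f \<Longrightarrow> lder w f \<one> = dv w f"
  unfolding lder_def by (rule tangent_one_cong[OF dv_tangent smooth_fun_lmult]) auto

lemma lder_lincomb:
  assumes "smooth_fun M f" "smooth_fun M g" "x \<in> carrier G"
  shows "lder w (\<lambda>x. a * f x + b * g x) x = a * lder w f x + b * lder w g x"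
  using tangentD(2)[OF dv_tangent[unfolded lie_algebra_def] smooth_fun_lmult[OF assms(3,1)] smooth_fun_lmult[OF assms(3,2)]]
  by (simp add: lder_def)

lemma lder_mult:
  assumes "smooth_fun M f" "smooth_fun M g" "x \<in> carrier G"
  shows "lder w (\<lambda>x. f x * g x) x = lder w f x * g x + f x * lder w g x"
  using tangentD(3)[OF dv_tangent[unfolded lie_algebra_def] smooth_fun_lmult[OF assms(3,1)] smooth_fun_lmult[OF assms(3,2)]]
  by (simp add: lder_def assms(3))

lemma dv_lder_lincomb:
  assumes f: "smooth_fun M f" and g: "smooth_fun M g"
  shows "dv v (lder w (\<lambda>x. a * f x + b * g x)) = a * dv v (lder w f) + b * dv v (lder w g)"
proof -
  have "dv v (lder w (\<lambda>x. a * f x + b * g x)) = dv v (\<lambda>x. a * lder w f x + b * lder w g x)"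
    by (intro tangent_one_cong[OF dv_tangent] smooth_lder smooth_fun_lincomb[OF manifold] f g lder_lincomb)
  thus ?thesis using tangentD(2)[OF dv_tangent[unfolded lie_algebra_def] smooth_lder[OF f] smooth_lder[OF g]] by simp
qed

lemma dv_lder_mult:
  assumes f: "smooth_fun M f" and g: "smooth_fun M g"
  shows "dv v (lder w (\<lambda>x. f x * g x)) = dv v (lder w f) * g \<one> + dv w f * dv v g + dv v f * dv w g + f \<one> * dv v (lder w g)"
proof -
  note t = dv_tangent[unfolded lie_algebra_def] and s = smooth_lder[OF f] smooth_lder[OF g]
  have m: "smooth_fun M (\<lambda>x. lder w f x * g x)" "smooth_fun M (\<lambda>x. f x * lder w g x)"
    by (intro smooth_fun_mult[OF manifold] s f g)+
  have "dv v (lder w (\<lambda>x. f x * g x)) = dv v (\<lambda>x. lder w f x * g x + f x * lder w g x)"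
    by (intro tangent_one_cong[OF dv_tangent] smooth_lder smooth_fun_mult[OF manifold] smooth_fun_add[OF manifold] f g lder_mult s)
  thus ?thesis
    using tangent_add[OF t m] tangentD(3)[OF t s(1) g] tangentD(3)[OF t f s(2)] by (simp add: lder_one f g)
qed

text \<open>The mixed products in the second-order Leibniz rule \<open>dv_lder_mult\<close> are
  symmetric in \<open>v\<close> and \<open>w\<close> and cancel. Membership in the Lie algebra
  matters because \<open>Ad\<close> is \<open>undefined\<close> elsewhere, and
  \<open>Ad_bracket\<close> evaluates it at a bracket.\<close>

lemma lie_bracket_tangent: "lie_bracket G M (dv v) (dv w) \<in> lie_algebra G M"
  unfolding lie_algebra_def tangent_space_def
proof (intro CollectI conjI allI impI)
  fix f show "\<not> smooth_fun M f \<Longrightarrow> lie_bracket G M (dv v) (dv w) f = 0" by (simp add: lie_bracket_def)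
  fix g assume f: "smooth_fun M f" and g: "smooth_fun M g"
  show "lie_bracket G M (dv v) (dv w) (\<lambda>x. a * f x + b * g x) = a * lie_bracket G M (dv v) (dv w) f + b * lie_bracket G M (dv v) (dv w) g" for a b
    by (simp add: lie_bracket_dv f g smooth_fun_lincomb[OF manifold] dv_lder_lincomb right_diff_distrib)
  show "lie_bracket G M (dv v) (dv w) (\<lambda>x. f x * g x) = lie_bracket G M (dv v) (dv w) f * g \<one> + f \<one> * lie_bracket G M (dv v) (dv w) g"
    by (simp add: lie_bracket_dv f g smooth_fun_mult[OF manifold] dv_lder_mult left_diff_distrib right_diff_distrib)
qed

lemma dv_lder_Adj:
  assumes g: "g \<in> carrier G" and v: "v \<in> model M" "w \<in> model M" and f: "smooth_fun M f"
  shows "dv (LG.Adj g v) (lder (LG.Adj g w) f) = dv v (lder w (\<lambda>x. f (g \<otimes> x \<otimes> inv g)))"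
proof -
  let ?c = "\<lambda>x. g \<otimes> x \<otimes> inv g"
  have fc: "smooth_fun M (\<lambda>x. f (?c x))" by (rule smooth_fun_pre[OF msmooth_conj[OF g] f])
  have "dv (LG.Adj g v) (lder (LG.Adj g w) f) = dv v (\<lambda>x. lder (LG.Adj g w) f (?c x))"
    by (rule dv_Adj[OF g v(1) smooth_lder[OF f]])
  also have "\<dots> = dv v (lder w (\<lambda>x. f (?c x)))"
  proof (rule tangent_one_cong[OF dv_tangent smooth_fun_pre[OF msmooth_conj[OF g] smooth_lder[OF f]] smooth_lder[OF fc]])
    fix x assume x: "x \<in> carrier G"
    have cx: "?c x \<in> carrier G" using g x by simp
    have "lder (LG.Adj g w) f (?c x) = dv w (\<lambda>y. f (?c x \<otimes> ?c y))"
      unfolding lder_def by (rule dv_Adj[OF g v(2) smooth_fun_lmult[OF cx f]])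
    also have "\<dots> = dv w (\<lambda>y. f (?c (x \<otimes> y)))"
    proof (rule tangent_one_cong[OF dv_tangent smooth_fun_pre[OF msmooth_conj[OF g] smooth_fun_lmult[OF cx f]] smooth_fun_lmult[OF x fc]])
      fix y assume "y \<in> carrier G"
      thus "f (?c x \<otimes> ?c y) = f (?c (x \<otimes> y))" using LG.conj_mult[OF g x] by simp
    qed
    finally show "lder (LG.Adj g w) f (?c x) = lder w (\<lambda>x. f (?c x)) x" unfolding lder_def .
  qed
  finally show ?thesis .
qed

lemma Ad_bracket:
  assumes g: "g \<in> carrier G" and v: "v \<in> model M" "w \<in> model M"
  shows "Ad G M g (lie_bracket G M (dv v) (dv w)) = lie_bracket G M (dv (LG.Adj g v)) (dv (LG.Adj g w))"
proof
  fix f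
  show "Ad G M g (lie_bracket G M (dv v) (dv w)) f = lie_bracket G M (dv (LG.Adj g v)) (dv (LG.Adj g w)) f"
  proof (cases "smooth_fun M f")
    case f: True
    have fc: "smooth_fun M (\<lambda>x. f (g \<otimes> x \<otimes> inv g))" by (rule smooth_fun_pre[OF msmooth_conj[OF g] f])
    show ?thesis
      using f lie_bracket_dv[OF fc] by (simp add: Ad_def lie_bracket_tangent differential_def o_def lie_bracket_dv dv_lder_Adj[OF g v f] dv_lder_Adj[OF g v(2,1) f])
  qed (simp add: Ad_def lie_bracket_tangent differential_def, simp add: lie_bracket_def)
qed

lemma dv_comb: "(\<lambda>f. a * dv v f + b * dv w f) = dv (a *\<^sub>R v + b *\<^sub>R w)"
  by (rule ext) (simp add: dv_lincomb)

text \<open>Zariski closed sets are taken inside the automorphism group, so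
  \<open>Ad \<Gamma>\<close> lies in the zero set of a polynomial only once it is known to consist
  of automorphisms.\<close>

lemma Ad_Aut:
  assumes g: "g \<in> carrier G" shows "Ad G M g \<in> Aut_lie_algebra G M"
proof -
  let ?L = "lie_algebra G M"
  have E: "subspace (model M)" by (rule subspace_model)
  have in_L: "Ad G M g X \<in> ?L" if X: "X \<in> ?L" and g: "g \<in> carrier G" for X g
    using tangent_dv[OF X] Ad_dv[OF g] dv_tangent by metis
  have inv: "Ad G M h (Ad G M g X) = X" if X: "X \<in> ?L" and gh: "g \<in> carrier G" "h \<in> carrier G" "h \<otimes> g = \<one>" for X g h
  proof -
    obtain v where v: "v \<in> model M" "X = dv v" using tangent_dv[OF X] by blast
    show ?thesis
      using Ad_dv[OF gh(1) v(1)] Ad_dv[OF gh(2) LG.Adj(1)[OF gh(1) v(1)]] LG.Adj_mult[OF gh(2,1) v(1)] gh(3) LG.Adj_one[OF v(1)]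
      by (simp add: v(2))
  qed
  have lin: "Ad G M g (\<lambda>s. a * X s + b * Y s) = (\<lambda>s. a * Ad G M g X s + b * Ad G M g Y s)"
    if XY: "X \<in> ?L" "Y \<in> ?L" for X Y a b
  proof -
    obtain v w where v: "v \<in> model M" "X = dv v" "w \<in> model M" "Y = dv w" using tangent_dv XY by metis
    have "LG.Adj g (a *\<^sub>R v + b *\<^sub>R w) = a *\<^sub>R LG.Adj g v + b *\<^sub>R LG.Adj g w"
      by (simp add: LG.Adj_add[OF g] LG.Adj_scale[OF g] subspace_scale[OF E] v)
    thus ?thesis by (simp add: v dv_comb Ad_dv[OF g] subspace_add[OF E] subspace_scale[OF E])
  qed
  have br: "Ad G M g (lie_bracket G M X Y) = lie_bracket G M (Ad G M g X) (Ad G M g Y)" if XY: "X \<in> ?L" "Y \<in> ?L" for X Y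
  proof -
    obtain v w where v: "v \<in> model M" "X = dv v" "w \<in> model M" "Y = dv w" using tangent_dv XY by metis
    show ?thesis by (simp add: v Ad_bracket[OF g] Ad_dv[OF g])
  qed
  have "bij_betw (Ad G M g) ?L ?L" by (rule bij_betw_byWitness[of _ "Ad G M (inv g)"]) (use g inv in_L in auto)
  thus ?thesis using lin br in_L[OF _ g] by (auto simp: Aut_lie_algebra_def linear_endo_def Ad_def)
qed

text \<open>The functional \<open>w \<bullet> v\<close> of a coordinate vector becomes evaluation of
  the derivation \<open>dv v\<close> at the cut-off coordinate function; so coefficients of
  \<open>Adj\<close> are matrix coefficients of \<open>Ad\<close>.\<close>

lemma Poly0_Ad:
  assumes "f \<in> LG.Poly0"
  shows "\<exists>P\<in>End_polynomials (lie_algebra G M). \<forall>g\<in>carrier G. f g = P (Ad G M g)" using assms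
proof induction
  case (const c)
  show ?case by (rule bexI[of _ "\<lambda>T. c"]) (simp_all add: End_polynomials.const)
next
  case (coef X w)
  let ?l = "\<lambda>D. D (loc (\<lambda>y. w \<bullet> y))"
  have "linear_functional (lie_algebra G M) ?l" by (simp add: linear_functional_def)
  hence "(\<lambda>T. ?l (T (dv X))) \<in> End_polynomials (lie_algebra G M)"
    by (rule End_polynomials.coefficient[OF dv_tangent])
  moreover have "w \<bullet> LG.Adj g X = ?l (Ad G M g (dv X))" if g: "g \<in> carrier G" for g
    by (simp add: Ad_dv[OF g coef] dv_coord[OF LG.Adj(1)[OF g coef]])
  ultimately show ?case by (intro bexI[of _ "\<lambda>T. ?l (T (dv X))"]) auto
next
  case (add f h)
  then obtain P Q where "P \<in> End_polynomials (lie_algebra G M)" "\<forall>g\<in>carrier G. f g = P (Ad G M g)"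
    "Q \<in> End_polynomials (lie_algebra G M)" "\<forall>g\<in>carrier G. h g = Q (Ad G M g)" by blast
  thus ?case by (intro bexI[of _ "\<lambda>T. P T + Q T"]) (simp_all add: End_polynomials.add)
next
  case (mult f h)
  then obtain P Q where "P \<in> End_polynomials (lie_algebra G M)" "\<forall>g\<in>carrier G. f g = P (Ad G M g)"
    "Q \<in> End_polynomials (lie_algebra G M)" "\<forall>g\<in>carrier G. h g = Q (Ad G M g)" by blast
  thus ?case by (intro bexI[of _ "\<lambda>T. P T * Q T"]) (simp_all add: End_polynomials.mult)
qed

lemma Poly0_dense:
  assumes dense: "algebraically_dense G M \<Gamma>" and sub: "\<Gamma> \<subseteq> carrier G"
    and f: "f \<in> LG.Poly0" "\<And>x. x \<in> \<Gamma> \<Longrightarrow> f x = 0" and x: "x \<in> carrier G"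
  shows "f x = 0"
proof -
  obtain P where P: "P \<in> End_polynomials (lie_algebra G M)" "\<And>g. g \<in> carrier G \<Longrightarrow> f g = P (Ad G M g)"
    using Poly0_Ad[OF f(1)] by blast
  let ?Z = "{T \<in> Aut_lie_algebra G M. \<forall>Q\<in>{P}. Q T = 0}"
  have "zariski_closedin (lie_algebra G M) (Aut_lie_algebra G M) ?Z"
    unfolding zariski_closedin_def using P(1) by (intro exI[of _ "{P}"]) simp
  moreover have "Ad G M ` \<Gamma> \<subseteq> ?Z"
  proof
    fix T assume "T \<in> Ad G M ` \<Gamma>"
    then obtain h where h: "h \<in> \<Gamma>" "T = Ad G M h" by blast
    thus "T \<in> ?Z" using Ad_Aut[of h] P(2)[of h] f(2)[of h] sub by auto
  qed
  ultimately have "zariski_closure (lie_algebra G M) (Aut_lie_algebra G M) (Ad G M ` \<Gamma>) \<subseteq> ?Z"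
    unfolding zariski_closure_def by blast
  hence "Ad G M x \<in> ?Z" using dense x unfolding algebraically_dense_def by blast
  thus ?thesis using P(2)[OF x] by simp
qed

end

section \<open>Kernels of homomorphisms to vector spaces\<close>

text \<open>Isolates what is used of the logarithm modulo \<open>W\<close> to make its kernel a Lie
  subgroup: a continuous homomorphism whose values on exponentials are known. Its smoothness is
  deduced from these.\<close>

locale euclidean_hom = lie_group G M
  for G :: "('g, 'm) monoid_scheme" (structure) and M :: "('g, 'e::euclidean_space) manifold" +
  fixes F :: "'g \<Rightarrow> 'e" and W :: "'e set"
  assumes subspace_W: "subspace W" and W_model: "W \<subseteq> model M"
    and F_mult: "\<And>x y. x \<in> carrier G \<Longrightarrow> y \<in> carrier G \<Longrightarrow> F (x \<otimes> y) = F x + F y"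
    and F_Exp: "\<And>X. X \<in> model M \<Longrightarrow> F (LG.Exp X) = X - oproj W X"
    and F_model: "\<And>x. x \<in> carrier G \<Longrightarrow> F x \<in> model M"
    and F_orth: "\<And>x w. x \<in> carrier G \<Longrightarrow> w \<in> W \<Longrightarrow> F x \<bullet> w = 0"
    and F_cont: "continuous_map T euclidean F"
begin

abbreviation "pE \<equiv> oproj (model M)"
abbreviation "pW \<equiv> oproj W"

lemma lin: "pE (x + y) = pE x + pE y" "pE (x - y) = pE x - pE y" "pE (c *\<^sub>R x) = c *\<^sub>R pE x" "pE 0 = 0"
  "pW (x + y) = pW x + pW y" "pW (x - y) = pW x - pW y" "pW (c *\<^sub>R x) = c *\<^sub>R pW x" "pW 0 = 0"
  by (simp_all add: linear_add[OF linear_oproj] linear_diff[OF linear_oproj] linear_cmul[OF linear_oproj] linear_0[OF linear_oproj])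

lemma pW_pE: "pW (pE x) = pW x"
proof -
  let ?u = "pW x - pW (pE x)"
  have u: "?u \<in> W" by (intro subspace_diff subspace_W oproj_in)
  have "(x - pE x) \<bullet> ?u = 0" using oproj_orth[OF subspace_model] u W_model by blast
  moreover have "(x - pW x) \<bullet> ?u = 0" "(pE x - pW (pE x)) \<bullet> ?u = 0" using oproj_orth[OF subspace_W u] by auto
  ultimately have "?u \<bullet> ?u = 0" by (simp add: inner_diff_left)
  thus ?thesis by simp
qed

lemma pE_pW: "pE (pW x) = pW x"
  using oproj_in[OF subspace_W] W_model by (intro oproj_id subspace_model) blast

lemma F_one: "F \<one> = 0"
  using F_mult[of \<one> \<one>] by simp

lemma F_inv: "x \<in> carrier G \<Longrightarrow> F (inv x) = - F x"
  using F_mult[of x "inv x"] F_one by (simp add: eq_neg_iff_add_eq_0 add.commute)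

lemma pW_F: "x \<in> carrier G \<Longrightarrow> pW (F x) = 0"
proof -
  assume x: "x \<in> carrier G"
  have "(F x - pW (F x)) \<bullet> pW (F x) = 0" by (rule oproj_orth[OF subspace_W oproj_in[OF subspace_W]])
  hence "pW (F x) \<bullet> pW (F x) = 0" using F_orth[OF x oproj_in[OF subspace_W]] by (simp add: inner_diff_left)
  thus ?thesis by simp
qed

lemma ps_carrier: "w \<in> dom \<Longrightarrow> ps w \<in> carrier G" by (rule msmooth_carrier[OF msmooth_ps])

lemma F_ps_derivative: "((\<lambda>w. F (ps w)) has_derivative (\<lambda>w. pE w - pW w)) (at 0)"
  unfolding has_derivative_at
proof
  show "bounded_linear (\<lambda>w. pE w - pW w)" by (intro bounded_linear_sub bounded_linear_oproj)
  obtain R where R: "0 < R" "ball 0 R \<subseteq> dom" using open_dom zero_dom(1) open_contains_ball by blast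
  let ?C = "4 * snd est" and ?f = "\<lambda>h. F (ps (0 + h)) - F (ps 0) - (pE h - pW h)"
  have "norm (norm (?f h) / norm h) \<le> norm h * ?C" if h: "norm h < min R (LG.\<delta> / 4)" for h
  proof -
    have hd: "h \<in> dom" using R h by auto
    have ph_h: "ph (ps h) = pE h" and U: "ps h \<in> U1" using ps[OF hd] by auto
    have n: "norm (pE h) \<le> norm h" by (rule norm_oproj(1)[OF subspace_model])
    hence "norm (ph (ps h)) < LG.\<delta> / 4" using h ph_h by simp
    then obtain X where X: "X \<in> model M" "norm X \<le> 2 * norm (ph (ps h))" "LG.Exp X = ps h"
      using LG.Exp_onto[OF U] by blast
    have nX: "norm X \<le> 2 * norm h" using X(2) n ph_h by simp
    have Xd: "norm X < LG.\<delta>" using nX h LG.\<delta>_pos by simp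
    have FX: "F (ps h) = X - pW X" using F_Exp[OF X(1)] X(3) by simp
    have eq: "?f h = (X - pE h) - pW (X - pE h)" by (simp add: zero_dom F_one FX lin pW_pE)
    have "norm (?f h) \<le> norm (X - pE h)" unfolding eq by (rule norm_oproj(2)[OF subspace_W])
    also have "\<dots> \<le> snd est * (norm X)\<^sup>2"
      using LG.Exp_small_est(1)[OF X(1) Xd] by (simp add: X(3) ph_h norm_minus_commute)
    also have "\<dots> \<le> snd est * (2 * norm h)\<^sup>2" by (intro mult_left_mono power_mono nX LG.C_nonneg) simp
    finally have "norm (?f h) \<le> norm h * ?C * norm h" by (simp add: power2_eq_square mult_ac)
    thus ?thesis by (cases "h = 0") (simp_all add: divide_simps LG.C_nonneg)
  qed
  moreover have "eventually (\<lambda>h::'e. norm h < min R (LG.\<delta> / 4)) (at 0)"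
    by (rule order_tendstoD(2)[where y=0]) (use R LG.\<delta>_pos in \<open>auto intro!: tendsto_eq_intros\<close>)
  ultimately have "eventually (\<lambda>h. norm (norm (?f h) / norm h) \<le> norm h * ?C) (at 0)"
    by (auto elim: eventually_mono)
  thus "((\<lambda>h. norm (?f h) / norm h) \<longlongrightarrow> 0) (at 0)" by (rule Lim_null_comparison) (auto intro!: tendsto_eq_intros)
qed

text \<open>By translation, \<open>F \<circ> a\<close> has at \<open>x\<close> the derivative of \<open>F\<close> at the identity applied to that of
  \<open>y \<mapsto> (a x)\<^sup>-\<^sup>1 a y\<close>, which depends smoothly on \<open>x\<close>.\<close>

lemma Cinf_F:
  fixes a :: "'x::euclidean_space \<Rightarrow> 'g"
  assumes a: "msmooth M \<Omega> a" shows "Cinf \<Omega> (\<lambda>x. F (a x))"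
proof -
  note o = msmoothD(1)[OF a]
  let ?D = "\<Omega> \<times> \<Omega>" and ?b = "\<lambda>q. inv (a (fst q)) \<otimes> a (snd q)"
  have oD: "open ?D" using o by (simp add: open_Times)
  have a1: "msmooth M ?D (\<lambda>q. a (fst q))"
    by (rule msmooth_precomp[OF manifold a oD Cinf_linear[OF oD bounded_linear_fst]]) auto
  have a2: "msmooth M ?D (\<lambda>q. a (snd q))"
    by (rule msmooth_precomp[OF manifold a oD Cinf_linear[OF oD bounded_linear_snd]]) auto
  have b: "msmooth M ?D ?b" by (intro msmooth_mult msmooth_inv a1 a2)
  let ?B = "?D \<inter> ?b -` U1"
  have oB: "open ?B" by (rule msmoothD(5)[OF b LG.open_U])
  define H where "H q = ph (?b q)" for q
  have H: "Cinf ?B H" unfolding H_def by (rule Cinf_ph[OF msmooth_subset[OF manifold b oB]]) auto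
  have ac: "a x \<in> carrier G" if "x \<in> \<Omega>" for x by (rule msmooth_carrier[OF a that])
  have dB: "(x, x) \<in> ?B" if "x \<in> \<Omega>" for x using ac[OF that] that ch(2) by simp
  let ?h = "\<lambda>x v. frechet_derivative H (at (x, x)) (0, v)"
  show ?thesis
  proof (rule CinfI[OF o])
    fix x assume x: "x \<in> \<Omega>"
    have "((\<lambda>y. (x, y)) has_derivative (\<lambda>v. (0, v))) (at x)" by (auto intro!: derivative_eq_intros)
    from has_derivative_compose[OF this Cinf_derivative(1)[OF H dB[OF x]]]
    have 1: "((\<lambda>y. H (x, y)) has_derivative ?h x) (at x)" .
    have "H (x, x) = 0" using ac[OF x] by (simp add: H_def LG.\<phi>_one)
    with F_ps_derivative have "((\<lambda>w. F (ps w)) has_derivative (\<lambda>w. pE w - pW w)) (at (H (x, x)))" by simp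
    from has_derivative_compose[OF 1 this]
    have m1: "((\<lambda>y. F (ps (H (x, y))) + F (a x)) has_derivative (\<lambda>v. (pE (?h x v) - pW (?h x v)) + 0)) (at x)"
      by (intro has_derivative_add has_derivative_const)
    have m2: "open ((\<lambda>y. (x, y)) -` ?B)" by (intro open_vimage oB continuous_intros)
    have m3: "F (ps (H (x, y))) + F (a x) = F (a y)" if "y \<in> (\<lambda>y. (x, y)) -` ?B" for y
    proof -
      have y: "y \<in> \<Omega>" "inv (a x) \<otimes> a y \<in> U1" using that x by auto
      have "F (ps (H (x, y))) = F (inv (a x) \<otimes> a y)" using y(2) by (simp add: H_def ps_ph)
      thus ?thesis using ac[OF x] ac[OF y(1)] by (simp add: F_mult F_inv)
    qed
    show "((\<lambda>x. F (a x)) has_derivative (\<lambda>v. pE (?h x v) - pW (?h x v))) (at x)"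
      by (rule has_derivative_transform_within_open[OF m1[simplified add_0_right] m2 _ m3]) (use dB[OF x] in simp)
  next
    have "Cinf \<Omega> (\<lambda>x. ?h x v)" for v
      by (rule Cinf_comp[OF o _ Cinf_Pair[OF o Cinf_id[OF o] Cinf_id[OF o]] Cinf_derivative(2)[OF H]]) (rule dB)
    thus "Cinf \<Omega> (\<lambda>x. pE (?h x v) - pW (?h x v))" for v
      by (intro Cinf_diff[OF o] Cinf_linear_comp[OF o bounded_linear_oproj])
  qed
qed

text \<open>The map \<open>\<Psi>\<close> adds three mutually orthogonal components: one in
  \<open>W\<close>, the value of \<open>F\<close> in the part of the model orthogonal to
  \<open>W\<close>, and one orthogonal to the model. Its derivative at 0 is the identity, because
  that of \<open>F \<circ> ps\<close> is \<open>pE - pW\<close>; and \<open>\<Psi> w \<in> W\<close>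
  holds exactly if \<open>w\<close> is in the model and \<open>F (ps w) = 0\<close>. The inverse
  function theorem thus straightens the kernel to \<open>W\<close>.\<close>

lemma slice:
  obtains U' V g where "open U'" "U' \<subseteq> dom" "0 \<in> U'" "open V" "0 \<in> V" "Cinf V g" "g ` V \<subseteq> U'"
    "\<And>v. v \<in> V \<Longrightarrow> v \<in> W \<Longrightarrow> g v \<in> U' \<and> g v \<in> model M \<and> F (ps (g v)) = 0 \<and> pW (g v) = v"
    "\<And>u. u \<in> U' \<Longrightarrow> u \<in> model M \<Longrightarrow> F (ps u) = 0 \<Longrightarrow> pW u \<in> V \<and> g (pW u) = u"
proof -
  define \<Psi> where "\<Psi> w = pW w + F (ps w) + (w - pE w)" for w
  have C: "Cinf dom \<Psi>"
    unfolding \<Psi>_def by (intro Cinf_add[OF open_dom] Cinf_diff[OF open_dom] Cinf_oproj[OF open_dom] Cinf_id[OF open_dom] Cinf_F[OF msmooth_ps])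
  have bl: "bounded_linear pW" "bounded_linear pE" by (rule bounded_linear_oproj)+
  have "(\<Psi> has_derivative (\<lambda>w. pW w + (pE w - pW w) + (w - pE w))) (at 0)" unfolding \<Psi>_def
    by (intro has_derivative_add has_derivative_diff F_ps_derivative has_derivative_ident bounded_linear_imp_has_derivative bl)
  hence d: "(\<Psi> has_derivative (\<lambda>w. w)) (at 0)" by simp
  have z: "\<Psi> 0 = 0" by (simp add: \<Psi>_def zero_dom lin F_one)
  obtain U' V g where g: "open U'" "U' \<subseteq> dom" "0 \<in> U'" "open V" "0 \<in> V" "homeomorphism U' V \<Psi> g" "Cinf V g"
    using smooth_local_inverse[OF open_dom zero_dom(1) C z d] by blast
  have FpsE: "F (ps u) \<in> model M" "pW (F (ps u)) = 0" if "u \<in> U'" for u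
    using F_model pW_F ps_carrier g(2) that by blast+
  have "g v \<in> U' \<and> g v \<in> model M \<and> F (ps (g v)) = 0 \<and> pW (g v) = v" if v: "v \<in> V" "v \<in> W" for v
  proof -
    let ?u = "g v"
    have u: "?u \<in> U'" "\<Psi> ?u = v" using g(6) v(1) unfolding homeomorphism_def by blast+
    note f = FpsE[OF u(1)]
    have pf: "pE (F (ps ?u)) = F (ps ?u)" by (rule oproj_id[OF subspace_model f(1)])
    have "pE (\<Psi> ?u) = pW ?u + F (ps ?u)" by (simp add: \<Psi>_def lin pE_pW pf oproj_id[OF subspace_model oproj_in[OF subspace_model]])
    moreover have "pE v = v" using v(2) W_model by (intro oproj_id subspace_model) blast
    ultimately have e: "v = pW ?u + F (ps ?u)" using u(2) by simp
    have "pW v = pW ?u" using arg_cong[OF e, of pW] by (simp add: lin f(2) oproj_id[OF subspace_W oproj_in[OF subspace_W]])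
    hence pv: "pW ?u = v" using oproj_id[OF subspace_W v(2)] by simp
    hence F0: "F (ps ?u) = 0" using e by simp
    hence "?u = pE ?u" using u(2) pv by (simp add: \<Psi>_def)
    hence "?u \<in> model M" using oproj_in[OF subspace_model] by metis
    thus ?thesis using u(1) F0 pv by blast
  qed
  moreover have "pW u \<in> V \<and> g (pW u) = u" if u: "u \<in> U'" "u \<in> model M" "F (ps u) = 0" for u
  proof -
    have "\<Psi> u = pW u" using u by (simp add: \<Psi>_def oproj_id[OF subspace_model])
    thus ?thesis using g(6) u(1) unfolding homeomorphism_def by (metis imageI)
  qed
  moreover have "g ` V \<subseteq> U'" using g(6) by (simp add: homeomorphism_def)
  ultimately show thesis using that g by blast
qed

end

section \<open>The kernel as an immersed Lie group\<close>

text \<open>One slice at the identity is fixed, and left translation carries it to every point of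
  the kernel. \<open>cf s\<close> is the resulting chart at \<open>s\<close>, \<open>ci s\<close>
  its inverse.\<close>

locale hom_slice = euclidean_hom G M F W
  for G :: "('g, 'm) monoid_scheme" (structure) and M :: "('g, 'e::euclidean_space) manifold" and F W +
  fixes U' V :: "'e set" and g :: "'e \<Rightarrow> 'e"
  assumes sl: "open U'" "U' \<subseteq> dom" "0 \<in> U'" "open V" "0 \<in> V" "Cinf V g" "g ` V \<subseteq> U'"
    and sl_inv: "\<And>v. v \<in> V \<Longrightarrow> v \<in> W \<Longrightarrow> g v \<in> U' \<and> g v \<in> model M \<and> F (ps (g v)) = 0 \<and> pW (g v) = v"
    and sl_param: "\<And>u. u \<in> U' \<Longrightarrow> u \<in> model M \<Longrightarrow> F (ps u) = 0 \<Longrightarrow> pW u \<in> V \<and> g (pW u) = u"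
begin

definition K :: "'g set" where "K = {x \<in> carrier G. F x = 0}"
definition cU :: "'g \<Rightarrow> 'g set" where "cU s = {x \<in> K. inv s \<otimes> x \<in> U1 \<and> ph (inv s \<otimes> x) \<in> U'}"
definition cf :: "'g \<Rightarrow> 'g \<Rightarrow> 'e" where "cf s x = pW (ph (inv s \<otimes> x))"
definition ci :: "'g \<Rightarrow> 'e \<Rightarrow> 'g" where "ci s v = s \<otimes> ps (g v)"
definition N :: "('g, 'e) manifold" where
  "N = \<lparr>mtop = subtopology T K, model = W, atlas = {(cU s, cf s) | s. s \<in> K}\<rparr>"

lemma N_simps [simp]: "mtop N = subtopology T K" "model N = W" "atlas N = {(cU s, cf s) | s. s \<in> K}"
  by (simp_all add: N_def)

lemma K_carrier: "x \<in> K \<Longrightarrow> x \<in> carrier G" by (simp add: K_def)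

lemma K_subgroup: "subgroup K G"
proof (rule subgroupI)
  have "\<one> \<in> K" by (simp add: K_def F_one)
  thus "K \<noteq> {}" by blast
qed (auto simp: K_def F_mult F_inv)

lemma K_mult: "x \<in> K \<Longrightarrow> y \<in> K \<Longrightarrow> x \<otimes> y \<in> K" by (rule subgroup.m_closed[OF K_subgroup])
lemma K_inv: "x \<in> K \<Longrightarrow> inv x \<in> K" by (rule subgroup.m_inv_closed[OF K_subgroup])
lemma topspace_N: "topspace (mtop N) = K" using K_carrier topspace_eq by auto

lemma inv_cancel: "a \<in> carrier G \<Longrightarrow> y \<in> carrier G \<Longrightarrow> inv a \<otimes> (a \<otimes> y) = y"
    "a \<in> carrier G \<Longrightarrow> y \<in> carrier G \<Longrightarrow> a \<otimes> (inv a \<otimes> y) = y" by (simp_all add: m_assoc[symmetric])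

lemma ci:
  assumes s: "s \<in> K"
  shows "v \<in> W \<inter> V \<Longrightarrow> ci s v \<in> cU s" "v \<in> W \<inter> V \<Longrightarrow> cf s (ci s v) = v"
    "x \<in> cU s \<Longrightarrow> cf s x \<in> W \<inter> V" "x \<in> cU s \<Longrightarrow> ci s (cf s x) = x"
proof -
  have sc: "s \<in> carrier G" by (rule K_carrier[OF s])
  {
    assume v: "v \<in> W \<inter> V"
    hence g: "g v \<in> U'" "g v \<in> model M" "F (ps (g v)) = 0" "pW (g v) = v" using sl_inv by blast+
    have d: "g v \<in> dom" using g(1) sl(2) by blast
    have pc: "ps (g v) \<in> carrier G" by (rule ps_carrier[OF d])
    have "inv s \<otimes> ci s v = ps (g v)" using sc pc by (simp add: ci_def inv_cancel)
    moreover have "ps (g v) \<in> K" using pc g(3) by (simp add: K_def)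
    moreover have "ph (ps (g v)) = g v" using ps(2)[OF d] oproj_id[OF subspace_model g(2)] by simp
    ultimately show "ci s v \<in> cU s" "cf s (ci s v) = v"
      using K_mult[OF s] ps(1)[OF d] g by (simp_all add: cU_def cf_def) (simp add: ci_def)
  }
  {
    assume x: "x \<in> cU s"
    let ?u = "ph (inv s \<otimes> x)"
    have xK: "x \<in> K" and U: "inv s \<otimes> x \<in> U1" and u: "?u \<in> U'" using x by (auto simp: cU_def)
    have uE: "?u \<in> model M" using U ph_model by blast
    have e: "ps ?u = inv s \<otimes> x" by (rule ps_ph[OF U])
    moreover have "F (inv s \<otimes> x) = 0" using K_mult[OF K_inv[OF s] xK] by (simp add: K_def)
    ultimately have "pW ?u \<in> V \<and> g (pW ?u) = ?u" using sl_param[OF u uE] by simp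
    thus "cf s x \<in> W \<inter> V" "ci s (cf s x) = x"
      using e sc K_carrier[OF xK] oproj_in[OF subspace_W] by (simp_all add: cf_def ci_def inv_cancel)
  }
qed

lemma cf_image: "s \<in> K \<Longrightarrow> cf s ` cU s = W \<inter> V"
proof (intro equalityI subsetI)
  fix v assume s: "s \<in> K" and v: "v \<in> W \<inter> V"
  show "v \<in> cf s ` cU s" using ci(1,2)[OF s v] by (metis imageI)
qed (use ci(3) in blast)

lemma inv_into_cf:
  assumes s: "s \<in> K" and v: "v \<in> W \<inter> V" shows "inv_into (cU s) (cf s) v = ci s v"
proof (rule inv_into_f_eq)
  show "inj_on (cf s) (cU s)" by (rule inj_on_inverseI) (rule ci(4)[OF s])
qed (rule ci(1,2)[OF s v])+

lemma msmooth_ci: "s \<in> K \<Longrightarrow> msmooth M V (ci s)"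
  unfolding ci_def[abs_def]
  by (intro msmooth_lmult K_carrier msmooth_precomp[OF manifold msmooth_ps sl(4,6)]) (use sl in auto)

text \<open>\<open>cf t\<close> is given by a formula that is smooth on an open set of the ambient
  group, so smoothness into the kernel follows from smoothness into \<open>M\<close>.\<close>

lemma smooth_on_cf:
  assumes b: "msmooth M \<Omega> b" and X: "X \<subseteq> \<Omega>" and t: "t \<in> K" and f: "\<And>x. x \<in> X \<Longrightarrow> b x \<in> cU t \<and> f x = cf t (b x)"
  shows "smooth_on X f"
proof (rule smooth_onI)
  let ?b = "\<lambda>x. inv t \<otimes> b x"
  have tb: "msmooth M \<Omega> ?b" by (rule msmooth_lmult[OF _ b]) (use K_carrier[OF t] in simp)
  let ?O = "\<Omega> \<inter> ?b -` U1"
  show o: "open ?O" by (rule msmoothD(5)[OF tb LG.open_U])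
  show "X \<subseteq> ?O" using X f by (auto simp: cU_def)
  show "Cinf ?O (\<lambda>x. cf t (b x))" unfolding cf_def
    by (intro Cinf_linear_comp[OF o bounded_linear_oproj] Cinf_ph msmooth_subset[OF manifold tb o]) auto
  show "cf t (b x) = f x" if "x \<in> X" for x using f[OF that] by simp
qed

lemma continuous_ph: "continuous_map (subtopology T U1) euclidean ph"
  using homeomorphic_imp_continuous_map[OF LG.homeo_\<phi>] continuous_map_into_fulltopology by blast

lemma continuous_lmult: "a \<in> carrier G \<Longrightarrow> continuous_map T T (\<lambda>x. a \<otimes> x)"
proof -
  assume a: "a \<in> carrier G"
  have "continuous_map T (prod_topology T T) (\<lambda>x. (a, x))"
    by (rule continuous_map_pairedI) (simp_all add: a topspace_eq)
  from continuous_map_compose[OF this LG.mult_cont] show ?thesis by (simp add: o_def)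
qed

lemma openin_cU:
  assumes s: "s \<in> K" shows "openin (mtop N) (cU s)"
proof -
  have "openin (subtopology T U1) {x \<in> topspace (subtopology T U1). ph x \<in> U'}"
    by (rule openin_continuous_map_preimage[OF continuous_ph]) (use sl(1) in simp)
  hence o: "openin T {x \<in> topspace (subtopology T U1). ph x \<in> U'}" using openin_trans_full LG.open_U by blast
  have "openin T {x \<in> topspace T. inv s \<otimes> x \<in> {x \<in> topspace (subtopology T U1). ph x \<in> U'}}"
    by (rule openin_continuous_map_preimage[OF continuous_lmult o]) (use K_carrier[OF s] in simp)
  hence "openin (mtop N) (K \<inter> {x \<in> topspace T. inv s \<otimes> x \<in> {x \<in> topspace (subtopology T U1). ph x \<in> U'}})"
    by (simp add: openin_subtopology_Int2)
  moreover have "K \<inter> {x \<in> topspace T. inv s \<otimes> x \<in> {x \<in> topspace (subtopology T U1). ph x \<in> U'}} = cU s"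
    using K_carrier K_carrier[OF s] topspace_eq by (auto simp: cU_def)
  ultimately show ?thesis by simp
qed

lemma is_chart_cU:
  assumes s: "s \<in> K" shows "is_chart (mtop N) W (cU s, cf s)"
proof -
  let ?N = "subtopology (mtop N) (cU s)" and ?V = "top_of_set (W \<inter> V)"
  have sc: "inv s \<in> carrier G" using K_carrier[OF s] by simp
  have "homeomorphic_maps ?N ?V (cf s) (ci s)" unfolding homeomorphic_maps_def
  proof (intro conjI ballI)
    have 1: "continuous_map ?N (subtopology T U1) (\<lambda>x. inv s \<otimes> x)"
      unfolding continuous_map_in_subtopology N_simps subtopology_subtopology
      by (intro conjI continuous_map_from_subtopology continuous_lmult sc) (auto simp: cU_def)
    have "continuous_map ?N euclidean (\<lambda>x. pW (ph (inv s \<otimes> x)))"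
      using continuous_map_compose[OF continuous_map_compose[OF 1 continuous_ph], of euclidean pW]
        linear_continuous_on[OF bounded_linear_oproj, of UNIV W] by (simp add: o_def)
    moreover have "(\<lambda>x. pW (ph (inv s \<otimes> x))) = cf s" by (rule ext) (simp add: cf_def)
    ultimately show "continuous_map ?N ?V (cf s)" unfolding continuous_map_in_subtopology using ci(3)[OF s] by auto
    have "continuous_map ?V T (ci s)"
      by (rule continuous_map_from_subtopology_mono[OF msmoothD(2)[OF msmooth_ci[OF s]]]) simp
    thus "continuous_map ?V ?N (ci s)"
      unfolding N_simps subtopology_subtopology continuous_map_in_subtopology using ci(1)[OF s] by (auto simp: cU_def)
    show "ci s (cf s x) = x" if "x \<in> topspace ?N" for x using that ci(4)[OF s] by simp
    show "cf s (ci s v) = v" if "v \<in> topspace ?V" for v using that ci(2)[OF s] by simp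
  qed
  hence "homeomorphic_map ?N (top_of_set (cf s ` cU s)) (cf s)"
    unfolding cf_image[OF s] homeomorphic_map_maps by blast
  moreover have "openin (top_of_set W) (cf s ` cU s)" unfolding cf_image[OF s] using sl(4) by (simp add: openin_open_Int)
  ultimately show ?thesis using openin_cU[OF s] by (simp add: is_chart_def)
qed

lemma cU_self: "s \<in> K \<Longrightarrow> s \<in> cU s"
  using K_carrier ch(2) sl(3) by (simp add: cU_def LG.\<phi>_one)

lemma manifold_N: "smooth_manifold N"
  unfolding smooth_manifold_def
proof (intro conjI ballI)
  show "Hausdorff_space (mtop N)" using LG.hausdorff by (simp add: Hausdorff_space_subtopology)
  show "second_countable (mtop N)" using smooth_manifoldD(2)[OF manifold] by (simp add: second_countable_subtopology)
  show "subspace (model N)" using subspace_W by simp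
  show "is_chart (mtop N) (model N) c" if "c \<in> atlas N" for c using that is_chart_cU by auto
  show "(\<Union>c\<in>atlas N. fst c) = topspace (mtop N)"
  proof -
    have "(\<Union>c\<in>atlas N. fst c) = (\<Union>s\<in>K. cU s)" by auto
    also have "\<dots> = K"
    proof (intro equalityI subsetI)
      show "x \<in> (\<Union>s\<in>K. cU s)" if "x \<in> K" for x using cU_self[OF that] that by blast
    qed (simp add: cU_def)
    finally show ?thesis unfolding topspace_N .
  qed
  fix c assume "c \<in> atlas N"
  then obtain s where c: "c = (cU s, cf s)" "s \<in> K" by auto
  have "smooth_on (cf s ` (cU s \<inter> cU t)) (cf t \<circ> inv_into (cU s) (cf s))" if t: "t \<in> K" for t
  proof (rule smooth_on_cf[OF msmooth_ci[OF c(2)] _ t])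
    show "cf s ` (cU s \<inter> cU t) \<subseteq> V" using ci(3)[OF c(2)] by auto
    show "ci s v \<in> cU t \<and> (cf t \<circ> inv_into (cU s) (cf s)) v = cf t (ci s v)" if "v \<in> cf s ` (cU s \<inter> cU t)" for v
      using that ci(3,4)[OF c(2)] inv_into_cf[OF c(2)] by auto
  qed
  thus "case c of (U, \<phi>) \<Rightarrow> \<forall>(V, \<psi>)\<in>atlas N. smooth_on (\<phi> ` (U \<inter> V)) (\<psi> \<circ> inv_into U \<phi>)" using c by auto
qed

end

lemma (in euclidean_hom) hom_slice_ex: "\<exists>U' V g. hom_slice G M F W U' V g"
proof (rule slice)
  fix U' V g
  assume a: "open U'" "U' \<subseteq> dom" "0 \<in> U'" "open V" "0 \<in> V" "Cinf V g" "g ` V \<subseteq> U'"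
    "\<And>v. v \<in> V \<Longrightarrow> v \<in> W \<Longrightarrow> g v \<in> U' \<and> g v \<in> model M \<and> F (ps (g v)) = 0 \<and> pW (g v) = v"
    "\<And>u. u \<in> U' \<Longrightarrow> u \<in> model M \<Longrightarrow> F (ps u) = 0 \<Longrightarrow> pW u \<in> V \<and> g (pW u) = u"
  have "hom_slice G M F W U' V g"
    by (rule hom_slice.intro[OF euclidean_hom_axioms hom_slice_axioms.intro]) (rule a; assumption)+
  thus ?thesis by blast
qed

context hom_slice
begin

lemma K_mult_smooth: "smooth_map (prod_manifold N N) N (\<lambda>(x, y). x \<otimes> y)"
  unfolding smooth_map_def
proof (intro conjI ballI)
  let ?m = "\<lambda>(x, y). x \<otimes> y"
  have 1: "continuous_map (prod_topology (mtop N) (mtop N)) T ?m"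
    unfolding N_simps subtopology_Times[symmetric] by (rule continuous_map_from_subtopology[OF LG.mult_cont])
  show "continuous_map (mtop (prod_manifold N N)) (mtop N) ?m"
    using 1 topspace_N K_mult by (auto simp: prod_manifold_def continuous_map_in_subtopology)
  fix c assume "c \<in> atlas (prod_manifold N N)"
  then obtain s t where c: "c = (cU s \<times> cU t, map_prod (cf s) (cf t))" and s: "s \<in> K" and t: "t \<in> K"
    by (auto simp: prod_manifold_def)
  let ?C = "cU s \<times> cU t" and ?f = "map_prod (cf s) (cf t)"
  have inv: "inv_into ?C ?f (?f p) = p" if "p \<in> ?C" for p
    by (rule inv_into_f_f[OF _ that], rule inj_on_inverseI[of _ "map_prod (ci s) (ci t)"]) (use ci(4) s t in auto)
  have oV: "open (V \<times> V)" using sl(4) by (simp add: open_Times)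
  have m1: "msmooth M (V \<times> V) (\<lambda>q. ci s (fst q))"
    by (rule msmooth_precomp[OF manifold msmooth_ci[OF s] oV Cinf_linear[OF oV bounded_linear_fst]]) auto
  have m2: "msmooth M (V \<times> V) (\<lambda>q. ci t (snd q))"
    by (rule msmooth_precomp[OF manifold msmooth_ci[OF t] oV Cinf_linear[OF oV bounded_linear_snd]]) auto
  note m = msmooth_mult[OF m1 m2]
  have "smooth_on (?f ` (?C \<inter> ?m -` cU u)) (cf u \<circ> ?m \<circ> inv_into ?C ?f)" if u: "u \<in> K" for u
  proof (rule smooth_on_cf[OF m _ u])
    show "?f ` (?C \<inter> ?m -` cU u) \<subseteq> V \<times> V" using ci(3) s t by auto
    fix q assume "q \<in> ?f ` (?C \<inter> ?m -` cU u)"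
    then obtain x y where xy: "x \<in> cU s" "y \<in> cU t" "x \<otimes> y \<in> cU u" "q = ?f (x, y)" by auto
    thus "ci s (fst q) \<otimes> ci t (snd q) \<in> cU u \<and> (cf u \<circ> ?m \<circ> inv_into ?C ?f) q = cf u (ci s (fst q) \<otimes> ci t (snd q))"
      using inv[of "(x, y)"] ci(4)[OF s xy(1)] ci(4)[OF t xy(2)] by simp
  qed
  thus "case c of (U, \<phi>) \<Rightarrow> \<forall>(Va, \<psi>)\<in>atlas N. smooth_on (\<phi> ` (U \<inter> ?m -` Va)) (\<psi> \<circ> ?m \<circ> inv_into U \<phi>)"
    unfolding c by auto
qed

lemma K_smooth_mapI:
  assumes cont: "continuous_map (mtop N) (mtop P) f"
    and sm: "\<And>s U \<psi>. s \<in> K \<Longrightarrow> (U, \<psi>) \<in> atlas P \<Longrightarrow> smooth_on (cf s ` (cU s \<inter> f -` U)) (\<lambda>v. \<psi> (f (ci s v)))"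
  shows "smooth_map N P f" unfolding smooth_map_def
proof (intro conjI cont ballI)
  fix c assume "c \<in> atlas N"
  then obtain s where c: "c = (cU s, cf s)" and s: "s \<in> K" by auto
  have "smooth_on (cf s ` (cU s \<inter> f -` U)) (\<psi> \<circ> f \<circ> inv_into (cU s) (cf s))" if U: "(U, \<psi>) \<in> atlas P" for U \<psi>
  proof -
    have "(\<psi> \<circ> f \<circ> inv_into (cU s) (cf s)) v = \<psi> (f (ci s v))" if "v \<in> cf s ` (cU s \<inter> f -` U)" for v
      using inv_into_cf[OF s, of v] ci(3)[OF s] that by auto
    thus ?thesis using sm[OF s U] unfolding smooth_on_def by (metis Int_iff)
  qed
  thus "case c of (V, \<phi>) \<Rightarrow> \<forall>(U, \<psi>)\<in>atlas P. smooth_on (\<phi> ` (V \<inter> f -` U)) (\<psi> \<circ> f \<circ> inv_into V \<phi>)"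
    unfolding c by auto
qed

text \<open>Stated for any \<open>f\<close> that inverts the elements of \<open>K\<close>, because
  the inverse of the subgroup is known to agree with that of \<open>G\<close> only there.\<close>

lemma K_inv_smooth:
  assumes f: "\<And>x. x \<in> K \<Longrightarrow> f x = inv x" shows "smooth_map N N f"
proof (rule K_smooth_mapI)
  have "continuous_map (mtop N) T (\<lambda>x. inv x)"
    unfolding N_simps by (rule continuous_map_from_subtopology[OF LG.inv_cont])
  hence "continuous_map (mtop N) T f" by (rule continuous_map_eq) (use f topspace_N in auto)
  thus "continuous_map (mtop N) (mtop N) f" using topspace_N K_inv f by (auto simp: continuous_map_in_subtopology)
  fix s U \<psi> assume s: "s \<in> K" and "(U, \<psi>) \<in> atlas N"
  then obtain t where t: "t \<in> K" "U = cU t" "\<psi> = cf t" by auto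
  have "smooth_on (cf s ` (cU s \<inter> f -` cU t)) (\<lambda>v. cf t (f (ci s v)))"
  proof (rule smooth_on_cf[OF msmooth_inv[OF msmooth_ci[OF s]] _ t(1)])
    show "cf s ` (cU s \<inter> f -` cU t) \<subseteq> V" using ci(3)[OF s] by auto
    fix v assume "v \<in> cf s ` (cU s \<inter> f -` cU t)"
    then obtain x where x: "x \<in> cU s" "f x \<in> cU t" "v = cf s x" by auto
    moreover have "f x = inv x" by (rule f) (use x(1) in \<open>simp add: cU_def\<close>)
    ultimately show "inv (ci s v) \<in> cU t \<and> cf t (f (ci s v)) = cf t (inv (ci s v))" using ci(4)[OF s x(1)] by simp
  qed
  thus "smooth_on (cf s ` (cU s \<inter> f -` U)) (\<lambda>v. \<psi> (f (ci s v)))" using t by simp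
qed

lemma lie_group_N: "lie_group (G\<lparr>carrier := K\<rparr>) N"
proof (rule lie_group.intro[OF subgroup.subgroup_is_group[OF K_subgroup is_group] lie_group_axioms.intro[OF manifold_N]])
  show "topspace (mtop N) = carrier (G\<lparr>carrier := K\<rparr>)" using topspace_N by simp
  show "smooth_map (prod_manifold N N) N (\<lambda>(x, y). x \<otimes>\<^bsub>G\<lparr>carrier := K\<rparr>\<^esub> y)" using K_mult_smooth by simp
  show "smooth_map N N (\<lambda>x. inv\<^bsub>G\<lparr>carrier := K\<rparr>\<^esub> x)" by (rule K_inv_smooth) (rule m_inv_consistent[OF K_subgroup])
qed

lemma inclusion_smooth: "smooth_map N M (\<lambda>x. x)"
proof (rule K_smooth_mapI)
  show "continuous_map (mtop N) T (\<lambda>x. x)" unfolding N_simps by (rule continuous_map_from_subtopology) simp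
  fix s U \<psi> assume s: "s \<in> K" and c: "(U, \<psi>) \<in> atlas M"
  show "smooth_on (cf s ` (cU s \<inter> (\<lambda>x. x) -` U)) (\<lambda>v. \<psi> (ci s v))"
  proof (rule smooth_onI[OF msmoothD(5)[OF msmooth_ci[OF s] chart(1)[OF manifold c]] _ msmoothD(3)[OF msmooth_ci[OF s] c]])
    show "cf s ` (cU s \<inter> (\<lambda>x. x) -` U) \<subseteq> V \<inter> ci s -` U" using ci(3,4)[OF s] by auto
  qed simp
qed

text \<open>Near \<open>p\<close>, a smooth function on \<open>K\<close> is the restriction of a smooth function on the ambient
  manifold: compose with the retraction given by the slice chart and multiply by a bump function.\<close>

lemma tangent_ext:
  assumes p: "p \<in> K" and f: "smooth_fun N f"
  shows "\<exists>h c. smooth_fun M h \<and> smooth_fun M c \<and> c p = 1 \<and> (\<forall>x\<in>K. h x = c x * f x)"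
proof -
  have pc: "inv p \<in> carrier G" using K_carrier[OF p] by simp
  let ?O = "pW -` (W \<inter> V)"
  have "Cinf (oproj (model N) -` (cf p ` cU p)) (\<lambda>x. f (inv_into (cU p) (cf p) (oproj (model N) x)))"
    by (rule smooth_fun_chart[OF manifold_N f]) (use p in auto)
  hence H0: "Cinf ?O (\<lambda>y. f (inv_into (cU p) (cf p) (pW y)))" by (simp add: cf_image[OF p])
  have oO: "open ?O" by (rule open_vimage_oproj[OF subspace_W]) (use sl(4) in \<open>auto simp: openin_open\<close>)
  define H where "H y = f (ci p (pW y))" for y
  have H: "Cinf ?O H" by (rule Cinf_cong[OF oO _ H0]) (use inv_into_cf[OF p] in \<open>auto simp: H_def\<close>)
  have "0 \<in> ?O \<inter> U'" using sl(3,5) subspace_0[OF subspace_W] by (simp add: lin)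
  then obtain R where R: "0 < R" "ball 0 R \<subseteq> ?O \<inter> U'" using oO sl(1) open_contains_ball[of "?O \<inter> U'"] by blast
  let ?b = "bump (R / 2) :: 'e \<Rightarrow> real"
  have bH: "Cinf UNIV (\<lambda>y. ?b y * H y)" by (rule Cinf_bump_mult[OF _ _ Cinf_subset[OF _ H]]) (use R in auto)
  define h where "h x = loc (\<lambda>y. ?b y * H y) (inv p \<otimes> x)" for x
  define c where "c x = loc ?b (inv p \<otimes> x)" for x
  have "smooth_fun M h" "smooth_fun M c"
    unfolding h_def[abs_def] c_def[abs_def] by (intro smooth_fun_lmult[OF pc] smooth_loc bH Cinf_bump)+
  moreover have "c p = 1" using K_carrier[OF p] ch(2) R(1) rad(1) by (simp add: c_def loc_def LG.\<phi>_one bump_zero)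
  moreover have "h x = c x * f x" if x: "x \<in> K" for x
  proof (cases "inv p \<otimes> x \<in> U1 \<and> norm (ph (inv p \<otimes> x)) < R")
    case True
    hence "ph (inv p \<otimes> x) \<in> U'" using R(2) by auto
    hence xU: "x \<in> cU p" using True x by (simp add: cU_def)
    hence "H (ph (inv p \<otimes> x)) = f x" using ci(4)[OF p xU] by (simp add: H_def cf_def)
    thus ?thesis by (simp add: h_def c_def loc_def)
  next
    case False
    thus ?thesis using bump_support[of "R / 2" "ph (inv p \<otimes> x)"] R(1) by (auto simp: h_def c_def loc_def)
  qed
  ultimately show ?thesis by blast
qed

text \<open>A derivation \<open>D\<close> at \<open>p\<close> is recovered from its values on
  restrictions of ambient functions: with \<open>h = c f\<close> on \<open>K\<close> and
  \<open>c p = 1\<close>, the Leibniz rule gives \<open>D f = D h - D c * f p\<close>.\<close>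

lemma immersion_N: "immersion N M (\<lambda>x. x)"
  unfolding immersion_def
proof (intro conjI inclusion_smooth ballI inj_onI)
  fix p D1 D2 assume "p \<in> topspace (mtop N)" and D: "D1 \<in> tangent_space N p" "D2 \<in> tangent_space N p"
    and eq: "differential N M (\<lambda>x. x) D1 = differential N M (\<lambda>x. x) D2"
  hence p: "p \<in> K" using topspace_N by simp
  have agree: "D1 h = D2 h" if "smooth_fun M h" for h
    using fun_cong[OF eq, of h] that by (simp add: differential_def o_def)
  have res: "smooth_fun N h" if "smooth_fun M h" for h
    by (rule smooth_fun_comp[OF manifold_N manifold inclusion_smooth that])
  show "D1 = D2"
  proof
    fix f show "D1 f = D2 f"
    proof (cases "smooth_fun N f")
      case f: True
      obtain h c where hc: "smooth_fun M h" "smooth_fun M c" "c p = 1" "\<And>x. x \<in> K \<Longrightarrow> h x = c x * f x"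
        using tangent_ext[OF p f] by blast
      have "D f = D h - D c * f p" if D: "D \<in> tangent_space N p" for D
      proof -
        have "D h = D (\<lambda>x. c x * f x)"
          by (rule tangent_local[OF manifold_N D res[OF hc(1)] smooth_fun_mult[OF manifold_N res[OF hc(2)] f] openin_topspace])
            (use p hc(4) topspace_N in auto)
        thus ?thesis using tangentD(3)[OF D res[OF hc(2)] f] hc(3) by simp
      qed
      thus ?thesis using D agree[OF hc(1)] agree[OF hc(2)] by metis
    qed (simp add: tangentD(1)[OF D(1)] tangentD(1)[OF D(2)])
  qed
qed

text \<open>A path \<open>c\<close> in \<open>G\<close> from the identity to a point of the kernel
  is pushed into the kernel as \<open>Exp (- F (c t)) \<otimes> c t\<close>. This works because
  values of \<open>F\<close> are orthogonal to \<open>W\<close>, so that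
  \<open>F (Exp (- F (c t))) = - F (c t)\<close>, and because the end points are unchanged.\<close>

lemma connected_N:
  assumes conn: "connected_space T" shows "connected_space (mtop N)"
proof -
  have cm: "continuous_map (top_of_set {0..1::real}) T (\<lambda>t. c t \<otimes> d t)"
    if "continuous_map (top_of_set {0..1::real}) T c" "continuous_map (top_of_set {0..1::real}) T d" for c d
    using continuous_map_compose[OF continuous_map_pairedI[OF that] LG.mult_cont] by (simp add: o_def)
  have path: "\<exists>c. continuous_map (top_of_set {0..1::real}) (mtop N) c \<and> c 0 = \<one> \<and> c 1 = x" if x: "x \<in> K" for x
  proof -
    obtain c where c: "continuous_map (top_of_set {0..1::real}) T c" "c 0 = \<one>" "c 1 = x"
      using LG.path_expgen[OF subspace_model subset_refl] K_carrier[OF x] LG.connected_generated[OF conn] by blast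
    have cc: "c t \<in> carrier G" if "t \<in> {0..1}" for t
      using continuous_map_image_subset_topspace[OF c(1)] that topspace_eq by auto
    let ?d = "\<lambda>t. LG.Exp (- F (c t)) \<otimes> c t"
    have "continuous_on {0..1} (\<lambda>t. F (c t))" using continuous_map_compose[OF c(1) F_cont] by (simp add: o_def)
    hence "continuous_map (top_of_set {0..1::real}) T (\<lambda>t. LG.Exp (- F (c t)))"
      by (intro LG.continuous_map_Exp continuous_intros) (auto intro!: subspace_neg[OF subspace_model] F_model cc)
    from cm[OF this c(1)] have d: "continuous_map (top_of_set {0..1::real}) T ?d" .
    have dK: "?d t \<in> K" if t: "t \<in> {0..1}" for t
    proof -
      have Fm: "- F (c t) \<in> model M" by (intro subspace_neg[OF subspace_model] F_model cc t)
      have "pW (- F (c t)) = 0" using lin(7)[of "-1" "F (c t)"] pW_F[OF cc[OF t]] by simp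
      thus ?thesis using F_Exp[OF Fm] F_mult[OF LG.Exp_carrier[OF Fm] cc[OF t]] LG.Exp_carrier[OF Fm] cc[OF t]
        by (simp add: K_def)
    qed
    have "continuous_map (top_of_set {0..1::real}) (mtop N) ?d"
      using d dK by (auto simp: continuous_map_in_subtopology)
    moreover have "F x = 0" "x \<in> carrier G" using x by (auto simp: K_def)
    ultimately show ?thesis using c F_one by (intro exI[of _ ?d]) (simp add: LG.Exp_zero)
  qed
  have "path_connected_space (mtop N)" unfolding path_connected_space_def
  proof (intro ballI)
    fix x y assume "x \<in> topspace (mtop N)" "y \<in> topspace (mtop N)"
    hence x: "x \<in> K" and y: "y \<in> K" using topspace_N by auto
    obtain c where c: "continuous_map (top_of_set {0..1::real}) (mtop N) c" "c 0 = \<one>" "c 1 = inv x \<otimes> y"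
      using path[OF K_mult[OF K_inv[OF x] y]] by blast
    have "continuous_map (top_of_set {0..1::real}) T (\<lambda>t. x \<otimes> c t)"
      using cm[OF _ continuous_map_into_fulltopology[OF c(1)[unfolded N_simps]], of "\<lambda>t. x"] K_carrier[OF x] topspace_eq by simp
    moreover have "x \<otimes> c t \<in> K" if "t \<in> {0..1}" for t
      using continuous_map_image_subset_topspace[OF c(1)] that topspace_N K_mult[OF x] by (auto simp: image_subset_iff)
    ultimately have "pathin (mtop N) (\<lambda>t. x \<otimes> c t)"
      unfolding pathin_def by (auto simp: continuous_map_in_subtopology)
    thus "\<exists>g. pathin (mtop N) g \<and> g 0 = x \<and> g 1 = y"
      using c K_carrier[OF x] K_carrier[OF y] by (intro exI[of _ "\<lambda>t. x \<otimes> c t"]) (simp add: inv_cancel)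
  qed
  thus ?thesis by (rule path_connected_imp_connected_space)
qed

lemma compact_quotient_N:
  assumes \<Gamma>: "subgroup \<Gamma> G" "\<Gamma> \<subseteq> K" and C: "compactin T C" "K \<subseteq> \<Gamma> <#> C" and cl: "closedin T K"
  shows "compact_space (quotient_topology (mtop N) (\<lambda>s. \<Gamma> #> s))"
proof -
  let ?q = "\<lambda>s. \<Gamma> #> s" and ?Q = "quotient_topology (mtop N) (\<lambda>s. \<Gamma> #> s)"
  have op: "openin ?Q O' \<longleftrightarrow> O' \<subseteq> ?q ` K \<and> openin (mtop N) {x \<in> topspace (mtop N). ?q x \<in> O'}" for O'
    unfolding openin_quotient_topology topspace_N by simp
  have tq: "topspace ?Q = ?q ` K"
  proof
    show "topspace ?Q \<subseteq> ?q ` K" using op openin_topspace by blast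
    have "openin ?Q (?q ` K)" unfolding op topspace_N using openin_topspace[of "mtop N"]
      by (auto simp del: N_simps simp: topspace_N intro: back_subst[of "openin (mtop N)"])
    thus "?q ` K \<subseteq> topspace ?Q" by (rule openin_subset)
  qed
  have cq: "continuous_map (mtop N) ?Q ?q" unfolding continuous_map_def tq using op unfolding topspace_N by blast
  have "compactin (mtop N) (C \<inter> K)"
    using closed_Int_compactin[OF cl C(1)] by (simp add: compactin_subtopology Int_commute)
  hence "compactin ?Q (?q ` (C \<inter> K))" by (rule image_compactin[OF _ cq])
  moreover have "?q ` (C \<inter> K) = topspace ?Q"
  proof
    show "?q ` (C \<inter> K) \<subseteq> topspace ?Q" unfolding tq by blast
    show "topspace ?Q \<subseteq> ?q ` (C \<inter> K)" unfolding tq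
    proof
      fix y assume "y \<in> ?q ` K"
      then obtain s where s: "s \<in> K" "y = \<Gamma> #> s" by blast
      then obtain a k where ak: "a \<in> \<Gamma>" "k \<in> C" "s = a \<otimes> k" using C(2) by (auto simp: set_mult_def)
      have ac: "a \<in> carrier G" "a \<in> K" using \<Gamma> ak(1) K_carrier by blast+
      have kc: "k \<in> carrier G" using compactin_subset_topspace[OF C(1)] ak(2) topspace_eq by auto
      have "k = inv a \<otimes> s" using ak(3) inv_cancel(1)[OF ac(1) kc] by simp
      hence "k \<in> K" using K_mult[OF K_inv[OF ac(2)] s(1)] by simp
      moreover have "\<Gamma> #> s = \<Gamma> #> k"
        using coset_mult_assoc[OF subgroup.subset[OF \<Gamma>(1)] ac(1) kc] coset_join2[OF ac(1) \<Gamma>(1) ak(1)] ak(3) by simp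
      ultimately show "y \<in> ?q ` (C \<inter> K)" using s(2) ak(2) by blast
    qed
  qed
  ultimately show ?thesis by (simp add: compact_space_def)
qed

end

section \<open>Existence of the syndetic hull\<close>

locale dense_lie_subgroup = lie_group G M
  for G :: "('g, 'm) monoid_scheme" (structure) and M :: "('g, 'e::euclidean_space) manifold" +
  fixes \<Gamma> :: "'g set"
  assumes conn: "connected_space T" and solv: "solvable G" and \<Gamma>: "subgroup \<Gamma> G" "closedin T \<Gamma>"
    and dense: "algebraically_dense G M \<Gamma>"
begin

sublocale DS: dense_subgroup G "mtop M" "model M" ph U1 "fst est" "snd est" \<Gamma>
  by (rule dense_subgroup.intro[OF local_group dense_subgroup_axioms.intro])
    (rule conn, rule solv, rule \<Gamma>, rule \<Gamma>, rule Poly0_dense[OF dense subgroup.subset[OF \<Gamma>(1)]])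

lemma W_model: "DS.Q.W \<subseteq> model M"
  using DS.Q.W_Lie DS.Lie_carrier by simp

sublocale EH: euclidean_hom G M DS.Q.F DS.Q.W
proof (rule euclidean_hom.intro[OF lie_group_axioms euclidean_hom_axioms.intro])
  show "subspace DS.Q.W" by (rule DS.Q.subspace_W)
  show "DS.Q.W \<subseteq> model M" by (rule W_model)
  show "DS.Q.F (x \<otimes> y) = DS.Q.F x + DS.Q.F y" if "x \<in> carrier G" "y \<in> carrier G" for x y
    by (rule DS.Q.F_mult[OF that])
  show "DS.Q.F (LG.Exp X) = X - oproj DS.Q.W X" if "X \<in> model M" for X
    by (rule DS.Q.F_Exp) (simp add: DS.Lie_carrier that)
  show "DS.Q.F x \<in> model M" if "x \<in> carrier G" for x using DS.Q.F_orth(1)[OF that] by (simp add: DS.Lie_carrier)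
  show "DS.Q.F x \<bullet> w = 0" if "x \<in> carrier G" "w \<in> DS.Q.W" for x w by (rule DS.Q.F_orth(2)[OF that])
  show "continuous_map T euclidean DS.Q.F"
    using DS.Q.F_continuous subtopology_topspace[of "mtop M"] unfolding topspace_eq by simp
qed

lemma closedin_S: "closedin T DS.S"
proof -
  have "closedin T {x \<in> topspace T. DS.Q.F x \<in> {0}}" by (rule closedin_continuous_map_preimage[OF EH.F_cont]) simp
  thus ?thesis by (simp add: DS.S_def topspace_eq)
qed

lemma Gamma_S: "\<Gamma> \<subseteq> DS.S"
proof
  fix x assume x: "x \<in> \<Gamma>"
  show "x \<in> DS.S" unfolding DS.S_def
    using DS.Q.F_Lambda[OF DS.Gamma_\<Lambda>0[OF x]] subgroup.mem_carrier[OF \<Gamma>(1) x] by simp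
qed

lemma syndetic_hull_S: "syndetic_hull G M \<Gamma> DS.S"
proof -
  obtain U' V g where "hom_slice G M DS.Q.F DS.Q.W U' V g" using EH.hom_slice_ex by blast
  then interpret H: hom_slice G M DS.Q.F DS.Q.W U' V g .
  have K: "H.K = DS.S" by (simp add: H.K_def DS.S_def)
  obtain C where C: "compactin T C" "DS.S \<subseteq> \<Gamma> <#> C" using DS.S_cocompact by blast
  have "connected_lie_subgroup G M DS.S H.N" unfolding connected_lie_subgroup_def
    using H.K_subgroup H.lie_group_N H.immersion_N H.connected_N[OF conn] unfolding K by blast
  moreover have "compact_space (quotient_topology (mtop H.N) (\<lambda>s. \<Gamma> #> s))"
    by (rule H.compact_quotient_N[OF \<Gamma>(1) _ C(1)], unfold K) (rule Gamma_S C(2) closedin_S)+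
  ultimately show ?thesis unfolding syndetic_hull_def using Gamma_S by blast
qed

end

section \<open>Uniqueness of the syndetic hull\<close>

locale syndetic_pair = dense_lie_subgroup G M \<Gamma>
  for G :: "('g, 'm) monoid_scheme" (structure) and M :: "('g, 'e::euclidean_space) manifold" and \<Gamma> +
  fixes S' :: "'g set" and N' :: "('g, 'e) manifold"
  assumes S': "connected_lie_subgroup G M S' N'" and \<Gamma>_S': "\<Gamma> \<subseteq> S'"
    and cocompact: "compact_space (quotient_topology (mtop N') (\<lambda>s. \<Gamma> #> s))"
begin

abbreviation "H \<equiv> G\<lparr>carrier := S'\<rparr>"

lemma S'_subgroup: "subgroup S' G" using S' by (simp add: connected_lie_subgroup_def)

sublocale L: lie_group H N' using S' by (simp add: connected_lie_subgroup_def)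

lemma S'_carrier: "x \<in> S' \<Longrightarrow> x \<in> carrier G" by (rule subgroup.mem_carrier[OF S'_subgroup])
lemma S'_mult: "x \<in> S' \<Longrightarrow> y \<in> S' \<Longrightarrow> x \<otimes> y \<in> S'" by (rule subgroup.m_closed[OF S'_subgroup])
lemma S'_inv: "x \<in> S' \<Longrightarrow> inv x \<in> S'" by (rule subgroup.m_inv_closed[OF S'_subgroup])
lemma topspace_N': "topspace (mtop N') = S'" using L.topspace_eq by simp

lemma inclusion: "continuous_map (mtop N') T (\<lambda>x. x)"
  using S' by (simp add: connected_lie_subgroup_def immersion_def smooth_map_def)

text \<open>Compactness is given for the quotient of the possibly finer topology of
  \<open>N'\<close>. The sets \<open>Os s = \<Gamma> s B\<close>, with \<open>B\<close> an open
  neighbourhood of the identity inside the image of a closed ball, are open and saturated; finitely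
  many of them cover. The image of the ball is compact in \<open>N'\<close>, hence in
  \<open>T\<close>.\<close>

lemma S'_cocompact: "\<exists>C. compactin T C \<and> S' = \<Gamma> <#> C"
proof -
  let ?q = "\<lambda>s. \<Gamma> #> s" and ?Q = "quotient_topology (mtop N') (\<lambda>s. \<Gamma> #> s)"
  have op: "openin ?Q O' \<longleftrightarrow> O' \<subseteq> ?q ` S' \<and> openin (mtop N') {x \<in> S'. ?q x \<in> O'}" for O'
    unfolding openin_quotient_topology topspace_N' ..
  have \<Gamma>c: "a \<in> carrier G" if "a \<in> \<Gamma>" for a using subgroup.mem_carrier[OF \<Gamma>(1) that] .
  obtain B where B: "openin (mtop N') B" "\<one>\<^bsub>H\<^esub> \<in> B" "\<forall>w\<in>B. \<exists>X\<in>model N'. norm X < 1 \<and> L.LG.Exp X = w"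
    using L.LG.Exp_neighbourhood[of 1] by auto
  let ?C = "L.LG.Exp ` (cball 0 1 \<inter> model N')"
  have BC: "B \<subseteq> ?C" using B(3) by force
  have BS: "B \<subseteq> S'" using openin_subset[OF B(1)] topspace_N' by simp
  have "compactin (mtop N') ?C"
    by (rule L.LG.compactin_Exp) (simp_all add: closed_Int_compact closed_subspace L.subspace_model compact_Int_closed)
  from image_compactin[OF this inclusion] have C: "compactin T ?C" by simp
  define Os where "Os s = (\<Union>a\<in>\<Gamma>. (\<lambda>w. a \<otimes> s \<otimes> w) ` B)" for s
  have Os_S: "Os s \<subseteq> S'" if "s \<in> S'" for s using that \<Gamma>_S' BS S'_mult unfolding Os_def by blast
  have Os_op: "openin (mtop N') (Os s)" if s: "s \<in> S'" for s unfolding Os_def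
  proof (rule openin_Union, safe)
    fix a assume "a \<in> \<Gamma>"
    hence "a \<otimes> s \<in> S'" using \<Gamma>_S' s S'_mult by blast
    thus "openin (mtop N') ((\<lambda>w. a \<otimes> s \<otimes> w) ` B)" using L.LG.openin_translate[OF _ B(1), of "a \<otimes> s"] by simp
  qed
  have Os_q: "x \<in> Os s" if s: "s \<in> S'" and x: "x \<in> S'" "?q x \<in> ?q ` Os s" for x s
  proof -
    obtain y where y: "y \<in> Os s" "?q x = ?q y" using x(2) by blast
    have "x \<in> \<Gamma> #> y" using rcos_self[OF S'_carrier[OF x(1)] \<Gamma>(1)] y(2) by simp
    then obtain a where a: "a \<in> \<Gamma>" "x = a \<otimes> y" unfolding r_coset_def by blast
    obtain b w where bw: "b \<in> \<Gamma>" "w \<in> B" "y = b \<otimes> s \<otimes> w" using y(1) by (auto simp: Os_def)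
    have "x = (a \<otimes> b) \<otimes> s \<otimes> w" using a bw \<Gamma>c S'_carrier[OF s] S'_carrier BS by (simp add: m_assoc subset_iff)
    moreover have "a \<otimes> b \<in> \<Gamma>" by (rule subgroup.m_closed[OF \<Gamma>(1) a(1) bw(1)])
    ultimately show ?thesis using bw(2) unfolding Os_def by blast
  qed
  have qop: "openin ?Q (?q ` Os s)" if s: "s \<in> S'" for s
  proof -
    have "{x \<in> S'. ?q x \<in> ?q ` Os s} = Os s" using Os_q[OF s] Os_S[OF s] by blast
    thus ?thesis unfolding op using Os_op[OF s] Os_S[OF s] by (simp add: image_mono)
  qed
  have tQ: "topspace ?Q \<subseteq> ?q ` S'" using op[of "topspace ?Q"] by simp
  have self: "s \<in> Os s" if s: "s \<in> S'" for s
    unfolding Os_def using s S'_carrier[OF s] B(2) subgroup.one_closed[OF \<Gamma>(1)] by (auto intro!: bexI[of _ \<one>] image_eqI[of _ _ \<one>])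
  have "topspace ?Q \<subseteq> \<Union>((\<lambda>s. ?q ` Os s) ` S')" using tQ self by blast
  then obtain \<F> where \<F>: "finite \<F>" "\<F> \<subseteq> (\<lambda>s. ?q ` Os s) ` S'" "topspace ?Q \<subseteq> \<Union>\<F>"
    using cocompact[unfolded compact_space_alt, rule_format, of "(\<lambda>s. ?q ` Os s) ` S'"] qop by blast
  obtain J where J: "J \<subseteq> S'" "finite J" "\<F> = (\<lambda>s. ?q ` Os s) ` J" using finite_subset_image[OF \<F>(1,2)] by blast
  have "S' \<subseteq> \<Gamma> <#> (J <#> ?C)"
  proof
    fix x assume x: "x \<in> S'"
    have "openin ?Q (?q ` S')" unfolding op using topspace_N' openin_topspace[of "mtop N'"] by (auto intro: back_subst[of "openin (mtop N')"])
    hence "?q x \<in> topspace ?Q" using openin_subset x by blast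
    then obtain s where s: "s \<in> J" "?q x \<in> ?q ` Os s" using \<F>(3) J(3) by blast
    hence "x \<in> Os s" using Os_q x J(1) by blast
    then obtain a w where aw: "a \<in> \<Gamma>" "w \<in> B" "x = a \<otimes> s \<otimes> w" by (auto simp: Os_def)
    have "x = a \<otimes> (s \<otimes> w)" using aw s(1) J(1) \<Gamma>c S'_carrier BS by (simp add: m_assoc subset_iff)
    moreover have "s \<otimes> w \<in> J <#> ?C" using aw(2) s(1) BC unfolding LG.set_mult_iff by blast
    ultimately show "x \<in> \<Gamma> <#> (J <#> ?C)" using aw(1) unfolding LG.set_mult_iff[of x] by blast
  qed
  moreover have "compactin T (J <#> ?C)"
    by (rule LG.compactin_set_mult[OF finite_imp_compactin C]) (use J S'_carrier topspace_eq in auto)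
  moreover have "\<Gamma> <#> (J <#> ?C) \<subseteq> S'"
  proof
    fix x assume "x \<in> \<Gamma> <#> (J <#> ?C)"
    then obtain a k where a: "a \<in> \<Gamma>" "k \<in> J <#> ?C" "x = a \<otimes> k" unfolding LG.set_mult_iff[of x] by blast
    obtain s X where "s \<in> J" "X \<in> model N'" "k = s \<otimes> L.LG.Exp X" using a(2) unfolding LG.set_mult_iff by blast
    with a show "x \<in> S'" using \<Gamma>_S' J(1) L.LG.Exp_carrier[of X] by (auto intro!: S'_mult)
  qed
  ultimately show ?thesis by blast
qed

lemma S'_closed: "closedin T S'"
  using S'_cocompact LG.closedin_set_mult[OF \<Gamma>(2)] by metis

lemma S'_subset: "S' \<subseteq> DS.S"
proof
  fix s assume s: "s \<in> S'"
  obtain C where C: "compactin T C" "S' = \<Gamma> <#> C" using S'_cocompact by blast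
  have Cc: "k \<in> carrier G" if "k \<in> C" for k using LG.compactin_carrier[OF C(1)] that by blast
  have "compact (DS.Q.F ` C)" using image_compactin[OF C(1) EH.F_cont] by simp
  then obtain B where B: "\<And>k. k \<in> C \<Longrightarrow> norm (DS.Q.F k) \<le> B" using compact_imp_bounded bounded_iff by (metis imageI)
  have bound: "norm (DS.Q.F x) \<le> B" if x: "x \<in> S'" for x
  proof -
    obtain a k where ak: "a \<in> \<Gamma>" "k \<in> C" "x = a \<otimes> k" using x C(2) LG.set_mult_iff by blast
    have "a \<in> carrier G" "DS.Q.F a = 0" using Gamma_S ak(1) by (auto simp: DS.S_def)
    thus ?thesis using B[OF ak(2)] EH.F_mult[OF _ Cc[OF ak(2)]] ak(3) by simp
  qed
  have pow: "DS.Q.F (s [^] n) = real n *\<^sub>R DS.Q.F s" for n :: nat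
    using S'_carrier[OF s] by (induction n) (simp_all add: EH.F_one EH.F_mult scaleR_add_left)
  have "norm (DS.Q.F s) = 0"
  proof (rule ccontr)
    assume "norm (DS.Q.F s) \<noteq> 0"
    then obtain n where "B < real n * norm (DS.Q.F s)" using reals_Archimedean3[of "norm (DS.Q.F s)"] by auto
    thus False using bound[OF LG.subgroup_pow[OF S'_subgroup s], of n] pow[of n] by simp
  qed
  thus "s \<in> DS.S" using S'_carrier[OF s] by (simp add: DS.S_def)
qed

abbreviation "\<LL> \<equiv> LG.Lie S'"

lemma \<LL>_model: "\<LL> \<subseteq> model M" using LG.LieD(1) by blast
lemma subspace_\<LL>: "subspace \<LL>" by (rule LG.subspace_Lie[OF S'_subgroup S'_closed])

text \<open>As a connected Lie group, \<open>S'\<close> is generated by its own one-parameter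
  subgroups. Composed with the continuous inclusion they are one-parameter subgroups of
  \<open>G\<close>, hence of the form \<open>Exp (t Y)\<close> with
  \<open>Y \<in> \<LL>\<close>.\<close>

lemma S'_generated: "LG.expgen \<LL> = S'"
proof
  show 1: "LG.expgen \<LL> \<subseteq> S'" by (intro LG.expgen_least S'_subgroup image_subsetI LG.Exp_Lie)
  have "connected_space (mtop N')" using S' by (simp add: connected_lie_subgroup_def)
  hence "S' = L.LG.expgen (model N')" using L.LG.connected_generated by simp
  also have "\<dots> \<subseteq> LG.expgen \<LL>"
  proof (rule L.LG.expgen_least)
    show "subgroup (LG.expgen \<LL>) H" by (rule subgroup_incl[OF LG.subgroup_expgen[OF \<LL>_model] S'_subgroup 1])
    show "L.LG.Exp ` model N' \<subseteq> LG.expgen \<LL>"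
    proof (rule image_subsetI)
      fix X assume X: "X \<in> model N'"
      let ?c = "\<lambda>t. L.LG.Exp (t *\<^sub>R X)"
      have tX: "t *\<^sub>R X \<in> model N'" for t by (rule subspace_scale[OF L.subspace_model X])
      have "continuous_map (top_of_set UNIV) (mtop N') ?c"
        by (rule L.LG.continuous_map_Exp) (use tX in \<open>auto intro!: continuous_intros\<close>)
      from continuous_map_compose[OF this inclusion] have c: "continuous_map euclideanreal T ?c" by (simp add: o_def)
      have "\<exists>Y\<in>model M. \<forall>t. ?c t = LG.Exp (t *\<^sub>R Y)"
        by (rule LG.one_parameter_subgroup[OF c]) (use L.LG.Exp_add[OF X] in simp)
      then obtain Y where Y: "Y \<in> model M" "\<And>t. ?c t = LG.Exp (t *\<^sub>R Y)" by blast
      have "?c t \<in> S'" for t using L.LG.Exp_carrier[OF tX] by simp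
      hence "Y \<in> \<LL>" using Y unfolding LG.Lie_def by simp
      thus "L.LG.Exp X \<in> LG.expgen \<LL>" using LG.Exp_expgen Y(2)[of 1] by simp
    qed
  qed
  finally show "S' \<subseteq> LG.expgen \<LL>" .
qed

text \<open>Let \<open>?w\<close> be the component of \<open>Adj g X - Y\<close> orthogonal to
  \<open>V\<close>, for the given \<open>g\<close>. The function
  \<open>h \<mapsto> ?w \<bullet> (Adj h X - Y)\<close> is polynomial and zero on
  \<open>\<Gamma>\<close>, hence zero at \<open>g\<close>, where its value is the square of the norm
  of \<open>?w\<close>.\<close>

lemma affine_dense:
  assumes V: "subspace V" and X: "X \<in> model M" and Y: "\<And>g. g \<in> \<Gamma> \<Longrightarrow> LG.Adj g X - Y \<in> V" and g: "g \<in> carrier G"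
  shows "LG.Adj g X - Y \<in> V"
proof -
  let ?Z = "LG.Adj g X - Y"
  let ?w = "?Z - oproj V ?Z"
  have "(\<lambda>g. ?w \<bullet> LG.Adj g X + - (?w \<bullet> Y)) \<in> LG.Poly0" by (intro LG.Poly0.add LG.Poly0.coef LG.Poly0.const X)
  moreover have "?w \<bullet> LG.Adj h X + - (?w \<bullet> Y) = 0" if "h \<in> \<Gamma>" for h
    using oproj_orth[OF V Y[OF that], of ?Z] by (simp add: inner_diff_right)
  ultimately have "?w \<bullet> LG.Adj g X + - (?w \<bullet> Y) = 0" using DS.dens[OF _ _ g] by blast
  hence "?w \<bullet> ?Z = 0" by (simp add: inner_diff_right)
  moreover have "?w \<bullet> oproj V ?Z = 0" by (rule oproj_orth[OF V oproj_in[OF V]])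
  ultimately have "?w \<bullet> ?w = 0" by (simp add: inner_diff_right[of ?w ?Z])
  hence "?Z = oproj V ?Z" by simp
  thus ?thesis using oproj_in[OF V] by metis
qed

lemma Adj_\<LL>:
  assumes g: "g \<in> carrier G" and X: "X \<in> \<LL>" shows "LG.Adj g X \<in> \<LL>"
proof -
  have "LG.Adj h X - 0 \<in> \<LL>" if "h \<in> \<Gamma>" for h
  proof -
    have h: "h \<in> S'" using that \<Gamma>_S' by blast
    show ?thesis using LG.Adj_Lie[OF S'_carrier[OF h] _ X] S'_mult[OF S'_mult[OF h] S'_inv[OF h]] by simp
  qed
  from affine_dense[OF subspace_\<LL> LG.LieD(1)[OF X] this g] show ?thesis by simp
qed

lemma S'_normal: "g \<in> carrier G \<Longrightarrow> x \<in> S' \<Longrightarrow> g \<otimes> x \<otimes> inv g \<in> S'"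
  using LG.expgen_conj[OF _ S'_subgroup Adj_\<LL>] S'_generated by metis

text \<open>For \<open>h \<in> \<Gamma>\<close> the commutators of \<open>h\<close> with elements of
  \<open>G\<close> lie in \<open>S'\<close>, which is already known to be normal; so the claim holds
  on \<open>\<Gamma>\<close>, and \<open>affine_dense\<close> extends it to
  \<open>G\<close>.\<close>

lemma Adj_diff_\<LL>:
  assumes g: "g \<in> carrier G" and X: "X \<in> model M" shows "LG.Adj g X - X \<in> \<LL>"
proof (rule affine_dense[OF subspace_\<LL> X _ g])
  fix h assume h: "h \<in> \<Gamma>"
  have hS: "h \<in> S'" using h \<Gamma>_S' by blast
  note hc = S'_carrier[OF hS]
  show "LG.Adj h X - X \<in> \<LL>"
  proof (rule LG.commutator_diff_Lie[OF S'_subgroup S'_closed subgroup_self hc])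
    show "X \<in> LG.Lie (carrier G)" using X DS.Lie_carrier by simp
    fix y assume y: "y \<in> carrier G"
    have "h \<otimes> (y \<otimes> inv h \<otimes> inv y) \<in> S'" by (intro S'_mult hS S'_normal y S'_inv)
    thus "h \<otimes> y \<otimes> inv h \<otimes> inv y \<in> S'" using hc y by (simp add: m_assoc)
  qed
qed

lemma commutator_S': "g \<in> carrier G \<Longrightarrow> h \<in> carrier G \<Longrightarrow> g \<otimes> h \<otimes> inv g \<otimes> inv h \<in> S'"
  by (rule LG.commutator_in[OF S'_subgroup S'_closed subgroup_self])
    (simp_all add: DS.Lie_carrier LG.connected_generated[OF conn] S'_normal Adj_diff_\<LL>)

lemma cl_S': "DS.cl (Suc 0) \<subseteq> S'"
proof -
  have "DS.D (Suc 0) \<subseteq> S'"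
    unfolding DS.D_def by (simp add: derived_def) (rule generate_subgroup_incl[OF _ S'_subgroup], use commutator_S' in blast)
  thus ?thesis unfolding DS.cl_def by (rule closure_of_minimal[OF _ S'_closed])
qed

lemma \<Lambda>0_S': "DS.\<Lambda>0 \<subseteq> S'"
proof -
  have "\<Gamma> <#> DS.cl (Suc 0) \<subseteq> S'" using \<Gamma>_S' cl_S' S'_mult unfolding LG.set_mult_iff subset_iff by blast
  thus ?thesis unfolding DS.\<Lambda>0_def by (rule closure_of_minimal[OF _ S'_closed])
qed

end

section \<open>Winding numbers modulo the closed derived group\<close>

context local_group
begin

text \<open>Uniform continuity of a map from a compact set, expressed by left quotients in the
  group.\<close>

lemma uniform_quotient:
  fixes h :: "'x::metric_space \<Rightarrow> 'g"
  assumes S: "compact S" and h: "continuous_map (top_of_set S) T h" and O: "openin T O'" "\<one> \<in> O'"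
  shows "\<exists>\<delta>>0. \<forall>a\<in>S. \<forall>b\<in>S. dist a b < \<delta> \<longrightarrow> inv (h a) \<otimes> h b \<in> O'"
proof (rule ccontr)
  assume "\<not> ?thesis"
  hence "\<forall>n::nat. \<exists>a\<in>S. \<exists>b\<in>S. dist a b < inverse (Suc n) \<and> inv (h a) \<otimes> h b \<notin> O'"
    by (metis inverse_positive_iff_positive of_nat_0_less_iff zero_less_Suc)
  then obtain a b where ab: "\<And>n::nat. a n \<in> S" "\<And>n. b n \<in> S" "\<And>n. dist (a n) (b n) < inverse (Suc n)"
    "\<And>n. inv (h (a n)) \<otimes> h (b n) \<notin> O'" by metis
  obtain l r where l: "l \<in> S" "strict_mono r" "(a \<circ> r) \<longlonglongrightarrow> l" using S ab(1) unfolding compact_def by metis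
  have "(\<lambda>n. dist (a (r n)) (b (r n))) \<longlonglongrightarrow> 0"
  proof (rule tendsto_sandwich[OF _ _ tendsto_const])
    show "\<forall>\<^sub>F n in sequentially. dist (a (r n)) (b (r n)) \<le> inverse (Suc (r n))"
      using ab(3) by (auto intro!: always_eventually less_imp_le)
    show "(\<lambda>n. inverse (real (Suc (r n)))) \<longlonglongrightarrow> 0"
      using LIMSEQ_subseq_LIMSEQ[OF LIMSEQ_inverse_real_of_nat l(2)] by (simp add: o_def)
  qed simp
  from tendsto_add[OF this l(3)[unfolded tendsto_dist_iff[of "a \<circ> r"]]]
  have "(\<lambda>n. dist (a (r n)) (b (r n)) + dist (a (r n)) l) \<longlonglongrightarrow> 0" by simp
  hence bl: "(b \<circ> r) \<longlonglongrightarrow> l" unfolding tendsto_dist_iff[of "b \<circ> r"]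
    by (rule Lim_null_comparison[rotated]) (auto intro!: always_eventually dist_triangle3 simp: o_def)
  have lim: "limitin T (h \<circ> (x \<circ> r)) (h l) sequentially" if "(x \<circ> r) \<longlonglongrightarrow> l" "\<And>n. x n \<in> S" for x
    by (rule continuous_map_limit[OF h]) (use that l(1) in \<open>simp add: limitin_subtopology\<close>)
  have "h l \<in> carrier G" using continuous_map_image_subset_topspace[OF h] l(1) by auto
  hence "limitin T (\<lambda>n. inv (h (a (r n))) \<otimes> h (b (r n))) \<one> sequentially"
    using limitin_mult[OF limitin_inv[OF lim[OF l(3) ab(1)]] lim[OF bl ab(2)]] by (simp add: o_def)
  hence "\<forall>\<^sub>F n in sequentially. inv (h (a (r n))) \<otimes> h (b (r n)) \<in> O'" using O by (simp add: limitin_def)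
  thus False using ab(4) by (simp add: eventually_sequentially)
qed

end

context dense_lie_subgroup
begin

abbreviation "\<CC> \<equiv> DS.cl (Suc 0)"

lemma abelian_quotient_cl: "subgroup A G \<Longrightarrow> closedin T A \<Longrightarrow> \<CC> \<subseteq> A \<Longrightarrow> LG.expgen (LG.Lie A) = A \<Longrightarrow>
    abelian_quotient G T (model M) ph U1 (fst est) (snd est) A \<CC>"
  by (rule abelian_quotient.intro[OF local_group abelian_quotient_axioms.intro])
    (simp_all add: DS.cl_subgroup DS.cl_closed DS.cl_comm DS.cl_zero subgroup.mem_carrier)

lemma abelian_quotient_carrier: "abelian_quotient G T (model M) ph U1 (fst est) (snd est) (carrier G) \<CC>"
proof (rule abelian_quotient_cl[OF subgroup_self])
  show "closedin T (carrier G)" using closedin_topspace[of "mtop M"] unfolding topspace_eq .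
  show "\<CC> \<subseteq> carrier G" using DS.cl_carrier by blast
  show "LG.expgen (LG.Lie (carrier G)) = carrier G" using LG.connected_generated[OF conn] by (simp add: DS.Lie_carrier)
qed

text \<open>In the abelian quotient by \<open>\<CC>\<close> the hypothesis says that
  \<open>Exp (X + Y - Z)\<close> lies in \<open>\<CC>\<close>. The bound of
  \<open>closed_subgroup_log\<close> is divided by 3, so that it covers this sum of three
  vectors.\<close>

lemma log_additive:
  "\<exists>\<epsilon>>0. \<forall>X\<in>model M. \<forall>Y\<in>model M. \<forall>Z\<in>model M. norm X < \<epsilon> \<longrightarrow> norm Y < \<epsilon> \<longrightarrow> norm Z < \<epsilon> \<longrightarrow>
     inv (LG.Exp Z) \<otimes> (LG.Exp X \<otimes> LG.Exp Y) \<in> \<CC> \<longrightarrow> X + Y - Z \<in> LG.Lie \<CC>"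
proof -
  interpret A: abelian_quotient G "mtop M" "model M" ph U1 "fst est" "snd est" "carrier G" \<CC>
    by (rule abelian_quotient_carrier)
  obtain \<epsilon> where e: "\<epsilon> > 0" "\<And>X. X \<in> model M \<Longrightarrow> norm X < \<epsilon> \<Longrightarrow> LG.Exp X \<in> \<CC> \<Longrightarrow> X \<in> LG.Lie \<CC>"
    using LG.closed_subgroup_log[OF DS.cl_subgroup DS.cl_closed] by blast
  have "X + Y - Z \<in> LG.Lie \<CC>" if X: "X \<in> model M" and Y: "Y \<in> model M" and Z: "Z \<in> model M"
    and n: "norm X < \<epsilon> / 3" "norm Y < \<epsilon> / 3" "norm Z < \<epsilon> / 3" and c: "inv (LG.Exp Z) \<otimes> (LG.Exp X \<otimes> LG.Exp Y) \<in> \<CC>" for X Y Z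
  proof -
    have XY: "X + Y \<in> model M" by (rule subspace_add[OF subspace_model X Y])
    have L: "X \<in> LG.Lie (carrier G)" "Y \<in> LG.Lie (carrier G)" "Z \<in> LG.Lie (carrier G)" "X + Y \<in> LG.Lie (carrier G)"
      using X Y Z XY by (simp_all add: DS.Lie_carrier)
    have "A.cong (LG.Exp Z) (LG.Exp X \<otimes> LG.Exp Y)" using c X Y Z by (simp add: A.cong_def LG.Exp_carrier)
    from A.cong_Exp_diff[OF L(3,4) A.cong_trans[OF this A.cong_Exp_add[OF L(1,2)]]]
    have "LG.Exp (X + Y - Z) \<in> \<CC>" by (simp add: A.lattice_def)
    moreover have "norm (X + Y - Z) < \<epsilon>"
      using norm_triangle_ineq4[of "X + Y" Z] norm_triangle_ineq[of X Y] n by linarith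
    ultimately show ?thesis using e(2)[OF subspace_diff[OF subspace_model XY Z]] by blast
  qed
  thus ?thesis using e(1) by (intro exI[of _ "\<epsilon> / 3"]) auto
qed

text \<open>A nonzero class of \<open>Z\<close> modulo the Lie algebra of \<open>\<CC>\<close> would be the winding number of the loop
  \<open>t \<mapsto> Exp (t Z) (c t)\<^sup>-\<^sup>1\<close>, where \<open>c\<close> is a path in \<open>\<CC>\<close> from \<open>\<one>\<close> to \<open>Exp Z\<close>: the sum of the logarithms of
  its small increments modulo the Lie algebra of \<open>\<CC>\<close> is a homotopy invariant.\<close>

lemma Exp_cl_imp_Lie:
  assumes sc: "simply_connected_space T" and Z: "Z \<in> model M" "LG.Exp Z \<in> \<CC>"
  shows "Z \<in> LG.Lie \<CC>"
proof -
  let ?\<cc> = "LG.Lie \<CC>" and ?I = "top_of_set {0..1::real}"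
  have sub\<cc>: "subspace ?\<cc>" by (rule LG.subspace_Lie[OF DS.cl_subgroup DS.cl_closed])
  have \<CC>m: "x \<otimes> y \<in> \<CC>" if "x \<in> \<CC>" "y \<in> \<CC>" for x y by (rule subgroup.m_closed[OF DS.cl_subgroup that])
  have \<CC>i: "inv x \<in> \<CC>" if "x \<in> \<CC>" for x by (rule subgroup.m_inv_closed[OF DS.cl_subgroup that])
  have \<CC>1: "\<one> \<in> \<CC>" by (rule subgroup.one_closed[OF DS.cl_subgroup])
  define q where "q X = X - oproj ?\<cc> X" for X
  have qd: "q (X - Y) = q X - q Y" and qa: "q (X + Y) = q X + q Y" and qs: "q (r *\<^sub>R X) = r *\<^sub>R q X" for X Y r
    by (simp_all add: q_def linear_diff[OF linear_oproj] linear_add[OF linear_oproj] linear_cmul[OF linear_oproj] scaleR_diff_right)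
  have q0: "q X = 0" if "X \<in> ?\<cc>" for X using oproj_id[OF sub\<cc> that] by (simp add: q_def)
  obtain \<epsilon> where e: "\<epsilon> > 0" and add: "\<And>X Y Z. X \<in> model M \<Longrightarrow> Y \<in> model M \<Longrightarrow> Z \<in> model M \<Longrightarrow> norm X < \<epsilon> \<Longrightarrow> norm Y < \<epsilon> \<Longrightarrow>
      norm Z < \<epsilon> \<Longrightarrow> inv (LG.Exp Z) \<otimes> (LG.Exp X \<otimes> LG.Exp Y) \<in> \<CC> \<Longrightarrow> X + Y - Z \<in> ?\<cc>" using log_additive by blast
  obtain B where B: "openin T B" "\<one> \<in> B" "\<And>w. w \<in> B \<Longrightarrow> \<exists>X\<in>model M. norm X < \<epsilon> \<and> LG.Exp X = w"
    using LG.Exp_neighbourhood[OF e] by blast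
  \<comment> \<open>The local logarithm modulo the Lie algebra of \<open>\<CC>\<close>; by
    \<open>log_additive\<close> its value does not depend on the choice.\<close>
  define D where "D z = q (SOME X. X \<in> model M \<and> norm X < \<epsilon> \<and> LG.Exp X = z)" for z
  have D: "\<exists>X\<in>model M. norm X < \<epsilon> \<and> LG.Exp X = z \<and> D z = q X" if "z \<in> B" for z
  proof -
    have "\<exists>X. X \<in> model M \<and> norm X < \<epsilon> \<and> LG.Exp X = z" using B(3)[OF that] by blast
    from someI_ex[OF this] show ?thesis unfolding D_def by blast
  qed
  have Deq: "D z = q X" if z: "z \<in> B" and X: "X \<in> model M" "norm X < \<epsilon>" and c: "inv (LG.Exp X) \<otimes> z \<in> \<CC>" for z X
  proof -
    obtain V where V: "V \<in> model M" "norm V < \<epsilon>" "LG.Exp V = z" "D z = q V" using D[OF z] by blast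
    have "V + 0 - X \<in> ?\<cc>"
      by (rule add) (use V X c e LG.Exp_zero LG.Exp_carrier[OF V(1)] subspace_0[OF subspace_model] in auto)
    from q0[OF this] show ?thesis using V(4) by (simp add: qd)
  qed
  have Dadd: "D (x \<otimes> y) = D x + D y" if xy: "x \<in> B" "y \<in> B" "x \<otimes> y \<in> B" for x y
  proof -
    obtain X where X: "X \<in> model M" "norm X < \<epsilon>" "LG.Exp X = x" "D x = q X" using D[OF xy(1)] by blast
    obtain Y where Y: "Y \<in> model M" "norm Y < \<epsilon>" "LG.Exp Y = y" "D y = q Y" using D[OF xy(2)] by blast
    obtain V where V: "V \<in> model M" "norm V < \<epsilon>" "LG.Exp V = x \<otimes> y" "D (x \<otimes> y) = q V" using D[OF xy(3)] by blast
    have "inv (LG.Exp V) \<otimes> (LG.Exp X \<otimes> LG.Exp Y) = \<one>" using V(3) X(3) Y(3) LG.Exp_carrier[OF V(1)] by simp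
    hence "X + Y - V \<in> ?\<cc>" by (intro add X Y V) (simp add: \<CC>1)
    from q0[OF this] show ?thesis using V(4) X(4) Y(4) by (simp add: qd qa)
  qed
  have D1: "D \<one> = 0"
    using Deq[OF B(2) subspace_0[OF subspace_model]] e \<CC>1 q0[OF subspace_0[OF sub\<cc>]] by (simp add: LG.Exp_zero)
  obtain c where c: "continuous_map ?I T c" "c 0 = \<one>" "c 1 = LG.Exp Z" "\<And>t. t \<in> {0..1} \<Longrightarrow> c t \<in> \<CC>"
    using LG.path_expgen[OF sub\<cc> _, of "LG.Exp Z"] Z(2) LG.LieD(1) DS.cl_gen by blast
  define p where "p t = LG.Exp (t *\<^sub>R Z) \<otimes> inv (c t)" for t
  have tZ: "t *\<^sub>R Z \<in> model M" for t by (rule subspace_scale[OF subspace_model Z(1)])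
  have cE: "continuous_map ?I T (\<lambda>t. LG.Exp (t *\<^sub>R Z))"
    by (rule LG.continuous_map_Exp) (use tZ in \<open>auto intro!: continuous_intros\<close>)
  have "continuous_map ?I T (\<lambda>t. inv (c t))" using continuous_map_compose[OF c(1) LG.inv_cont] by (simp add: o_def)
  from continuous_map_compose[OF continuous_map_pairedI[OF cE this] LG.mult_cont]
  have "pathin T p" by (simp add: pathin_def p_def[abs_def] o_def)
  moreover have p01: "p 0 = \<one>" "p 1 = \<one>" using c LG.Exp_carrier[OF Z(1)] by (simp_all add: p_def LG.Exp_zero)
  moreover have "pathin T (\<lambda>t. \<one>)" using topspace_eq by (simp add: pathin_def)
  ultimately have "homotopic_with (\<lambda>r. r 1 = r 0) ?I T p (\<lambda>t. \<one>)"
    using sc[unfolded simply_connected_space_def, rule_format, of p "\<lambda>t. \<one>"] by simp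
  then obtain h where h: "continuous_map (prod_topology ?I ?I) T h" "\<And>x. h (0, x) = p x" "\<And>x. h (1, x) = \<one>"
    "\<And>t. t \<in> {0..1} \<Longrightarrow> h (t, 1) = h (t, 0)" unfolding homotopic_with_def by auto
  let ?S = "{0..1::real} \<times> {0..1::real}"
  have h': "continuous_map (top_of_set ?S) T h" using h(1) by (simp add: subtopology_Times euclidean_product_topology)
  have hG: "h a \<in> carrier G" if "a \<in> ?S" for a
    using continuous_map_image_subset_topspace[OF h'] that topspace_eq by (auto simp: image_subset_iff)
  obtain \<delta> where d: "\<delta> > 0" "\<And>a b. a \<in> ?S \<Longrightarrow> b \<in> ?S \<Longrightarrow> dist a b < \<delta> \<Longrightarrow> inv (h a) \<otimes> h b \<in> B"
    using LG.uniform_quotient[OF compact_Times[OF compact_Icc compact_Icc] h' B(1,2)] by blast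
  \<comment> \<open>The first bound makes one grid step in each direction move \<open>h\<close> by
    an element of \<open>B\<close>; the second makes \<open>Z / N\<close> short enough for the local
    logarithm.\<close>
  obtain N :: nat where "max (2 / \<delta>) (norm Z / \<epsilon>) < real N" using reals_Archimedean2 by blast
  hence N: "2 / \<delta> < real N" "norm Z / \<epsilon> < real N" by auto
  hence N0: "0 < N" using d(1) by (metis divide_pos_pos gr0I less_trans of_nat_0 zero_less_numeral order_less_irrefl)
  have N2: "2 / real N < \<delta>" "norm Z / real N < \<epsilon>" using N N0 d(1) e by (simp_all add: field_simps)
  let ?t = "\<lambda>i::nat. real i / real N"
  have t01: "?t i \<in> {0..1}" if "i \<le> N" for i using that N0 by (auto simp: divide_simps)
  have near: "inv (h (s, ?t i)) \<otimes> h (s', ?t j) \<in> B"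
    if "s \<in> {0..1}" "s' \<in> {0..1}" "\<bar>s - s'\<bar> \<le> 1 / real N" "i \<le> N" "j \<le> N" "j = i \<or> j = Suc i" for s s' i j
  proof (rule d(2))
    have "\<bar>?t i - ?t j\<bar> \<le> 1 / real N" using that(6) N0 by (auto simp: divide_simps)
    hence "dist (s, ?t i) (s', ?t j) \<le> 2 / real N"
      using sqrt_sum_squares_le_sum_abs[of "s - s'" "?t i - ?t j"] that(3) by (simp add: dist_Pair_Pair dist_real_def)
    thus "dist (s, ?t i) (s', ?t j) < \<delta>" using N2(1) by linarith
  qed (use that t01 in auto)
  define w where "w s = (\<Sum>i<N. D (inv (h (s, ?t i)) \<otimes> h (s, ?t (Suc i))))" for s
  have step: "w s = w s'" if s: "s \<in> {0..1}" "s' \<in> {0..1}" "\<bar>s - s'\<bar> \<le> 1 / real N" for s s'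
  proof -
    \<comment> \<open>The logarithms of the transversal increments between two neighbouring loops.
      Going around a small square both ways gives a telescoping sum, and \<open>?e 0 = ?e N\<close>
      because the intermediate paths are closed.\<close>
    let ?e = "\<lambda>i. D (inv (h (s, ?t i)) \<otimes> h (s', ?t i))"
    have "D (inv (h (s, ?t i)) \<otimes> h (s, ?t (Suc i))) - D (inv (h (s', ?t i)) \<otimes> h (s', ?t (Suc i))) = ?e i - ?e (Suc i)"
      if i: "i < N" for i
    proof -
      let ?a = "h (s, ?t i)" and ?a' = "h (s, ?t (Suc i))" and ?b = "h (s', ?t i)" and ?b' = "h (s', ?t (Suc i))"
      have G: "?a \<in> carrier G" "?a' \<in> carrier G" "?b \<in> carrier G" "?b' \<in> carrier G"
        using i s by (auto intro!: hG t01)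
      have m: "(inv ?a \<otimes> ?a') \<otimes> (inv ?a' \<otimes> ?b') = inv ?a \<otimes> ?b'" "(inv ?a \<otimes> ?b) \<otimes> (inv ?b \<otimes> ?b') = inv ?a \<otimes> ?b'"
        using G by (simp_all add: m_assoc inv_solve_left[symmetric])
      have n: "inv ?a \<otimes> ?a' \<in> B" "inv ?a' \<otimes> ?b' \<in> B" "inv ?a \<otimes> ?b' \<in> B" "inv ?a \<otimes> ?b \<in> B" "inv ?b \<otimes> ?b' \<in> B"
        by (rule near; use i s in simp)+
      have "D (inv ?a \<otimes> ?a') + D (inv ?a' \<otimes> ?b') = D (inv ?a \<otimes> ?b')" using Dadd[OF n(1,2)] n(3) m(1) by simp
      moreover have "D (inv ?a \<otimes> ?b) + D (inv ?b \<otimes> ?b') = D (inv ?a \<otimes> ?b')" using Dadd[OF n(4,5)] n(3) m(2) by simp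
      ultimately show ?thesis by (simp add: algebra_simps)
    qed
    hence "w s - w s' = (\<Sum>i<N. ?e i - ?e (Suc i))" by (simp add: w_def sum_subtractf[symmetric])
    also have "\<dots> = ?e 0 - ?e N" by (rule sum_lessThan_telescope')
    also have "\<dots> = 0" using h(4)[OF s(1)] h(4)[OF s(2)] N0 by simp
    finally show ?thesis by simp
  qed
  have "w (?t j) = w 0" if "j \<le> N" for j using that
  proof (induction j)
    case (Suc j)
    have "w (?t (Suc j)) = w (?t j)" by (rule step) (use Suc t01 in \<open>auto simp: divide_simps\<close>)
    thus ?case using Suc by simp
  qed simp
  from this[of N] have "w 0 = w 1" using N0 by simp
  also have "w 1 = 0" by (simp add: w_def h(3) D1)
  finally have w0: "w 0 = 0" .
  \<comment> \<open>An increment of \<open>p\<close> is \<open>Exp (Z / N)\<close> with elements of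
    \<open>\<CC>\<close> on both sides. Since \<open>\<CC>\<close> is normal, it is congruent to
    \<open>Exp (Z / N)\<close> modulo \<open>\<CC>\<close>, so the increments sum to the class of
    \<open>Z\<close>.\<close>
  have "D (inv (p (?t i)) \<otimes> p (?t (Suc i))) = (1 / real N) *\<^sub>R q Z" if i: "i < N" for i
  proof -
    let ?x = "LG.Exp ((1 / real N) *\<^sub>R Z)" and ?c = "c (?t i)" and ?c' = "c (?t (Suc i))" and ?y = "LG.Exp (?t i *\<^sub>R Z)"
    have cC: "?c \<in> \<CC>" "?c' \<in> \<CC>" using i by (auto intro!: c(4) t01)
    note cc = DS.cl_carrier[OF cC(1)] DS.cl_carrier[OF cC(2)] and xc = LG.Exp_carrier[OF tZ]
    have e1: "LG.Exp (?t (Suc i) *\<^sub>R Z) = ?y \<otimes> ?x"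
      using LG.Exp_add[OF Z(1), of "?t i" "1 / real N"] by (simp add: add_divide_distrib add.commute)
    have "inv (p (?t i)) \<otimes> p (?t (Suc i)) = ?c \<otimes> ?x \<otimes> inv ?c'"
      using cc xc by (simp add: p_def e1 inv_mult_group m_assoc[symmetric] del: of_nat_Suc) (simp add: m_assoc del: of_nat_Suc)
    moreover have "inv ?x \<otimes> (?c \<otimes> ?x \<otimes> inv ?c') = (inv ?x \<otimes> ?c \<otimes> inv (inv ?x)) \<otimes> inv ?c'"
      using cc xc by (simp add: m_assoc)
    moreover have "(inv ?x \<otimes> ?c \<otimes> inv (inv ?x)) \<otimes> inv ?c' \<in> \<CC>" by (intro \<CC>m \<CC>i cC DS.cl_conj) (use xc in simp)
    moreover have "inv (p (?t i)) \<otimes> p (?t (Suc i)) \<in> B" using near[of 0 0 i "Suc i"] i by (simp add: h(2))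
    ultimately have "D (inv (p (?t i)) \<otimes> p (?t (Suc i))) = q ((1 / real N) *\<^sub>R Z)"
      by (intro Deq tZ) (use N2(2) in auto)
    thus ?thesis by (simp add: qs)
  qed
  hence "w 0 = q Z" using N0 by (simp add: w_def h(2) sum_constant_scaleR)
  hence "Z = oproj ?\<cc> Z" using w0 by (simp add: q_def)
  thus ?thesis using oproj_in[OF sub\<cc>] by metis
qed

end

context syndetic_pair
begin

text \<open>If \<open>Exp X\<close> lies in \<open>\<Lambda>0\<close>, then it lies in
  \<open>S'\<close> and is congruent modulo \<open>\<CC>\<close> to some \<open>Exp Y\<close> with
  \<open>Y \<in> \<LL>\<close>. In the quotient of \<open>G\<close> by \<open>\<CC>\<close> this
  gives \<open>Exp (X - Y) \<in> \<CC>\<close>, and simple connectedness puts \<open>X - Y\<close>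
  in the Lie algebra of \<open>\<CC>\<close>, so \<open>X \<in> \<LL>\<close>. Hence
  \<open>W \<subseteq> \<LL>\<close>; every element of the kernel is congruent modulo
  \<open>\<Lambda>0\<close> to some \<open>Exp X\<close> with \<open>X \<in> W\<close>, so it lies
  in \<open>S'\<close>.\<close>

lemma hull_eq:
  assumes sc: "simply_connected_space T" shows "S' = DS.S"
proof
  have lat: "DS.Q.lattice \<subseteq> \<LL>"
  proof
    fix X assume "X \<in> DS.Q.lattice"
    hence X: "X \<in> model M" "LG.Exp X \<in> S'" using \<Lambda>0_S' by (auto simp: DS.Q.lattice_def DS.Lie_carrier)
    interpret A: abelian_quotient G "mtop M" "model M" ph U1 "fst est" "snd est" S' \<CC>
      by (rule abelian_quotient_cl[OF S'_subgroup S'_closed cl_S' S'_generated])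
    interpret B: abelian_quotient G "mtop M" "model M" ph U1 "fst est" "snd est" "carrier G" \<CC>
      by (rule abelian_quotient_carrier)
    obtain Y where Y: "Y \<in> \<LL>" "A.cong (LG.Exp Y) (LG.Exp X)" using A.cong_Exp_ex[OF X(2)] by blast
    have YM: "Y \<in> model M" using Y(1) \<LL>_model by blast
    have "B.cong (LG.Exp Y) (LG.Exp X)" using Y(2) S'_carrier unfolding A.cong_def B.cong_def by blast
    hence "X - Y \<in> B.lattice" using B.cong_Exp_diff[of Y X] YM X(1) by (simp add: DS.Lie_carrier)
    hence "X - Y \<in> LG.Lie \<CC>" by (intro Exp_cl_imp_Lie[OF sc]) (auto simp: B.lattice_def DS.Lie_carrier)
    hence "X - Y \<in> \<LL>" using cl_S' by (auto simp: LG.Lie_def)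
    thus "X \<in> \<LL>" using subspace_add[OF subspace_\<LL> _ Y(1)] by fastforce
  qed
  have W: "DS.Q.W \<subseteq> \<LL>" unfolding DS.Q.W_def by (rule span_minimal[OF lat subspace_\<LL>])
  show "DS.S \<subseteq> S'"
  proof
    fix x assume "x \<in> DS.S"
    hence x: "x \<in> carrier G" "DS.Q.F x = 0" by (auto simp: DS.S_def)
    obtain X where X: "X \<in> LG.Lie (carrier G)" "DS.Q.cong (LG.Exp X) x" using DS.Q.cong_Exp_ex[OF x(1)] by blast
    have "X - oproj DS.Q.W X = 0" using DS.Q.F_eq[OF X] x(2) by simp
    hence e: "oproj DS.Q.W X = X" by simp
    have "X \<in> DS.Q.W" by (subst e[symmetric]) (rule oproj_in[OF DS.Q.subspace_W])
    hence "X \<in> \<LL>" using W by blast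
    hence 1: "LG.Exp X \<in> S'" by (rule LG.Exp_Lie)
    have "inv (LG.Exp X) \<otimes> x \<in> S'" using X(2) \<Lambda>0_S' by (auto simp: DS.Q.cong_def)
    from S'_mult[OF 1 this] show "x \<in> S'" using S'_carrier[OF 1] x(1) by (simp add: m_assoc[symmetric])
  qed
qed (rule S'_subset)

end

theorem theorem21:
  fixes G :: "('g, 'm) monoid_scheme" and M :: "('g, 'e::euclidean_space) manifold"
    and \<Gamma> :: "'g set"
  assumes "lie_group G M"
    and "connected_space (mtop M)"
    and "solvable G"
    and "subgroup \<Gamma> G"
    and "closedin (mtop M) \<Gamma>"
    and "algebraically_dense G M \<Gamma>"
  shows "(\<exists>S. syndetic_hull G M \<Gamma> S) \<and>
    (simply_connected_space (mtop M) \<longrightarrow> (\<exists>!S. syndetic_hull G M \<Gamma> S))"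
proof -
  interpret dense_lie_subgroup G M \<Gamma>
    by (rule dense_lie_subgroup.intro[OF assms(1) dense_lie_subgroup_axioms.intro[OF assms(2-6)]])
  have "S = DS.S" if "simply_connected_space (mtop M)" and S: "syndetic_hull G M \<Gamma> S" for S
  proof -
    obtain N where "connected_lie_subgroup G M S N" "\<Gamma> \<subseteq> S" "compact_space (quotient_topology (mtop N) (\<lambda>s. \<Gamma> #>\<^bsub>G\<^esub> s))"
      using S unfolding syndetic_hull_def by blast
    then interpret P: syndetic_pair G M \<Gamma> S N
      by (intro syndetic_pair.intro[OF dense_lie_subgroup_axioms] syndetic_pair_axioms.intro)
    show ?thesis by (rule P.hull_eq[OF that(1)])
  qed
  thus ?thesis using syndetic_hull_S by blast
qed

end
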